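(* Suppose that $(E,\nabla_E,\sigma_E)$ is an object of ${}_A\mathcal F_A$ and that $\Omega^2A$ is finitely generated projective as a right $A$-module. Then $\vartheta_E(\mathcal W\otimes_AE)\subset E\otimes_A\mathcal W$, and as a result $\vartheta_E:\mathcal T\mathrm{Vec}A_\bullet\otimes_AE\to E\otimes_A\mathcal T\mathrm{Vec}A_\bullet$ has a well defined quotient $\vartheta_E:\mathcal DA\otimes_AE\to E\otimes_A\mathcal DA$.
   Context: Setting. $A$ is a unital algebra over $\mathbb C$ and $(\Omega A=\oplus_{n\ge0}\Omega^nA,\mathrm d,\wedge)$ is a differential graded algebra with $\Omega^0A=A$, $\mathrm d^2=0$, graded Leibniz rule, generated over $A$ by $\Omega^1A$, with $\Omega^1A=A.\mathrm dA$ (no graded commutativity). $\Omega^1A$ is finitely generated projective as a right $A$-module; $\mathrm{Vec}A=\mathrm{Hom}_A(\Omega^1A,A)$ (right module maps), a bimodule by $(a.v)(\xi)=a\,v(\xi)$, $(v.a)(\xi)=v(a\xi)$; $\mathrm{ev}$ is evaluation and $\sum_i\xi_i\otimes u_i\in\Omega^1A\otimes_A\mathrm{Vec}A$ is the dual basis ($\xi=\sum_i\xi_i.u_i(\xi)$). $\Omega^{\otimes n}A$, $\mathrm{Vec}^{\otimes n}A$ are $n$-fold tensor powers over $A$ (equal to $A$ for $n=0$). $\mathrm{ev}^{\langle n\rangle}:\mathrm{Vec}^{\otimes n}A\otimes_A\Omega^{\otimes n}A\to A$ is nested evaluation: $\mathrm{ev}^{\langle1\rangle}=\mathrm{ev}$,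 $\mathrm{ev}^{\langle n+1\rangle}=\mathrm{ev}(\mathrm{id}\otimes\mathrm{ev}^{\langle n\rangle}\otimes\mathrm{id})$. Covariant derivatives. A left bimodule covariant derivative $(\nabla_E,\sigma_E)$ on a bimodule $E$: $\nabla_E:E\to\Omega^1A\otimes_AE$ with $\nabla_E(ae)=\mathrm da\otimes e+a\nabla_E(e)$ and $\nabla_E(ea)=\nabla_E(e)a+\sigma_E(e\otimes\mathrm da)$, where $\sigma_E:E\otimes_A\Omega^1A\to\Omega^1A\otimes_AE$ is a bimodule map. The objects of ${}_A\mathcal F_A$ are the bimodules with left bimodule covariant derivative $(E,\nabla_E,\sigma_E)$ whose curvature $R_E=(\mathrm d\otimes\mathrm{id}_E-\mathrm{id}\wedge\nabla_E)\nabla_E$ vanishes and for which there exists a map $\sigma_E:E\otimes_A\Omega^2A\to\Omega^2A\otimes_AE$ with $\sigma_E(\mathrm{id}_E\otimes\wedge)=(\wedge\otimes\mathrm{id}_E)(\mathrm{id}\otimes\sigma_E)(\sigma_E\otimes\mathrm{id})$ on $E\otimes_A\Omega^1A\otimes_A\Omega^1A$. A right bimodule covariant derivative $(\square,\sigma^{-1})$ on $\Omega^1A$ is fixed: $\square:\Omega^1A\to\Omega^{\otimes2}A$, $\square(\xi a)=\square(\xi)a+\xi\otimes\mathrm da$, $\square(a\xi)=a\square(\xi)+\sigma^{-1}(\mathrm da\otimes\xi)$, $\sigma^{-1}:\Omega^{\otimes2}A\to\Omega^{\otimes2}A$ a bimodule map (not assumed invertible). Extend by $\square^{\langle0\rangle}=\mathrm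 d$, $\square^{\langle1\rangle}=\square$, $\square^{\langle n+1\rangle}=\mathrm{id}^{\otimes n}\otimes\square+(\mathrm{id}^{\otimes n}\otimes\sigma^{-1})(\square^{\langle n\rangle}\otimes\mathrm{id})$. The dual left bimodule covariant derivative $\square:\mathrm{Vec}A\to\Omega^1A\otimes_A\mathrm{Vec}A$ is determined by $\mathrm d\circ\mathrm{ev}=(\mathrm{id}\otimes\mathrm{ev})(\square\otimes\mathrm{id})+(\mathrm{ev}\otimes\mathrm{id})(\mathrm{id}\otimes\square)$, with $\sigma=(\mathrm{ev}\otimes\mathrm{id}\otimes\mathrm{id})(\mathrm{id}\otimes\sigma^{-1}\otimes\mathrm{id})(\mathrm{id}\otimes\mathrm{id}\otimes\mathrm{coev}(1))$, $\mathrm{coev}(1)=\sum_i\xi_i\otimes u_i$, extended to $\mathrm{Vec}^{\otimes n}A$ by $\square^{\langle0\rangle}=\mathrm d$, $\square^{\langle n+1\rangle}=\square\otimes\mathrm{id}^{\otimes n}+(\sigma\otimes\mathrm{id}^{\otimes n})(\mathrm{id}\otimes\square^{\langle n\rangle})$. Product and action. $\mathcal T\mathrm{Vec}A_\bullet=\bigoplus_{n\ge0}\mathrm{Vec}^{\otimes n}A$ with the associative unital product $\bullet$ determined by $a\bullet\underline w=a.\underline w$, $u\bullet\underline w=u\otimes\underline w+(\mathrm{ev}\otimes\mathrm{id}^{\otimes m})(u\otimes\square^{\langle m\rangle}\underline w)$ and $(u\otimes\underline v)\bullet\underline w=u\bullet(\underline v\bullet\underline w)-\big((\mathrm{ev}\otimes\mathrm{id}^{\otimes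 n})(u\otimes\square^{\langle n\rangle}\underline v)\big)\bullet\underline w$ ($a\in A$, $u\in\mathrm{Vec}A$, $\underline v\in\mathrm{Vec}^{\otimes n}A$, $\underline w\in\mathrm{Vec}^{\otimes m}A$); left $A$-action the usual one, right $A$-action by $\bullet$. It acts on $(E,\nabla_E)$ by $\underline v\triangleright e=(\mathrm{ev}^{\langle n\rangle}\otimes\mathrm{id}_E)(\underline v\otimes\nabla_E^{(n)}e)$, where $\nabla_E^{(1)}=\nabla_E$, $\nabla_E^{(n+1)}=(\square^{\langle n\rangle}\otimes\mathrm{id}_E+\mathrm{id}^{\otimes n}\otimes\nabla_E)\nabla_E^{(n)}$ (and $a\triangleright e=ae$). Crossing map. $\sigma_E^{-1}:\mathrm{Vec}A\otimes_AE\to E\otimes_A\mathrm{Vec}A$ is defined by $(\mathrm{id}\otimes\mathrm{ev})(\sigma_E^{-1}\otimes\mathrm{id})=(\mathrm{ev}\otimes\mathrm{id})(\mathrm{id}\otimes\sigma_E)$ on $\mathrm{Vec}A\otimes_AE\otimes_A\Omega^1A$ (not an actual inverse). $\vartheta_E:\mathcal T\mathrm{Vec}A_\bullet\otimes_AE\to E\otimes_A\mathcal T\mathrm{Vec}A_\bullet$ is the (known to be well defined) map given recursively by $\vartheta_E(a\otimes e)=ae\otimes1$ for $a\in A$; $\vartheta_E(u\otimes e)=(u\triangleright e)\otimes1+\sigma_E^{-1}(u\otimes e)$ for $u\in\mathrm{Vec}A$; and, for $w\in\mathrm{Vec}A$ and $\vartheta_E(\underline v\otimes e)=\sum f\otimes\underline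 x$, $\vartheta_E(w\bullet\underline v\otimes e)=\sum(w\triangleright f)\otimes\underline x+\sum\sigma_E^{-1}(w\otimes f)\bullet\underline x$, where $(f'\otimes w')\bullet\underline x=f'\otimes(w'\bullet\underline x)$. It is known that $\vartheta_E(\underline u\bullet\underline v\otimes e)=(\mathrm{id}_E\otimes\bullet)(\vartheta_E\otimes\mathrm{id})(\mathrm{id}\otimes\vartheta_E)(\underline u\otimes\underline v\otimes e)$. The algebra $\mathcal DA$. $\mathcal R=\sum_i\mathrm d\xi_i\otimes u_i-\sum_{i,j}\xi_i\wedge\xi_j\otimes(u_j\bullet u_i)\in\Omega^2A\otimes_A\mathcal T\mathrm{Vec}A_\bullet$; $(\Omega^2A)'=\mathrm{Hom}_A(\Omega^2A,A)$ (right module maps); $\widehat{\mathcal R}(\alpha)=(\alpha\otimes\mathrm{id})\mathcal R$. $\mathcal W$ is the two-sided ideal of $\mathcal T\mathrm{Vec}A_\bullet$ generated by the image of $\widehat{\mathcal R}$ and $\mathcal DA=\mathcal T\mathrm{Vec}A_\bullet/\mathcal W$. Here $\mathcal W\otimes_AE$ and $E\otimes_A\mathcal W$ are understood via their images in $\mathcal T\mathrm{Vec}A_\bullet\otimes_AE$ and $E\otimes_A\mathcal T\mathrm{Vec}A_\bullet$. *)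

theory Defs
  imports
    "HOL-Algebra.Free_Abelian_Groups"
    "HOL-Algebra.Generated_Groups"
    "HOL-Algebra.Generated_Rings"
    "HOL-Algebra.QuotRing"
begin

section \<open>Bimodules over a noncommutative ring\<close>

text \<open>
  As for the library record of modules, the multiplicative part of the underlying ring record
  carries no meaning for a bimodule, except for the bimodules below that are also algebras.
\<close>

record ('a, 'm) bimod = "'m ring" +
  lact :: "'a \<Rightarrow> 'm \<Rightarrow> 'm"
  ract :: "'m \<Rightarrow> 'a \<Rightarrow> 'm"

locale bimodule = A: ring A + M: abelian_group M
  for A :: "('a, 'x) ring_scheme" and M :: "('a, 'm, 'y) bimod_scheme" +
  assumes lact_closed: "\<lbrakk>a \<in> carrier A; m \<in> carrier M\<rbrakk> \<Longrightarrow> lact M a m \<in> carrier M"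
    and ract_closed: "\<lbrakk>a \<in> carrier A; m \<in> carrier M\<rbrakk> \<Longrightarrow> ract M m a \<in> carrier M"
    and lact_add: "\<lbrakk>a \<in> carrier A; m \<in> carrier M; m' \<in> carrier M\<rbrakk>
      \<Longrightarrow> lact M a (m \<oplus>\<^bsub>M\<^esub> m') = lact M a m \<oplus>\<^bsub>M\<^esub> lact M a m'"
    and add_lact: "\<lbrakk>a \<in> carrier A; b \<in> carrier A; m \<in> carrier M\<rbrakk>
      \<Longrightarrow> lact M (a \<oplus>\<^bsub>A\<^esub> b) m = lact M a m \<oplus>\<^bsub>M\<^esub> lact M b m"
    and mult_lact: "\<lbrakk>a \<in> carrier A; b \<in> carrier A; m \<in> carrier M\<rbrakk>
      \<Longrightarrow> lact M (a \<otimes>\<^bsub>A\<^esub> b) m = lact M a (lact M b m)"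
    and one_lact: "m \<in> carrier M \<Longrightarrow> lact M \<one>\<^bsub>A\<^esub> m = m"
    and ract_add: "\<lbrakk>a \<in> carrier A; m \<in> carrier M; m' \<in> carrier M\<rbrakk>
      \<Longrightarrow> ract M (m \<oplus>\<^bsub>M\<^esub> m') a = ract M m a \<oplus>\<^bsub>M\<^esub> ract M m' a"
    and add_ract: "\<lbrakk>a \<in> carrier A; b \<in> carrier A; m \<in> carrier M\<rbrakk>
      \<Longrightarrow> ract M m (a \<oplus>\<^bsub>A\<^esub> b) = ract M m a \<oplus>\<^bsub>M\<^esub> ract M m b"
    and mult_ract: "\<lbrakk>a \<in> carrier A; b \<in> carrier A; m \<in> carrier M\<rbrakk>
      \<Longrightarrow> ract M m (a \<otimes>\<^bsub>A\<^esub> b) = ract M (ract M m a) b"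
    and one_ract: "m \<in> carrier M \<Longrightarrow> ract M m \<one>\<^bsub>A\<^esub> = m"
    and lact_ract: "\<lbrakk>a \<in> carrier A; b \<in> carrier A; m \<in> carrier M\<rbrakk>
      \<Longrightarrow> ract M (lact M a m) b = lact M a (ract M m b)"

definition add_hom :: "('m, 'x) ring_scheme \<Rightarrow> ('n, 'y) ring_scheme \<Rightarrow> ('m \<Rightarrow> 'n) set" where
  "add_hom M N = hom (add_monoid M) (add_monoid N)"

definition bimod_hom :: "('a, 'x) ring_scheme \<Rightarrow> ('a, 'm, 'y) bimod_scheme \<Rightarrow>
    ('a, 'n, 'z) bimod_scheme \<Rightarrow> ('m \<Rightarrow> 'n) set" where
  "bimod_hom A M N = {f \<in> add_hom M N. \<forall>a\<in>carrier A. \<forall>m\<in>carrier M.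
     f (lact M a m) = lact N a (f m) \<and> f (ract M m a) = ract N (f m) a}"

text \<open>
  Right module maps between bimodules, with the bimodule structure
  $(a.f)(m) = a.f(m)$, $(f.a)(m) = f(a.m)$.
\<close>

definition rhom :: "('a, 'x) ring_scheme \<Rightarrow> ('a, 'm, 'y) bimod_scheme \<Rightarrow>
    ('a, 'n, 'z) bimod_scheme \<Rightarrow> ('a, 'm \<Rightarrow> 'n) bimod" where
  "rhom A M N =
    \<lparr>carrier = {f \<in> add_hom M N \<inter> extensional (carrier M).
        \<forall>a\<in>carrier A. \<forall>m\<in>carrier M. f (ract M m a) = ract N (f m) a},
     mult = (\<lambda>_ _. undefined), one = undefined,
     zero = (\<lambda>m\<in>carrier M. \<zero>\<^bsub>N\<^esub>),
     add = (\<lambda>f g. \<lambda>m\<in>carrier M. f m \<oplus>\<^bsub>N\<^esub> g m),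
     lact = (\<lambda>a f. \<lambda>m\<in>carrier M. lact N a (f m)),
     ract = (\<lambda>f a. \<lambda>m\<in>carrier M. f (lact M a m))\<rparr>"

definition self_bimod :: "('a, 'x) ring_scheme \<Rightarrow> ('a, 'a) bimod" where
  "self_bimod A = \<lparr>carrier = carrier A, mult = mult A, one = one A, zero = zero A, add = add A,
     lact = mult A, ract = mult A\<rparr>"

definition free_bimod :: "('a, 'x) ring_scheme \<Rightarrow> nat \<Rightarrow> ('a, nat \<Rightarrow> 'a) bimod" where
  "free_bimod A n =
    \<lparr>carrier = {..<n} \<rightarrow>\<^sub>E carrier A,
     mult = (\<lambda>_ _. undefined), one = undefined,
     zero = (\<lambda>i\<in>{..<n}. \<zero>\<^bsub>A\<^esub>),
     add = (\<lambda>x y. \<lambda>i\<in>{..<n}. x i \<oplus>\<^bsub>A\<^esub> y i),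
     lact = (\<lambda>a x. \<lambda>i\<in>{..<n}. a \<otimes>\<^bsub>A\<^esub> x i),
     ract = (\<lambda>x a. \<lambda>i\<in>{..<n}. x i \<otimes>\<^bsub>A\<^esub> a)\<rparr>"

text \<open>Finitely generated projective right modules: direct summands (retracts) of some $A^n$.\<close>

definition right_fgp :: "('a, 'x) ring_scheme \<Rightarrow> ('a, 'm, 'y) bimod_scheme \<Rightarrow> bool" where
  "right_fgp A M \<longleftrightarrow> (\<exists>n. \<exists>j\<in>carrier (rhom A M (free_bimod A n)).
     \<exists>p\<in>carrier (rhom A (free_bimod A n) M). \<forall>m\<in>carrier M. p (j m) = m)"


section \<open>Tensor products\<close>

type_synonym 'g frag = "'g \<Rightarrow>\<^sub>0 int"

text \<open>
  All tensor products are quotients of free abelian groups, so their elements are cosets of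
  formal integer combinations of generators. Given an abelian group P and a map f from
  generators to P, \<^term>\<open>tlift P f\<close> evaluates the additive extension of f on a representative
  of the coset. It is independent of the representative, and additive, exactly when the
  extension of f kills the relations (for a tensor product: when f is biadditive and balanced).
\<close>

definition frag_eval :: "('p, 'x) ring_scheme \<Rightarrow> ('g \<Rightarrow> 'p) \<Rightarrow> 'g frag \<Rightarrow> 'p" where
  "frag_eval P f x =
     (\<Oplus>\<^bsub>P\<^esub>g\<in>Poly_Mapping.keys x. add_pow P (Poly_Mapping.lookup x g) (f g))"

definition tlift :: "('p, 'x) ring_scheme \<Rightarrow> ('g \<Rightarrow> 'p) \<Rightarrow> 'g frag set \<Rightarrow> 'p" where
  "tlift P f X = frag_eval P f (SOME x. x \<in> X)"

definition tens_rels :: "('a, 'x) ring_scheme \<Rightarrow> ('a, 'm, 'y) bimod_scheme \<Rightarrow>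
    ('a, 'n, 'z) bimod_scheme \<Rightarrow> ('m \<times> 'n) frag set" where
  "tens_rels A M N =
     {frag_of (m \<oplus>\<^bsub>M\<^esub> m', n) - frag_of (m, n) - frag_of (m', n) | m m' n.
        m \<in> carrier M \<and> m' \<in> carrier M \<and> n \<in> carrier N} \<union>
     {frag_of (m, n \<oplus>\<^bsub>N\<^esub> n') - frag_of (m, n) - frag_of (m, n') | m n n'.
        m \<in> carrier M \<and> n \<in> carrier N \<and> n' \<in> carrier N} \<union>
     {frag_of (ract M m a, n) - frag_of (m, lact N a n) | m a n.
        m \<in> carrier M \<and> a \<in> carrier A \<and> n \<in> carrier N}"

definition tens_group :: "('a, 'x) ring_scheme \<Rightarrow> ('a, 'm, 'y) bimod_scheme \<Rightarrow>
    ('a, 'n, 'z) bimod_scheme \<Rightarrow> ('m \<times> 'n) frag set monoid" where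
  "tens_group A M N = free_Abelian_group (carrier M \<times> carrier N) Mod
     generate (free_Abelian_group (carrier M \<times> carrier N)) (tens_rels A M N)"

definition stens :: "('a, 'x) ring_scheme \<Rightarrow> ('a, 'm, 'y) bimod_scheme \<Rightarrow>
    ('a, 'n, 'z) bimod_scheme \<Rightarrow> 'm \<Rightarrow> 'n \<Rightarrow> ('m \<times> 'n) frag set" where
  "stens A M N m n =
     generate (free_Abelian_group (carrier M \<times> carrier N)) (tens_rels A M N)
       #>\<^bsub>free_Abelian_group (carrier M \<times> carrier N)\<^esub> frag_of (m, n)"

text \<open>
  The abelian group $M \otimes_A N$ only involves the right action on M and the left action on N;
  the remaining two actions make it a bimodule.
\<close>

definition tens :: "('a, 'x) ring_scheme \<Rightarrow> ('a, 'm, 'y) bimod_scheme \<Rightarrow>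
    ('a, 'n, 'z) bimod_scheme \<Rightarrow> ('a, ('m \<times> 'n) frag set) bimod" where
  "tens A M N = (let G = \<lparr>carrier = carrier (tens_group A M N),
       mult = (\<lambda>_ _. undefined), one = undefined,
       zero = one (tens_group A M N), add = mult (tens_group A M N)\<rparr>
     in ring.extend G (bimod.fields
       (\<lambda>a. tlift G (\<lambda>(m, n). stens A M N (lact M a m) n))
       (\<lambda>X a. tlift G (\<lambda>(m, n). stens A M N m (ract N n a)) X)))"

text \<open>The map $f \otimes g$ into $M' \otimes_A N'$.\<close>

definition tmap :: "('a, 'x) ring_scheme \<Rightarrow> ('a, 'm, 'y) bimod_scheme \<Rightarrow>
    ('a, 'n, 'z) bimod_scheme \<Rightarrow> ('k \<Rightarrow> 'm) \<Rightarrow> ('l \<Rightarrow> 'n) \<Rightarrow> ('k \<times> 'l) frag set \<Rightarrow>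
    ('m \<times> 'n) frag set" where
  "tmap A M' N' f g = tlift (tens A M' N') (\<lambda>(m, n). stens A M' N' (f m) (g n))"

text \<open>
  The direct sum $\bigoplus_n V^{\otimes n}$ of all tensor powers over A, presented in one step:
  a generator $([v_1, \dots, v_n], a)$ stands for $v_1 \otimes \dots \otimes v_n \otimes a$ in
  $V^{\otimes n} \otimes_A A = V^{\otimes n}$, which is $a \in A$ when $n = 0$. All relations are
  between words of the same length, so the quotient is the direct sum over n.
\<close>

definition talg_gens :: "('a, 'x) ring_scheme \<Rightarrow> ('a, 'v, 'y) bimod_scheme \<Rightarrow> ('v list \<times> 'a) set" where
  "talg_gens A V = lists (carrier V) \<times> carrier A"

definition talg_rels :: "('a, 'x) ring_scheme \<Rightarrow> ('a, 'v, 'y) bimod_scheme \<Rightarrow>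
    ('v list \<times> 'a) frag set" where
  "talg_rels A V =
     {frag_of (us @ (v \<oplus>\<^bsub>V\<^esub> v') # vs, a) - frag_of (us @ v # vs, a) - frag_of (us @ v' # vs, a) |
        us v v' vs a. us \<in> lists (carrier V) \<and> vs \<in> lists (carrier V) \<and>
          v \<in> carrier V \<and> v' \<in> carrier V \<and> a \<in> carrier A} \<union>
     {frag_of (vs, a \<oplus>\<^bsub>A\<^esub> b) - frag_of (vs, a) - frag_of (vs, b) | vs a b.
        vs \<in> lists (carrier V) \<and> a \<in> carrier A \<and> b \<in> carrier A} \<union>
     {frag_of (us @ ract V v c # v' # vs, a) - frag_of (us @ v # lact V c v' # vs, a) |
        us v c v' vs a. us \<in> lists (carrier V) \<and> vs \<in> lists (carrier V) \<and>
          v \<in> carrier V \<and> v' \<in> carrier V \<and> c \<in> carrier A \<and> a \<in> carrier A} \<union>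
     {frag_of (us @ [ract V v c], a) - frag_of (us @ [v], c \<otimes>\<^bsub>A\<^esub> a) | us v c a.
        us \<in> lists (carrier V) \<and> v \<in> carrier V \<and> c \<in> carrier A \<and> a \<in> carrier A}"

definition talg_group :: "('a, 'x) ring_scheme \<Rightarrow> ('a, 'v, 'y) bimod_scheme \<Rightarrow>
    ('v list \<times> 'a) frag set monoid" where
  "talg_group A V = free_Abelian_group (talg_gens A V) Mod
     generate (free_Abelian_group (talg_gens A V)) (talg_rels A V)"

definition tword :: "('a, 'x) ring_scheme \<Rightarrow> ('a, 'v, 'y) bimod_scheme \<Rightarrow> 'v list \<Rightarrow> 'a \<Rightarrow>
    ('v list \<times> 'a) frag set" where
  "tword A V vs a = generate (free_Abelian_group (talg_gens A V)) (talg_rels A V)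
     #>\<^bsub>free_Abelian_group (talg_gens A V)\<^esub> frag_of (vs, a)"

text \<open>The tensor algebra as a bimodule with its usual actions; its product is left open here.\<close>

definition talg :: "('a, 'x) ring_scheme \<Rightarrow> ('a, 'v, 'y) bimod_scheme \<Rightarrow>
    ('a, ('v list \<times> 'a) frag set) bimod" where
  "talg A V = (let G = \<lparr>carrier = carrier (talg_group A V),
       mult = (\<lambda>_ _. undefined), one = tword A V [] \<one>\<^bsub>A\<^esub>,
       zero = one (talg_group A V), add = mult (talg_group A V)\<rparr>
     in ring.extend G (bimod.fields
       (\<lambda>a. tlift G (\<lambda>(vs, b). case vs of
           [] \<Rightarrow> tword A V [] (a \<otimes>\<^bsub>A\<^esub> b)
         | v # ws \<Rightarrow> tword A V (lact V a v # ws) b))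
       (\<lambda>X a. tlift G (\<lambda>(vs, b). tword A V vs (b \<otimes>\<^bsub>A\<^esub> a)) X)))"


section \<open>Differential graded algebras with a connection\<close>

record 'w calculus = "'w ring" +
  piece :: "nat \<Rightarrow> 'w set"
  dif :: "'w \<Rightarrow> 'w"
  cst :: "complex \<Rightarrow> 'w"

text \<open>
  The ring product of the calculus is the wedge product, and the algebra A is its degree 0 part.
  The complex algebra structure is the central unital ring homomorphism \<^term>\<open>cst Om\<close>.
\<close>

definition base :: "('w, 'b) calculus_scheme \<Rightarrow> ('w, 'b) calculus_scheme" where
  "base Om = Om\<lparr>carrier := piece Om 0\<rparr>"

definition forms :: "('w, 'b) calculus_scheme \<Rightarrow> nat \<Rightarrow> ('w, 'w) bimod" where
  "forms Om k = (self_bimod Om)\<lparr>carrier := piece Om k\<rparr>"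

locale dga = ring Om for Om :: "('w, 'b) calculus_scheme" (structure) +
  assumes piece_subgroup: "subgroup (piece Om k) (add_monoid Om)"
    and piece_span: "x \<in> carrier Om \<Longrightarrow> \<exists>N. \<exists>f\<in>Pi {..N} (piece Om). x = (\<Oplus>k\<in>{..N}. f k)"
    and piece_indep: "\<lbrakk>f \<in> Pi {..N} (piece Om); (\<Oplus>k\<in>{..(N::nat)}. f k) = \<zero>; k \<le> N\<rbrakk> \<Longrightarrow> f k = \<zero>"
    and one_piece: "\<one> \<in> piece Om 0"
    and mult_piece: "\<lbrakk>x \<in> piece Om k; y \<in> piece Om l\<rbrakk> \<Longrightarrow> x \<otimes> y \<in> piece Om (k + l)"
    and cst_piece: "cst Om z \<in> piece Om 0"
    and cst_one: "cst Om 1 = \<one>"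
    and cst_add: "cst Om (z + z') = cst Om z \<oplus> cst Om z'"
    and cst_mult: "cst Om (z * z') = cst Om z \<otimes> cst Om z'"
    and cst_central: "x \<in> carrier Om \<Longrightarrow> cst Om z \<otimes> x = x \<otimes> cst Om z"
    and dif_hom: "dif Om \<in> add_hom Om Om"
    and dif_cst: "dif Om (cst Om z) = \<zero>"
    and dif_piece: "x \<in> piece Om k \<Longrightarrow> dif Om x \<in> piece Om (Suc k)"
    and dif_dif: "x \<in> carrier Om \<Longrightarrow> dif Om (dif Om x) = \<zero>"
    and dif_mult: "\<lbrakk>x \<in> piece Om k; y \<in> carrier Om\<rbrakk> \<Longrightarrow> dif Om (x \<otimes> y) =
      dif Om x \<otimes> y \<oplus> (if even k then x \<otimes> dif Om y else \<ominus> (x \<otimes> dif Om y))"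
    and generated: "generate_ring Om (piece Om 0 \<union> piece Om 1) = carrier Om"
    and piece_one: "piece Om 1 =
      generate (add_monoid Om) {a \<otimes> dif Om b | a b. a \<in> piece Om 0 \<and> b \<in> piece Om 0}"

definition vec :: "('w, 'b) calculus_scheme \<Rightarrow> ('w, 'w \<Rightarrow> 'w) bimod" where
  "vec Om = rhom (base Om) (forms Om 1) (forms Om 0)"

abbreviation otens :: "('w, 'b) calculus_scheme \<Rightarrow> ('w, 'm, 'y) bimod_scheme \<Rightarrow>
    ('w, 'n, 'z) bimod_scheme \<Rightarrow> ('w, ('m \<times> 'n) frag set) bimod" where
  "otens Om \<equiv> tens (base Om)"

abbreviation ostens :: "('w, 'b) calculus_scheme \<Rightarrow> ('w, 'm, 'y) bimod_scheme \<Rightarrow>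
    ('w, 'n, 'z) bimod_scheme \<Rightarrow> 'm \<Rightarrow> 'n \<Rightarrow> ('m \<times> 'n) frag set" where
  "ostens Om \<equiv> stens (base Om)"

text \<open>
  Fixed data on a calculus: the dual basis $\xi_i$ (\<^term>\<open>xi Om i\<close>), $u_i$ (\<^term>\<open>ub Om i\<close>) for
  $i <$ \<^term>\<open>rk Om\<close>, the right connection $\square$ on one-forms (\<^term>\<open>box Om\<close>) and its
  generalised braiding $\sigma^{-1}$ (\<^term>\<open>sgi Om\<close>), which need not be invertible.
\<close>

record 'w geometry = "'w calculus" +
  rk :: nat
  xi :: "nat \<Rightarrow> 'w"
  ub :: "nat \<Rightarrow> 'w \<Rightarrow> 'w"
  box :: "'w \<Rightarrow> ('w \<times> 'w) frag set"
  sgi :: "('w \<times> 'w) frag set \<Rightarrow> ('w \<times> 'w) frag set"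

abbreviation forms11 :: "('w, 'b) calculus_scheme \<Rightarrow> ('w, ('w \<times> 'w) frag set) bimod" where
  "forms11 Om \<equiv> otens Om (forms Om 1) (forms Om 1)"

locale geometry = dga Om for Om :: "('w, 'b) geometry_scheme" (structure) +
  assumes fgp1: "right_fgp (base Om) (forms Om 1)"
    and xi_closed: "i < rk Om \<Longrightarrow> xi Om i \<in> piece Om 1"
    and ub_closed: "i < rk Om \<Longrightarrow> ub Om i \<in> carrier (vec Om)"
    and dual_basis: "\<eta> \<in> piece Om 1 \<Longrightarrow> \<eta> = (\<Oplus>i\<in>{..<rk Om}. xi Om i \<otimes> ub Om i \<eta>)"
    and box_hom: "box Om \<in> add_hom (forms Om 1) (forms11 Om)"
    and sgi_hom: "sgi Om \<in> bimod_hom (base Om) (forms11 Om) (forms11 Om)"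
    and box_ract: "\<lbrakk>\<eta> \<in> piece Om 1; a \<in> piece Om 0\<rbrakk> \<Longrightarrow> box Om (\<eta> \<otimes> a) =
      ract (forms11 Om) (box Om \<eta>) a \<oplus>\<^bsub>forms11 Om\<^esub>
      ostens Om (forms Om 1) (forms Om 1) \<eta> (dif Om a)"
    and box_lact: "\<lbrakk>\<eta> \<in> piece Om 1; a \<in> piece Om 0\<rbrakk> \<Longrightarrow> box Om (a \<otimes> \<eta>) =
      lact (forms11 Om) a (box Om \<eta>) \<oplus>\<^bsub>forms11 Om\<^esub>
      sgi Om (ostens Om (forms Om 1) (forms Om 1) (dif Om a) \<eta>)"

text \<open>The dual left connection $\square$ on vector fields, and its $\sigma(v \otimes \eta)$.\<close>

definition vbox :: "('w, 'b) geometry_scheme \<Rightarrow> ('w \<Rightarrow> 'w) \<Rightarrow> ('w \<times> ('w \<Rightarrow> 'w)) frag set" where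
  "vbox Om v = (THE Y. Y \<in> carrier (otens Om (forms Om 1) (vec Om)) \<and>
     (\<forall>\<eta>\<in>piece Om 1. dif Om (v \<eta>) =
        tlift (forms Om 1) (\<lambda>(\<zeta>, w). \<zeta> \<otimes>\<^bsub>Om\<^esub> w \<eta>) Y \<oplus>\<^bsub>Om\<^esub>
        tlift (forms Om 1) (\<lambda>(\<zeta>, \<chi>). v \<zeta> \<otimes>\<^bsub>Om\<^esub> \<chi>) (box Om \<eta>)))"

definition vsig :: "('w, 'b) geometry_scheme \<Rightarrow> ('w \<Rightarrow> 'w) \<Rightarrow> 'w \<Rightarrow> ('w \<times> ('w \<Rightarrow> 'w)) frag set" where
  "vsig Om v \<eta> = (\<Oplus>\<^bsub>otens Om (forms Om 1) (vec Om)\<^esub>i\<in>{..<rk Om}.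
     tlift (otens Om (forms Om 1) (vec Om))
       (\<lambda>(\<zeta>, \<chi>). ostens Om (forms Om 1) (vec Om) (v \<zeta> \<otimes>\<^bsub>Om\<^esub> \<chi>) (ub Om i))
       (sgi Om (ostens Om (forms Om 1) (forms Om 1) \<eta> (xi Om i))))"


section \<open>The algebra of vector fields with the bullet product\<close>

type_synonym 'w tvec = "(('w \<Rightarrow> 'w) list \<times> 'w) frag set"
type_synonym 'w tvec_op = "'w tvec \<Rightarrow> 'w tvec \<Rightarrow> 'w tvec"

definition tvec :: "('w, 'b) calculus_scheme \<Rightarrow> ('w, 'w tvec) bimod" where
  "tvec Om = talg (base Om) (vec Om)"

definition emb0 :: "('w, 'b) calculus_scheme \<Rightarrow> 'w \<Rightarrow> 'w tvec" where
  "emb0 Om a = tword (base Om) (vec Om) [] a"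

definition emb1 :: "('w, 'b) calculus_scheme \<Rightarrow> ('w \<Rightarrow> 'w) \<Rightarrow> 'w tvec" where
  "emb1 Om u = tword (base Om) (vec Om) [u] \<one>\<^bsub>Om\<^esub>"

text \<open>$u \otimes x$ for a vector field u and a tensor x.\<close>

definition tcons :: "('w, 'b) calculus_scheme \<Rightarrow> ('w \<Rightarrow> 'w) \<Rightarrow> 'w tvec \<Rightarrow> 'w tvec" where
  "tcons Om u = tlift (tvec Om) (\<lambda>(vs, a). tword (base Om) (vec Om) (u # vs) a)"

abbreviation form_tvec :: "('w, 'b) calculus_scheme \<Rightarrow> nat \<Rightarrow>
    ('w, ('w \<times> 'w tvec) frag set) bimod" where
  "form_tvec Om k \<equiv> otens Om (forms Om k) (tvec Om)"

text \<open>
  $\square^{\langle n \rangle}$ for all n at once, by recursion on the length of words: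
  $\square^{\langle 0 \rangle} = \mathrm d$ and
  $\square^{\langle n+1 \rangle}(v \otimes x) =
    \square v \otimes x + (\sigma \otimes \mathrm{id})(v \otimes \square^{\langle n \rangle} x)$.
\<close>

primrec box_word :: "('w, 'b) geometry_scheme \<Rightarrow> 'w \<Rightarrow> ('w \<Rightarrow> 'w) list \<Rightarrow>
    ('w \<times> 'w tvec) frag set" where
  "box_word Om a [] = ostens Om (forms Om 1) (tvec Om) (dif Om a) (emb0 Om \<one>\<^bsub>Om\<^esub>)"
| "box_word Om a (v # vs) =
     tlift (form_tvec Om 1)
       (\<lambda>(\<eta>, w). ostens Om (forms Om 1) (tvec Om) \<eta> (tword (base Om) (vec Om) (w # vs) a))
       (vbox Om v)
     \<oplus>\<^bsub>form_tvec Om 1\<^esub>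
     tlift (form_tvec Om 1)
       (\<lambda>(\<eta>, y). tlift (form_tvec Om 1)
          (\<lambda>(\<zeta>, w). ostens Om (forms Om 1) (tvec Om) \<zeta> (tcons Om w y)) (vsig Om v \<eta>))
       (box_word Om a vs)"

definition tbox :: "('w, 'b) geometry_scheme \<Rightarrow> 'w tvec \<Rightarrow> ('w \<times> 'w tvec) frag set" where
  "tbox Om = tlift (form_tvec Om 1) (\<lambda>(vs, a). box_word Om a vs)"

text \<open>$(\mathrm{ev} \otimes \mathrm{id})(u \otimes Y)$, for u any right module map from forms to A.\<close>

definition ev_left :: "('w, 'b) calculus_scheme \<Rightarrow> ('w \<Rightarrow> 'w) \<Rightarrow> ('w, 'm, 'y) bimod_scheme \<Rightarrow>
    ('w \<times> 'm) frag set \<Rightarrow> 'm" where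
  "ev_left Om u M = tlift M (\<lambda>(\<eta>, m). lact M (u \<eta>) m)"

text \<open>
  The bimodule (and ring) of tensors with product \<^term>\<open>mul\<close>: the left action is the usual one,
  the right action is by the product.
\<close>

definition tvec_bullet :: "('w, 'b) calculus_scheme \<Rightarrow> 'w tvec_op \<Rightarrow> ('w, 'w tvec) bimod" where
  "tvec_bullet Om mul = (tvec Om)\<lparr>mult := mul, ract := (\<lambda>x a. mul x (emb0 Om a))\<rparr>"

text \<open>
  Associativity, distributivity and the unit (which is the unit of A) are in the ring locale.
\<close>

definition bullet_product :: "('w, 'b) geometry_scheme \<Rightarrow> 'w tvec_op \<Rightarrow> bool" where
  "bullet_product Om mul \<longleftrightarrow>
     ring (tvec_bullet Om mul) \<and>
     (\<forall>a\<in>piece Om 0. \<forall>x\<in>carrier (tvec Om). mul (emb0 Om a) x = lact (tvec Om) a x) \<and>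
     (\<forall>u\<in>carrier (vec Om). \<forall>x\<in>carrier (tvec Om).
        mul (emb1 Om u) x = tcons Om u x \<oplus>\<^bsub>tvec Om\<^esub> ev_left Om u (tvec Om) (tbox Om x)) \<and>
     (\<forall>u\<in>carrier (vec Om). \<forall>v\<in>carrier (tvec Om). \<forall>x\<in>carrier (tvec Om).
        mul (tcons Om u v) x =
          mul (emb1 Om u) (mul v x) \<ominus>\<^bsub>tvec Om\<^esub> mul (ev_left Om u (tvec Om) (tbox Om v)) x)"

definition curv_elem :: "('w, 'b) geometry_scheme \<Rightarrow> 'w tvec_op \<Rightarrow> ('w \<times> 'w tvec) frag set" where
  "curv_elem Om mul =
     (\<Oplus>\<^bsub>form_tvec Om 2\<^esub>i\<in>{..<rk Om}.
        ostens Om (forms Om 2) (tvec Om) (dif Om (xi Om i)) (emb1 Om (ub Om i)))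
     \<ominus>\<^bsub>form_tvec Om 2\<^esub>
     (\<Oplus>\<^bsub>form_tvec Om 2\<^esub>i\<in>{..<rk Om}. \<Oplus>\<^bsub>form_tvec Om 2\<^esub>j\<in>{..<rk Om}.
        ostens Om (forms Om 2) (tvec Om) (xi Om i \<otimes>\<^bsub>Om\<^esub> xi Om j)
          (mul (emb1 Om (ub Om j)) (emb1 Om (ub Om i))))"

definition curv_hat :: "('w, 'b) geometry_scheme \<Rightarrow> 'w tvec_op \<Rightarrow> ('w \<Rightarrow> 'w) \<Rightarrow> 'w tvec" where
  "curv_hat Om mul \<alpha> = ev_left Om \<alpha> (tvec Om) (curv_elem Om mul)"

definition curv_ideal :: "('w, 'b) geometry_scheme \<Rightarrow> 'w tvec_op \<Rightarrow> 'w tvec set" where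
  "curv_ideal Om mul = genideal (tvec_bullet Om mul)
     (curv_hat Om mul ` carrier (rhom (base Om) (forms Om 2) (forms Om 0)))"

definition dproj :: "('w, 'b) geometry_scheme \<Rightarrow> 'w tvec_op \<Rightarrow> 'w tvec \<Rightarrow> 'w tvec set" where
  "dproj Om mul x = curv_ideal Om mul +>\<^bsub>tvec_bullet Om mul\<^esub> x"

definition dalg :: "('w, 'b) geometry_scheme \<Rightarrow> 'w tvec_op \<Rightarrow> ('w, 'w tvec set) bimod" where
  "dalg Om mul = (let D = tvec_bullet Om mul Quot curv_ideal Om mul
     in ring.extend D (bimod.fields
       (\<lambda>a X. dproj Om mul (emb0 Om a) \<otimes>\<^bsub>D\<^esub> X)
       (\<lambda>X a. X \<otimes>\<^bsub>D\<^esub> dproj Om mul (emb0 Om a))))"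


section \<open>Flat extendable bimodule connections and the crossing map\<close>

record ('w, 'e) cbimod = "('w, 'e) bimod" +
  nab :: "'e \<Rightarrow> ('w \<times> 'e) frag set"
  sig :: "('e \<times> 'w) frag set \<Rightarrow> ('w \<times> 'e) frag set"

text \<open>$\eta \wedge Y \in \Omega^2 \otimes_A E$ for a one-form $\eta$ and $Y \in \Omega^1 \otimes_A E$.\<close>

definition wedge_left :: "('w, 'b) calculus_scheme \<Rightarrow> ('w, 'e, 'y) bimod_scheme \<Rightarrow> 'w \<Rightarrow>
    ('w \<times> 'e) frag set \<Rightarrow> ('w \<times> 'e) frag set" where
  "wedge_left Om E \<eta> = tlift (otens Om (forms Om 2) E)
     (\<lambda>(\<zeta>, e). ostens Om (forms Om 2) E (\<eta> \<otimes>\<^bsub>Om\<^esub> \<zeta>) e)"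

definition curvature :: "('w, 'b) calculus_scheme \<Rightarrow> ('w, 'e, 'y) cbimod_scheme \<Rightarrow> 'e \<Rightarrow>
    ('w \<times> 'e) frag set" where
  "curvature Om E e = tlift (otens Om (forms Om 2) E)
     (\<lambda>(\<eta>, f). ostens Om (forms Om 2) E (dif Om \<eta>) f
        \<ominus>\<^bsub>otens Om (forms Om 2) E\<^esub> wedge_left Om E \<eta> (nab E f))
     (nab E e)"

text \<open>
  As a bimodule over the complex algebra A, E has complex scalars acting equally on both sides.
\<close>

locale left_bimod_connection = dga Om + bimodule "base Om" E
  for Om :: "('w, 'b) calculus_scheme" and E :: "('w, 'e, 'y) cbimod_scheme" +
  assumes cst_act: "e \<in> carrier E \<Longrightarrow> lact E (cst Om z) e = ract E e (cst Om z)"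
    and nab_hom: "nab E \<in> add_hom E (otens Om (forms Om 1) E)"
    and sig_hom: "sig E \<in>
      bimod_hom (base Om) (otens Om E (forms Om 1)) (otens Om (forms Om 1) E)"
    and nab_lact: "\<lbrakk>a \<in> piece Om 0; e \<in> carrier E\<rbrakk> \<Longrightarrow> nab E (lact E a e) =
      ostens Om (forms Om 1) E (dif Om a) e \<oplus>\<^bsub>otens Om (forms Om 1) E\<^esub>
      lact (otens Om (forms Om 1) E) a (nab E e)"
    and nab_ract: "\<lbrakk>a \<in> piece Om 0; e \<in> carrier E\<rbrakk> \<Longrightarrow> nab E (ract E e a) =
      ract (otens Om (forms Om 1) E) (nab E e) a \<oplus>\<^bsub>otens Om (forms Om 1) E\<^esub>
      sig E (ostens Om E (forms Om 1) e (dif Om a))"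

locale flat_bimod = left_bimod_connection Om E
  for Om :: "('w, 'b) calculus_scheme" and E :: "('w, 'e, 'y) cbimod_scheme" +
  assumes flat: "e \<in> carrier E \<Longrightarrow> curvature Om E e = \<zero>\<^bsub>otens Om (forms Om 2) E\<^esub>"
    and extendable: "\<exists>s\<in>add_hom (otens Om E (forms Om 2)) (otens Om (forms Om 2) E).
      \<forall>e\<in>carrier E. \<forall>\<eta>\<in>piece Om 1. \<forall>\<zeta>\<in>piece Om 1.
        s (ostens Om E (forms Om 2) e (\<eta> \<otimes>\<^bsub>Om\<^esub> \<zeta>)) =
          tlift (otens Om (forms Om 2) E)
            (\<lambda>(\<chi>, f). wedge_left Om E \<chi> (sig E (ostens Om E (forms Om 1) f \<zeta>)))
            (sig E (ostens Om E (forms Om 1) e \<eta>))"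

text \<open>The action $u \triangleright e$ of a vector field.\<close>

definition vact :: "('w, 'b) calculus_scheme \<Rightarrow> ('w, 'e, 'y) cbimod_scheme \<Rightarrow> ('w \<Rightarrow> 'w) \<Rightarrow> 'e \<Rightarrow> 'e" where
  "vact Om E u e = ev_left Om u E (nab E e)"

text \<open>$\sigma_E^{-1}(u \otimes e)$, which is not an inverse of $\sigma_E$.\<close>

definition esigi :: "('w, 'b) calculus_scheme \<Rightarrow> ('w, 'e, 'y) cbimod_scheme \<Rightarrow> ('w \<Rightarrow> 'w) \<Rightarrow> 'e \<Rightarrow>
    ('e \<times> ('w \<Rightarrow> 'w)) frag set" where
  "esigi Om E u e = (THE Z. Z \<in> carrier (otens Om E (vec Om)) \<and>
     (\<forall>\<eta>\<in>piece Om 1. tlift E (\<lambda>(f, w). ract E f (w \<eta>)) Z =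
        ev_left Om u E (sig E (ostens Om E (forms Om 1) e \<eta>))))"

text \<open>
  The defining recursion of $\vartheta_E$. In the last clause the two sums are lifted together,
  since only their sum is balanced over A.
\<close>

definition crossing_map :: "('w, 'b) geometry_scheme \<Rightarrow> 'w tvec_op \<Rightarrow> ('w, 'e, 'y) cbimod_scheme \<Rightarrow>
    (('w tvec \<times> 'e) frag set \<Rightarrow> ('e \<times> 'w tvec) frag set) \<Rightarrow> bool" where
  "crossing_map Om mul E \<theta> \<longleftrightarrow> (let T = tvec_bullet Om mul; TE = otens Om T E; ET = otens Om E T in
     \<theta> \<in> add_hom TE ET \<and>
     (\<forall>a\<in>piece Om 0. \<forall>e\<in>carrier E.
        \<theta> (ostens Om T E (emb0 Om a) e) = ostens Om E T (lact E a e) \<one>\<^bsub>T\<^esub>) \<and>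
     (\<forall>u\<in>carrier (vec Om). \<forall>e\<in>carrier E.
        \<theta> (ostens Om T E (emb1 Om u) e) =
          ostens Om E T (vact Om E u e) \<one>\<^bsub>T\<^esub> \<oplus>\<^bsub>ET\<^esub>
          tmap (base Om) E T id (emb1 Om) (esigi Om E u e)) \<and>
     (\<forall>w\<in>carrier (vec Om). \<forall>v\<in>carrier T. \<forall>e\<in>carrier E.
        \<theta> (ostens Om T E (emb1 Om w \<otimes>\<^bsub>T\<^esub> v) e) =
          tlift ET
            (\<lambda>(f, x). ostens Om E T (vact Om E w f) x \<oplus>\<^bsub>ET\<^esub>
               tmap (base Om) E T id (\<lambda>w'. emb1 Om w' \<otimes>\<^bsub>T\<^esub> x) (esigi Om E w f))
            (\<theta> (ostens Om T E v e))))"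

end

theory Submission
  imports Defs
begin

text \<open>
  The tensor product $E \otimes_A \mathcal T\mathrm{Vec} A_\bullet$ carries the left connection
  $\nabla(f \otimes x) = \nabla_E f \otimes x + \sum_k \sigma_E(f \otimes \xi_k) \otimes u_k \bullet x$, and the recursion for
  $\vartheta_E$ says that left multiplication by $u \in \mathrm{Vec} A$ becomes
  $(\mathrm{ev} \otimes \mathrm{id})(u \otimes \nabla(-))$ under $\vartheta_E$. Hence left multiplication by
  $\widehat{\mathcal R}(\alpha)$ becomes $(\alpha \otimes \mathrm{id})$ applied to the curvature of $\nabla$. Since E is
  flat and extendable, that curvature is
  $f \otimes x \mapsto (\sigma_E \otimes \mathrm{id})(f \otimes \mathcal R \bullet x)$, and a dual basis of $\Omega^2 A$ rewrites
  its image under $\alpha$ as a sum of elements $h \otimes \widehat{\mathcal R}(\beta) \bullet x$ of $E \otimes_A \mathcal W$.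
\<close>

text \<open>The curvature formula covers only elements \<open>curv_hat Om mul \<alpha>\<close>
  \<bullet> y, while \<open>curv_ideal\<close> is two-sided. Right factors are absorbed by treating
  all y at once. Left factors need an induction over the bullet algebra, since the recursion for
  \<theta> speaks only of left factors in A and Vec A; that these generate is the reason for the
  filtration of tensors by word length.

  Two obstacles shape the analysis of E. The mixed terms of the curvature measure how far \<sigma>_E
  is from being parallel. That this defect is \<sigma>_E(f \<otimes> d\<xi>) comes from flatness:
  compare the curvature at f and at f.b for \<xi> = db, then use \<Omega>^1 = A.dA. And the
  extension of \<sigma>_E to \<Omega>^2 is known only on products of one-forms, while the axioms say
  only that degrees 0 and 1 generate the whole algebra; that products span \<Omega>^2 has to be
  extracted from this and the grading.

  Sums over a dual basis replace iterated tensor products. Their balancing over A rests on the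
  centrality of the dual basis element.\<close>

declare One_nat_def [simp del]

section \<open>Additive maps\<close>

lemma add_homI:
  assumes "\<And>x. x \<in> carrier M \<Longrightarrow> f x \<in> carrier N"
    and "\<And>x y. \<lbrakk>x \<in> carrier M; y \<in> carrier M\<rbrakk> \<Longrightarrow> f (x \<oplus>\<^bsub>M\<^esub> y) = f x \<oplus>\<^bsub>N\<^esub> f y"
  shows "f \<in> add_hom M N"
  using assms by (auto simp: add_hom_def hom_def)

lemma add_hom_closed: "\<lbrakk>f \<in> add_hom M N; x \<in> carrier M\<rbrakk> \<Longrightarrow> f x \<in> carrier N"
  by (auto simp: add_hom_def hom_def)

lemma add_hom_add:
  "\<lbrakk>f \<in> add_hom M N; x \<in> carrier M; y \<in> carrier M\<rbrakk> \<Longrightarrow> f (x \<oplus>\<^bsub>M\<^esub> y) = f x \<oplus>\<^bsub>N\<^esub> f y"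
  by (auto simp: add_hom_def hom_def)

lemma add_hom_compose:
  "\<lbrakk>f \<in> add_hom M N; g \<in> add_hom N P\<rbrakk> \<Longrightarrow> (\<lambda>x. g (f x)) \<in> add_hom M P"
  by (auto intro!: add_homI simp: add_hom_closed add_hom_add)

lemma add_hom_cong:
  assumes "f \<in> add_hom M N" "\<And>x. x \<in> carrier M \<Longrightarrow> g x = f x" "abelian_monoid M"
  shows "g \<in> add_hom M N"
  using assms by (auto intro!: add_homI simp: add_hom_closed add_hom_add abelian_monoidE(1))

locale additive_map = M: abelian_group M + N: abelian_group N
  for M (structure) and N (structure) +
  fixes f
  assumes hom: "f \<in> add_hom M N"
begin

sublocale abelian_group_hom M N f
  using hom
  by (auto intro!: abelian_group_hom.intro abelian_group_hom_axioms.intro group_hom.intro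
      group_hom_axioms.intro M.a_group N.a_group M.abelian_group_axioms N.abelian_group_axioms
      simp: add_hom_def)

lemma map_minus: "\<lbrakk>x \<in> carrier M; y \<in> carrier M\<rbrakk> \<Longrightarrow> f (x \<ominus>\<^bsub>M\<^esub> y) = f x \<ominus>\<^bsub>N\<^esub> f y"
  by (simp add: a_minus_def)

lemma map_finsum:
  "(\<And>i. i \<in> I \<Longrightarrow> g i \<in> carrier M) \<Longrightarrow>
    f (\<Oplus>\<^bsub>M\<^esub>i\<in>I. g i) = (\<Oplus>\<^bsub>N\<^esub>i\<in>I. f (g i))"
proof (induction I rule: infinite_finite_induct)
  \<comment> \<open>\<open>finsum\<close> over an infinite index set is zero by convention, and f
    preserves zero.\<close>
  case (infinite I)
  then show ?case by (simp add: M.finsum_infinite N.finsum_infinite)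
next
  case (insert i I)
  then show ?case by (simp add: M.finsum_insert N.finsum_insert Pi_def)
qed simp

text \<open>Combines \<open>map_finsum\<close> with a rewriting of the summands. Read forwards it
  pushes f into a sum, read backwards it collects a sum under f; nested sums are treated by using it
  twice.\<close>

lemma map_finsum_eq:
  assumes "\<And>i. i \<in> I \<Longrightarrow> g i \<in> carrier M" "\<And>i. i \<in> I \<Longrightarrow> f (g i) = k i"
  shows "f (\<Oplus>\<^bsub>M\<^esub>i\<in>I. g i) = (\<Oplus>\<^bsub>N\<^esub>i\<in>I. k i)"
proof -
  have "(\<Oplus>\<^bsub>N\<^esub>i\<in>I. f (g i)) = (\<Oplus>\<^bsub>N\<^esub>i\<in>I. k i)"
    using assms hom_closed by (intro N.finsum_cong') (simp_all flip: assms(2))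
  then show ?thesis using map_finsum[of I g] assms(1) by simp
qed

end

lemma (in abelian_group) finsum_in_subgroup:
  assumes "subgroup H (add_monoid G)" "\<And>i. i \<in> I \<Longrightarrow> g i \<in> H"
  shows "(\<Oplus>i\<in>I. g i) \<in> H"
  using assms(2)
proof (induction I rule: infinite_finite_induct)
  case (infinite I)
  then show ?case
    using subgroup.one_closed[OF assms(1)] by (simp add: finsum_infinite)
next
  case empty
  then show ?case using subgroup.one_closed[OF assms(1)] by simp
next
  case (insert i I)
  have "g j \<in> carrier G" if "j \<in> insert i I" for j
    using insert.prems[OF that] subgroup.subset[OF assms(1)] by auto
  then show ?case
    using insert subgroup.m_closed[OF assms(1), of "g i" "finsum G g I"]
    by (simp add: finsum_insert Pi_def)
qed

section \<open>Pointwise operations on additive maps, and finite sums\<close>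

context abelian_group
begin

lemma add_hom_add_pointwise:
  assumes "f \<in> add_hom M G" "g \<in> add_hom M G"
  shows "(\<lambda>x. f x \<oplus> g x) \<in> add_hom M G"
  using assms by (auto intro!: add_homI simp: add_hom_closed add_hom_add a_ac)

lemma add_hom_zero: "(\<lambda>x. \<zero>) \<in> add_hom M G"
  by (auto intro!: add_homI)

lemma add_hom_neg:
  assumes "f \<in> add_hom M G"
  shows "(\<lambda>x. \<ominus> f x) \<in> add_hom M G"
  using assms by (auto intro!: add_homI simp: add_hom_closed add_hom_add minus_add)

lemma add_hom_diff:
  assumes "f \<in> add_hom M G" "g \<in> add_hom M G"
  shows "(\<lambda>x. f x \<ominus> g x) \<in> add_hom M G"
  unfolding a_minus_def by (intro add_hom_add_pointwise add_hom_neg assms)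

lemma add_hom_finsum_pointwise:
  assumes "\<And>i. i \<in> I \<Longrightarrow> f i \<in> add_hom M G"
  shows "(\<lambda>x. \<Oplus>i\<in>I. f i x) \<in> add_hom M G"
  using assms
proof (induction I rule: infinite_finite_induct)
  case (insert i I)
  have "(\<lambda>x. f i x \<oplus> (\<Oplus>i\<in>I. f i x)) \<in> add_hom M G"
    using insert by (intro add_hom_add_pointwise) auto
  then show ?case
  proof (rule_tac add_homI)
    fix x assume "x \<in> carrier M"
    then show "(\<Oplus>i\<in>insert i I. f i x) \<in> carrier G"
      using insert.prems by (intro finsum_closed) (blast intro: add_hom_closed)
  next
    fix x y assume xy: "x \<in> carrier M" "y \<in> carrier M"
    have "f j (x \<oplus>\<^bsub>M\<^esub> y) = f j x \<oplus> f j y" if "j \<in> insert i I" for j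
      using insert.prems[OF that] xy by (simp add: add_hom_add)
    moreover have "f j x \<in> carrier G" "f j y \<in> carrier G" if "j \<in> insert i I" for j
      using insert.prems[OF that] xy by (auto simp: add_hom_closed)
    ultimately show "(\<Oplus>i\<in>insert i I. f i (x \<oplus>\<^bsub>M\<^esub> y)) =
        (\<Oplus>i\<in>insert i I. f i x) \<oplus> (\<Oplus>i\<in>insert i I. f i y)"
      using finsum_addf[of "\<lambda>j. f j x" "insert i I" "\<lambda>j. f j y"]
        finsum_cong'[of "insert i I" "insert i I" "\<lambda>j. f j x \<oplus> f j y" "\<lambda>j. f j (x \<oplus>\<^bsub>M\<^esub> y)"]
      by (simp add: Pi_def del: finsum_insert)
  qed
qed (auto simp: add_hom_zero finsum_infinite)

lemma finsum_swap:
  assumes "finite J" "\<And>i j. \<lbrakk>i \<in> I; j \<in> J\<rbrakk> \<Longrightarrow> f i j \<in> carrier G"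
  shows "(\<Oplus>i\<in>I. \<Oplus>j\<in>J. f i j) = (\<Oplus>j\<in>J. \<Oplus>i\<in>I. f i j)"
  using assms
proof (induction J rule: finite_induct)
  case empty
  then show ?case by (simp add: finsum_zero)
next
  case (insert j J)
  have "(\<Oplus>i\<in>I. \<Oplus>j\<in>insert j J. f i j) = (\<Oplus>i\<in>I. f i j \<oplus> (\<Oplus>j\<in>J. f i j))"
    using insert by (intro finsum_cong') (auto intro!: finsum_insert finsum_closed)
  also have "\<dots> = (\<Oplus>i\<in>I. f i j) \<oplus> (\<Oplus>i\<in>I. \<Oplus>j\<in>J. f i j)"
    using insert by (intro finsum_addf) (auto intro!: finsum_closed)
  also have "\<dots> = (\<Oplus>j\<in>insert j J. \<Oplus>i\<in>I. f i j)"
    using insert by (subst finsum_insert) (auto intro!: finsum_closed)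
  finally show ?case .
qed

lemma minus_eq_zero_iff: "\<lbrakk>x \<in> carrier G; y \<in> carrier G\<rbrakk> \<Longrightarrow> x \<ominus> y = \<zero> \<longleftrightarrow> x = y"
  unfolding a_minus_def by (metis minus_equality minus_minus a_inv_closed r_neg)

lemma finsum_minus:
  assumes "f \<in> I \<rightarrow> carrier G" "g \<in> I \<rightarrow> carrier G"
  shows "(\<Oplus>i\<in>I. f i \<ominus> g i) = (\<Oplus>i\<in>I. f i) \<ominus> (\<Oplus>i\<in>I. g i)"
proof -
  interpret neg: additive_map G G "\<lambda>x. \<ominus> x"
    by unfold_locales (auto intro!: add_homI simp: minus_add)
  have "(\<Oplus>i\<in>I. f i \<ominus> g i) = (\<Oplus>i\<in>I. f i) \<oplus> (\<Oplus>i\<in>I. \<ominus> g i)"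
    unfolding a_minus_def using assms by (intro finsum_addf) auto
  also have "(\<Oplus>i\<in>I. \<ominus> g i) = \<ominus> (\<Oplus>i\<in>I. g i)"
    using assms by (subst neg.map_finsum) auto
  finally show ?thesis by (simp add: a_minus_def)
qed

end

section \<open>Abelian groups given by generators and relations\<close>

text \<open>The common pattern of \<open>tens_group\<close> and \<open>talg_group\<close>, so that
  the universal property is proved once for both.\<close>

definition presented_group :: "'g set \<Rightarrow> 'g frag set \<Rightarrow> 'g frag set monoid" where
  "presented_group S R = free_Abelian_group S Mod generate (free_Abelian_group S) R"

definition presented_gen :: "'g set \<Rightarrow> 'g frag set \<Rightarrow> 'g \<Rightarrow> 'g frag set" where
  "presented_gen S R g = generate (free_Abelian_group S) R #>\<^bsub>free_Abelian_group S\<^esub> frag_of g"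

lemma (in abelian_group) frag_eval_props:
  fixes S :: "'g set"
  assumes "\<And>g. g \<in> S \<Longrightarrow> f g \<in> carrier G"
  shows frag_eval_hom: "frag_eval G f \<in> hom (free_Abelian_group S) (add_monoid G)"
    and frag_eval_frag_of: "g \<in> S \<Longrightarrow> frag_eval G f (frag_of g) = f g"
proof -
  \<comment> \<open>\<open>frag_eval\<close> sums over the support of x, which changes with x.
    \<open>gfinprod\<close> over the fixed set S ignores neutral terms, so all elements are
    evaluated over the same index set and additivity becomes distributivity of one product.\<close>
  have fin: "frag_eval G f x = gfinprod (add_monoid G) (\<lambda>a. add_pow G (Poly_Mapping.lookup x a) (f a)) S"
    if "Poly_Mapping.keys x \<subseteq> S" for x
  proof -
    let ?F = "\<lambda>a. add_pow G (Poly_Mapping.lookup x a) (f a)"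
    have cl: "?F a \<in> carrier G" if "a \<in> S" for a
      using assms[OF that] add.int_pow_closed[of "f a" "Poly_Mapping.lookup x a"] by (simp add: add_pow_def)
    have z: "{a \<in> S. ?F a \<noteq> \<zero>} \<subseteq> Poly_Mapping.keys x"
      by (auto simp: in_keys_iff add_pow_def int_pow_def nat_pow_def)
    have "finsum G ?F {a \<in> S. ?F a \<noteq> \<zero>} = finsum G ?F (Poly_Mapping.keys x)"
      using z that cl by (intro add.finprod_mono_neutral_cong_left) auto
    moreover have "finite {a \<in> S. ?F a \<noteq> \<zero>}"
      using z finite_keys finite_subset by blast
    ultimately show ?thesis
      by (simp add: frag_eval_def gfinprod_def finsum_def)
  qed
  obtain h where h: "h \<in> hom (free_Abelian_group S) (add_monoid G)" "\<And>x. x \<in> S \<Longrightarrow> h (frag_of x) = f x"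
    using comm_group.free_Abelian_group_universal[OF a_comm_group, of f S] assms by auto
  have single: "frag_eval G f (frag_of g) = f g" if "g \<in> S" for g
  proof -
    have one: "add_pow G (1::int) (f g) = f g"
      using assms[OF that] by (simp add: add_pow_def int_pow_def nat_pow_def)
    then show ?thesis
      using assms[OF that] by (simp add: frag_eval_def finsum_insert[OF finite.emptyI])
  qed
  show "g \<in> S \<Longrightarrow> frag_eval G f (frag_of g) = f g" by (rule single)
  show "frag_eval G f \<in> hom (free_Abelian_group S) (add_monoid G)"
  proof (rule homI)
    fix x y assume xy: "x \<in> carrier (free_Abelian_group S)" "y \<in> carrier (free_Abelian_group S)"
    have fs: "finite {a \<in> S. add_pow G (Poly_Mapping.lookup u a) (f a) \<noteq> \<zero>}"
      if "Poly_Mapping.keys u \<subseteq> S" for u :: "'g frag"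
      by (rule finite_subset [OF _ finite_keys [of u]])
        (auto simp: in_keys_iff add_pow_def int_pow_def nat_pow_def)
    have cl: "add_pow G (k::int) (f a) \<in> carrier G" if "a \<in> S" for a k
      using assms[OF that] add.int_pow_closed[of "f a" k] by (simp add: add_pow_def)
    have "Poly_Mapping.keys (x + y) \<subseteq> S" using xy keys_add[of x y] by auto
    moreover have "gfinprod (add_monoid G)
          (\<lambda>a. add_pow G (Poly_Mapping.lookup x a + Poly_Mapping.lookup y a) (f a)) S =
        gfinprod (add_monoid G) (\<lambda>a. add_pow G (Poly_Mapping.lookup x a) (f a) \<oplus>
          add_pow G (Poly_Mapping.lookup y a) (f a)) S"
      using cl assms
      by (intro comm_monoid.gfinprod_cong[OF a_comm_monoid])
        (auto simp: simp_implies_def add.int_pow_mult)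
    moreover have "\<dots> = gfinprod (add_monoid G) (\<lambda>a. add_pow G (Poly_Mapping.lookup x a) (f a)) S \<oplus>
        gfinprod (add_monoid G) (\<lambda>a. add_pow G (Poly_Mapping.lookup y a) (f a)) S"
      using comm_monoid.gfinprod_distrib[OF a_comm_monoid, of S
          "\<lambda>a. add_pow G (Poly_Mapping.lookup x a) (f a)" "\<lambda>a. add_pow G (Poly_Mapping.lookup y a) (f a)"]
        cl fs xy
      by auto
    ultimately show "frag_eval G f (x \<otimes>\<^bsub>free_Abelian_group S\<^esub> y) =
        frag_eval G f x \<otimes>\<^bsub>add_monoid G\<^esub> frag_eval G f y"
      using xy by (simp add: fin Poly_Mapping.lookup_add)
  next
    fix x assume "x \<in> carrier (free_Abelian_group S)"
    then show "frag_eval G f x \<in> carrier (add_monoid G)"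
      using assms by (auto simp: frag_eval_def intro!: finsum_closed) 
  qed
qed

locale presentation =
  fixes S :: "'g set" and R :: "'g frag set"
  assumes relations_closed: "r \<in> R \<Longrightarrow> Poly_Mapping.keys r \<subseteq> S"
begin

abbreviation "F \<equiv> free_Abelian_group S"

sublocale F: comm_group F
  by (rule abelian_free_Abelian_group)

lemma relations_subgroup: "subgroup (generate F R) F"
  using relations_closed by (intro F.generate_is_subgroup) auto

sublocale rel: normal "generate F R" F
  using relations_subgroup F.normal_iff_subgroup by blast

sublocale comm_group "presented_group S R"
  unfolding presented_group_def by (rule F.abelian_FactGroup[OF relations_subgroup])

lemma carrier_eq: "carrier (presented_group S R) = (\<lambda>x. generate F R #>\<^bsub>F\<^esub> x) ` carrier F"
  by (simp add: presented_group_def carrier_FactGroup)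

lemma coset_hom: "(\<lambda>x. generate F R #>\<^bsub>F\<^esub> x) \<in> hom F (presented_group S R)"
  unfolding presented_group_def by (rule rel.r_coset_hom_Mod)

lemma gen_closed: "g \<in> S \<Longrightarrow> presented_gen S R g \<in> carrier (presented_group S R)"
  by (auto simp: carrier_eq presented_gen_def)

lemma coset_zero: "r \<in> R \<Longrightarrow> generate F R #>\<^bsub>F\<^esub> r = \<one>\<^bsub>presented_group S R\<^esub>"
  using relations_closed generate.incl[of r R F] relations_subgroup
  by (simp add: presented_group_def F.coset_join2)

lemma presented_induct [consumes 1, case_names gen one mult inv]:
  assumes X: "X \<in> carrier (presented_group S R)"
    and gen: "\<And>g. g \<in> S \<Longrightarrow> P (presented_gen S R g)"
    and one: "P \<one>\<^bsub>presented_group S R\<^esub>"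
    and mult: "\<And>X Y. \<lbrakk>X \<in> carrier (presented_group S R); Y \<in> carrier (presented_group S R); P X; P Y\<rbrakk>
      \<Longrightarrow> P (X \<otimes>\<^bsub>presented_group S R\<^esub> Y)"
    and inv: "\<And>X. \<lbrakk>X \<in> carrier (presented_group S R); P X\<rbrakk> \<Longrightarrow> P (inv\<^bsub>presented_group S R\<^esub> X)"
  shows "P X"
proof -
  interpret c: group_hom F "presented_group S R" "\<lambda>x. generate F R #>\<^bsub>F\<^esub> x"
    using coset_hom by unfold_locales
  obtain x where x: "Poly_Mapping.keys x \<subseteq> S" "X = generate F R #>\<^bsub>F\<^esub> x"
    using X by (auto simp: carrier_eq)
  have "P (generate F R #>\<^bsub>F\<^esub> x)"
    using x(1)
  proof (induction rule: free_Abelian_group_induct[consumes 1, case_names 1 2 3])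
    case 1
    then show ?case using one c.hom_one by simp
  next
    case (2 x y)
    have "generate F R #>\<^bsub>F\<^esub> (x - y) = (generate F R #>\<^bsub>F\<^esub> x) \<otimes>\<^bsub>presented_group S R\<^esub>
        inv\<^bsub>presented_group S R\<^esub> (generate F R #>\<^bsub>F\<^esub> y)"
      using 2 c.hom_mult[of x "- y"] c.hom_inv[of y] by simp
    with 2 show ?case by (auto intro!: mult inv)
  next
    case (3 a)
    then show ?case using gen by (simp add: presented_gen_def)
  qed
  with x(2) show ?thesis by simp
qed

text \<open>The relations lie in the kernel of the evaluation, hence so does the subgroup they
  generate. The representative that \<open>tlift\<close> picks from the coset of x has the form k +
  x with k in that subgroup, so the choice has no effect.\<close>

lemma lift_props:
  assumes P: "abelian_group P" and f: "\<And>g. g \<in> S \<Longrightarrow> f g \<in> carrier P"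
    and rels: "\<And>r. r \<in> R \<Longrightarrow> frag_eval P f r = \<zero>\<^bsub>P\<^esub>"
  shows lift_hom: "tlift P f \<in> hom (presented_group S R) (add_monoid P)"
    and lift_gen: "g \<in> S \<Longrightarrow> tlift P f (presented_gen S R g) = f g"
proof -
  interpret P: abelian_group P by (rule P)
  have h: "frag_eval P f \<in> hom F (add_monoid P)"
    using f by (rule P.frag_eval_hom)
  interpret h: group_hom F "add_monoid P" "frag_eval P f"
    using h P.a_group by (intro group_hom.intro group_hom_axioms.intro) auto
  have "R \<subseteq> kernel F (add_monoid P) (frag_eval P f)"
    using rels relations_closed by (auto simp: kernel_def)
  then have ker: "frag_eval P f k = \<zero>\<^bsub>P\<^esub>" if "k \<in> generate F R" for k
    using F.generate_subgroup_incl[OF _ h.subgroup_kernel] that by (auto simp: kernel_def)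
  have val: "tlift P f (generate F R #>\<^bsub>F\<^esub> x) = frag_eval P f x" if x: "x \<in> carrier F" for x
  proof -
    have "x \<in> generate F R #>\<^bsub>F\<^esub> x"
      using F.rcos_self[OF x relations_subgroup] .
    then have "(SOME y. y \<in> generate F R #>\<^bsub>F\<^esub> x) \<in> generate F R #>\<^bsub>F\<^esub> x"
      by (rule someI)
    then obtain k where k: "k \<in> generate F R" "(SOME y. y \<in> generate F R #>\<^bsub>F\<^esub> x) = k + x"
      by (auto simp: r_coset_def)
    have kF: "k \<in> carrier F"
      using k(1) subgroup.subset[OF relations_subgroup] by blast
    show ?thesis
      using h.hom_mult[OF kF x] ker[OF k(1)] h.hom_closed[OF x] by (simp add: tlift_def k(2))
  qed
  show "tlift P f \<in> hom (presented_group S R) (add_monoid P)"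
  proof (rule homI)
    fix X assume "X \<in> carrier (presented_group S R)"
    then show "tlift P f X \<in> carrier (add_monoid P)"
      using val h.hom_closed by (auto simp: carrier_eq simp del: carrier_free_Abelian_group_iff)
  next
    fix X Y assume "X \<in> carrier (presented_group S R)" "Y \<in> carrier (presented_group S R)"
    then obtain x y where xy: "x \<in> carrier F" "y \<in> carrier F"
        "X = generate F R #>\<^bsub>F\<^esub> x" "Y = generate F R #>\<^bsub>F\<^esub> y"
      by (auto simp: carrier_eq simp del: carrier_free_Abelian_group_iff)
    have "X \<otimes>\<^bsub>presented_group S R\<^esub> Y = generate F R #>\<^bsub>F\<^esub> (x \<otimes>\<^bsub>F\<^esub> y)"
      using hom_mult[OF coset_hom xy(1,2)] xy(3,4) by simp
    then show "tlift P f (X \<otimes>\<^bsub>presented_group S R\<^esub> Y) =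
        tlift P f X \<otimes>\<^bsub>add_monoid P\<^esub> tlift P f Y"
      using xy h.hom_mult[OF xy(1,2)] F.m_closed[OF xy(1,2)]
      by (simp only: val)
  qed
  show "tlift P f (presented_gen S R g) = f g" if "g \<in> S"
    using that val[of "frag_of g"] P.frag_eval_frag_of[of S f g] f by (simp add: presented_gen_def)
qed

text \<open>The members of \<open>tens_rels\<close> and \<open>talg_rels\<close> have one of two
  shapes: a - b - c, which expresses additivity and is treated here, and a - b, which expresses
  balancing and is treated in \<open>gen_relation2\<close>.\<close>

lemma gen_relation:
  assumes "r \<in> R" "r = frag_of a - frag_of b - frag_of c" "a \<in> S" "b \<in> S" "c \<in> S"
  shows "presented_gen S R a = presented_gen S R b \<otimes>\<^bsub>presented_group S R\<^esub> presented_gen S R c"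
proof -
  interpret c: group_hom F "presented_group S R" "\<lambda>x. generate F R #>\<^bsub>F\<^esub> x"
    using coset_hom by unfold_locales
  have "frag_of a = r \<otimes>\<^bsub>F\<^esub> (frag_of b \<otimes>\<^bsub>F\<^esub> frag_of c)" using assms(2) by simp
  then show ?thesis
    using c.hom_mult[of r "frag_of b \<otimes>\<^bsub>F\<^esub> frag_of c"] c.hom_mult[of "frag_of b" "frag_of c"]
      relations_closed[OF assms(1)] assms coset_zero[OF assms(1)] gen_closed
      F.m_closed[of "frag_of b" "frag_of c"]
    by (simp add: presented_gen_def)
qed

lemma gen_relation2:
  assumes "r \<in> R" "r = frag_of a - frag_of b" "a \<in> S" "b \<in> S"
  shows "presented_gen S R a = presented_gen S R b"
proof -
  interpret c: group_hom F "presented_group S R" "\<lambda>x. generate F R #>\<^bsub>F\<^esub> x"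
    using coset_hom by unfold_locales
  have "frag_of a = r \<otimes>\<^bsub>F\<^esub> frag_of b" using assms(2) by simp
  then show ?thesis
    using c.hom_mult[of r "frag_of b"] relations_closed[OF assms(1)] assms coset_zero[OF assms(1)]
      gen_closed[of b]
    by (simp add: presented_gen_def)
qed

end

section \<open>Evaluation of the two shapes of relations\<close>

context abelian_group
begin

context
  fixes S and f
  assumes f: "\<And>g. g \<in> S \<Longrightarrow> f g \<in> carrier G"
begin

lemma frag_eval_diff:
  assumes "Poly_Mapping.keys x \<subseteq> S" "b \<in> S"
  shows "frag_eval G f (x - frag_of b) = frag_eval G f x \<ominus> f b"
proof -
  interpret h: group_hom "free_Abelian_group S" "add_monoid G" "frag_eval G f"
    using frag_eval_hom[OF f] a_group by (intro group_hom.intro group_hom_axioms.intro) auto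
  have "frag_eval G f (- frag_of b) = \<ominus> f b"
    using h.hom_inv[of "frag_of b"] assms(2) frag_eval_frag_of[of S f b, OF f]
    by (simp add: a_inv_def)
  then show ?thesis
    using h.hom_mult[of x "- frag_of b"] assms by (simp add: a_minus_def)
qed

lemma frag_eval_relation2:
  assumes "a \<in> S" "b \<in> S"
  shows "frag_eval G f (frag_of a - frag_of b) = \<zero> \<longleftrightarrow> f a = f b"
  using assms f frag_eval_diff[of "frag_of a" b] frag_eval_frag_of[of S f a, OF f]
  by (simp add: minus_eq_zero_iff)

lemma frag_eval_relation:
  assumes "a \<in> S" "b \<in> S" "c \<in> S"
  shows "frag_eval G f (frag_of a - frag_of b - frag_of c) = \<zero> \<longleftrightarrow> f a = f b \<oplus> f c"
proof -
  have "Poly_Mapping.keys (frag_of a - frag_of b) \<subseteq> S"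
    using assms keys_diff[of "frag_of a" "frag_of b"] by auto
  then have "frag_eval G f (frag_of a - frag_of b - frag_of c) = f a \<ominus> f b \<ominus> f c"
    using assms f frag_eval_diff frag_eval_frag_of[of S f a, OF f] by simp
  also have "\<dots> = f a \<ominus> (f b \<oplus> f c)"
    using assms f by (simp add: a_minus_def minus_add a_assoc)
  finally show ?thesis
    using assms f by (simp add: minus_eq_zero_iff)
qed

end

end

section \<open>Tensor products\<close>

lemma keys_relation:
  "\<lbrakk>x \<in> S; y \<in> S; z \<in> S\<rbrakk> \<Longrightarrow> Poly_Mapping.keys (frag_of x - frag_of y - frag_of z) \<subseteq> S"
  "\<lbrakk>x \<in> S; y \<in> S\<rbrakk> \<Longrightarrow> Poly_Mapping.keys (frag_of x - frag_of y) \<subseteq> S"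
  using keys_diff[of "frag_of x - frag_of y" "frag_of z"] keys_diff[of "frag_of x" "frag_of y"]
  by auto

text \<open>The quotient groups are multiplicative monoids, while \<open>tens\<close>,
  \<open>talg\<close> and their auxiliary records carry the same data as additive structure.
  Agreement of carrier, operation and unit transfers the group laws.\<close>

lemma abelian_group_of_comm_group:
  assumes "comm_group G" "carrier R = carrier G" "add R = mult G" "zero R = one G"
  shows "abelian_group R"
  using comm_groupE[OF assms(1)] assms(2-4) by (intro abelian_groupI) auto

lemma a_inv_of_comm_group:
  assumes "carrier R = carrier G" "add R = mult G" "zero R = one G"
  shows "\<ominus>\<^bsub>R\<^esub> x = inv\<^bsub>G\<^esub> x"
  using assms by (simp add: a_inv_def m_inv_def)

text \<open>These are just the data that \<open>tens_group\<close> depends on. Factors such as the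
  tensors with the bullet product, the ideal \<open>TW\<close> and the quotient \<open>D\<close>
  thus enter tensor products through their group and the one action that is balanced.\<close>

locale tensor_pair =
  fixes A :: "('a, 'x) ring_scheme" and M :: "('a, 'm, 'y) bimod_scheme"
    and N :: "('a, 'n, 'z) bimod_scheme"
  assumes abelian_left: "abelian_group M" and abelian_right: "abelian_group N"
    and ract_left: "\<lbrakk>a \<in> carrier A; m \<in> carrier M\<rbrakk> \<Longrightarrow> ract M m a \<in> carrier M"
    and lact_right: "\<lbrakk>a \<in> carrier A; n \<in> carrier N\<rbrakk> \<Longrightarrow> lact N a n \<in> carrier N"
begin

sublocale L: abelian_group M by (rule abelian_left)
sublocale R: abelian_group N by (rule abelian_right)

sublocale P: presentation "carrier M \<times> carrier N" "tens_rels A M N"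
proof
  fix r assume r: "r \<in> tens_rels A M N"
  show "Poly_Mapping.keys r \<subseteq> carrier M \<times> carrier N"
    using r unfolding tens_rels_def
    by (elim UnE CollectE exE conjE; simp only:; intro keys_relation)
      (simp_all add: ract_left lact_right)
qed

lemma tens_group_eq: "tens_group A M N = presented_group (carrier M \<times> carrier N) (tens_rels A M N)"
  by (simp add: tens_group_def presented_group_def)

lemma stens_eq: "stens A M N m n = presented_gen (carrier M \<times> carrier N) (tens_rels A M N) (m, n)"
  by (simp add: stens_def presented_gen_def)

lemma tens_fields:
  "carrier (tens A M N) = carrier (tens_group A M N)"
  "add (tens A M N) = mult (tens_group A M N)"
  "zero (tens A M N) = one (tens_group A M N)"
  by (simp_all add: tens_def Let_def ring.defs bimod.defs)

sublocale T: abelian_group "tens A M N"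
  by (rule abelian_group_of_comm_group[of "tens_group A M N"])
    (auto simp: tens_fields tens_group_eq P.comm_group_axioms)

lemma stens_closed: "\<lbrakk>m \<in> carrier M; n \<in> carrier N\<rbrakk> \<Longrightarrow> stens A M N m n \<in> carrier (tens A M N)"
  by (simp add: tens_fields tens_group_eq stens_eq P.gen_closed)

lemma stens_add_left:
  assumes "m \<in> carrier M" "m' \<in> carrier M" "n \<in> carrier N"
  shows "stens A M N (m \<oplus>\<^bsub>M\<^esub> m') n = stens A M N m n \<oplus>\<^bsub>tens A M N\<^esub> stens A M N m' n"
  unfolding stens_eq tens_fields tens_group_eq
  by (rule P.gen_relation[OF _ refl]) (use assms in \<open>auto simp: tens_rels_def\<close>)

lemma stens_add_right:
  assumes "m \<in> carrier M" "n \<in> carrier N" "n' \<in> carrier N"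
  shows "stens A M N m (n \<oplus>\<^bsub>N\<^esub> n') = stens A M N m n \<oplus>\<^bsub>tens A M N\<^esub> stens A M N m n'"
  unfolding stens_eq tens_fields tens_group_eq
  by (rule P.gen_relation[OF _ refl]) (use assms in \<open>auto simp: tens_rels_def\<close>)

lemma stens_balanced:
  assumes "m \<in> carrier M" "a \<in> carrier A" "n \<in> carrier N"
  shows "stens A M N (ract M m a) n = stens A M N m (lact N a n)"
  unfolding stens_eq
  by (rule P.gen_relation2[OF _ refl])
    (use assms ract_left lact_right in \<open>auto simp: tens_rels_def\<close>)

lemma stens_hom_left: "n \<in> carrier N \<Longrightarrow> (\<lambda>m. stens A M N m n) \<in> add_hom M (tens A M N)"
  by (auto intro!: add_homI simp: stens_closed stens_add_left)

lemma stens_hom_right: "m \<in> carrier M \<Longrightarrow> stens A M N m \<in> add_hom N (tens A M N)"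
  by (auto intro!: add_homI simp: stens_closed stens_add_right)

lemma tens_induct [consumes 1, case_names stens add minus]:
  assumes X: "X \<in> carrier (tens A M N)"
    and stens: "\<And>m n. \<lbrakk>m \<in> carrier M; n \<in> carrier N\<rbrakk> \<Longrightarrow> P (stens A M N m n)"
    and add: "\<And>X Y. \<lbrakk>X \<in> carrier (tens A M N); Y \<in> carrier (tens A M N); P X; P Y\<rbrakk>
      \<Longrightarrow> P (X \<oplus>\<^bsub>tens A M N\<^esub> Y)"
    and minus: "\<And>X. \<lbrakk>X \<in> carrier (tens A M N); P X\<rbrakk> \<Longrightarrow> P (\<ominus>\<^bsub>tens A M N\<^esub> X)"
  shows "P X"
proof -
  have ainv: "\<ominus>\<^bsub>tens A M N\<^esub> X = inv\<^bsub>presented_group (carrier M \<times> carrier N) (tens_rels A M N)\<^esub> X" for X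
    by (rule a_inv_of_comm_group) (simp_all add: tens_fields tens_group_eq)
  \<comment> \<open>The rule has no case for zero: it is obtained as a simple tensor plus its
    negative.\<close>
  have s: "stens A M N \<zero>\<^bsub>M\<^esub> \<zero>\<^bsub>N\<^esub> \<in> carrier (tens A M N)" "P (stens A M N \<zero>\<^bsub>M\<^esub> \<zero>\<^bsub>N\<^esub>)"
    by (auto intro: stens_closed stens)
  have zero: "P \<zero>\<^bsub>tens A M N\<^esub>"
    using add[OF s(1) T.a_inv_closed[OF s(1)] s(2) minus[OF s]] s(1) by (simp add: T.r_neg)
  have "X \<in> carrier (presented_group (carrier M \<times> carrier N) (tens_rels A M N))"
    using X by (simp add: tens_fields tens_group_eq)
  then show ?thesis
  proof (induction rule: P.presented_induct)
    case (gen g)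
    then show ?case using stens[of "fst g" "snd g"] by (auto simp: stens_eq)
  next
    case one
    then show ?case using zero by (simp add: tens_fields tens_group_eq)
  next
    case (mult X Y)
    then show ?case using add by (simp add: tens_fields tens_group_eq)
  next
    case (inv X)
    then show ?case using minus[of X] by (simp add: tens_fields(1) tens_group_eq ainv)
  qed
qed

lemma tens_hom_eqI:
  assumes X: "X \<in> carrier (tens A M N)"
    and G: "abelian_group G" and h: "h \<in> add_hom (tens A M N) G" and k: "k \<in> add_hom (tens A M N) G"
    and eq: "\<And>m n. \<lbrakk>m \<in> carrier M; n \<in> carrier N\<rbrakk> \<Longrightarrow> h (stens A M N m n) = k (stens A M N m n)"
  shows "h X = k X"
proof -
  interpret h: additive_map "tens A M N" G h
    using G h by (intro additive_map.intro additive_map_axioms.intro T.abelian_group_axioms)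
  interpret k: additive_map "tens A M N" G k
    using G k by (intro additive_map.intro additive_map_axioms.intro T.abelian_group_axioms)
  show ?thesis
    using X by (induction rule: tens_induct) (auto simp: eq)
qed

lemma tens_hom_in_subgroup:
  assumes X: "X \<in> carrier (tens A M N)"
    and G: "abelian_group G" and h: "h \<in> add_hom (tens A M N) G" and H: "subgroup H (add_monoid G)"
    and mem: "\<And>m n. \<lbrakk>m \<in> carrier M; n \<in> carrier N\<rbrakk> \<Longrightarrow> h (stens A M N m n) \<in> H"
  shows "h X \<in> H"
proof -
  interpret h: additive_map "tens A M N" G h
    using G h by (intro additive_map.intro additive_map_axioms.intro T.abelian_group_axioms)
  show ?thesis
    using X
  proof (induction rule: tens_induct)
    case (add X Y)
    then show ?case using subgroup.m_closed[OF H, of "h X" "h Y"] by simp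
  next
    case (minus X)
    then show ?case using subgroup.m_inv_closed[OF H, of "h X"] by (simp add: a_inv_def[symmetric])
  qed (rule mem)
qed

end

section \<open>Balanced maps and the universal property\<close>

definition balanced_map :: "('a, 'x) ring_scheme \<Rightarrow> ('a, 'm, 'y) bimod_scheme \<Rightarrow>
    ('a, 'n, 'z) bimod_scheme \<Rightarrow> ('p, 'w) ring_scheme \<Rightarrow> ('m \<Rightarrow> 'n \<Rightarrow> 'p) \<Rightarrow> bool" where
  "balanced_map A M N P f \<longleftrightarrow>
     (\<forall>n\<in>carrier N. (\<lambda>m. f m n) \<in> add_hom M P) \<and>
     (\<forall>m\<in>carrier M. f m \<in> add_hom N P) \<and>
     (\<forall>m\<in>carrier M. \<forall>a\<in>carrier A. \<forall>n\<in>carrier N. f (ract M m a) n = f m (lact N a n))"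

lemma balanced_mapI:
  assumes "\<And>n. n \<in> carrier N \<Longrightarrow> (\<lambda>m. f m n) \<in> add_hom M P"
    and "\<And>m. m \<in> carrier M \<Longrightarrow> (\<lambda>n. f m n) \<in> add_hom N P"
    and "\<And>m a n. \<lbrakk>m \<in> carrier M; a \<in> carrier A; n \<in> carrier N\<rbrakk> \<Longrightarrow> f (ract M m a) n = f m (lact N a n)"
  shows "balanced_map A M N P f"
  using assms by (simp add: balanced_map_def)

lemma balanced_mapD:
  assumes "balanced_map A M N P f"
  shows "n \<in> carrier N \<Longrightarrow> (\<lambda>m. f m n) \<in> add_hom M P"
    and "m \<in> carrier M \<Longrightarrow> (\<lambda>n. f m n) \<in> add_hom N P"
    and "\<lbrakk>m \<in> carrier M; a \<in> carrier A; n \<in> carrier N\<rbrakk> \<Longrightarrow> f (ract M m a) n = f m (lact N a n)"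
    and "\<lbrakk>m \<in> carrier M; n \<in> carrier N\<rbrakk> \<Longrightarrow> f m n \<in> carrier P"
  using assms by (auto simp: balanced_map_def intro: add_hom_closed)

lemma balanced_map_compose:
  assumes "balanced_map A M N P f" "h \<in> add_hom P Q"
  shows "balanced_map A M N Q (\<lambda>m n. h (f m n))"
proof (rule balanced_mapI)
  show "(\<lambda>m. h (f m n)) \<in> add_hom M Q" if "n \<in> carrier N" for n
    by (rule add_hom_compose[OF balanced_mapD(1)[OF assms(1) that] assms(2)])
  show "(\<lambda>n. h (f m n)) \<in> add_hom N Q" if "m \<in> carrier M" for m
    by (rule add_hom_compose[OF balanced_mapD(2)[OF assms(1) that] assms(2)])
qed (simp add: balanced_mapD(3)[OF assms(1)])

lemma (in tensor_pair) balanced_stens: "balanced_map A M N (tens A M N) (stens A M N)"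
  by (intro balanced_mapI stens_hom_left stens_hom_right stens_balanced)

context tensor_pair
begin

context
  fixes P :: "('p, 'w) ring_scheme" and f :: "'m \<Rightarrow> 'n \<Rightarrow> 'p"
  assumes P: "abelian_group P" and f: "balanced_map A M N P f"
begin

lemma tlift_props:
  shows tlift_hom: "tlift P (\<lambda>(m, n). f m n) \<in> add_hom (tens A M N) P"
    and tlift_stens: "\<lbrakk>m \<in> carrier M; n \<in> carrier N\<rbrakk> \<Longrightarrow> tlift P (\<lambda>(m, n). f m n) (stens A M N m n) = f m n"
proof -
  interpret G: abelian_group P by (rule P)
  let ?f = "\<lambda>(m, n). f m n"
  let ?S = "carrier M \<times> carrier N"
  have cl: "?f g \<in> carrier P" if "g \<in> ?S" for g
    using that balanced_mapD(4)[OF f] by auto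
  have rels: "frag_eval P ?f r = \<zero>\<^bsub>P\<^esub>" if "r \<in> tens_rels A M N" for r
    using that unfolding tens_rels_def
    by (elim UnE CollectE exE conjE)
      (simp_all add: G.frag_eval_relation[where S = ?S and f = ?f, OF cl]
        G.frag_eval_relation2[where S = ?S and f = ?f, OF cl] ract_left lact_right
        balanced_mapD(3)[OF f] add_hom_add[OF balanced_mapD(1)[OF f]] add_hom_add[OF balanced_mapD(2)[OF f]])
  show "tlift P ?f \<in> add_hom (tens A M N) P"
    using P.lift_hom[OF P cl rels]
    by (simp add: add_hom_def hom_def tens_fields tens_group_eq)
  show "tlift P ?f (stens A M N m n) = f m n" if "m \<in> carrier M" "n \<in> carrier N"
    using P.lift_gen[OF P cl rels, of "(m, n)"] that by (simp add: stens_eq)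
qed

lemma tlift_closed: "X \<in> carrier (tens A M N) \<Longrightarrow> tlift P (\<lambda>(m, n). f m n) X \<in> carrier P"
  using tlift_hom by (rule add_hom_closed)

end

lemma tlift_unique:
  assumes "abelian_group P" "balanced_map A M N P f" "h \<in> add_hom (tens A M N) P"
    and "\<And>m n. \<lbrakk>m \<in> carrier M; n \<in> carrier N\<rbrakk> \<Longrightarrow> h (stens A M N m n) = f m n"
    and "X \<in> carrier (tens A M N)"
  shows "tlift P (\<lambda>(m, n). f m n) X = h X"
  by (rule tens_hom_eqI[OF assms(5,1) tlift_hom[OF assms(1,2)] assms(3)])
    (simp add: tlift_stens[OF assms(1,2)] assms(4))

end

text \<open>The two functions need to agree only on the carriers. There g inherits balancedness from
  f, and both lifts are the additive map with these values on simple tensors. This replaces the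
  integrands written in \<open>box_word\<close> and \<open>crossing_map\<close> by functions already
  known to be balanced.\<close>

lemma tlift_cong:
  assumes "tensor_pair A M N" "abelian_group P" "balanced_map A M N P f"
    and "\<And>m n. \<lbrakk>m \<in> carrier M; n \<in> carrier N\<rbrakk> \<Longrightarrow> f m n = g m n"
    and "X \<in> carrier (tens A M N)"
  shows "tlift P (\<lambda>(m, n). g m n) X = tlift P (\<lambda>(m, n). f m n) X"
proof -
  interpret tensor_pair A M N by (rule assms(1))
  have "balanced_map A M N P g"
  proof (rule balanced_mapI)
    show "(\<lambda>m. g m n) \<in> add_hom M P" if "n \<in> carrier N" for n
      by (rule add_hom_cong[OF balanced_mapD(1)[OF assms(3) that]])
        (simp_all add: assms(4) that L.abelian_monoid_axioms)
    show "(\<lambda>n. g m n) \<in> add_hom N P" if "m \<in> carrier M" for m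
      by (rule add_hom_cong[OF balanced_mapD(2)[OF assms(3) that]])
        (simp_all add: assms(4) that R.abelian_monoid_axioms)
    show "g (ract M m a) n = g m (lact N a n)"
      if "m \<in> carrier M" "a \<in> carrier A" "n \<in> carrier N" for m a n
      using that balanced_mapD(3)[OF assms(3) that]
      by (simp add: assms(4)[symmetric] ract_left lact_right)
  qed
  then show ?thesis
    by (rule tlift_unique[OF assms(2) _ tlift_hom[OF assms(2,3)] _ assms(5)])
      (simp add: tlift_stens[OF assms(2,3)] assms(4))
qed

section \<open>Actions on tensor products and tensor products of maps\<close>

lemma (in tensor_pair) tens_lact:
  assumes a: "(\<lambda>m. lact M a m) \<in> add_hom M M"
    and comm: "\<And>m b. \<lbrakk>m \<in> carrier M; b \<in> carrier A\<rbrakk> \<Longrightarrow> lact M a (ract M m b) = ract M (lact M a m) b"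
  shows tens_lact_hom: "lact (tens A M N) a \<in> add_hom (tens A M N) (tens A M N)"
    and tens_lact_stens: "\<lbrakk>m \<in> carrier M; n \<in> carrier N\<rbrakk> \<Longrightarrow>
      lact (tens A M N) a (stens A M N m n) = stens A M N (lact M a m) n"
proof -
  \<comment> \<open>The actions of \<open>tens\<close> are defined by lifting into this record, in
    which no actions exist yet. It has the additive group of the tensor product, so additive maps
    into the two records are the same.\<close>
  let ?G = "\<lparr>carrier = carrier (tens_group A M N),
       mult = (\<lambda>_ _. undefined), one = undefined,
       zero = one (tens_group A M N), add = mult (tens_group A M N)\<rparr>"
  have G: "abelian_group ?G"
    by (rule abelian_group_of_comm_group[of "tens_group A M N"])
      (auto simp: tens_group_eq P.comm_group_axioms)
  have [simp]: "add_hom X ?G = add_hom X (tens A M N)" for X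
    by (simp add: add_hom_def hom_def tens_fields)
  have eq: "lact (tens A M N) a = tlift ?G (\<lambda>(m, n). stens A M N (lact M a m) n)"
    by (simp add: tens_def Let_def ring.defs bimod.defs)
  have "balanced_map A M N ?G (\<lambda>m n. stens A M N (lact M a m) n)"
  proof (rule balanced_mapI)
    show "(\<lambda>m. stens A M N (lact M a m) n) \<in> add_hom M ?G" if "n \<in> carrier N" for n
      using add_hom_compose[OF a stens_hom_left[OF that]] by simp
    show "stens A M N (lact M a m) \<in> add_hom N ?G" if "m \<in> carrier M" for m
      using stens_hom_right[OF add_hom_closed[OF a that]] by simp
  qed (simp add: comm stens_balanced add_hom_closed[OF a])
  from tlift_props[OF G this] show "lact (tens A M N) a \<in> add_hom (tens A M N) (tens A M N)"
    "\<lbrakk>m \<in> carrier M; n \<in> carrier N\<rbrakk> \<Longrightarrow>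
      lact (tens A M N) a (stens A M N m n) = stens A M N (lact M a m) n"
    by (simp_all add: eq)
qed

lemma (in tensor_pair) tens_ract:
  assumes a: "(\<lambda>n. ract N n a) \<in> add_hom N N"
    and comm: "\<And>n b. \<lbrakk>n \<in> carrier N; b \<in> carrier A\<rbrakk> \<Longrightarrow> ract N (lact N b n) a = lact N b (ract N n a)"
  shows tens_ract_hom: "(\<lambda>X. ract (tens A M N) X a) \<in> add_hom (tens A M N) (tens A M N)"
    and tens_ract_stens: "\<lbrakk>m \<in> carrier M; n \<in> carrier N\<rbrakk> \<Longrightarrow>
      ract (tens A M N) (stens A M N m n) a = stens A M N m (ract N n a)"
proof -
  let ?G = "\<lparr>carrier = carrier (tens_group A M N),
       mult = (\<lambda>_ _. undefined), one = undefined,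
       zero = one (tens_group A M N), add = mult (tens_group A M N)\<rparr>"
  have G: "abelian_group ?G"
    by (rule abelian_group_of_comm_group[of "tens_group A M N"])
      (auto simp: tens_group_eq P.comm_group_axioms)
  have [simp]: "add_hom X ?G = add_hom X (tens A M N)" for X
    by (simp add: add_hom_def hom_def tens_fields)
  have eq: "(\<lambda>X. ract (tens A M N) X a) = tlift ?G (\<lambda>(m, n). stens A M N m (ract N n a))"
    by (simp add: tens_def Let_def ring.defs bimod.defs)
  have "balanced_map A M N ?G (\<lambda>m n. stens A M N m (ract N n a))"
  proof (rule balanced_mapI)
    show "(\<lambda>n. stens A M N m (ract N n a)) \<in> add_hom N ?G" if "m \<in> carrier M" for m
      using add_hom_compose[OF a stens_hom_right[OF that]] by simp
    show "(\<lambda>m. stens A M N m (ract N n a)) \<in> add_hom M ?G" if "n \<in> carrier N" for n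
      using stens_hom_left[OF add_hom_closed[OF a that]] by simp
  qed (simp add: comm stens_balanced add_hom_closed[OF a])
  from tlift_props[OF G this] show "(\<lambda>X. ract (tens A M N) X a) \<in> add_hom (tens A M N) (tens A M N)"
    "\<lbrakk>m \<in> carrier M; n \<in> carrier N\<rbrakk> \<Longrightarrow>
      ract (tens A M N) (stens A M N m n) a = stens A M N m (ract N n a)"
    by (simp_all add: eq[symmetric])
qed

lemma balanced_map_stens_map:
  assumes "tensor_pair A M' N'" "f \<in> add_hom M M'" "g \<in> add_hom N N'"
    and "\<And>m a. \<lbrakk>m \<in> carrier M; a \<in> carrier A\<rbrakk> \<Longrightarrow> f (ract M m a) = ract M' (f m) a"
    and "\<And>n a. \<lbrakk>n \<in> carrier N; a \<in> carrier A\<rbrakk> \<Longrightarrow> g (lact N a n) = lact N' a (g n)"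
  shows "balanced_map A M N (tens A M' N') (\<lambda>m n. stens A M' N' (f m) (g n))"
proof -
  interpret T': tensor_pair A M' N' by (rule assms(1))
  show ?thesis
  proof (rule balanced_mapI)
    show "(\<lambda>m. stens A M' N' (f m) (g n)) \<in> add_hom M (tens A M' N')" if "n \<in> carrier N" for n
      by (rule add_hom_compose[OF assms(2) T'.stens_hom_left[OF add_hom_closed[OF assms(3) that]]])
    show "(\<lambda>n. stens A M' N' (f m) (g n)) \<in> add_hom N (tens A M' N')" if "m \<in> carrier M" for m
      by (rule add_hom_compose[OF assms(3) T'.stens_hom_right[OF add_hom_closed[OF assms(2) that]]])
  qed (simp add: assms(4,5) T'.stens_balanced add_hom_closed[OF assms(2)] add_hom_closed[OF assms(3)])
qed

lemma tmap_props:
  assumes "tensor_pair A M N" "tensor_pair A M' N'" "f \<in> add_hom M M'" "g \<in> add_hom N N'"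
    and "\<And>m a. \<lbrakk>m \<in> carrier M; a \<in> carrier A\<rbrakk> \<Longrightarrow> f (ract M m a) = ract M' (f m) a"
    and "\<And>n a. \<lbrakk>n \<in> carrier N; a \<in> carrier A\<rbrakk> \<Longrightarrow> g (lact N a n) = lact N' a (g n)"
  shows tmap_hom: "tmap A M' N' f g \<in> add_hom (tens A M N) (tens A M' N')"
    and tmap_stens: "\<lbrakk>m \<in> carrier M; n \<in> carrier N\<rbrakk> \<Longrightarrow>
      tmap A M' N' f g (stens A M N m n) = stens A M' N' (f m) (g n)"
proof -
  interpret T: tensor_pair A M N by (rule assms(1))
  interpret T': tensor_pair A M' N' by (rule assms(2))
  note * = T.tlift_props[OF T'.T.abelian_group_axioms balanced_map_stens_map[OF assms(2-)]]
  show "tmap A M' N' f g \<in> add_hom (tens A M N) (tens A M' N')"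
    unfolding tmap_def by (rule *(1))
  show "tmap A M' N' f g (stens A M N m n) = stens A M' N' (f m) (g n)"
    if "m \<in> carrier M" "n \<in> carrier N"
    using that by (simp add: tmap_def *(2))
qed

section \<open>Bimodules of forms and vector fields\<close>

context bimodule
begin

lemma lact_hom: "a \<in> carrier A \<Longrightarrow> (\<lambda>m. lact M a m) \<in> add_hom M M"
  by (auto intro!: add_homI simp: lact_closed lact_add)

lemma ract_hom: "a \<in> carrier A \<Longrightarrow> (\<lambda>m. ract M m a) \<in> add_hom M M"
  by (auto intro!: add_homI simp: ract_closed ract_add)

end

lemma tensor_pair_bimodules:
  assumes "bimodule A M" "bimodule A N"
  shows "tensor_pair A M N"
  using assms by (auto intro!: tensor_pair.intro simp: bimodule_def bimodule_axioms_def)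

section \<open>The bimodule of right module maps\<close>

lemma rhom_carrierD:
  assumes "f \<in> carrier (rhom A M N)"
  shows "f \<in> add_hom M N" "f \<in> extensional (carrier M)"
    "\<lbrakk>a \<in> carrier A; m \<in> carrier M\<rbrakk> \<Longrightarrow> f (ract M m a) = ract N (f m) a"
  using assms by (auto simp: rhom_def)

lemma rhom_eqI:
  assumes "f \<in> carrier (rhom A M N)" "g \<in> carrier (rhom A M N)"
    and "\<And>m. m \<in> carrier M \<Longrightarrow> f m = g m"
  shows "f = g"
  using assms by (auto intro: extensionalityI dest: rhom_carrierD(2))

lemma rhom_apply:
  assumes "m \<in> carrier M"
  shows "add (rhom A M N) f g m = f m \<oplus>\<^bsub>N\<^esub> g m"
    and "zero (rhom A M N) m = \<zero>\<^bsub>N\<^esub>"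
    and "lact (rhom A M N) a f m = lact N a (f m)"
    and "ract (rhom A M N) f a m = f (lact M a m)"
  using assms by (simp_all add: rhom_def)

lemma rhomI:
  assumes "bimodule A M" "f \<in> add_hom M N"
    and "\<And>a m. \<lbrakk>a \<in> carrier A; m \<in> carrier M\<rbrakk> \<Longrightarrow> f (ract M m a) = ract N (f m) a"
  shows "restrict f (carrier M) \<in> carrier (rhom A M N)"
proof -
  interpret bimodule A M by (rule assms(1))
  show ?thesis
    using assms(2,3) by (auto simp: rhom_def ract_closed add_hom_closed add_hom_add intro!: add_homI)
qed

lemma bimodule_rhom:
  assumes "bimodule A M" "bimodule A N"
  shows "bimodule A (rhom A M N)"
proof -
  interpret M: bimodule A M by (rule assms(1))
  interpret N: bimodule A N by (rule assms(2))
  let ?H = "rhom A M N"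
  note D = rhom_carrierD(1)[of _ A M N, THEN add_hom_closed]
    rhom_carrierD(1)[of _ A M N, THEN add_hom_add] rhom_carrierD(3)[of _ A M N]
  \<comment> \<open>Each operation of \<open>rhom\<close> is a restricted pointwise formula, so
    closure is in every case this one criterion.\<close>
  have H: "restrict f (carrier M) \<in> carrier ?H"
    if "\<And>m. m \<in> carrier M \<Longrightarrow> f m \<in> carrier N"
      "\<And>m n. \<lbrakk>m \<in> carrier M; n \<in> carrier M\<rbrakk> \<Longrightarrow> f (m \<oplus>\<^bsub>M\<^esub> n) = f m \<oplus>\<^bsub>N\<^esub> f n"
      "\<And>a m. \<lbrakk>a \<in> carrier A; m \<in> carrier M\<rbrakk> \<Longrightarrow> f (ract M m a) = ract N (f m) a" for f
    using that by (intro rhomI[OF assms(1)] add_homI) auto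
  have neg_ract: "ract N (\<ominus>\<^bsub>N\<^esub> m) a = \<ominus>\<^bsub>N\<^esub> ract N m a" if "m \<in> carrier N" "a \<in> carrier A" for m a
  proof -
    interpret h: additive_map N N "\<lambda>m. ract N m a"
      by unfold_locales (rule N.ract_hom[OF that(2)])
    show ?thesis using that by simp
  qed
  have zero_ract: "ract N \<zero>\<^bsub>N\<^esub> a = \<zero>\<^bsub>N\<^esub>" if "a \<in> carrier A" for a
  proof -
    interpret h: additive_map N N "\<lambda>m. ract N m a"
      by unfold_locales (rule N.ract_hom[OF that])
    show ?thesis by (rule h.hom_zero)
  qed
  have add: "f \<oplus>\<^bsub>?H\<^esub> g \<in> carrier ?H" if "f \<in> carrier ?H" "g \<in> carrier ?H" for f g
    using H[of "\<lambda>m. f m \<oplus>\<^bsub>N\<^esub> g m"] D(1)[OF that(1)] D(1)[OF that(2)] D(2)[OF that(1)] D(2)[OF that(2)]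
      D(3)[OF that(1)] D(3)[OF that(2)]
    by (simp add: rhom_def N.M.a_ac N.ract_add)
  have zero: "\<zero>\<^bsub>?H\<^esub> \<in> carrier ?H"
    using H[of "\<lambda>m. \<zero>\<^bsub>N\<^esub>"] by (simp add: rhom_def zero_ract)
  have lact: "lact ?H a f \<in> carrier ?H" if "a \<in> carrier A" "f \<in> carrier ?H" for a f
    using H[of "\<lambda>m. lact N a (f m)"] D(1)[OF that(2)] D(2)[OF that(2)] D(3)[OF that(2)] that(1)
    by (simp add: rhom_def N.lact_add N.lact_closed N.lact_ract)
  have ract: "ract ?H f a \<in> carrier ?H" if "a \<in> carrier A" "f \<in> carrier ?H" for a f
    using H[of "\<lambda>m. f (lact M a m)"] D(1)[OF that(2)] D(2)[OF that(2)] D(3)[OF that(2)] that(1)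
    by (simp add: rhom_def M.lact_add M.lact_closed M.lact_ract[symmetric])
  have neg: "(\<lambda>m\<in>carrier M. \<ominus>\<^bsub>N\<^esub> f m) \<in> carrier ?H" if "f \<in> carrier ?H" for f
    using H[of "\<lambda>m. \<ominus>\<^bsub>N\<^esub> f m"] D(1)[OF that] D(2)[OF that] D(3)[OF that]
    by (simp add: N.M.minus_add neg_ract)
  have "abelian_group ?H"
  proof (rule abelian_groupI)
    fix f assume f: "f \<in> carrier ?H"
    show "\<exists>g\<in>carrier ?H. g \<oplus>\<^bsub>?H\<^esub> f = \<zero>\<^bsub>?H\<^esub>"
    proof (rule bexI)
      show "(\<lambda>m\<in>carrier M. \<ominus>\<^bsub>N\<^esub> f m) \<oplus>\<^bsub>?H\<^esub> f = \<zero>\<^bsub>?H\<^esub>"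
        by (rule rhom_eqI[OF add[OF neg[OF f] f] zero]) (simp add: rhom_apply N.M.l_neg D(1)[OF f])
    qed (rule neg[OF f])
  next
    fix f g h assume fgh: "f \<in> carrier ?H" "g \<in> carrier ?H" "h \<in> carrier ?H"
    show "f \<oplus>\<^bsub>?H\<^esub> g \<oplus>\<^bsub>?H\<^esub> h = f \<oplus>\<^bsub>?H\<^esub> (g \<oplus>\<^bsub>?H\<^esub> h)"
      by (rule rhom_eqI) (use fgh D(1) in \<open>auto intro!: add simp: rhom_apply N.M.a_assoc\<close>)
  next
    fix f g assume fg: "f \<in> carrier ?H" "g \<in> carrier ?H"
    show "f \<oplus>\<^bsub>?H\<^esub> g = g \<oplus>\<^bsub>?H\<^esub> f"
      by (rule rhom_eqI) (use fg D(1) in \<open>auto intro!: add simp: rhom_apply N.M.a_comm\<close>)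
  next
    fix f assume f: "f \<in> carrier ?H"
    show "\<zero>\<^bsub>?H\<^esub> \<oplus>\<^bsub>?H\<^esub> f = f"
      by (rule rhom_eqI) (use f D(1) in \<open>auto intro!: add zero simp: rhom_apply\<close>)
  qed (auto intro: add zero)
  moreover have "bimodule_axioms A ?H"
  proof
    fix a b f assume abf: "a \<in> carrier A" "b \<in> carrier A" "f \<in> carrier ?H"
    note f = D(1)[OF abf(3)]
    show "lact ?H (a \<oplus>\<^bsub>A\<^esub> b) f = lact ?H a f \<oplus>\<^bsub>?H\<^esub> lact ?H b f"
      by (rule rhom_eqI) (use abf f in \<open>auto intro!: add lact simp: rhom_apply N.add_lact\<close>)
    show "lact ?H (a \<otimes>\<^bsub>A\<^esub> b) f = lact ?H a (lact ?H b f)"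
      by (rule rhom_eqI) (use abf f in \<open>auto intro!: add lact simp: rhom_apply N.mult_lact\<close>)
    show "ract ?H f (a \<oplus>\<^bsub>A\<^esub> b) = ract ?H f a \<oplus>\<^bsub>?H\<^esub> ract ?H f b"
      by (rule rhom_eqI)
        (use abf f D(2)[OF abf(3)] in \<open>auto intro!: add ract simp: rhom_apply M.add_lact M.lact_closed\<close>)
    show "ract ?H f (a \<otimes>\<^bsub>A\<^esub> b) = ract ?H (ract ?H f a) b"
      by (rule rhom_eqI) (use abf f in \<open>auto intro!: add ract simp: rhom_apply M.mult_lact M.lact_closed\<close>)
    show "ract ?H (lact ?H a f) b = lact ?H a (ract ?H f b)"
      by (rule rhom_eqI) (use abf f in \<open>auto intro!: lact ract simp: rhom_apply M.lact_closed\<close>)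
  next
    fix a f g assume afg: "a \<in> carrier A" "f \<in> carrier ?H" "g \<in> carrier ?H"
    note f = D(1)[OF afg(2)] D(1)[OF afg(3)]
    show "lact ?H a (f \<oplus>\<^bsub>?H\<^esub> g) = lact ?H a f \<oplus>\<^bsub>?H\<^esub> lact ?H a g"
      by (rule rhom_eqI) (use afg f in \<open>auto intro!: add lact simp: rhom_apply N.lact_add\<close>)
    show "ract ?H (f \<oplus>\<^bsub>?H\<^esub> g) a = ract ?H f a \<oplus>\<^bsub>?H\<^esub> ract ?H g a"
      by (rule rhom_eqI) (use afg f in \<open>auto intro!: add ract simp: rhom_apply M.lact_closed\<close>)
  next
    fix f assume f: "f \<in> carrier ?H"
    show "lact ?H \<one>\<^bsub>A\<^esub> f = f"
      by (rule rhom_eqI) (use f D(1) in \<open>auto intro!: lact simp: rhom_apply N.one_lact\<close>)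
    show "ract ?H f \<one>\<^bsub>A\<^esub> = f"
      by (rule rhom_eqI) (use f D(1) in \<open>auto intro!: ract simp: rhom_apply M.one_lact\<close>)
  qed (auto intro: lact ract)
  ultimately show ?thesis
    by (auto intro!: bimodule.intro M.A.ring_axioms)
qed

section \<open>Forms and vector fields\<close>

lemma base_simps [simp]:
  "carrier (base Om) = piece Om 0" "add (base Om) = add Om" "mult (base Om) = mult Om"
  "zero (base Om) = zero Om" "one (base Om) = one Om"
  by (simp_all add: base_def)

lemma forms_simps [simp]:
  "carrier (forms Om k) = piece Om k" "add (forms Om k) = add Om" "zero (forms Om k) = zero Om"
  "lact (forms Om k) = mult Om" "ract (forms Om k) = mult Om"
  by (simp_all add: forms_def self_bimod_def)

context dga
begin

lemma piece_closed: "x \<in> piece Om k \<Longrightarrow> x \<in> carrier Om"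
  using subgroup.subset[OF piece_subgroup] by auto

lemma piece_add: "\<lbrakk>x \<in> piece Om k; y \<in> piece Om k\<rbrakk> \<Longrightarrow> x \<oplus> y \<in> piece Om k"
  using subgroup.m_closed[OF piece_subgroup] by auto

lemma piece_zero: "\<zero> \<in> piece Om k"
  using subgroup.one_closed[OF piece_subgroup] by auto

lemma piece_neg: "x \<in> piece Om k \<Longrightarrow> \<ominus> x \<in> piece Om k"
  using subgroup.m_inv_closed[OF piece_subgroup] by (auto simp: a_inv_def)

lemma piece_mult:
  "\<lbrakk>a \<in> piece Om 0; x \<in> piece Om k\<rbrakk> \<Longrightarrow> a \<otimes> x \<in> piece Om k"
  "\<lbrakk>x \<in> piece Om k; a \<in> piece Om 0\<rbrakk> \<Longrightarrow> x \<otimes> a \<in> piece Om k"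
  "\<lbrakk>x \<in> piece Om 1; y \<in> piece Om 1\<rbrakk> \<Longrightarrow> x \<otimes> y \<in> piece Om 2"
  using mult_piece[of a 0 x k] mult_piece[of x k a 0] mult_piece[of x 1 y 1]
  by (simp_all add: numeral_2_eq_2 One_nat_def)

lemma piece_dif: "a \<in> piece Om 0 \<Longrightarrow> dif Om a \<in> piece Om 1" "x \<in> piece Om 1 \<Longrightarrow> dif Om x \<in> piece Om 2"
  using dif_piece[of a 0] dif_piece[of x 1] by (simp_all add: numeral_2_eq_2 One_nat_def)

lemmas piece_rules = piece_add piece_zero piece_neg piece_mult piece_dif one_piece

lemma abelian_group_forms: "abelian_group (forms Om k)"
proof (rule abelian_groupI)
  fix x assume "x \<in> carrier (forms Om k)"
  then show "\<exists>y\<in>carrier (forms Om k). y \<oplus>\<^bsub>forms Om k\<^esub> x = \<zero>\<^bsub>forms Om k\<^esub>"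
    by (intro bexI[of _ "\<ominus> x"]) (auto simp: piece_neg piece_closed l_neg)
qed (auto simp: piece_rules piece_closed a_ac)

lemma ring_base: "ring (base Om)"
proof (rule ringI)
  show "abelian_group (base Om)"
    using abelian_groupE[OF abelian_group_forms[of 0]] by (intro abelian_groupI) auto
  show "monoid (base Om)"
    by (rule monoidI) (auto simp: piece_rules piece_closed m_assoc)
qed (auto simp: piece_closed l_distr r_distr)

lemma bimodule_forms: "bimodule (base Om) (forms Om k)"
  using ring_base abelian_group_forms
  by (intro bimodule.intro bimodule_axioms.intro)
    (auto simp: piece_rules piece_closed l_distr r_distr m_assoc)

sublocale forms: bimodule "base Om" "forms Om k" for k
  by (rule bimodule_forms)

lemma bimodule_vec: "bimodule (base Om) (vec Om)"
  unfolding vec_def by (rule bimodule_rhom[OF bimodule_forms bimodule_forms])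

sublocale vec: bimodule "base Om" "vec Om"
  by (rule bimodule_vec)

lemma forms_incl: "(\<lambda>x. x) \<in> add_hom (forms Om k) Om"
  by (auto intro!: add_homI simp: piece_closed)

text \<open>\<open>finsum\<close> is computed in a given record and depends on its carrier. Sums in
  degree k agree with sums in the ambient ring because the inclusion is additive; the same reason
  serves for negatives and differences below.\<close>

lemma finsum_forms:
  assumes "\<And>i. i \<in> I \<Longrightarrow> f i \<in> piece Om k"
  shows "finsum (forms Om k) f I = finsum Om f I"
proof -
  interpret h: additive_map "forms Om k" Om "\<lambda>x. x"
    by unfold_locales (rule forms_incl)
  show ?thesis using h.map_finsum[of I f] assms by simp
qed

lemma a_inv_forms: "x \<in> piece Om k \<Longrightarrow> \<ominus>\<^bsub>forms Om k\<^esub> x = \<ominus> x"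
proof -
  interpret h: additive_map "forms Om k" Om "\<lambda>x. x"
    by unfold_locales (rule forms_incl)
  show "x \<in> piece Om k \<Longrightarrow> \<ominus>\<^bsub>forms Om k\<^esub> x = \<ominus> x" using h.hom_a_inv[of x] by simp
qed

lemma a_minus_forms: "\<lbrakk>x \<in> piece Om k; y \<in> piece Om k\<rbrakk> \<Longrightarrow> x \<ominus>\<^bsub>forms Om k\<^esub> y = x \<ominus> y"
  by (simp add: a_minus_def a_inv_forms)

lemma vec_closed: "\<lbrakk>v \<in> carrier (vec Om); \<eta> \<in> piece Om 1\<rbrakk> \<Longrightarrow> v \<eta> \<in> piece Om 0"
  using rhom_carrierD(1)[THEN add_hom_closed, of v "base Om" "forms Om 1" "forms Om 0" \<eta>] by (simp add: vec_def)

lemma vec_hom: "v \<in> carrier (vec Om) \<Longrightarrow> v \<in> add_hom (forms Om 1) (forms Om 0)"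
  using rhom_carrierD(1) by (simp add: vec_def)

lemma vec_ract: "\<lbrakk>v \<in> carrier (vec Om); \<eta> \<in> piece Om 1; a \<in> piece Om 0\<rbrakk> \<Longrightarrow> v (\<eta> \<otimes> a) = v \<eta> \<otimes> a"
  using rhom_carrierD(3)[of v "base Om" "forms Om 1" "forms Om 0" a \<eta>] by (simp add: vec_def)

lemma vec_apply:
  assumes "\<eta> \<in> piece Om 1"
  shows "(v \<oplus>\<^bsub>vec Om\<^esub> w) \<eta> = v \<eta> \<oplus> w \<eta>" "\<zero>\<^bsub>vec Om\<^esub> \<eta> = \<zero>"
    "lact (vec Om) a v \<eta> = a \<otimes> v \<eta>" "ract (vec Om) v a \<eta> = v (a \<otimes> \<eta>)"
  using assms by (simp_all add: vec_def rhom_apply)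

lemma vec_eqI:
  assumes "v \<in> carrier (vec Om)" "w \<in> carrier (vec Om)" "\<And>\<eta>. \<eta> \<in> piece Om 1 \<Longrightarrow> v \<eta> = w \<eta>"
  shows "v = w"
  using assms rhom_eqI[of v "base Om" "forms Om 1" "forms Om 0" w] by (simp add: vec_def)

lemma eval_hom: "\<eta> \<in> piece Om 1 \<Longrightarrow> (\<lambda>v. v \<eta>) \<in> add_hom (vec Om) (forms Om 0)"
  by (auto intro!: add_homI simp: vec_closed vec_apply)

lemma finsum_vec_apply:
  assumes "\<And>i. i \<in> I \<Longrightarrow> f i \<in> carrier (vec Om)" "\<eta> \<in> piece Om 1"
  shows "finsum (vec Om) f I \<eta> = (\<Oplus>i\<in>I. f i \<eta>)"
proof -
  interpret h: additive_map "vec Om" "forms Om 0" "\<lambda>v. v \<eta>"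
    by unfold_locales (rule eval_hom[OF assms(2)])
  show ?thesis using h.map_finsum[of I f] assms finsum_forms[of I "\<lambda>i. f i \<eta>" 0] vec_closed by simp
qed

lemma dif_forms: "(\<lambda>x. dif Om x) \<in> add_hom (forms Om k) (forms Om (Suc k))"
  by (auto intro!: add_homI simp: dif_piece add_hom_add[OF dif_hom] piece_closed)

lemma dif_mult0: "\<lbrakk>a \<in> piece Om 0; x \<in> carrier Om\<rbrakk> \<Longrightarrow> dif Om (a \<otimes> x) = dif Om a \<otimes> x \<oplus> a \<otimes> dif Om x"
  using dif_mult[of a 0 x] by simp

lemma dif_mult1: "\<lbrakk>\<eta> \<in> piece Om 1; x \<in> carrier Om\<rbrakk> \<Longrightarrow> dif Om (\<eta> \<otimes> x) = dif Om \<eta> \<otimes> x \<ominus> \<eta> \<otimes> dif Om x"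
  using dif_mult[of \<eta> 1 x] by (simp add: a_minus_def)

end

text \<open>Unlike the elements of \<^const>\<open>rhom\<close>, these maps need not be extensional.\<close>

definition (in dga) right_map :: "('w, 'm, 'y) bimod_scheme \<Rightarrow> ('w \<Rightarrow> 'm) \<Rightarrow> bool" where
  "right_map M \<psi> \<longleftrightarrow> \<psi> \<in> add_hom (forms Om 1) M \<and>
     (\<forall>\<eta>\<in>piece Om 1. \<forall>a\<in>piece Om 0. \<psi> (\<eta> \<otimes> a) = ract M (\<psi> \<eta>) a)"

section \<open>Expansions in the dual basis\<close>

context geometry
begin

abbreviation "I \<equiv> {..<rk Om}"

text \<open>The expansion dual to \<open>dual_basis\<close>: apply w to the expansion of a one-form
  and use right linearity.\<close>

lemma vec_expansion:
  assumes "w \<in> carrier (vec Om)"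
  shows "w = (\<Oplus>\<^bsub>vec Om\<^esub>i\<in>I. lact (vec Om) (w (xi Om i)) (ub Om i))"
proof (rule vec_eqI)
  have cl: "lact (vec Om) (w (xi Om i)) (ub Om i) \<in> carrier (vec Om)" if "i \<in> I" for i
    using that assms by (simp add: vec.lact_closed vec_closed xi_closed ub_closed)
  show "(\<Oplus>\<^bsub>vec Om\<^esub>i\<in>I. lact (vec Om) (w (xi Om i)) (ub Om i)) \<in> carrier (vec Om)"
    using cl by (auto intro!: vec.M.finsum_closed)
  fix \<eta> assume \<eta>: "\<eta> \<in> piece Om 1"
  interpret w: additive_map "forms Om 1" "forms Om 0" w
    by unfold_locales (rule vec_hom[OF assms])
  have t: "xi Om i \<otimes> ub Om i \<eta> \<in> piece Om 1" if "i \<in> I" for i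
    using that by (simp add: piece_mult(2) vec_closed \<eta> xi_closed ub_closed)
  have "w \<eta> = w (\<Oplus>\<^bsub>forms Om 1\<^esub>i\<in>I. xi Om i \<otimes> ub Om i \<eta>)"
    using dual_basis[OF \<eta>] finsum_forms[of I, OF t] by simp
  also have "\<dots> = (\<Oplus>\<^bsub>forms Om 0\<^esub>i\<in>I. w (xi Om i \<otimes> ub Om i \<eta>))"
    using t by (intro w.map_finsum) simp
  also have "\<dots> = (\<Oplus>i\<in>I. w (xi Om i) \<otimes> ub Om i \<eta>)"
    using t \<eta> assms by (subst finsum_forms)
      (auto intro!: finsum_cong' simp: vec_ract piece_closed[of _ 0] piece_mult vec_closed xi_closed ub_closed)
  also have "\<dots> = (\<Oplus>\<^bsub>vec Om\<^esub>i\<in>I. lact (vec Om) (w (xi Om i)) (ub Om i)) \<eta>"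
    using cl \<eta> by (subst finsum_vec_apply) (simp_all add: vec_apply)
  finally show "w \<eta> = (\<Oplus>\<^bsub>vec Om\<^esub>i\<in>I. lact (vec Om) (w (xi Om i)) (ub Om i)) \<eta>" .
qed (rule assms)

lemma right_map_expansion:
  assumes M: "bimodule (base Om) M" and "right_map M \<psi>" "\<eta> \<in> piece Om 1"
  shows "\<psi> \<eta> = (\<Oplus>\<^bsub>M\<^esub>i\<in>I. ract M (\<psi> (xi Om i)) (ub Om i \<eta>))"
proof -
  interpret M: bimodule "base Om" M by (rule M)
  interpret p: additive_map "forms Om 1" M \<psi>
    using assms(2) by unfold_locales (simp add: right_map_def)
  have t: "xi Om i \<otimes> ub Om i \<eta> \<in> piece Om 1" if "i \<in> I" for i
    using that by (simp add: piece_mult(2) vec_closed assms(3) xi_closed ub_closed)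
  have "\<psi> \<eta> = \<psi> (\<Oplus>\<^bsub>forms Om 1\<^esub>i\<in>I. xi Om i \<otimes> ub Om i \<eta>)"
    using dual_basis[OF assms(3)] finsum_forms[of I, OF t] by simp
  also have "\<dots> = (\<Oplus>\<^bsub>M\<^esub>i\<in>I. \<psi> (xi Om i \<otimes> ub Om i \<eta>))"
    using t by (intro p.map_finsum) simp
  also have "\<dots> = (\<Oplus>\<^bsub>M\<^esub>i\<in>I. ract M (\<psi> (xi Om i)) (ub Om i \<eta>))"
    using assms(2,3) t p.hom_closed
    by (intro M.M.finsum_cong')
      (auto simp: right_map_def xi_closed vec_closed ub_closed M.ract_closed)
  finally show ?thesis .
qed

context
  fixes M :: "('w, 'm, 'y) bimod_scheme" and P :: "('p, 'z) ring_scheme" and f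
  assumes M: "bimodule (base Om) M" and P: "abelian_group P"
    and f: "balanced_map (base Om) M (vec Om) P f"
begin

interpretation M: bimodule "base Om" M by (rule M)
interpretation P: abelian_group P by (rule P)

text \<open>Expand w by \<open>vec_expansion\<close> and move each coefficient w(\<xi>_i) across to
  the left argument. A balanced map is therefore determined by its values with some u_i on the
  right.\<close>

lemma balanced_expansion:
  assumes "m \<in> carrier M" "w \<in> carrier (vec Om)"
  shows "f m w = (\<Oplus>\<^bsub>P\<^esub>i\<in>I. f (ract M m (w (xi Om i))) (ub Om i))"
proof -
  interpret h: additive_map "vec Om" P "f m"
    by unfold_locales (use balanced_mapD(2)[OF f assms(1)] in simp)
  have "f m w = f m (\<Oplus>\<^bsub>vec Om\<^esub>i\<in>I. lact (vec Om) (w (xi Om i)) (ub Om i))"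
    using vec_expansion[OF assms(2)] by simp
  also have "\<dots> = (\<Oplus>\<^bsub>P\<^esub>i\<in>I. f m (lact (vec Om) (w (xi Om i)) (ub Om i)))"
    using assms by (intro h.map_finsum) (simp add: vec.lact_closed vec_closed xi_closed ub_closed)
  also have "\<dots> = (\<Oplus>\<^bsub>P\<^esub>i\<in>I. f (ract M m (w (xi Om i))) (ub Om i))"
    using assms
    by (intro P.finsum_cong')
      (auto simp: balanced_mapD(3)[OF f, symmetric] balanced_mapD(4)[OF f] M.ract_closed
        vec_closed xi_closed ub_closed)
  finally show ?thesis .
qed

text \<open>This is the centrality $\sum_i a\xi_i \otimes u_i = \sum_i \xi_i \otimes u_i a$ of the dual basis element.\<close>

lemma coev_central:
  assumes "right_map M \<psi>" "a \<in> piece Om 0"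
  shows "(\<Oplus>\<^bsub>P\<^esub>i\<in>I. f (\<psi> (a \<otimes> xi Om i)) (ub Om i)) = (\<Oplus>\<^bsub>P\<^esub>i\<in>I. f (\<psi> (xi Om i)) (ract (vec Om) (ub Om i) a))"
proof -
  have \<psi>: "\<psi> \<eta> \<in> carrier M" if "\<eta> \<in> piece Om 1" for \<eta>
    using assms(1) that add_hom_closed[of \<psi> "forms Om 1" M \<eta>] by (simp add: right_map_def)
  \<comment> \<open>Both sides of the claim become the double sum of these terms: u_j.a is expanded
    by \<open>balanced_expansion\<close>, a\<xi>_i by \<open>right_map_expansion\<close>, and the
    two orders of summation are exchanged.\<close>
  have fcl: "f (ract M (\<psi> (xi Om j)) (ub Om j (a \<otimes> xi Om i))) (ub Om i) \<in> carrier P"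
    if "i \<in> I" "j \<in> I" for i j
    using that assms(2)
    by (auto intro!: balanced_mapD(4)[OF f] M.ract_closed \<psi> simp: xi_closed ub_closed vec_closed piece_mult)
  have "(\<Oplus>\<^bsub>P\<^esub>j\<in>I. f (\<psi> (xi Om j)) (ract (vec Om) (ub Om j) a)) =
      (\<Oplus>\<^bsub>P\<^esub>j\<in>I. \<Oplus>\<^bsub>P\<^esub>i\<in>I. f (ract M (\<psi> (xi Om j)) (ub Om j (a \<otimes> xi Om i))) (ub Om i))"
  proof (rule P.finsum_cong')
    fix j assume j: "j \<in> I"
    have "f (\<psi> (xi Om j)) (ract (vec Om) (ub Om j) a) =
        (\<Oplus>\<^bsub>P\<^esub>i\<in>I. f (ract M (\<psi> (xi Om j)) (ract (vec Om) (ub Om j) a (xi Om i))) (ub Om i))"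
      using j assms(2) by (intro balanced_expansion) (auto intro!: \<psi> vec.ract_closed simp: xi_closed ub_closed)
    also have "\<dots> = (\<Oplus>\<^bsub>P\<^esub>i\<in>I. f (ract M (\<psi> (xi Om j)) (ub Om j (a \<otimes> xi Om i))) (ub Om i))"
      using j fcl by (intro P.finsum_cong') (auto simp: vec_apply xi_closed)
    finally show "f (\<psi> (xi Om j)) (ract (vec Om) (ub Om j) a) =
        (\<Oplus>\<^bsub>P\<^esub>i\<in>I. f (ract M (\<psi> (xi Om j)) (ub Om j (a \<otimes> xi Om i))) (ub Om i))" .
  qed (auto intro!: P.finsum_closed fcl)
  also have "\<dots> = (\<Oplus>\<^bsub>P\<^esub>i\<in>I. \<Oplus>\<^bsub>P\<^esub>j\<in>I. f (ract M (\<psi> (xi Om j)) (ub Om j (a \<otimes> xi Om i))) (ub Om i))"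
    by (rule P.finsum_swap) (auto intro!: fcl)
  also have "\<dots> = (\<Oplus>\<^bsub>P\<^esub>i\<in>I. f (\<psi> (a \<otimes> xi Om i)) (ub Om i))"
  proof (rule P.finsum_cong')
    fix i assume i: "i \<in> I"
    interpret h: additive_map M P "\<lambda>m. f m (ub Om i)"
      by unfold_locales (use balanced_mapD(1)[OF f] i ub_closed in simp)
    have "f (\<psi> (a \<otimes> xi Om i)) (ub Om i) =
        f (\<Oplus>\<^bsub>M\<^esub>j\<in>I. ract M (\<psi> (xi Om j)) (ub Om j (a \<otimes> xi Om i))) (ub Om i)"
      using i assms by (subst right_map_expansion[OF M assms(1)]) (auto simp: piece_mult xi_closed)
    also have "\<dots> = (\<Oplus>\<^bsub>P\<^esub>j\<in>I. f (ract M (\<psi> (xi Om j)) (ub Om j (a \<otimes> xi Om i))) (ub Om i))"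
      using i assms by (intro h.map_finsum) (auto intro!: M.ract_closed \<psi> simp: xi_closed ub_closed vec_closed piece_mult)
    finally show "(\<Oplus>\<^bsub>P\<^esub>j\<in>I. f (ract M (\<psi> (xi Om j)) (ub Om j (a \<otimes> xi Om i))) (ub Om i)) = f (\<psi> (a \<otimes> xi Om i)) (ub Om i)" ..
  qed (auto intro!: balanced_mapD(4)[OF f] \<psi> simp: piece_mult assms(2) xi_closed ub_closed)
  finally show ?thesis ..
qed

end

text \<open>$M \otimes_A \mathrm{Vec} A = \mathrm{Hom}_A(\Omega^1 A, M)$: this evaluates \<^const>\<open>vbox\<close> and \<^const>\<open>esigi\<close>.\<close>

lemma the_vec_tensor:
  assumes M: "bimodule (base Om) M" and \<psi>: "right_map M \<psi>"
  shows "(THE Z. Z \<in> carrier (otens Om M (vec Om)) \<and>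
      (\<forall>\<eta>\<in>piece Om 1. tlift M (\<lambda>(m, w). ract M m (w \<eta>)) Z = \<psi> \<eta>)) =
    (\<Oplus>\<^bsub>otens Om M (vec Om)\<^esub>i\<in>I. ostens Om M (vec Om) (\<psi> (xi Om i)) (ub Om i))"
proof -
  interpret M: bimodule "base Om" M by (rule M)
  interpret T: tensor_pair "base Om" M "vec Om"
    by (rule tensor_pair_bimodules[OF M bimodule_vec])
  let ?ev = "\<lambda>\<eta>. tlift M (\<lambda>(m, w). ract M m (w \<eta>))"
  let ?Z = "\<lambda>\<psi>. \<Oplus>\<^bsub>otens Om M (vec Om)\<^esub>i\<in>I. ostens Om M (vec Om) (\<psi> (xi Om i)) (ub Om i)"
  have \<psi>cl: "\<psi> \<eta> \<in> carrier M" if "\<eta> \<in> piece Om 1" for \<eta>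
    using \<psi> that add_hom_closed[of \<psi> "forms Om 1" M \<eta>] by (simp add: right_map_def)
  have bal: "balanced_map (base Om) M (vec Om) M (\<lambda>m w. ract M m (w \<eta>))" if "\<eta> \<in> piece Om 1" for \<eta>
    using that
    by (intro balanced_mapI add_homI)
      (simp_all add: vec_closed vec_apply M.mult_ract[simplified] M.ract_closed M.ract_add M.add_ract[simplified])
  note ev = T.tlift_hom[OF M.M.abelian_group_axioms bal] T.tlift_stens[OF M.M.abelian_group_axioms bal]
    T.tlift_closed[OF M.M.abelian_group_axioms bal]
  have Z: "?Z \<psi> \<in> carrier (otens Om M (vec Om))"
    using \<psi>cl by (auto intro!: T.T.finsum_closed T.stens_closed simp: xi_closed ub_closed)
  have Zev: "?ev \<eta> (?Z \<psi>) = \<psi> \<eta>" if \<eta>: "\<eta> \<in> piece Om 1" for \<eta>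
  proof -
    interpret h: additive_map "otens Om M (vec Om)" M "?ev \<eta>"
      by unfold_locales (rule ev(1)[OF \<eta>])
    have "?ev \<eta> (?Z \<psi>) = (\<Oplus>\<^bsub>M\<^esub>i\<in>I. ?ev \<eta> (ostens Om M (vec Om) (\<psi> (xi Om i)) (ub Om i)))"
      using \<psi>cl by (intro h.map_finsum) (auto intro!: T.stens_closed simp: xi_closed ub_closed)
    also have "\<dots> = (\<Oplus>\<^bsub>M\<^esub>i\<in>I. ract M (\<psi> (xi Om i)) (ub Om i \<eta>))"
      using \<psi>cl \<eta> by (intro M.M.finsum_cong') 
        (auto simp: ev(2) xi_closed ub_closed vec_closed intro!: M.ract_closed)
    finally show ?thesis
      using right_map_expansion[OF M \<psi> \<eta>] by simp
  qed
  \<comment> \<open>Rebuilding an element from its own evaluations at the \<xi>_i is an additive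
    operation that fixes simple tensors, hence the identity. So the evaluations determine Z.\<close>
  have uniq: "Z = ?Z \<psi>" if Zc: "Z \<in> carrier (otens Om M (vec Om))"
    and "\<And>\<eta>. \<eta> \<in> piece Om 1 \<Longrightarrow> ?ev \<eta> Z = \<psi> \<eta>" for Z
  proof -
    have "Z = ?Z (\<lambda>\<eta>. ?ev \<eta> Z)"
    proof (rule T.tens_hom_eqI[OF Zc T.T.abelian_group_axioms])
      show "(\<lambda>Z. Z) \<in> add_hom (otens Om M (vec Om)) (otens Om M (vec Om))"
        by (auto intro!: add_homI)
      show "(\<lambda>Z. ?Z (\<lambda>\<eta>. ?ev \<eta> Z)) \<in> add_hom (otens Om M (vec Om)) (otens Om M (vec Om))"
      proof (rule T.T.add_hom_finsum_pointwise)
        show "(\<lambda>Z. ostens Om M (vec Om) (?ev (xi Om i) Z) (ub Om i)) \<in>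
            add_hom (otens Om M (vec Om)) (otens Om M (vec Om))" if "i \<in> I" for i
          using that by (intro add_hom_compose[OF ev(1) T.stens_hom_left]) (simp_all add: xi_closed ub_closed)
      qed
      fix m w assume mw: "m \<in> carrier M" "w \<in> carrier (vec Om)"
      show "ostens Om M (vec Om) m w = ?Z (\<lambda>\<eta>. ?ev \<eta> (ostens Om M (vec Om) m w))"
        by (rule trans[OF balanced_expansion[OF M T.T.abelian_group_axioms T.balanced_stens mw]],
            rule T.T.finsum_cong')
          (simp_all add: mw ev(2) xi_closed ub_closed vec_closed T.stens_closed M.ract_closed)
    qed
    also have "\<dots> = ?Z \<psi>"
      using that(2) \<psi>cl by (intro T.T.finsum_cong') (auto simp: xi_closed ub_closed intro!: T.stens_closed)
    finally show ?thesis .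
  qed
  show ?thesis
    by (rule the_equality) (use Z Zev in blast, use uniq in blast)
qed

end

section \<open>The tensor algebra\<close>

text \<open>For words this is what \<open>balanced_map\<close> is for pairs: its clauses mirror the
  four families of \<open>talg_rels\<close>.\<close>

definition word_map :: "('a, 'x) ring_scheme \<Rightarrow> ('a, 'v, 'y) bimod_scheme \<Rightarrow> ('p, 'z) ring_scheme \<Rightarrow>
    ('v list \<Rightarrow> 'a \<Rightarrow> 'p) \<Rightarrow> bool" where
  "word_map A V P f \<longleftrightarrow>
     (\<forall>vs\<in>lists (carrier V). f vs \<in> add_hom A P) \<and>
     (\<forall>us\<in>lists (carrier V). \<forall>vs\<in>lists (carrier V). \<forall>a\<in>carrier A.
        (\<forall>v\<in>carrier V. \<forall>v'\<in>carrier V.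
           f (us @ (v \<oplus>\<^bsub>V\<^esub> v') # vs) a = f (us @ v # vs) a \<oplus>\<^bsub>P\<^esub> f (us @ v' # vs) a) \<and>
        (\<forall>v\<in>carrier V. \<forall>v'\<in>carrier V. \<forall>c\<in>carrier A.
           f (us @ ract V v c # v' # vs) a = f (us @ v # lact V c v' # vs) a)) \<and>
     (\<forall>us\<in>lists (carrier V). \<forall>v\<in>carrier V. \<forall>c\<in>carrier A. \<forall>a\<in>carrier A.
        f (us @ [ract V v c]) a = f (us @ [v]) (c \<otimes>\<^bsub>A\<^esub> a))"

lemma word_mapI:
  assumes "\<And>vs. vs \<in> lists (carrier V) \<Longrightarrow> f vs \<in> add_hom A P"
    and "\<And>us v v' vs a. \<lbrakk>us \<in> lists (carrier V); vs \<in> lists (carrier V); v \<in> carrier V; v' \<in> carrier V;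
      a \<in> carrier A\<rbrakk> \<Longrightarrow> f (us @ (v \<oplus>\<^bsub>V\<^esub> v') # vs) a = f (us @ v # vs) a \<oplus>\<^bsub>P\<^esub> f (us @ v' # vs) a"
    and "\<And>us v c v' vs a. \<lbrakk>us \<in> lists (carrier V); vs \<in> lists (carrier V); v \<in> carrier V; v' \<in> carrier V;
      c \<in> carrier A; a \<in> carrier A\<rbrakk> \<Longrightarrow> f (us @ ract V v c # v' # vs) a = f (us @ v # lact V c v' # vs) a"
    and "\<And>us v c a. \<lbrakk>us \<in> lists (carrier V); v \<in> carrier V; c \<in> carrier A; a \<in> carrier A\<rbrakk>
      \<Longrightarrow> f (us @ [ract V v c]) a = f (us @ [v]) (c \<otimes>\<^bsub>A\<^esub> a)"
  shows "word_map A V P f"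
  unfolding word_map_def using assms by (intro conjI ballI) simp_all

lemma word_mapD:
  assumes "word_map A V P f" "us \<in> lists (carrier V)" "a \<in> carrier A"
  shows "f us \<in> add_hom A P" "f us a \<in> carrier P"
    and "\<lbrakk>vs \<in> lists (carrier V); v \<in> carrier V; v' \<in> carrier V\<rbrakk>
      \<Longrightarrow> f (us @ (v \<oplus>\<^bsub>V\<^esub> v') # vs) a = f (us @ v # vs) a \<oplus>\<^bsub>P\<^esub> f (us @ v' # vs) a"
    and "\<lbrakk>vs \<in> lists (carrier V); v \<in> carrier V; v' \<in> carrier V; c \<in> carrier A\<rbrakk>
      \<Longrightarrow> f (us @ ract V v c # v' # vs) a = f (us @ v # lact V c v' # vs) a"
    and "\<lbrakk>v \<in> carrier V; c \<in> carrier A\<rbrakk> \<Longrightarrow> f (us @ [ract V v c]) a = f (us @ [v]) (c \<otimes>\<^bsub>A\<^esub> a)"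
  using assms by (auto simp: word_map_def intro: add_hom_closed[of "f us" A P a])

locale tensor_algebra = bimodule A V
  for A :: "('a, 'x) ring_scheme" and V :: "('a, 'v, 'y) bimod_scheme"
begin

sublocale P: presentation "talg_gens A V" "talg_rels A V"
proof
  fix r assume r: "r \<in> talg_rels A V"
  show "Poly_Mapping.keys r \<subseteq> talg_gens A V"
    using r unfolding talg_rels_def
    by (elim UnE CollectE exE conjE; simp only:; intro keys_relation)
      (simp_all add: talg_gens_def lact_closed ract_closed)
qed

lemma talg_group_eq: "talg_group A V = presented_group (talg_gens A V) (talg_rels A V)"
  by (simp add: talg_group_def presented_group_def)

lemma tword_eq: "tword A V vs a = presented_gen (talg_gens A V) (talg_rels A V) (vs, a)"
  by (simp add: tword_def presented_gen_def)

lemma talg_fields: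
  "carrier (talg A V) = carrier (talg_group A V)"
  "add (talg A V) = mult (talg_group A V)"
  "zero (talg A V) = one (talg_group A V)"
  by (simp_all add: talg_def Let_def ring.defs bimod.defs)

lemma one_talg: "\<one>\<^bsub>talg A V\<^esub> = tword A V [] \<one>\<^bsub>A\<^esub>"
  by (simp add: talg_def Let_def ring.defs bimod.defs)

sublocale T: abelian_group "talg A V"
  by (rule abelian_group_of_comm_group[of "talg_group A V"])
    (auto simp: talg_fields talg_group_eq P.comm_group_axioms)

lemma tword_closed: "\<lbrakk>vs \<in> lists (carrier V); a \<in> carrier A\<rbrakk> \<Longrightarrow> tword A V vs a \<in> carrier (talg A V)"
  unfolding talg_fields talg_group_eq tword_eq by (rule P.gen_closed) (simp add: talg_gens_def)

lemma word_map_tword: "word_map A V (talg A V) (tword A V)"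
proof (rule word_mapI)
  fix vs assume vs: "vs \<in> lists (carrier V)"
  show "tword A V vs \<in> add_hom A (talg A V)"
  proof (rule add_homI)
    fix a b assume "a \<in> carrier A" "b \<in> carrier A"
    with vs show "tword A V vs (a \<oplus>\<^bsub>A\<^esub> b) = tword A V vs a \<oplus>\<^bsub>talg A V\<^esub> tword A V vs b"
      unfolding tword_eq talg_fields talg_group_eq
      by (intro P.gen_relation[OF _ refl]) (unfold talg_rels_def, blast, auto simp: talg_gens_def)
  qed (rule tword_closed[OF vs])
next
  fix us v v' vs a
  assume "us \<in> lists (carrier V)" "vs \<in> lists (carrier V)" "v \<in> carrier V" "v' \<in> carrier V" "a \<in> carrier A"
  then show "tword A V (us @ (v \<oplus>\<^bsub>V\<^esub> v') # vs) a =
      tword A V (us @ v # vs) a \<oplus>\<^bsub>talg A V\<^esub> tword A V (us @ v' # vs) a"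
    unfolding tword_eq talg_fields talg_group_eq
    by (intro P.gen_relation[OF _ refl]) (unfold talg_rels_def, blast, auto simp: talg_gens_def)
next
  fix us v c v' vs a
  assume "us \<in> lists (carrier V)" "vs \<in> lists (carrier V)" "v \<in> carrier V" "v' \<in> carrier V"
    "c \<in> carrier A" "a \<in> carrier A"
  then show "tword A V (us @ ract V v c # v' # vs) a = tword A V (us @ v # lact V c v' # vs) a"
    unfolding tword_eq
    by (intro P.gen_relation2[OF _ refl])
      (unfold talg_rels_def, blast, auto simp: talg_gens_def lact_closed ract_closed)
next
  fix us v c a
  assume "us \<in> lists (carrier V)" "v \<in> carrier V" "c \<in> carrier A" "a \<in> carrier A"
  then show "tword A V (us @ [ract V v c]) a = tword A V (us @ [v]) (c \<otimes>\<^bsub>A\<^esub> a)"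
    unfolding tword_eq
    by (intro P.gen_relation2[OF _ refl])
      (unfold talg_rels_def, blast, auto simp: talg_gens_def lact_closed ract_closed)
qed

lemmas tword_hom = word_mapD(1)[OF word_map_tword]
  and tword_add = word_mapD(3)[OF word_map_tword]
  and tword_balanced = word_mapD(4)[OF word_map_tword]
  and tword_last = word_mapD(5)[OF word_map_tword]

lemma talg_induct [consumes 1, case_names tword add minus]:
  assumes X: "X \<in> carrier (talg A V)"
    and tword: "\<And>vs a. \<lbrakk>vs \<in> lists (carrier V); a \<in> carrier A\<rbrakk> \<Longrightarrow> Q (tword A V vs a)"
    and add: "\<And>X Y. \<lbrakk>X \<in> carrier (talg A V); Y \<in> carrier (talg A V); Q X; Q Y\<rbrakk>
      \<Longrightarrow> Q (X \<oplus>\<^bsub>talg A V\<^esub> Y)"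
    and minus: "\<And>X. \<lbrakk>X \<in> carrier (talg A V); Q X\<rbrakk> \<Longrightarrow> Q (\<ominus>\<^bsub>talg A V\<^esub> X)"
  shows "Q X"
proof -
  have ainv: "\<ominus>\<^bsub>talg A V\<^esub> X = inv\<^bsub>presented_group (talg_gens A V) (talg_rels A V)\<^esub> X" for X
    by (rule a_inv_of_comm_group) (simp_all add: talg_fields talg_group_eq)
  have s: "tword A V [] \<zero>\<^bsub>A\<^esub> \<in> carrier (talg A V)" "Q (tword A V [] \<zero>\<^bsub>A\<^esub>)"
    by (auto intro: tword_closed tword)
  have zero: "Q \<zero>\<^bsub>talg A V\<^esub>"
    using add[OF s(1) T.a_inv_closed[OF s(1)] s(2) minus[OF s]] s(1) by (simp add: T.r_neg)
  have "X \<in> carrier (presented_group (talg_gens A V) (talg_rels A V))"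
    using X by (simp add: talg_fields talg_group_eq)
  then show ?thesis
  proof (induction rule: P.presented_induct)
    case (gen g)
    then show ?case using tword[of "fst g" "snd g"] by (cases g) (simp add: tword_eq talg_gens_def)
  next
    case one
    then show ?case using zero by (simp add: talg_fields talg_group_eq)
  next
    case (mult X Y)
    then show ?case using add by (simp add: talg_fields talg_group_eq)
  next
    case (inv X)
    then show ?case using minus[of X] by (simp add: talg_fields(1) talg_group_eq ainv)
  qed
qed

lemma talg_hom_eqI:
  assumes X: "X \<in> carrier (talg A V)"
    and G: "abelian_group G" and h: "h \<in> add_hom (talg A V) G" and k: "k \<in> add_hom (talg A V) G"
    and eq: "\<And>vs a. \<lbrakk>vs \<in> lists (carrier V); a \<in> carrier A\<rbrakk> \<Longrightarrow> h (tword A V vs a) = k (tword A V vs a)"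
  shows "h X = k X"
proof -
  interpret h: additive_map "talg A V" G h
    using G h by (intro additive_map.intro additive_map_axioms.intro T.abelian_group_axioms)
  interpret k: additive_map "talg A V" G k
    using G k by (intro additive_map.intro additive_map_axioms.intro T.abelian_group_axioms)
  show ?thesis
    using X by (induction rule: talg_induct) (auto simp: eq)
qed

lemma tlift_word_props:
  assumes P: "abelian_group P" and f: "word_map A V P f"
  shows tlift_word_hom: "tlift P (\<lambda>(vs, a). f vs a) \<in> add_hom (talg A V) P"
    and tlift_tword: "\<lbrakk>vs \<in> lists (carrier V); a \<in> carrier A\<rbrakk> \<Longrightarrow> tlift P (\<lambda>(vs, a). f vs a) (tword A V vs a) = f vs a"
proof -
  interpret G: abelian_group P by (rule P)
  let ?f = "\<lambda>(vs, a). f vs a"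
  let ?S = "talg_gens A V"
  have cl: "?f g \<in> carrier P" if "g \<in> ?S" for g
    using that word_mapD(2)[OF f] by (auto simp: talg_gens_def)
  note ev = G.frag_eval_relation[where S = ?S and f = ?f, OF cl]
    G.frag_eval_relation2[where S = ?S and f = ?f, OF cl]
  have rels: "frag_eval P ?f r = \<zero>\<^bsub>P\<^esub>" if "r \<in> talg_rels A V" for r
    using that unfolding talg_rels_def
  proof (elim UnE CollectE exE conjE, goal_cases)
    case (1 us v v' vs a)
    show ?case
      unfolding 1(1) using 1(2-) word_mapD(3)[OF f, of us a vs v v']
      by (subst ev(1)) (simp_all add: talg_gens_def)
  next
    case (2 vs a b)
    show ?case
      unfolding 2(1) using 2(2-) add_hom_add[OF word_mapD(1)[OF f, of vs a], of a b]
      by (subst ev(1)) (simp_all add: talg_gens_def)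
  next
    case (3 us v c v' vs a)
    show ?case
      unfolding 3(1) using 3(2-) word_mapD(4)[OF f, of us a vs v v' c]
      by (subst ev(2)) (simp_all add: talg_gens_def lact_closed ract_closed)
  next
    case (4 us v c a)
    show ?case
      unfolding 4(1) using 4(2-) word_mapD(5)[OF f, of us a v c]
      by (subst ev(2)) (simp_all add: talg_gens_def lact_closed ract_closed)
  qed
  show "tlift P ?f \<in> add_hom (talg A V) P"
    using P.lift_hom[OF P cl rels]
    by (simp add: add_hom_def hom_def talg_fields talg_group_eq)
  show "tlift P ?f (tword A V vs a) = f vs a" if "vs \<in> lists (carrier V)" "a \<in> carrier A"
    using P.lift_gen[OF P cl rels, of "(vs, a)"] that by (simp add: tword_eq talg_gens_def)
qed

lemma word_map_cons:
  assumes u: "u \<in> carrier V"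
  shows "word_map A V (talg A V) (\<lambda>vs. tword A V (u # vs))"
proof (rule word_mapI)
  fix us v v' vs a
  assume "us \<in> lists (carrier V)" "vs \<in> lists (carrier V)" "v \<in> carrier V" "v' \<in> carrier V" "a \<in> carrier A"
  then show "tword A V (u # us @ (v \<oplus>\<^bsub>V\<^esub> v') # vs) a =
      tword A V (u # us @ v # vs) a \<oplus>\<^bsub>talg A V\<^esub> tword A V (u # us @ v' # vs) a"
    using tword_add[of "u # us" a vs v v'] u by simp
next
  fix us v c v' vs a
  assume "us \<in> lists (carrier V)" "vs \<in> lists (carrier V)" "v \<in> carrier V" "v' \<in> carrier V"
    "c \<in> carrier A" "a \<in> carrier A"
  then show "tword A V (u # us @ ract V v c # v' # vs) a = tword A V (u # us @ v # lact V c v' # vs) a"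
    using tword_balanced[of "u # us" a vs v v' c] u by simp
next
  fix us v c a
  assume "us \<in> lists (carrier V)" "v \<in> carrier V" "c \<in> carrier A" "a \<in> carrier A"
  then show "tword A V (u # us @ [ract V v c]) a = tword A V (u # us @ [v]) (c \<otimes>\<^bsub>A\<^esub> a)"
    using tword_last[of "u # us" a v c] u by simp
qed (use u tword_hom[OF _ A.one_closed] in simp)

text \<open>The action changes the leading letter, or the coefficient when the word is empty.
  Splitting on the prefix \<open>us\<close> decides whether the letter in the relation is itself the
  leading one; \<open>hd us\<close> and \<open>tl us\<close> serve the case where it is not.\<close>

lemma lact_word_map:
  assumes c: "c \<in> carrier A"
  shows "word_map A V (talg A V) (\<lambda>vs b. case vs of
           [] \<Rightarrow> tword A V [] (c \<otimes>\<^bsub>A\<^esub> b) | v # ws \<Rightarrow> tword A V (lact V c v # ws) b)"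
proof (rule word_mapI)
  fix vs assume vs: "vs \<in> lists (carrier V)"
  show "(\<lambda>b. case vs of [] \<Rightarrow> tword A V [] (c \<otimes>\<^bsub>A\<^esub> b) | v # ws \<Rightarrow> tword A V (lact V c v # ws) b)
      \<in> add_hom A (talg A V)"
  proof (cases vs)
    case Nil
    then show ?thesis
      using c add_hom_add[OF tword_hom[of "[]"]]
      by (intro add_homI) (simp_all add: tword_closed A.r_distr)
  next
    case (Cons v ws)
    then show ?thesis
      using c vs tword_hom[of "lact V c v # ws"] by (auto simp: lact_closed)
  qed
next
  fix us v v' vs a
  assume "us \<in> lists (carrier V)" "vs \<in> lists (carrier V)" "v \<in> carrier V" "v' \<in> carrier V" "a \<in> carrier A"
  then show "(case us @ (v \<oplus>\<^bsub>V\<^esub> v') # vs of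
        [] \<Rightarrow> tword A V [] (c \<otimes>\<^bsub>A\<^esub> a) | v # ws \<Rightarrow> tword A V (lact V c v # ws) a) =
      (case us @ v # vs of [] \<Rightarrow> tword A V [] (c \<otimes>\<^bsub>A\<^esub> a) | v # ws \<Rightarrow> tword A V (lact V c v # ws) a)
      \<oplus>\<^bsub>talg A V\<^esub>
      (case us @ v' # vs of [] \<Rightarrow> tword A V [] (c \<otimes>\<^bsub>A\<^esub> a) | v # ws \<Rightarrow> tword A V (lact V c v # ws) a)"
    using c tword_add[of "[]" a vs "lact V c v" "lact V c v'"]
      tword_add[of "lact V c (hd us) # tl us" a vs v v']
    by (cases us) (simp_all add: lact_add lact_closed)
next
  fix us v d v' vs a
  assume "us \<in> lists (carrier V)" "vs \<in> lists (carrier V)" "v \<in> carrier V" "v' \<in> carrier V"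
    "d \<in> carrier A" "a \<in> carrier A"
  then show "(case us @ ract V v d # v' # vs of
        [] \<Rightarrow> tword A V [] (c \<otimes>\<^bsub>A\<^esub> a) | v # ws \<Rightarrow> tword A V (lact V c v # ws) a) =
      (case us @ v # lact V d v' # vs of
        [] \<Rightarrow> tword A V [] (c \<otimes>\<^bsub>A\<^esub> a) | v # ws \<Rightarrow> tword A V (lact V c v # ws) a)"
    using c tword_balanced[of "[]" a vs "lact V c v" v' d]
      tword_balanced[of "lact V c (hd us) # tl us" a vs v v' d]
    by (cases us) (simp_all add: lact_ract[symmetric] lact_closed)
next
  fix us v d a
  assume "us \<in> lists (carrier V)" "v \<in> carrier V" "d \<in> carrier A" "a \<in> carrier A"
  then show "(case us @ [ract V v d] of
        [] \<Rightarrow> tword A V [] (c \<otimes>\<^bsub>A\<^esub> a) | v # ws \<Rightarrow> tword A V (lact V c v # ws) a) =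
      (case us @ [v] of
        [] \<Rightarrow> tword A V [] (c \<otimes>\<^bsub>A\<^esub> (d \<otimes>\<^bsub>A\<^esub> a)) | v # ws \<Rightarrow> tword A V (lact V c v # ws) (d \<otimes>\<^bsub>A\<^esub> a))"
    using c tword_last[of "[]" a "lact V c v" d] tword_last[of "lact V c (hd us) # tl us" a v d]
    by (cases us) (simp_all add: lact_ract[symmetric] lact_closed)
qed

lemma lact_talg_props:
  assumes c: "c \<in> carrier A"
  shows lact_talg_hom: "lact (talg A V) c \<in> add_hom (talg A V) (talg A V)"
    and lact_talg_Nil: "a \<in> carrier A \<Longrightarrow> lact (talg A V) c (tword A V [] a) = tword A V [] (c \<otimes>\<^bsub>A\<^esub> a)"
    and lact_talg_Cons: "\<lbrakk>v \<in> carrier V; vs \<in> lists (carrier V); a \<in> carrier A\<rbrakk> \<Longrightarrow>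
      lact (talg A V) c (tword A V (v # vs) a) = tword A V (lact V c v # vs) a"
proof -
  let ?G = "\<lparr>carrier = carrier (talg_group A V), mult = (\<lambda>_ _. undefined), one = tword A V [] \<one>\<^bsub>A\<^esub>,
       zero = one (talg_group A V), add = mult (talg_group A V)\<rparr>"
  let ?f = "\<lambda>vs b. case vs of
           [] \<Rightarrow> tword A V [] (c \<otimes>\<^bsub>A\<^esub> b) | v # ws \<Rightarrow> tword A V (lact V c v # ws) b"
  have G: "abelian_group ?G"
    by (rule abelian_group_of_comm_group[of "talg_group A V"])
      (auto simp: talg_group_eq P.comm_group_axioms)
  have hom: "add_hom X ?G = add_hom X (talg A V)" for X
    by (simp add: add_hom_def hom_def talg_fields)
  have eq: "lact (talg A V) c = tlift ?G (\<lambda>(vs, b). ?f vs b)"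
    by (simp add: talg_def Let_def ring.defs bimod.defs)
  have "word_map A V ?G ?f"
    using lact_word_map[OF c] unfolding word_map_def hom by (simp add: talg_fields)
  note * = tlift_word_props[OF G this, folded eq]
  show "lact (talg A V) c \<in> add_hom (talg A V) (talg A V)"
    using *(1) by (simp add: hom)
  show "a \<in> carrier A \<Longrightarrow> lact (talg A V) c (tword A V [] a) = tword A V [] (c \<otimes>\<^bsub>A\<^esub> a)"
    using *(2)[of "[]" a] by simp
  show "\<lbrakk>v \<in> carrier V; vs \<in> lists (carrier V); a \<in> carrier A\<rbrakk> \<Longrightarrow>
      lact (talg A V) c (tword A V (v # vs) a) = tword A V (lact V c v # vs) a"
    using *(2)[of "v # vs" a] by simp
qed

lemma lact_talg_closed: "\<lbrakk>c \<in> carrier A; X \<in> carrier (talg A V)\<rbrakk> \<Longrightarrow> lact (talg A V) c X \<in> carrier (talg A V)"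
  by (rule add_hom_closed[OF lact_talg_hom])

lemma lact_talg_add:
  assumes "c \<in> carrier A" "d \<in> carrier A" "X \<in> carrier (talg A V)"
  shows "lact (talg A V) (c \<oplus>\<^bsub>A\<^esub> d) X = lact (talg A V) c X \<oplus>\<^bsub>talg A V\<^esub> lact (talg A V) d X"
proof (rule talg_hom_eqI[OF assms(3) T.abelian_group_axioms])
  show "(\<lambda>X. lact (talg A V) c X \<oplus>\<^bsub>talg A V\<^esub> lact (talg A V) d X) \<in> add_hom (talg A V) (talg A V)"
    by (intro T.add_hom_add_pointwise lact_talg_hom assms)
  fix vs a assume va: "vs \<in> lists (carrier V)" "a \<in> carrier A"
  show "lact (talg A V) (c \<oplus>\<^bsub>A\<^esub> d) (tword A V vs a) =
      lact (talg A V) c (tword A V vs a) \<oplus>\<^bsub>talg A V\<^esub> lact (talg A V) d (tword A V vs a)"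
  proof (cases vs)
    case Nil
    then show ?thesis
      using va assms add_hom_add[OF tword_hom[of "[]"]] by (simp add: lact_talg_Nil A.l_distr)
  next
    case (Cons v ws)
    then show ?thesis
      using va assms tword_add[of "[]" a ws "lact V c v" "lact V d v"]
      by (simp add: lact_talg_Cons add_lact lact_closed)
  qed
qed (intro lact_talg_hom A.a_closed assms)

lemma lact_talg_mult:
  assumes "c \<in> carrier A" "d \<in> carrier A" "X \<in> carrier (talg A V)"
  shows "lact (talg A V) (c \<otimes>\<^bsub>A\<^esub> d) X = lact (talg A V) c (lact (talg A V) d X)"
proof (rule talg_hom_eqI[OF assms(3) T.abelian_group_axioms])
  show "(\<lambda>X. lact (talg A V) c (lact (talg A V) d X)) \<in> add_hom (talg A V) (talg A V)"
    by (rule add_hom_compose[OF lact_talg_hom[OF assms(2)] lact_talg_hom[OF assms(1)]])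
  fix vs a assume va: "vs \<in> lists (carrier V)" "a \<in> carrier A"
  then show "lact (talg A V) (c \<otimes>\<^bsub>A\<^esub> d) (tword A V vs a) =
      lact (talg A V) c (lact (talg A V) d (tword A V vs a))"
    using assms
    by (cases vs) (simp_all add: lact_talg_Nil lact_talg_Cons A.m_assoc mult_lact lact_closed)
qed (intro lact_talg_hom A.m_closed assms)

end

lemma (in abelian_group) add_diff_add_cancel:
  "\<lbrakk>x \<in> carrier G; y \<in> carrier G; z \<in> carrier G\<rbrakk> \<Longrightarrow> (x \<oplus> y) \<ominus> (z \<oplus> y) = x \<ominus> z"
  by (simp add: a_minus_def minus_add a_ac r_neg2 r_neg1)

section \<open>The connection on tensors of vector fields\<close>

context dga
begin

lemmas pieces_closed = piece_closed[of _ 0] piece_closed[of _ 1] piece_closed[of _ 2]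

sublocale words: tensor_algebra "base Om" "vec Om"
  by (rule tensor_algebra.intro[OF bimodule_vec])

lemma tvec_eq: "talg (base Om) (vec Om) = tvec Om"
  by (simp add: tvec_def)

lemmas tvec_group = words.T.abelian_group_axioms[unfolded tvec_eq]
  and tword_closed = words.tword_closed[unfolded tvec_eq base_simps]
  and tword_hom = words.tword_hom[unfolded tvec_eq base_simps]
  and lact_tvec_closed = words.lact_talg_closed[unfolded tvec_eq base_simps]
  and lact_tvec_hom = words.lact_talg_hom[unfolded tvec_eq base_simps]
  and lact_tvec_add = words.lact_talg_add[unfolded tvec_eq base_simps]
  and lact_tvec_mult = words.lact_talg_mult[unfolded tvec_eq base_simps]
  and lact_tvec_Nil = words.lact_talg_Nil[unfolded tvec_eq base_simps]
  and lact_tvec_Cons = words.lact_talg_Cons[unfolded tvec_eq base_simps]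
  and tvec_induct = words.talg_induct[unfolded tvec_eq base_simps, consumes 1, case_names tword add minus]
  and tvec_hom_eqI = words.talg_hom_eqI[unfolded tvec_eq base_simps]

sublocale tvec: abelian_group "tvec Om"
  by (rule tvec_group)

lemma emb0_closed: "a \<in> piece Om 0 \<Longrightarrow> emb0 Om a \<in> carrier (tvec Om)"
  by (simp add: emb0_def tword_closed)

lemma emb1_closed: "u \<in> carrier (vec Om) \<Longrightarrow> emb1 Om u \<in> carrier (tvec Om)"
  by (simp add: emb1_def tword_closed one_piece)

lemma tcons_props:
  assumes u: "u \<in> carrier (vec Om)"
  shows tcons_hom: "tcons Om u \<in> add_hom (tvec Om) (tvec Om)"
    and tcons_tword: "\<lbrakk>vs \<in> lists (carrier (vec Om)); a \<in> piece Om 0\<rbrakk> \<Longrightarrow>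
      tcons Om u (tword (base Om) (vec Om) vs a) = tword (base Om) (vec Om) (u # vs) a"
  using words.tlift_word_props[OF words.T.abelian_group_axioms words.word_map_cons[OF u]]
  by (simp_all add: tcons_def tvec_eq)

lemma tcons_closed: "\<lbrakk>u \<in> carrier (vec Om); x \<in> carrier (tvec Om)\<rbrakk> \<Longrightarrow> tcons Om u x \<in> carrier (tvec Om)"
  by (rule add_hom_closed[OF tcons_hom])

lemma tcons_add_left:
  assumes "u \<in> carrier (vec Om)" "v \<in> carrier (vec Om)" "x \<in> carrier (tvec Om)"
  shows "tcons Om (u \<oplus>\<^bsub>vec Om\<^esub> v) x = tcons Om u x \<oplus>\<^bsub>tvec Om\<^esub> tcons Om v x"
proof (rule tvec_hom_eqI[OF assms(3) tvec_group])
  show "(\<lambda>x. tcons Om u x \<oplus>\<^bsub>tvec Om\<^esub> tcons Om v x) \<in> add_hom (tvec Om) (tvec Om)"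
    by (intro tvec.add_hom_add_pointwise tcons_hom assms)
  fix vs a assume "vs \<in> lists (carrier (vec Om))" "a \<in> piece Om 0"
  then show "tcons Om (u \<oplus>\<^bsub>vec Om\<^esub> v) (tword (base Om) (vec Om) vs a) =
      tcons Om u (tword (base Om) (vec Om) vs a) \<oplus>\<^bsub>tvec Om\<^esub> tcons Om v (tword (base Om) (vec Om) vs a)"
    using assms words.tword_add[of "[]" a vs u v] by (simp add: tcons_tword tvec_eq)
qed (simp add: tcons_hom assms)

lemma tcons_hom_left: "x \<in> carrier (tvec Om) \<Longrightarrow> (\<lambda>u. tcons Om u x) \<in> add_hom (vec Om) (tvec Om)"
  by (intro add_homI) (simp_all add: tcons_closed tcons_add_left)

lemma tcons_balanced:
  assumes "u \<in> carrier (vec Om)" "c \<in> piece Om 0" "x \<in> carrier (tvec Om)"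
  shows "tcons Om (ract (vec Om) u c) x = tcons Om u (lact (tvec Om) c x)"
proof (rule tvec_hom_eqI[OF assms(3) tvec_group])
  show "(\<lambda>x. tcons Om u (lact (tvec Om) c x)) \<in> add_hom (tvec Om) (tvec Om)"
    by (rule add_hom_compose[OF lact_tvec_hom[OF assms(2)] tcons_hom[OF assms(1)]])
  fix vs a assume "vs \<in> lists (carrier (vec Om))" "a \<in> piece Om 0"
  then show "tcons Om (ract (vec Om) u c) (tword (base Om) (vec Om) vs a) =
      tcons Om u (lact (tvec Om) c (tword (base Om) (vec Om) vs a))"
    using assms words.tword_balanced[of "[]" a "tl vs" u "hd vs" c] words.tword_last[of "[]" a u c]
    by (cases vs) (simp_all add: tcons_tword lact_tvec_Nil lact_tvec_Cons vec.ract_closed vec.lact_closed piece_mult)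
qed (simp add: tcons_hom assms vec.ract_closed)

lemma tcons_lact:
  assumes "u \<in> carrier (vec Om)" "c \<in> piece Om 0" "x \<in> carrier (tvec Om)"
  shows "tcons Om (lact (vec Om) c u) x = lact (tvec Om) c (tcons Om u x)"
proof (rule tvec_hom_eqI[OF assms(3) tvec_group])
  show "(\<lambda>x. lact (tvec Om) c (tcons Om u x)) \<in> add_hom (tvec Om) (tvec Om)"
    by (rule add_hom_compose[OF tcons_hom[OF assms(1)] lact_tvec_hom[OF assms(2)]])
  fix vs a assume "vs \<in> lists (carrier (vec Om))" "a \<in> piece Om 0"
  then show "tcons Om (lact (vec Om) c u) (tword (base Om) (vec Om) vs a) =
      lact (tvec Om) c (tcons Om u (tword (base Om) (vec Om) vs a))"
    using assms by (simp add: tcons_tword lact_tvec_Cons vec.lact_closed)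
qed (simp add: tcons_hom assms vec.lact_closed)

lemma tcons_emb0: "\<lbrakk>u \<in> carrier (vec Om); a \<in> piece Om 0\<rbrakk> \<Longrightarrow> tcons Om u (emb0 Om a) = emb1 Om (ract (vec Om) u a)"
  using words.tword_last[of "[]" \<one> u a] one_piece
  by (simp add: emb0_def emb1_def tcons_tword pieces_closed)

lemma lact_emb0: "\<lbrakk>a \<in> piece Om 0; b \<in> piece Om 0\<rbrakk> \<Longrightarrow> lact (tvec Om) a (emb0 Om b) = emb0 Om (a \<otimes> b)"
  by (simp add: emb0_def lact_tvec_Nil)

lemma lact_emb1: "\<lbrakk>a \<in> piece Om 0; u \<in> carrier (vec Om)\<rbrakk> \<Longrightarrow> lact (tvec Om) a (emb1 Om u) = emb1 Om (lact (vec Om) a u)"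
  by (simp add: emb1_def lact_tvec_Cons one_piece)

lemma emb1_hom: "emb1 Om \<in> add_hom (vec Om) (tvec Om)"
  using tcons_hom_left[OF emb0_closed[OF one_piece]]
  by (rule add_hom_cong) (simp_all add: tcons_emb0 one_piece vec.one_ract[simplified] vec.M.abelian_monoid_axioms)

sublocale ft: tensor_pair "base Om" "forms Om k" "tvec Om" for k
  by unfold_locales (simp_all add: tvec_group piece_mult lact_tvec_closed)

sublocale ff: tensor_pair "base Om" "forms Om k" "forms Om l" for k l
  by (rule tensor_pair_bimodules[OF bimodule_forms bimodule_forms])

lemma lact_form_tvec:
  assumes "a \<in> piece Om 0"
  shows lact_form_tvec_hom: "lact (form_tvec Om k) a \<in> add_hom (form_tvec Om k) (form_tvec Om k)"
    and lact_form_tvec_stens: "\<lbrakk>\<eta> \<in> piece Om k; x \<in> carrier (tvec Om)\<rbrakk> \<Longrightarrow>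
      lact (form_tvec Om k) a (ostens Om (forms Om k) (tvec Om) \<eta> x) = ostens Om (forms Om k) (tvec Om) (a \<otimes> \<eta>) x"
proof -
  have 1: "(\<lambda>m. lact (forms Om k) a m) \<in> add_hom (forms Om k) (forms Om k)"
    using forms.lact_hom[of a k] assms by simp
  have 2: "lact (forms Om k) a (ract (forms Om k) m b) = ract (forms Om k) (lact (forms Om k) a m) b"
    if "m \<in> carrier (forms Om k)" "b \<in> carrier (base Om)" for m b
    using that assms piece_closed[of _ k] by (simp add: m_assoc pieces_closed)
  show "lact (form_tvec Om k) a \<in> add_hom (form_tvec Om k) (form_tvec Om k)"
    by (rule ft.tens_lact_hom[OF 1 2])
  show "\<lbrakk>\<eta> \<in> piece Om k; x \<in> carrier (tvec Om)\<rbrakk> \<Longrightarrow>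
      lact (form_tvec Om k) a (ostens Om (forms Om k) (tvec Om) \<eta> x) = ostens Om (forms Om k) (tvec Om) (a \<otimes> \<eta>) x"
    using ft.tens_lact_stens[OF 1 2, where m = \<eta> and n = x] by simp
qed

lemma lact_forms2:
  assumes "a \<in> piece Om 0"
  shows lact_forms2_hom: "lact (otens Om (forms Om k) (forms Om l)) a \<in>
      add_hom (otens Om (forms Om k) (forms Om l)) (otens Om (forms Om k) (forms Om l))"
    and lact_forms2_stens: "\<lbrakk>\<eta> \<in> piece Om k; \<zeta> \<in> piece Om l\<rbrakk> \<Longrightarrow>
      lact (otens Om (forms Om k) (forms Om l)) a (ostens Om (forms Om k) (forms Om l) \<eta> \<zeta>) =
      ostens Om (forms Om k) (forms Om l) (a \<otimes> \<eta>) \<zeta>"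
    and ract_forms2_hom: "(\<lambda>X. ract (otens Om (forms Om k) (forms Om l)) X a) \<in>
      add_hom (otens Om (forms Om k) (forms Om l)) (otens Om (forms Om k) (forms Om l))"
    and ract_forms2_stens: "\<lbrakk>\<eta> \<in> piece Om k; \<zeta> \<in> piece Om l\<rbrakk> \<Longrightarrow>
      ract (otens Om (forms Om k) (forms Om l)) (ostens Om (forms Om k) (forms Om l) \<eta> \<zeta>) a =
      ostens Om (forms Om k) (forms Om l) \<eta> (\<zeta> \<otimes> a)"
proof -
  have 1: "(\<lambda>m. lact (forms Om k) a m) \<in> add_hom (forms Om k) (forms Om k)" for k
    using forms.lact_hom[of a k] assms by simp
  have 2: "lact (forms Om k) a (ract (forms Om k) m b) = ract (forms Om k) (lact (forms Om k) a m) b"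
    if "m \<in> carrier (forms Om k)" "b \<in> carrier (base Om)" for m b k
    using that assms piece_closed[of _ k] by (simp add: m_assoc pieces_closed)
  have 3: "(\<lambda>m. ract (forms Om k) m a) \<in> add_hom (forms Om k) (forms Om k)" for k
    using forms.ract_hom[of a k] assms by simp
  have 4: "ract (forms Om k) (lact (forms Om k) b m) a = lact (forms Om k) b (ract (forms Om k) m a)"
    if "m \<in> carrier (forms Om k)" "b \<in> carrier (base Om)" for m b k
    using that assms piece_closed[of _ k] by (simp add: m_assoc pieces_closed)
  let ?T = "otens Om (forms Om k) (forms Om l)"
  show "lact ?T a \<in> add_hom ?T ?T"
    by (rule ff.tens_lact_hom[OF 1 2])
  show "\<lbrakk>\<eta> \<in> piece Om k; \<zeta> \<in> piece Om l\<rbrakk> \<Longrightarrow> lact ?T a (ostens Om (forms Om k) (forms Om l) \<eta> \<zeta>) =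
      ostens Om (forms Om k) (forms Om l) (a \<otimes> \<eta>) \<zeta>"
    using ff.tens_lact_stens[OF 1 2, where m = \<eta> and n = \<zeta>] by simp
  show "(\<lambda>X. ract ?T X a) \<in> add_hom ?T ?T"
    by (rule ff.tens_ract_hom[OF 3 4])
  show "\<lbrakk>\<eta> \<in> piece Om k; \<zeta> \<in> piece Om l\<rbrakk> \<Longrightarrow> ract ?T (ostens Om (forms Om k) (forms Om l) \<eta> \<zeta>) a =
      ostens Om (forms Om k) (forms Om l) \<eta> (\<zeta> \<otimes> a)"
    using ff.tens_ract_stens[OF 3 4, where m = \<eta> and n = \<zeta>] by simp
qed

end

text \<open>The map (ev \<otimes> id)(v \<otimes> -) in the identity that determines
  \<open>vbox\<close>, with A \<otimes> \<Omega>^1 identified with \<Omega>^1.\<close>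

definition contract :: "('w, 'b) calculus_scheme \<Rightarrow> ('w \<Rightarrow> 'w) \<Rightarrow> ('w \<times> 'w) frag set \<Rightarrow> 'w" where
  "contract Om v = tlift (forms Om 1) (\<lambda>(\<zeta>, \<chi>). v \<zeta> \<otimes>\<^bsub>Om\<^esub> \<chi>)"

context dga
begin

lemma contract_props:
  assumes v: "v \<in> carrier (vec Om)"
  shows contract_hom: "contract Om v \<in> add_hom (forms11 Om) (forms Om 1)"
    and contract_stens: "\<lbrakk>\<eta> \<in> piece Om 1; \<zeta> \<in> piece Om 1\<rbrakk> \<Longrightarrow>
      contract Om v (ostens Om (forms Om 1) (forms Om 1) \<eta> \<zeta>) = v \<eta> \<otimes> \<zeta>"
proof -
  have "balanced_map (base Om) (forms Om 1) (forms Om 1) (forms Om 1) (\<lambda>\<zeta> \<chi>. v \<zeta> \<otimes> \<chi>)"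
  proof (rule balanced_mapI)
    fix \<zeta> assume "\<zeta> \<in> carrier (forms Om 1)"
    then show "(\<lambda>\<eta>. v \<eta> \<otimes> \<zeta>) \<in> add_hom (forms Om 1) (forms Om 1)" "(\<lambda>\<eta>. v \<zeta> \<otimes> \<eta>) \<in> add_hom (forms Om 1) (forms Om 1)"
      using v add_hom_add[OF vec_hom[OF v]] vec_closed[OF v] pieces_closed
      by (auto intro!: add_homI simp: piece_mult l_distr r_distr)
  next
    fix \<eta> a \<zeta> assume "\<eta> \<in> carrier (forms Om 1)" "a \<in> carrier (base Om)" "\<zeta> \<in> carrier (forms Om 1)"
    then show "v (ract (forms Om 1) \<eta> a) \<otimes> \<zeta> = v \<eta> \<otimes> lact (forms Om 1) a \<zeta>"
      using v vec_closed[OF v] pieces_closed by (simp add: vec_ract m_assoc)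
  qed
  note * = ff.tlift_props[OF abelian_group_forms this]
  show "contract Om v \<in> add_hom (forms11 Om) (forms Om 1)"
    using *(1) by (simp add: contract_def)
  show "\<lbrakk>\<eta> \<in> piece Om 1; \<zeta> \<in> piece Om 1\<rbrakk> \<Longrightarrow>
      contract Om v (ostens Om (forms Om 1) (forms Om 1) \<eta> \<zeta>) = v \<eta> \<otimes> \<zeta>"
    using *(2) by (simp add: contract_def)
qed

lemma contract_closed: "\<lbrakk>v \<in> carrier (vec Om); Y \<in> carrier (forms11 Om)\<rbrakk> \<Longrightarrow> contract Om v Y \<in> piece Om 1"
  using add_hom_closed[OF contract_hom] by simp

lemma contract_add:
  assumes "v \<in> carrier (vec Om)" "w \<in> carrier (vec Om)" "Y \<in> carrier (forms11 Om)"
  shows "contract Om (v \<oplus>\<^bsub>vec Om\<^esub> w) Y = contract Om v Y \<oplus> contract Om w Y"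
proof -
  have "contract Om (v \<oplus>\<^bsub>vec Om\<^esub> w) Y = contract Om v Y \<oplus>\<^bsub>forms Om 1\<^esub> contract Om w Y"
  proof (rule ff.tens_hom_eqI[OF assms(3) abelian_group_forms])
    show "(\<lambda>Y. contract Om v Y \<oplus>\<^bsub>forms Om 1\<^esub> contract Om w Y) \<in> add_hom (forms11 Om) (forms Om 1)"
      by (rule forms.M.add_hom_add_pointwise[OF contract_hom[OF assms(1)] contract_hom[OF assms(2)]])
  qed (use assms in \<open>simp_all add: contract_hom contract_stens vec_apply l_distr pieces_closed vec_closed\<close>)
  then show ?thesis by simp
qed

lemma contract_lact:
  assumes "v \<in> carrier (vec Om)" "a \<in> piece Om 0" "Y \<in> carrier (forms11 Om)"
  shows "contract Om (lact (vec Om) a v) Y = a \<otimes> contract Om v Y"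
proof (rule ff.tens_hom_eqI[OF assms(3) abelian_group_forms])
  show "contract Om (lact (vec Om) a v) \<in> add_hom (forms11 Om) (forms Om 1)"
    using assms by (intro contract_hom vec.lact_closed) auto
  show "(\<lambda>Y. a \<otimes> contract Om v Y) \<in> add_hom (forms11 Om) (forms Om 1)"
    using add_hom_compose[OF contract_hom[OF assms(1)] forms.lact_hom[of a 1]] assms by simp
qed (use assms in \<open>simp add: contract_stens vec.lact_closed vec_apply m_assoc pieces_closed vec_closed\<close>)

lemma contract_balanced:
  assumes "v \<in> carrier (vec Om)" "a \<in> piece Om 0" "Y \<in> carrier (forms11 Om)"
  shows "contract Om (ract (vec Om) v a) Y = contract Om v (lact (forms11 Om) a Y)"
proof (rule ff.tens_hom_eqI[OF assms(3) abelian_group_forms])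
  show "contract Om (ract (vec Om) v a) \<in> add_hom (forms11 Om) (forms Om 1)"
    using assms by (intro contract_hom vec.ract_closed) auto
  show "(\<lambda>Y. contract Om v (lact (forms11 Om) a Y)) \<in> add_hom (forms11 Om) (forms Om 1)"
    by (rule add_hom_compose[OF lact_forms2_hom[OF assms(2)] contract_hom[OF assms(1)]])
qed (use assms in \<open>simp add: contract_stens vec.ract_closed vec_apply lact_forms2_stens piece_mult\<close>)

lemma contract_ract:
  assumes "v \<in> carrier (vec Om)" "a \<in> piece Om 0" "Y \<in> carrier (forms11 Om)"
  shows "contract Om v (ract (forms11 Om) Y a) = contract Om v Y \<otimes> a"
proof (rule ff.tens_hom_eqI[OF assms(3) abelian_group_forms])
  show "(\<lambda>Y. contract Om v Y \<otimes> a) \<in> add_hom (forms11 Om) (forms Om 1)"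
    using add_hom_compose[OF contract_hom[OF assms(1)] forms.ract_hom[of a 1]] assms by simp
  show "(\<lambda>Y. contract Om v (ract (forms11 Om) Y a)) \<in> add_hom (forms11 Om) (forms Om 1)"
    by (rule add_hom_compose[OF ract_forms2_hom[OF assms(2)] contract_hom[OF assms(1)]])
qed (use assms in \<open>simp add: contract_stens ract_forms2_stens m_assoc piece_mult pieces_closed vec_closed\<close>)

end

section \<open>The dual connection and its braiding, described by their evaluations\<close>

context geometry
begin

text \<open>The right module map \<eta> \<mapsto> (id \<otimes> ev)(\<square>v \<otimes> \<eta>)
  that the duality identity forces on \<square>v. Since \<Omega>^1 \<otimes> Vec A is
  Hom(\<Omega>^1, \<Omega>^1), it encodes \<square>v faithfully, and identities between elements of
  a tensor product become identities between one-forms.\<close>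

definition pbox :: "('w \<Rightarrow> 'w) \<Rightarrow> 'w \<Rightarrow> 'w" where
  "pbox v \<eta> = dif Om (v \<eta>) \<ominus> contract Om v (box Om \<eta>)"

text \<open>In the same way \<sigma>(v \<otimes> \<eta>) is encoded by its evaluation at
  \<xi>.\<close>

definition qbox :: "('w \<Rightarrow> 'w) \<Rightarrow> 'w \<Rightarrow> 'w \<Rightarrow> 'w" where
  "qbox v \<eta> \<xi> = contract Om v (sgi Om (ostens Om (forms Om 1) (forms Om 1) \<eta> \<xi>))"

lemma box_closed: "\<eta> \<in> piece Om 1 \<Longrightarrow> box Om \<eta> \<in> carrier (forms11 Om)"
  using add_hom_closed[OF box_hom] by simp

lemma sgi_add_hom: "sgi Om \<in> add_hom (forms11 Om) (forms11 Om)"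
  using sgi_hom by (simp add: bimod_hom_def)

lemma sgi_closed: "Y \<in> carrier (forms11 Om) \<Longrightarrow> sgi Om Y \<in> carrier (forms11 Om)"
  by (rule add_hom_closed[OF sgi_add_hom])

lemma stens11_closed: "\<lbrakk>\<eta> \<in> piece Om 1; \<zeta> \<in> piece Om 1\<rbrakk> \<Longrightarrow>
    ostens Om (forms Om 1) (forms Om 1) \<eta> \<zeta> \<in> carrier (forms11 Om)"
  by (rule ff.stens_closed) simp_all

lemma pbox_closed: "\<lbrakk>v \<in> carrier (vec Om); \<eta> \<in> piece Om 1\<rbrakk> \<Longrightarrow> pbox v \<eta> \<in> piece Om 1"
  by (simp add: pbox_def a_minus_def piece_add piece_neg piece_dif vec_closed contract_closed box_closed)

lemma qbox_closed: "\<lbrakk>v \<in> carrier (vec Om); \<eta> \<in> piece Om 1; \<xi> \<in> piece Om 1\<rbrakk> \<Longrightarrow> qbox v \<eta> \<xi> \<in> piece Om 1"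
  by (simp add: qbox_def contract_closed sgi_closed stens11_closed)

lemma dif_add: "\<lbrakk>x \<in> carrier Om; y \<in> carrier Om\<rbrakk> \<Longrightarrow> dif Om (x \<oplus> y) = dif Om x \<oplus> dif Om y"
  by (rule add_hom_add[OF dif_hom])

lemma minus_ldistr: "\<lbrakk>x \<in> carrier Om; y \<in> carrier Om; z \<in> carrier Om\<rbrakk> \<Longrightarrow> (x \<ominus> y) \<otimes> z = x \<otimes> z \<ominus> y \<otimes> z"
  by (simp add: a_minus_def l_distr l_minus)

text \<open>For \<eta>.a both d(v(\<eta>)a) and the contraction of \<square>(\<eta>a) produce the
  term v(\<eta>).da, and these cancel.\<close>

lemma pbox_right_map: "v \<in> carrier (vec Om) \<Longrightarrow> right_map (forms Om 1) (pbox v)"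
  unfolding right_map_def
proof (intro conjI ballI)
  assume v: "v \<in> carrier (vec Om)"
  have "(\<lambda>\<eta>. dif Om (v \<eta>) \<ominus>\<^bsub>forms Om 1\<^esub> contract Om v (box Om \<eta>)) \<in> add_hom (forms Om 1) (forms Om 1)"
    using add_hom_compose[OF vec_hom[OF v] dif_forms[of 0]] add_hom_compose[OF box_hom contract_hom[OF v]]
    by (intro forms.M.add_hom_diff) (simp_all add: One_nat_def)
  then show "pbox v \<in> add_hom (forms Om 1) (forms Om 1)"
    by (rule add_hom_cong)
      (use v in \<open>simp_all add: pbox_def a_minus_forms piece_dif vec_closed contract_closed box_closed
        forms.M.abelian_monoid_axioms\<close>)
  fix \<eta> a assume \<eta>a: "\<eta> \<in> piece Om 1" "a \<in> piece Om 0"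
  have "contract Om v (box Om (\<eta> \<otimes> a)) = contract Om v (box Om \<eta>) \<otimes> a \<oplus> v \<eta> \<otimes> dif Om a"
    using \<eta>a v add_hom_add[OF contract_hom[OF v]] add_hom_closed[OF ract_forms2_hom[OF \<eta>a(2)]]
    by (simp add: box_ract contract_ract contract_stens box_closed stens11_closed piece_dif)
  then show "pbox v (\<eta> \<otimes> a) = ract (forms Om 1) (pbox v \<eta>) a"
    using \<eta>a v
    by (simp add: pbox_def vec_ract dif_mult0 vec_closed pieces_closed contract_closed box_closed
        piece_dif piece_mult add_diff_add_cancel minus_ldistr)
qed

lemma qbox_right_map:
  assumes "v \<in> carrier (vec Om)" "\<eta> \<in> piece Om 1"
  shows "right_map (forms Om 1) (qbox v \<eta>)"
  unfolding right_map_def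
proof (intro conjI ballI)
  show "qbox v \<eta> \<in> add_hom (forms Om 1) (forms Om 1)"
    unfolding qbox_def[abs_def] using assms
    by (intro add_hom_compose[OF add_hom_compose[OF ff.stens_hom_right sgi_add_hom] contract_hom]) simp_all
  fix \<xi> a assume "\<xi> \<in> piece Om 1" "a \<in> piece Om 0"
  then show "qbox v \<eta> (\<xi> \<otimes> a) = ract (forms Om 1) (qbox v \<eta> \<xi>) a"
    using assms sgi_hom
    by (simp add: qbox_def ract_forms2_stens[symmetric] bimod_hom_def stens11_closed contract_ract sgi_closed)
qed

lemma qbox_add_form:
  assumes "v \<in> carrier (vec Om)" "\<xi> \<in> piece Om 1"
  shows "(\<lambda>\<eta>. qbox v \<eta> \<xi>) \<in> add_hom (forms Om 1) (forms Om 1)"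
  unfolding qbox_def using assms
  by (intro add_hom_compose[OF add_hom_compose[OF ff.stens_hom_left sgi_add_hom] contract_hom]) simp_all

lemma qbox_form_balanced:
  assumes "v \<in> carrier (vec Om)" "\<eta> \<in> piece Om 1" "\<xi> \<in> piece Om 1" "a \<in> piece Om 0"
  shows "qbox v (\<eta> \<otimes> a) \<xi> = qbox v \<eta> (a \<otimes> \<xi>)"
  using assms ff.stens_balanced[of \<eta> 1 a \<xi> 1] by (simp add: qbox_def)

lemma qbox_vec:
  assumes "v \<in> carrier (vec Om)" "\<eta> \<in> piece Om 1" "\<xi> \<in> piece Om 1" "a \<in> piece Om 0"
  shows qbox_lact: "qbox (lact (vec Om) a v) \<eta> \<xi> = a \<otimes> qbox v \<eta> \<xi>"
    and qbox_ract: "qbox (ract (vec Om) v a) \<eta> \<xi> = qbox v (a \<otimes> \<eta>) \<xi>"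
  using assms sgi_hom
  by (simp_all add: qbox_def contract_lact contract_balanced stens11_closed sgi_closed
      lact_forms2_stens[symmetric] bimod_hom_def)

lemma qbox_vec_add:
  assumes "v \<in> carrier (vec Om)" "w \<in> carrier (vec Om)" "\<eta> \<in> piece Om 1" "\<xi> \<in> piece Om 1"
  shows "qbox (v \<oplus>\<^bsub>vec Om\<^esub> w) \<eta> \<xi> = qbox v \<eta> \<xi> \<oplus> qbox w \<eta> \<xi>"
  using assms by (simp add: qbox_def contract_add stens11_closed sgi_closed)

lemma pbox_vec_add:
  assumes "v \<in> carrier (vec Om)" "w \<in> carrier (vec Om)" "\<eta> \<in> piece Om 1"
  shows "pbox (v \<oplus>\<^bsub>vec Om\<^esub> w) \<eta> = pbox v \<eta> \<oplus> pbox w \<eta>"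
  using assms
  by (simp add: pbox_def vec_apply contract_add box_closed dif_add vec_closed pieces_closed piece_dif
      contract_closed a_minus_def minus_add a_ac piece_neg piece_add)

text \<open>The left Leibniz rule of the dual connection: dc \<otimes> v evaluates at \<eta> to
  dc.v(\<eta>).\<close>

lemma pbox_lact:
  assumes "v \<in> carrier (vec Om)" "\<eta> \<in> piece Om 1" "c \<in> piece Om 0"
  shows "pbox (lact (vec Om) c v) \<eta> = dif Om c \<otimes> v \<eta> \<oplus> c \<otimes> pbox v \<eta>"
  using assms
  by (simp add: pbox_def vec_apply contract_lact box_closed dif_mult0 vec_closed pieces_closed piece_dif
      contract_closed a_minus_def a_ac r_distr r_minus piece_mult piece_neg piece_add)

text \<open>The twisted Leibniz rule on the right. The braiding term comes from
  \<open>box_lact\<close>: d(v(c\<eta>)) is paired with the contraction of \<square>(c\<eta>), which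
  exceeds that of c\<square>\<eta> by the contraction of \<sigma>^{-1}(dc \<otimes> \<eta>).\<close>

lemma pbox_ract:
  assumes "v \<in> carrier (vec Om)" "\<eta> \<in> piece Om 1" "c \<in> piece Om 0"
  shows "pbox (ract (vec Om) v c) \<eta> = pbox v (c \<otimes> \<eta>) \<oplus> qbox v (dif Om c) \<eta>"
proof -
  have "contract Om v (box Om (c \<otimes> \<eta>)) =
      contract Om (ract (vec Om) v c) (box Om \<eta>) \<oplus> qbox v (dif Om c) \<eta>"
    using assms add_hom_add[OF contract_hom[OF assms(1)]] add_hom_closed[OF lact_forms2_hom[OF assms(3)]]
    by (simp add: box_lact contract_balanced box_closed sgi_closed stens11_closed piece_dif qbox_def)
  then show ?thesis
    using assms
    by (simp add: pbox_def vec_apply a_minus_def minus_add a_assoc l_neg qbox_closed contract_closed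
        box_closed vec.ract_closed piece_dif pieces_closed vec_closed piece_mult)
qed

sublocale fv: tensor_pair "base Om" "forms Om 1" "vec Om"
  by (rule tensor_pair_bimodules[OF bimodule_forms bimodule_vec])

text \<open>Moving the contraction to the other side turns the condition in \<open>vbox\<close> into
  prescribed evaluations, the case treated by \<open>the_vec_tensor\<close>.\<close>

lemma vbox_eq:
  assumes v: "v \<in> carrier (vec Om)"
  shows "vbox Om v = (\<Oplus>\<^bsub>otens Om (forms Om 1) (vec Om)\<^esub>i\<in>I.
    ostens Om (forms Om 1) (vec Om) (pbox v (xi Om i)) (ub Om i))"
proof -
  let ?ev = "\<lambda>\<eta>. tlift (forms Om 1) (\<lambda>(\<zeta>, w). \<zeta> \<otimes> w \<eta>)"
  have cl: "?ev \<eta> Y \<in> carrier Om" if "Y \<in> carrier (otens Om (forms Om 1) (vec Om))" "\<eta> \<in> piece Om 1" for Y \<eta>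
  proof -
    have "balanced_map (base Om) (forms Om 1) (vec Om) (forms Om 1) (\<lambda>\<zeta> w. \<zeta> \<otimes> w \<eta>)"
      using that(2)
      by (intro balanced_mapI add_homI)
        (simp_all add: piece_mult vec_closed vec_apply l_distr r_distr m_assoc pieces_closed)
    from fv.tlift_closed[OF abelian_group_forms this that(1)] show ?thesis
      using piece_closed by simp
  qed
  have "x = a \<oplus> b \<longleftrightarrow> a = x \<ominus> b" if "x \<in> carrier Om" "a \<in> carrier Om" "b \<in> carrier Om" for x a b
    using that by (metis a_minus_def a_comm a_inv_closed minus_closed r_neg1 r_neg2 add.m_assoc r_neg r_zero l_neg)
  then have "(dif Om (v \<eta>) = ?ev \<eta> Y \<oplus> contract Om v (box Om \<eta>)) \<longleftrightarrow> ?ev \<eta> Y = pbox v \<eta>"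
    if "Y \<in> carrier (otens Om (forms Om 1) (vec Om))" "\<eta> \<in> piece Om 1" for Y \<eta>
    using that cl[OF that] v
    by (simp add: pbox_def pieces_closed piece_dif vec_closed contract_closed box_closed)
  then have "vbox Om v = (THE Y. Y \<in> carrier (otens Om (forms Om 1) (vec Om)) \<and>
      (\<forall>\<eta>\<in>piece Om 1. ?ev \<eta> Y = pbox v \<eta>))"
    unfolding vbox_def contract_def[symmetric] by (metis (no_types, lifting))
  then show ?thesis
    using the_vec_tensor[OF bimodule_forms pbox_right_map[OF v]] by simp
qed

lemma vsig_eq:
  assumes v: "v \<in> carrier (vec Om)" "\<eta> \<in> piece Om 1"
  shows "vsig Om v \<eta> = (\<Oplus>\<^bsub>otens Om (forms Om 1) (vec Om)\<^esub>i\<in>I.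
    ostens Om (forms Om 1) (vec Om) (qbox v \<eta> (xi Om i)) (ub Om i))"
  unfolding vsig_def
proof (rule fv.T.finsum_cong')
  show "(\<lambda>i. ostens Om (forms Om 1) (vec Om) (qbox v \<eta> (xi Om i)) (ub Om i)) \<in>
      I \<rightarrow> carrier (otens Om (forms Om 1) (vec Om))"
    using assms by (auto intro!: fv.stens_closed simp: qbox_closed xi_closed ub_closed)
  fix i assume i: "i \<in> I"
  let ?h = "\<lambda>\<zeta>. ostens Om (forms Om 1) (vec Om) \<zeta> (ub Om i)"
  have h: "?h \<in> add_hom (forms Om 1) (otens Om (forms Om 1) (vec Om))"
    using i by (intro fv.stens_hom_left) (simp add: ub_closed)
  have "balanced_map (base Om) (forms Om 1) (forms Om 1) (forms Om 1) (\<lambda>\<zeta> \<chi>. v \<zeta> \<otimes> \<chi>)"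
    using v add_hom_add[OF vec_hom[OF v(1)]]
    by (intro balanced_mapI add_homI)
      (simp_all add: piece_mult vec_closed vec_ract l_distr r_distr m_assoc pieces_closed)
  from balanced_map_compose[OF this h]
  show "tlift (otens Om (forms Om 1) (vec Om)) (\<lambda>(\<zeta>, \<chi>). ?h (v \<zeta> \<otimes> \<chi>))
      (sgi Om (ostens Om (forms Om 1) (forms Om 1) \<eta> (xi Om i))) = ?h (qbox v \<eta> (xi Om i))"
    unfolding qbox_def
    by (rule ff.tlift_unique[OF fv.T.abelian_group_axioms _ add_hom_compose[OF contract_hom[OF v(1)] h]])
      (use v i in \<open>simp_all add: contract_stens sgi_closed stens11_closed xi_closed\<close>)
qed simp

section \<open>One step of the extended connection\<close>

definition form_cons :: "'w \<Rightarrow> ('w \<Rightarrow> 'w) \<Rightarrow> 'w tvec \<Rightarrow> ('w \<times> 'w tvec) frag set" where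
  "form_cons \<zeta> w x = ostens Om (forms Om 1) (tvec Om) \<zeta> (tcons Om w x)"

lemma form_cons_closed: "\<lbrakk>\<zeta> \<in> piece Om 1; w \<in> carrier (vec Om); x \<in> carrier (tvec Om)\<rbrakk>
    \<Longrightarrow> form_cons \<zeta> w x \<in> carrier (form_tvec Om 1)"
  by (simp add: form_cons_def ft.stens_closed tcons_closed)

lemma form_cons_hom1: "\<lbrakk>w \<in> carrier (vec Om); x \<in> carrier (tvec Om)\<rbrakk>
    \<Longrightarrow> (\<lambda>\<zeta>. form_cons \<zeta> w x) \<in> add_hom (forms Om 1) (form_tvec Om 1)"
  unfolding form_cons_def by (intro ft.stens_hom_left tcons_closed)

lemma form_cons_hom2: "\<lbrakk>\<zeta> \<in> piece Om 1; x \<in> carrier (tvec Om)\<rbrakk>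
    \<Longrightarrow> (\<lambda>w. form_cons \<zeta> w x) \<in> add_hom (vec Om) (form_tvec Om 1)"
  unfolding form_cons_def by (rule add_hom_compose[OF tcons_hom_left ft.stens_hom_right]) simp_all

lemma form_cons_hom3: "\<lbrakk>\<zeta> \<in> piece Om 1; w \<in> carrier (vec Om)\<rbrakk>
    \<Longrightarrow> form_cons \<zeta> w \<in> add_hom (tvec Om) (form_tvec Om 1)"
  unfolding form_cons_def[abs_def] by (rule add_hom_compose[OF tcons_hom ft.stens_hom_right]) simp_all

lemma form_cons_balanced: "x \<in> carrier (tvec Om) \<Longrightarrow>
    balanced_map (base Om) (forms Om 1) (vec Om) (form_tvec Om 1) (\<lambda>\<zeta> w. form_cons \<zeta> w x)"
  by (intro balanced_mapI form_cons_hom1 form_cons_hom2)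
    (simp_all add: form_cons_def tcons_lact ft.stens_balanced[of _ 1, simplified] tcons_closed)

lemma form_cons_ract: "\<lbrakk>\<zeta> \<in> piece Om 1; w \<in> carrier (vec Om); x \<in> carrier (tvec Om); c \<in> piece Om 0\<rbrakk>
    \<Longrightarrow> form_cons \<zeta> (ract (vec Om) w c) x = form_cons \<zeta> w (lact (tvec Om) c x)"
  by (simp add: form_cons_def tcons_balanced)

lemma lact_form_cons: "\<lbrakk>\<zeta> \<in> piece Om 1; w \<in> carrier (vec Om); x \<in> carrier (tvec Om); c \<in> piece Om 0\<rbrakk>
    \<Longrightarrow> lact (form_tvec Om 1) c (form_cons \<zeta> w x) = form_cons (c \<otimes> \<zeta>) w x"
  by (simp add: form_cons_def lact_form_tvec_stens tcons_closed)

text \<open>\<square>v \<otimes> x, with \<square>v expanded by \<open>vbox_eq\<close>.\<close>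

definition bvec :: "('w \<Rightarrow> 'w) \<Rightarrow> 'w tvec \<Rightarrow> ('w \<times> 'w tvec) frag set" where
  "bvec v x = (\<Oplus>\<^bsub>form_tvec Om 1\<^esub>i\<in>I. form_cons (pbox v (xi Om i)) (ub Om i) x)"

text \<open>(\<sigma> \<otimes> id)(v \<otimes> \<eta> \<otimes> y), with \<sigma>(v \<otimes>
  \<eta>) expanded by \<open>vsig_eq\<close>; \<open>qlift\<close> extends it from \<eta> \<otimes>
  y to all of \<Omega>^1 \<otimes> T.\<close>

definition qvec :: "('w \<Rightarrow> 'w) \<Rightarrow> 'w \<Rightarrow> 'w tvec \<Rightarrow> ('w \<times> 'w tvec) frag set" where
  "qvec v \<eta> y = (\<Oplus>\<^bsub>form_tvec Om 1\<^esub>i\<in>I. form_cons (qbox v \<eta> (xi Om i)) (ub Om i) y)"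

definition qlift :: "('w \<Rightarrow> 'w) \<Rightarrow> ('w \<times> 'w tvec) frag set \<Rightarrow> ('w \<times> 'w tvec) frag set" where
  "qlift v = tlift (form_tvec Om 1) (\<lambda>(\<eta>, y). qvec v \<eta> y)"

lemma bvec_hom: "v \<in> carrier (vec Om) \<Longrightarrow> bvec v \<in> add_hom (tvec Om) (form_tvec Om 1)"
  unfolding bvec_def[abs_def]
  by (intro ft.T.add_hom_finsum_pointwise form_cons_hom3) (simp_all add: pbox_closed xi_closed ub_closed)

text \<open>Balancing does not hold term by term. A scalar on \<eta> passes to \<xi>_i through the
  balancing of \<sigma>^{-1}, from \<xi>_i to u_i by centrality of the dual basis element, and from
  u_i to y by the balancing of words.\<close>

lemma qvec_balanced:
  assumes v: "v \<in> carrier (vec Om)"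
  shows "balanced_map (base Om) (forms Om 1) (tvec Om) (form_tvec Om 1) (qvec v)"
proof (rule balanced_mapI)
  fix y assume y: "y \<in> carrier (tvec Om)"
  show "(\<lambda>\<eta>. qvec v \<eta> y) \<in> add_hom (forms Om 1) (form_tvec Om 1)"
    unfolding qvec_def
  proof (rule ft.T.add_hom_finsum_pointwise)
    show "(\<lambda>\<eta>. form_cons (qbox v \<eta> (xi Om i)) (ub Om i) y) \<in> add_hom (forms Om 1) (form_tvec Om 1)"
      if "i \<in> I" for i
      using that v y by (intro add_hom_compose[OF qbox_add_form form_cons_hom1]) (simp_all add: xi_closed ub_closed)
  qed
next
  fix \<eta> assume \<eta>: "\<eta> \<in> carrier (forms Om 1)"
  show "qvec v \<eta> \<in> add_hom (tvec Om) (form_tvec Om 1)"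
    unfolding qvec_def[abs_def] using \<eta> v
    by (intro ft.T.add_hom_finsum_pointwise form_cons_hom3) (simp_all add: qbox_closed xi_closed ub_closed)
next
  fix \<eta> a y assume "\<eta> \<in> carrier (forms Om 1)" "a \<in> carrier (base Om)" "y \<in> carrier (tvec Om)"
  then have \<eta>ay: "\<eta> \<in> piece Om 1" "a \<in> piece Om 0" "y \<in> carrier (tvec Om)" by simp_all
  have "qvec v (\<eta> \<otimes> a) y = (\<Oplus>\<^bsub>form_tvec Om 1\<^esub>i\<in>I. form_cons (qbox v \<eta> (a \<otimes> xi Om i)) (ub Om i) y)"
    unfolding qvec_def using \<eta>ay v
    by (intro ft.T.finsum_cong')
      (auto intro!: form_cons_closed simp: qbox_form_balanced qbox_closed xi_closed ub_closed piece_mult)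
  also have "\<dots> = (\<Oplus>\<^bsub>form_tvec Om 1\<^esub>i\<in>I. form_cons (qbox v \<eta> (xi Om i)) (ract (vec Om) (ub Om i) a) y)"
    by (rule coev_central[OF bimodule_forms ft.T.abelian_group_axioms form_cons_balanced[OF \<eta>ay(3)]
          qbox_right_map[OF v \<eta>ay(1)] \<eta>ay(2)])
  also have "\<dots> = qvec v \<eta> (lact (tvec Om) a y)"
    unfolding qvec_def using \<eta>ay v
    by (intro ft.T.finsum_cong')
      (auto intro!: form_cons_closed simp: form_cons_ract qbox_closed xi_closed ub_closed lact_tvec_closed)
  finally show "qvec v (ract (forms Om 1) \<eta> a) y = qvec v \<eta> (lact (tvec Om) a y)" by simp
qed

lemma qlift_props:
  assumes v: "v \<in> carrier (vec Om)"
  shows qlift_hom: "qlift v \<in> add_hom (form_tvec Om 1) (form_tvec Om 1)"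
    and qlift_stens: "\<lbrakk>\<eta> \<in> piece Om 1; y \<in> carrier (tvec Om)\<rbrakk> \<Longrightarrow>
      qlift v (ostens Om (forms Om 1) (tvec Om) \<eta> y) = qvec v \<eta> y"
  using ft.tlift_props[OF ft.T.abelian_group_axioms qvec_balanced[OF v]]
  by (simp_all add: qlift_def)

lemma form_cons_vec_tensor:
  assumes p: "\<And>i. i \<in> I \<Longrightarrow> p i \<in> piece Om 1" and x: "x \<in> carrier (tvec Om)"
  shows "tlift (form_tvec Om 1) (\<lambda>(\<zeta>, w). form_cons \<zeta> w x)
      (\<Oplus>\<^bsub>otens Om (forms Om 1) (vec Om)\<^esub>i\<in>I. ostens Om (forms Om 1) (vec Om) (p i) (ub Om i)) =
    (\<Oplus>\<^bsub>form_tvec Om 1\<^esub>i\<in>I. form_cons (p i) (ub Om i) x)"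
proof -
  note b = form_cons_balanced[OF x]
  interpret h: additive_map "otens Om (forms Om 1) (vec Om)" "form_tvec Om 1"
      "tlift (form_tvec Om 1) (\<lambda>(\<zeta>, w). form_cons \<zeta> w x)"
    by unfold_locales (rule fv.tlift_hom[OF ft.T.abelian_group_axioms b])
  show ?thesis
    using p x
    by (intro h.map_finsum_eq)
      (simp_all add: fv.stens_closed fv.tlift_stens[OF ft.T.abelian_group_axioms b] ub_closed)
qed

text \<open>The recursion of \<open>box_word\<close> with the value on the tail as an independent
  argument Y. Its compatibility with the relations can then be checked before \<square> is known to
  be well defined on tensors.\<close>

definition bstep :: "('w \<Rightarrow> 'w) \<Rightarrow> 'w tvec \<Rightarrow> ('w \<times> 'w tvec) frag set \<Rightarrow> ('w \<times> 'w tvec) frag set" where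
  "bstep v x Y = bvec v x \<oplus>\<^bsub>form_tvec Om 1\<^esub> qlift v Y"

lemma bvec_closed: "\<lbrakk>v \<in> carrier (vec Om); x \<in> carrier (tvec Om)\<rbrakk> \<Longrightarrow> bvec v x \<in> carrier (form_tvec Om 1)"
  by (rule add_hom_closed[OF bvec_hom])

lemma qlift_closed: "\<lbrakk>v \<in> carrier (vec Om); Y \<in> carrier (form_tvec Om 1)\<rbrakk> \<Longrightarrow> qlift v Y \<in> carrier (form_tvec Om 1)"
  by (rule add_hom_closed[OF qlift_hom])

lemma bstep_closed: "\<lbrakk>v \<in> carrier (vec Om); x \<in> carrier (tvec Om); Y \<in> carrier (form_tvec Om 1)\<rbrakk>
    \<Longrightarrow> bstep v x Y \<in> carrier (form_tvec Om 1)"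
  by (simp add: bstep_def bvec_closed qlift_closed)

text \<open>Membership of the tail value is an assumption here, because
  \<open>box_word_closed\<close> is itself an induction that uses this equation.\<close>

lemma box_word_Cons:
  assumes v: "v \<in> carrier (vec Om)" "vs \<in> lists (carrier (vec Om))" "a \<in> piece Om 0"
    and Y: "box_word Om a vs \<in> carrier (form_tvec Om 1)"
  shows "box_word Om a (v # vs) = bstep v (tword (base Om) (vec Om) vs a) (box_word Om a vs)"
proof -
  let ?x = "tword (base Om) (vec Om) vs a"
  have x: "?x \<in> carrier (tvec Om)"
    using assms by (simp add: tword_closed)
  have vb: "vbox Om v \<in> carrier (otens Om (forms Om 1) (vec Om))"
    unfolding vbox_eq[OF v(1)] using v(1)
    by (auto intro!: fv.T.finsum_closed fv.stens_closed simp: pbox_closed xi_closed ub_closed)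
  have "tlift (form_tvec Om 1)
       (\<lambda>(\<eta>, w). ostens Om (forms Om 1) (tvec Om) \<eta> (tword (base Om) (vec Om) (w # vs) a)) (vbox Om v) =
      tlift (form_tvec Om 1) (\<lambda>(\<zeta>, w). form_cons \<zeta> w ?x) (vbox Om v)"
    by (rule tlift_cong[OF fv.tensor_pair_axioms ft.T.abelian_group_axioms form_cons_balanced[OF x] _ vb])
      (use assms in \<open>simp add: form_cons_def tcons_tword\<close>)
  also have "\<dots> = bvec v ?x"
    unfolding vbox_eq[OF v(1)] bvec_def
    by (rule form_cons_vec_tensor[OF _ x]) (use v(1) in \<open>simp add: pbox_closed xi_closed\<close>)
  moreover have "tlift (form_tvec Om 1)
       (\<lambda>(\<eta>, y). tlift (form_tvec Om 1)
          (\<lambda>(\<zeta>, w). ostens Om (forms Om 1) (tvec Om) \<zeta> (tcons Om w y)) (vsig Om v \<eta>))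
       (box_word Om a vs) = qlift v (box_word Om a vs)"
    unfolding qlift_def
  proof (rule tlift_cong[OF ft.tensor_pair_axioms ft.T.abelian_group_axioms qvec_balanced[OF v(1)] _ Y])
    fix \<eta> y assume "\<eta> \<in> carrier (forms Om 1)" "y \<in> carrier (tvec Om)"
    then show "qvec v \<eta> y = tlift (form_tvec Om 1)
        (\<lambda>(\<zeta>, w). ostens Om (forms Om 1) (tvec Om) \<zeta> (tcons Om w y)) (vsig Om v \<eta>)"
      unfolding form_cons_def[symmetric]
      using v(1) form_cons_vec_tensor[of "\<lambda>i. qbox v \<eta> (xi Om i)" y]
      by (simp add: vsig_eq qvec_def qbox_closed xi_closed)
  qed
  ultimately show ?thesis by (simp add: bstep_def)
qed

lemma box_word_closed:
  "\<lbrakk>vs \<in> lists (carrier (vec Om)); a \<in> piece Om 0\<rbrakk> \<Longrightarrow> box_word Om a vs \<in> carrier (form_tvec Om 1)"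
proof (induction vs)
  case Nil
  then show ?case
    by (simp add: ft.stens_closed piece_dif emb0_closed one_piece)
next
  case (Cons v vs)
  then have "box_word Om a vs \<in> carrier (form_tvec Om 1)" by simp
  then show ?case
    using Cons.prems by (subst box_word_Cons) (simp_all add: bstep_closed tword_closed del: box_word.simps)
qed

lemma box_word_step:
  "\<lbrakk>v \<in> carrier (vec Om); vs \<in> lists (carrier (vec Om)); a \<in> piece Om 0\<rbrakk> \<Longrightarrow>
    box_word Om a (v # vs) = bstep v (tword (base Om) (vec Om) vs a) (box_word Om a vs)"
  by (rule box_word_Cons) (simp_all add: box_word_closed)

lemma bstep_add:
  assumes "v \<in> carrier (vec Om)" "x \<in> carrier (tvec Om)" "y \<in> carrier (tvec Om)"
    "X \<in> carrier (form_tvec Om 1)" "Y \<in> carrier (form_tvec Om 1)"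
  shows "bstep v (x \<oplus>\<^bsub>tvec Om\<^esub> y) (X \<oplus>\<^bsub>form_tvec Om 1\<^esub> Y) = bstep v x X \<oplus>\<^bsub>form_tvec Om 1\<^esub> bstep v y Y"
  using assms
  by (simp add: bstep_def add_hom_add[OF bvec_hom] add_hom_add[OF qlift_hom] bvec_closed qlift_closed ft.T.a_ac)

lemma bstep_vec_add:
  assumes "v \<in> carrier (vec Om)" "w \<in> carrier (vec Om)" "x \<in> carrier (tvec Om)" "Y \<in> carrier (form_tvec Om 1)"
  shows "bstep (v \<oplus>\<^bsub>vec Om\<^esub> w) x Y = bstep v x Y \<oplus>\<^bsub>form_tvec Om 1\<^esub> bstep w x Y"
proof -
  have vw: "v \<oplus>\<^bsub>vec Om\<^esub> w \<in> carrier (vec Om)" using assms by simp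
  have "bvec (v \<oplus>\<^bsub>vec Om\<^esub> w) x = (\<Oplus>\<^bsub>form_tvec Om 1\<^esub>i\<in>I. form_cons (pbox v (xi Om i)) (ub Om i) x
      \<oplus>\<^bsub>form_tvec Om 1\<^esub> form_cons (pbox w (xi Om i)) (ub Om i) x)"
    unfolding bvec_def using assms add_hom_add[OF form_cons_hom1]
    by (intro ft.T.finsum_cong')
      (auto simp: pbox_vec_add xi_closed ub_closed pbox_closed intro!: ft.T.a_closed form_cons_closed)
  also have "\<dots> = bvec v x \<oplus>\<^bsub>form_tvec Om 1\<^esub> bvec w x"
    unfolding bvec_def using assms
    by (intro ft.T.finsum_addf) (auto simp: xi_closed ub_closed pbox_closed intro!: form_cons_closed)
  finally have b: "bvec (v \<oplus>\<^bsub>vec Om\<^esub> w) x = bvec v x \<oplus>\<^bsub>form_tvec Om 1\<^esub> bvec w x" .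
  have "qlift (v \<oplus>\<^bsub>vec Om\<^esub> w) Y = qlift v Y \<oplus>\<^bsub>form_tvec Om 1\<^esub> qlift w Y"
  proof (rule ft.tens_hom_eqI[OF assms(4) ft.T.abelian_group_axioms qlift_hom[OF vw]])
    show "(\<lambda>Y. qlift v Y \<oplus>\<^bsub>form_tvec Om 1\<^esub> qlift w Y) \<in> add_hom (form_tvec Om 1) (form_tvec Om 1)"
      by (intro ft.T.add_hom_add_pointwise qlift_hom assms)
    fix \<eta> y assume "\<eta> \<in> carrier (forms Om 1)" and y: "y \<in> carrier (tvec Om)"
    then have \<eta>: "\<eta> \<in> piece Om 1" by simp
    have "qvec (v \<oplus>\<^bsub>vec Om\<^esub> w) \<eta> y = (\<Oplus>\<^bsub>form_tvec Om 1\<^esub>i\<in>I. form_cons (qbox v \<eta> (xi Om i)) (ub Om i) y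
        \<oplus>\<^bsub>form_tvec Om 1\<^esub> form_cons (qbox w \<eta> (xi Om i)) (ub Om i) y)"
      unfolding qvec_def using assms y \<eta> add_hom_add[OF form_cons_hom1]
      by (intro ft.T.finsum_cong')
        (auto simp: qbox_vec_add xi_closed ub_closed qbox_closed intro!: ft.T.a_closed form_cons_closed)
    also have "\<dots> = qvec v \<eta> y \<oplus>\<^bsub>form_tvec Om 1\<^esub> qvec w \<eta> y"
      unfolding qvec_def using assms y \<eta>
      by (intro ft.T.finsum_addf) (auto simp: xi_closed ub_closed qbox_closed intro!: form_cons_closed)
    finally show "qlift (v \<oplus>\<^bsub>vec Om\<^esub> w) (ostens Om (forms Om 1) (tvec Om) \<eta> y) =
        qlift v (ostens Om (forms Om 1) (tvec Om) \<eta> y) \<oplus>\<^bsub>form_tvec Om 1\<^esub>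
        qlift w (ostens Om (forms Om 1) (tvec Om) \<eta> y)"
      using assms y \<eta> vw by (simp add: qlift_stens)
  qed
  then show ?thesis
    using b assms by (simp add: bstep_def bvec_closed qlift_closed ft.T.a_ac)
qed

text \<open>The extra summand comes from \<open>pbox_lact\<close>; \<open>balanced_expansion\<close>
  resums its components to dc \<otimes> (v \<otimes> x). The braiding part is left linear.\<close>

lemma bstep_lact:
  assumes "v \<in> carrier (vec Om)" "c \<in> piece Om 0" "x \<in> carrier (tvec Om)" "Y \<in> carrier (form_tvec Om 1)"
  shows "bstep (lact (vec Om) c v) x Y =
    ostens Om (forms Om 1) (tvec Om) (dif Om c) (tcons Om v x) \<oplus>\<^bsub>form_tvec Om 1\<^esub>
    lact (form_tvec Om 1) c (bstep v x Y)"
proof -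
  have cv: "lact (vec Om) c v \<in> carrier (vec Om)" using assms by (simp add: vec.lact_closed)
  interpret h: additive_map "form_tvec Om 1" "form_tvec Om 1" "lact (form_tvec Om 1) c"
    by unfold_locales (rule lact_form_tvec_hom[OF assms(2)])
  have "bvec (lact (vec Om) c v) x =
      (\<Oplus>\<^bsub>form_tvec Om 1\<^esub>i\<in>I. form_cons (dif Om c \<otimes> v (xi Om i)) (ub Om i) x
        \<oplus>\<^bsub>form_tvec Om 1\<^esub> form_cons (c \<otimes> pbox v (xi Om i)) (ub Om i) x)"
    unfolding bvec_def using assms add_hom_add[OF form_cons_hom1]
    by (intro ft.T.finsum_cong')
      (auto simp: pbox_lact xi_closed ub_closed pbox_closed piece_mult piece_dif vec_closed
        intro!: ft.T.a_closed form_cons_closed)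
  also have "\<dots> = (\<Oplus>\<^bsub>form_tvec Om 1\<^esub>i\<in>I. form_cons (dif Om c \<otimes> v (xi Om i)) (ub Om i) x)
        \<oplus>\<^bsub>form_tvec Om 1\<^esub> (\<Oplus>\<^bsub>form_tvec Om 1\<^esub>i\<in>I. form_cons (c \<otimes> pbox v (xi Om i)) (ub Om i) x)"
    using assms
    by (intro ft.T.finsum_addf)
      (auto simp: xi_closed ub_closed pbox_closed piece_mult piece_dif vec_closed intro!: form_cons_closed)
  also have "(\<Oplus>\<^bsub>form_tvec Om 1\<^esub>i\<in>I. form_cons (dif Om c \<otimes> v (xi Om i)) (ub Om i) x) = form_cons (dif Om c) v x"
    using balanced_expansion[OF bimodule_forms ft.T.abelian_group_axioms form_cons_balanced[OF assms(3)], of "dif Om c" v]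
      assms by (simp add: piece_dif)
  also have "(\<Oplus>\<^bsub>form_tvec Om 1\<^esub>i\<in>I. form_cons (c \<otimes> pbox v (xi Om i)) (ub Om i) x) = lact (form_tvec Om 1) c (bvec v x)"
    unfolding bvec_def using assms
    by (intro h.map_finsum_eq[symmetric])
      (simp_all add: form_cons_closed xi_closed ub_closed pbox_closed lact_form_cons)
  finally have b: "bvec (lact (vec Om) c v) x = form_cons (dif Om c) v x \<oplus>\<^bsub>form_tvec Om 1\<^esub> lact (form_tvec Om 1) c (bvec v x)" .
  have "qlift (lact (vec Om) c v) Y = lact (form_tvec Om 1) c (qlift v Y)"
  proof (rule ft.tens_hom_eqI[OF assms(4) ft.T.abelian_group_axioms qlift_hom[OF cv]])
    show "(\<lambda>Y. lact (form_tvec Om 1) c (qlift v Y)) \<in> add_hom (form_tvec Om 1) (form_tvec Om 1)"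
      by (rule add_hom_compose[OF qlift_hom[OF assms(1)] h.hom])
    fix \<eta> y assume "\<eta> \<in> carrier (forms Om 1)" and y: "y \<in> carrier (tvec Om)"
    then have \<eta>: "\<eta> \<in> piece Om 1" by simp
    have "lact (form_tvec Om 1) c (qvec v \<eta> y) = qvec (lact (vec Om) c v) \<eta> y"
      unfolding qvec_def using assms y \<eta>
      by (intro h.map_finsum_eq)
        (simp_all add: form_cons_closed xi_closed ub_closed qbox_closed lact_form_cons qbox_lact)
    then show "qlift (lact (vec Om) c v) (ostens Om (forms Om 1) (tvec Om) \<eta> y) =
        lact (form_tvec Om 1) c (qlift v (ostens Om (forms Om 1) (tvec Om) \<eta> y))"
      using assms y \<eta> cv by (simp add: qlift_stens)
  qed
  then show ?thesis
    using b assms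
    by (simp add: bstep_def bvec_closed qlift_closed form_cons_def ft.T.a_assoc ft.stens_closed piece_dif tcons_closed)
qed

text \<open>The compatibility that makes \<square> balanced between consecutive letters. The last
  argument on the right is the value that the Leibniz rule gives for \<square>(c.x); applying
  \<sigma> to its summand dc \<otimes> x yields exactly the braiding term of
  \<open>pbox_ract\<close>.\<close>

lemma bstep_ract:
  assumes "v \<in> carrier (vec Om)" "c \<in> piece Om 0" "x \<in> carrier (tvec Om)" "Y \<in> carrier (form_tvec Om 1)"
  shows "bstep (ract (vec Om) v c) x Y =
    bstep v (lact (tvec Om) c x)
      (ostens Om (forms Om 1) (tvec Om) (dif Om c) x \<oplus>\<^bsub>form_tvec Om 1\<^esub> lact (form_tvec Om 1) c Y)"
proof -
  have vc: "ract (vec Om) v c \<in> carrier (vec Om)" using assms by (simp add: vec.ract_closed)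
  have "bvec (ract (vec Om) v c) x =
      (\<Oplus>\<^bsub>form_tvec Om 1\<^esub>i\<in>I. form_cons (pbox v (c \<otimes> xi Om i)) (ub Om i) x
        \<oplus>\<^bsub>form_tvec Om 1\<^esub> form_cons (qbox v (dif Om c) (xi Om i)) (ub Om i) x)"
    unfolding bvec_def using assms add_hom_add[OF form_cons_hom1]
    by (intro ft.T.finsum_cong')
      (auto simp: pbox_ract xi_closed ub_closed pbox_closed qbox_closed piece_mult piece_dif
        intro!: ft.T.a_closed form_cons_closed)
  also have "\<dots> = (\<Oplus>\<^bsub>form_tvec Om 1\<^esub>i\<in>I. form_cons (pbox v (c \<otimes> xi Om i)) (ub Om i) x)
        \<oplus>\<^bsub>form_tvec Om 1\<^esub> qvec v (dif Om c) x"
    unfolding qvec_def using assms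
    by (intro ft.T.finsum_addf)
      (auto simp: xi_closed ub_closed pbox_closed qbox_closed piece_mult piece_dif intro!: form_cons_closed)
  also have "(\<Oplus>\<^bsub>form_tvec Om 1\<^esub>i\<in>I. form_cons (pbox v (c \<otimes> xi Om i)) (ub Om i) x) =
      (\<Oplus>\<^bsub>form_tvec Om 1\<^esub>i\<in>I. form_cons (pbox v (xi Om i)) (ract (vec Om) (ub Om i) c) x)"
    by (rule coev_central[OF bimodule_forms ft.T.abelian_group_axioms form_cons_balanced[OF assms(3)]
          pbox_right_map[OF assms(1)] assms(2)])
  also have "\<dots> = bvec v (lact (tvec Om) c x)"
    unfolding bvec_def using assms
    by (intro ft.T.finsum_cong')
      (auto intro!: form_cons_closed simp: form_cons_ract pbox_closed xi_closed ub_closed lact_tvec_closed)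
  finally have b: "bvec (ract (vec Om) v c) x =
      bvec v (lact (tvec Om) c x) \<oplus>\<^bsub>form_tvec Om 1\<^esub> qvec v (dif Om c) x" .
  have "qlift (ract (vec Om) v c) Y = qlift v (lact (form_tvec Om 1) c Y)"
  proof (rule ft.tens_hom_eqI[OF assms(4) ft.T.abelian_group_axioms qlift_hom[OF vc]])
    show "(\<lambda>Y. qlift v (lact (form_tvec Om 1) c Y)) \<in> add_hom (form_tvec Om 1) (form_tvec Om 1)"
      by (rule add_hom_compose[OF lact_form_tvec_hom[OF assms(2)] qlift_hom[OF assms(1)]])
    fix \<eta> y assume "\<eta> \<in> carrier (forms Om 1)" and y: "y \<in> carrier (tvec Om)"
    then have \<eta>: "\<eta> \<in> piece Om 1" by simp
    have "qvec (ract (vec Om) v c) \<eta> y = qvec v (c \<otimes> \<eta>) y"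
      unfolding qvec_def using assms y \<eta>
      by (intro ft.T.finsum_cong')
        (auto intro!: form_cons_closed simp: xi_closed ub_closed qbox_closed piece_mult qbox_ract)
    then show "qlift (ract (vec Om) v c) (ostens Om (forms Om 1) (tvec Om) \<eta> y) =
        qlift v (lact (form_tvec Om 1) c (ostens Om (forms Om 1) (tvec Om) \<eta> y))"
      using assms y \<eta> vc by (simp add: qlift_stens lact_form_tvec_stens piece_mult)
  qed
  then show ?thesis
    using b assms add_hom_add[OF qlift_hom[OF assms(1)]] add_hom_closed[OF lact_form_tvec_hom[OF assms(2)], of Y 1]
    by (simp add: bstep_def bvec_closed qlift_closed ft.T.a_assoc ft.stens_closed piece_dif lact_tvec_closed
        qlift_stens balanced_mapD(4)[OF qvec_balanced])
qed

section \<open>Descent of the extended connection from words to tensors\<close>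

abbreviation "tw \<equiv> tword (base Om) (vec Om)"
abbreviation "V \<equiv> carrier (vec Om)"
abbreviation "F1 \<equiv> form_tvec Om 1"

text \<open>Transports a relation at the head of a word past an arbitrary prefix. The tensor and its
  derivative are carried along together, since \<open>bstep\<close> uses both.\<close>

lemma box_prefix_add:
  assumes "us \<in> lists V" "w1 \<in> lists V" "w2 \<in> lists V" "w3 \<in> lists V"
    "a1 \<in> piece Om 0" "a2 \<in> piece Om 0" "a3 \<in> piece Om 0"
    "tw w1 a1 = tw w2 a2 \<oplus>\<^bsub>tvec Om\<^esub> tw w3 a3"
    "box_word Om a1 w1 = box_word Om a2 w2 \<oplus>\<^bsub>F1\<^esub> box_word Om a3 w3"
  shows "tw (us @ w1) a1 = tw (us @ w2) a2 \<oplus>\<^bsub>tvec Om\<^esub> tw (us @ w3) a3 \<and>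
    box_word Om a1 (us @ w1) = box_word Om a2 (us @ w2) \<oplus>\<^bsub>F1\<^esub> box_word Om a3 (us @ w3)"
  using assms(1)
proof (induction us)
  case Nil
  then show ?case using assms by simp
next
  case (Cons u us)
  have u: "u \<in> V" "us \<in> lists V" by (rule Cons.hyps)+
  have w: "us @ w1 \<in> lists V" "us @ w2 \<in> lists V" "us @ w3 \<in> lists V" using u assms(2-4) by simp_all
  note IH = Cons.IH
  have "tw (u # us @ w1) a1 = tcons Om u (tw (us @ w1) a1)"
    using u w assms by (simp add: tcons_tword)
  also have "\<dots> = tw (u # us @ w2) a2 \<oplus>\<^bsub>tvec Om\<^esub> tw (u # us @ w3) a3"
    using u w assms IH add_hom_add[OF tcons_hom[OF u(1)]] by (simp add: tcons_tword tword_closed)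
  finally have 1: "tw (u # us @ w1) a1 = tw (u # us @ w2) a2 \<oplus>\<^bsub>tvec Om\<^esub> tw (u # us @ w3) a3" .
  have "box_word Om a1 (u # us @ w1) =
      box_word Om a2 (u # us @ w2) \<oplus>\<^bsub>F1\<^esub> box_word Om a3 (u # us @ w3)"
    unfolding box_word_step[OF u(1) w(1) assms(5)] box_word_step[OF u(1) w(2) assms(6)]
      box_word_step[OF u(1) w(3) assms(7)]
    using IH bstep_add[OF u(1) tword_closed[OF w(2) assms(6)] tword_closed[OF w(3) assms(7)]
        box_word_closed[OF w(2) assms(6)] box_word_closed[OF w(3) assms(7)]]
    by simp
  with 1 show ?case by (simp del: box_word.simps)
qed

lemma box_prefix_eq:
  assumes "us \<in> lists V" "w1 \<in> lists V" "w2 \<in> lists V" "a1 \<in> piece Om 0" "a2 \<in> piece Om 0"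
    "tw w1 a1 = tw w2 a2" "box_word Om a1 w1 = box_word Om a2 w2"
  shows "tw (us @ w1) a1 = tw (us @ w2) a2 \<and> box_word Om a1 (us @ w1) = box_word Om a2 (us @ w2)"
  using assms(1)
proof (induction us)
  case Nil
  then show ?case using assms by simp
next
  case (Cons u us)
  have u: "u \<in> V" "us \<in> lists V" by (rule Cons.hyps)+
  have w: "us @ w1 \<in> lists V" "us @ w2 \<in> lists V" using u assms(2-3) by simp_all
  have "tw (u # us @ w1) a1 = tw (u # us @ w2) a2"
    using Cons.IH tcons_tword[OF u(1) w(1) assms(4)] tcons_tword[OF u(1) w(2) assms(5)] by simp
  then show ?case
    using Cons.IH box_word_step[OF u(1) w(1) assms(4)] box_word_step[OF u(1) w(2) assms(5)]
    by (simp del: box_word.simps)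
qed

lemma box_word_Nil_add:
  assumes "a \<in> piece Om 0" "b \<in> piece Om 0"
  shows "box_word Om (a \<oplus> b) [] = box_word Om a [] \<oplus>\<^bsub>F1\<^esub> box_word Om b []"
  using assms ft.stens_add_left[of "dif Om a" 1 "dif Om b" "emb0 Om \<one>"]
  by (simp add: dif_add pieces_closed piece_dif emb0_closed one_piece)

lemma box_word_Nil_mult:
  assumes "c \<in> piece Om 0" "a \<in> piece Om 0"
  shows "box_word Om (c \<otimes> a) [] = ostens Om (forms Om 1) (tvec Om) (dif Om c) (emb0 Om a)
    \<oplus>\<^bsub>F1\<^esub> lact F1 c (box_word Om a [])"
  using assms ft.stens_add_left[of "dif Om c \<otimes> a" 1 "c \<otimes> dif Om a" "emb0 Om \<one>"]
    ft.stens_balanced[of "dif Om c" 1 a "emb0 Om \<one>"]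
  by (simp add: dif_mult0 pieces_closed piece_dif piece_mult emb0_closed one_piece lact_emb0 lact_form_tvec_stens)

text \<open>Each relation is verified where it stands at the head of the word, and then moved behind
  the prefix \<open>us\<close>.\<close>

lemma box_word_map: "word_map (base Om) (vec Om) F1 (\<lambda>vs a. box_word Om a vs)"
proof (rule word_mapI)
  fix vs assume vs: "vs \<in> lists V"
  show "(\<lambda>a. box_word Om a vs) \<in> add_hom (base Om) F1"
  proof (rule add_homI)
    fix a b assume "a \<in> carrier (base Om)" "b \<in> carrier (base Om)"
    then have ab: "a \<in> piece Om 0" "b \<in> piece Om 0" by simp_all
    have "tw [] (a \<oplus> b) = tw [] a \<oplus>\<^bsub>tvec Om\<^esub> tw [] b"
      using add_hom_add[OF tword_hom[of "[]" a]] ab by simp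
    from box_prefix_add[OF vs _ _ _ _ ab this box_word_Nil_add[OF ab]]
    show "box_word Om (a \<oplus>\<^bsub>base Om\<^esub> b) vs = box_word Om a vs \<oplus>\<^bsub>F1\<^esub> box_word Om b vs"
      using ab by (simp add: piece_add)
  qed (use vs in \<open>simp add: box_word_closed\<close>)
next
  fix us v v' vs a
  assume *: "us \<in> lists V" "vs \<in> lists V" "v \<in> V" "v' \<in> V" "a \<in> carrier (base Om)"
  then have a: "a \<in> piece Om 0" by simp
  have vv: "v \<oplus>\<^bsub>vec Om\<^esub> v' \<in> V" using * by simp
  have 1: "tw ((v \<oplus>\<^bsub>vec Om\<^esub> v') # vs) a = tw (v # vs) a \<oplus>\<^bsub>tvec Om\<^esub> tw (v' # vs) a"
    using words.tword_add[of "[]" a vs v v'] * by (simp add: tvec_eq)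
  have 2: "box_word Om a ((v \<oplus>\<^bsub>vec Om\<^esub> v') # vs) = box_word Om a (v # vs) \<oplus>\<^bsub>F1\<^esub> box_word Om a (v' # vs)"
    unfolding box_word_step[OF vv *(2) a] box_word_step[OF *(3,2) a] box_word_step[OF *(4,2) a]
    by (intro bstep_vec_add * tword_closed box_word_closed a)
  show "box_word Om a (us @ (v \<oplus>\<^bsub>vec Om\<^esub> v') # vs) =
      box_word Om a (us @ v # vs) \<oplus>\<^bsub>F1\<^esub> box_word Om a (us @ v' # vs)"
    by (rule box_prefix_add[THEN conjunct2]) (use * vv a 1 2 in \<open>simp_all del: box_word.simps\<close>)
next
  fix us v c v' vs a
  assume *: "us \<in> lists V" "vs \<in> lists V" "v \<in> V" "v' \<in> V" "c \<in> carrier (base Om)" "a \<in> carrier (base Om)"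
  then have ca: "a \<in> piece Om 0" "c \<in> piece Om 0" by simp_all
  have cv: "ract (vec Om) v c \<in> V" "lact (vec Om) c v' \<in> V"
    using * by (simp_all add: vec.ract_closed vec.lact_closed)
  have vs': "v' # vs \<in> lists V" "lact (vec Om) c v' # vs \<in> lists V" using * cv by simp_all
  have 1: "tw (ract (vec Om) v c # v' # vs) a = tw (v # lact (vec Om) c v' # vs) a"
    using words.tword_balanced[of "[]" a vs v v' c] * by simp
  note x = tword_closed[OF *(2) ca(1)] and Y = box_word_closed[OF *(2) ca(1)]
  have tv: "tcons Om v' (tw vs a) = tw (v' # vs) a"
    using * ca by (simp add: tcons_tword)
  \<comment> \<open>\<open>bstep_ract\<close> asks for the Leibniz value of c applied to the tail v'
    # vs, and \<open>bstep_lact\<close> shows that this is the value on the tail starting with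
    c.v'.\<close>
  have 2: "box_word Om a (ract (vec Om) v c # v' # vs) = box_word Om a (v # lact (vec Om) c v' # vs)"
    unfolding box_word_step[OF cv(1) vs'(1) ca(1)] box_word_step[OF *(3) vs'(2) ca(1)]
    using * ca lact_tvec_Cons[of c v' vs a] box_word_step[OF *(4,2) ca(1)] box_word_step[OF cv(2) *(2) ca(1)]
      bstep_ract[OF *(3) ca(2) tword_closed[OF vs'(1) ca(1)] box_word_closed[OF vs'(1) ca(1)]]
      bstep_lact[OF *(4) ca(2) x Y]
    by (simp add: tv del: box_word.simps)
  show "box_word Om a (us @ ract (vec Om) v c # v' # vs) = box_word Om a (us @ v # lact (vec Om) c v' # vs)"
    by (rule box_prefix_eq[THEN conjunct2]) (use * cv ca 1 2 in \<open>simp_all del: box_word.simps\<close>)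
next
  fix us v c a
  assume *: "us \<in> lists V" "v \<in> V" "c \<in> carrier (base Om)" "a \<in> carrier (base Om)"
  then have ca: "a \<in> piece Om 0" "c \<in> piece Om 0" "c \<otimes> a \<in> piece Om 0" by (simp_all add: piece_mult)
  have vc: "ract (vec Om) v c \<in> V" using * by (simp add: vec.ract_closed)
  have 1: "tw [ract (vec Om) v c] a = tw [v] (c \<otimes> a)"
    using words.tword_last[of "[]" a v c] * by simp
  have Nil: "[] \<in> lists V" by simp
  note x = tword_closed[OF Nil ca(1)] and Y = box_word_closed[OF Nil ca(1)]
  \<comment> \<open>Here the tail is a scalar, and the Leibniz value is that of d(ca), given by
    \<open>box_word_Nil_mult\<close>.\<close>
  have 2: "box_word Om a [ract (vec Om) v c] = box_word Om (c \<otimes> a) [v]"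
    unfolding box_word_step[OF vc Nil ca(1)] box_word_step[OF *(2) Nil ca(3)]
      bstep_ract[OF *(2) ca(2) x Y] box_word_Nil_mult[OF ca(2,1)]
    using ca by (simp add: lact_tvec_Nil emb0_def)
  show "box_word Om a (us @ [ract (vec Om) v c]) = box_word Om (c \<otimes>\<^bsub>base Om\<^esub> a) (us @ [v])"
    using box_prefix_eq[OF *(1) _ _ ca(1,3) 1 2] vc * by simp
qed

lemma tbox_tword: "\<lbrakk>vs \<in> lists V; a \<in> piece Om 0\<rbrakk> \<Longrightarrow> tbox Om (tw vs a) = box_word Om a vs"
  using words.tlift_tword[OF ft.T.abelian_group_axioms box_word_map]
  by (simp add: tbox_def)

lemma tbox_emb0: "a \<in> piece Om 0 \<Longrightarrow>
    tbox Om (emb0 Om a) = ostens Om (forms Om 1) (tvec Om) (dif Om a) (emb0 Om \<one>)"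
  by (simp add: emb0_def tbox_tword)

end

section \<open>Evaluation of the form factor\<close>

lemma (in dga) ev_left_props:
  assumes M: "bimodule (base Om) M" and \<alpha>: "\<alpha> \<in> carrier (rhom (base Om) (forms Om k) (forms Om 0))"
  shows ev_left_hom: "ev_left Om \<alpha> M \<in> add_hom (otens Om (forms Om k) M) M"
    and ev_left_stens: "\<lbrakk>\<eta> \<in> piece Om k; m \<in> carrier M\<rbrakk> \<Longrightarrow>
      ev_left Om \<alpha> M (ostens Om (forms Om k) M \<eta> m) = lact M (\<alpha> \<eta>) m"
proof -
  interpret M: bimodule "base Om" M by (rule M)
  interpret T: tensor_pair "base Om" "forms Om k" M by (rule tensor_pair_bimodules[OF bimodule_forms M])
  have cl: "\<alpha> \<eta> \<in> piece Om 0" if "\<eta> \<in> piece Om k" for \<eta>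
    using add_hom_closed[OF rhom_carrierD(1)[OF \<alpha>]] that by simp
  have "balanced_map (base Om) (forms Om k) M M (\<lambda>\<eta> m. lact M (\<alpha> \<eta>) m)"
    using cl add_hom_add[OF rhom_carrierD(1)[OF \<alpha>]] rhom_carrierD(3)[OF \<alpha>]
    by (intro balanced_mapI add_homI)
      (simp_all add: M.lact_closed M.add_lact[simplified] M.lact_add M.mult_lact[simplified])
  note * = T.tlift_props[OF M.M.abelian_group_axioms this]
  show "ev_left Om \<alpha> M \<in> add_hom (otens Om (forms Om k) M) M"
    using *(1) by (simp add: ev_left_def)
  show "\<lbrakk>\<eta> \<in> piece Om k; m \<in> carrier M\<rbrakk> \<Longrightarrow> ev_left Om \<alpha> M (ostens Om (forms Om k) M \<eta> m) = lact M (\<alpha> \<eta>) m"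
    using *(2) by (simp add: ev_left_def)
qed

text \<open>The module \<open>tvec Om\<close> enters only with its left action, whose laws are at
  hand, so this stands beside the version for bimodules.\<close>

lemma (in dga) ev_left_tvec_props:
  assumes \<alpha>: "\<alpha> \<in> carrier (rhom (base Om) (forms Om k) (forms Om 0))"
  shows ev_left_tvec_hom: "ev_left Om \<alpha> (tvec Om) \<in> add_hom (form_tvec Om k) (tvec Om)"
    and ev_left_tvec_stens: "\<lbrakk>\<eta> \<in> piece Om k; x \<in> carrier (tvec Om)\<rbrakk> \<Longrightarrow>
      ev_left Om \<alpha> (tvec Om) (ostens Om (forms Om k) (tvec Om) \<eta> x) = lact (tvec Om) (\<alpha> \<eta>) x"
proof -
  have cl: "\<alpha> \<eta> \<in> piece Om 0" if "\<eta> \<in> piece Om k" for \<eta>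
    using add_hom_closed[OF rhom_carrierD(1)[OF \<alpha>]] that by simp
  have "balanced_map (base Om) (forms Om k) (tvec Om) (tvec Om) (\<lambda>\<eta> m. lact (tvec Om) (\<alpha> \<eta>) m)"
    using cl add_hom_add[OF rhom_carrierD(1)[OF \<alpha>]] rhom_carrierD(3)[OF \<alpha>]
    by (intro balanced_mapI add_homI)
      (simp_all add: lact_tvec_closed lact_tvec_add lact_tvec_mult add_hom_add[OF lact_tvec_hom])
  note * = ft.tlift_props[OF tvec_group this]
  show "ev_left Om \<alpha> (tvec Om) \<in> add_hom (form_tvec Om k) (tvec Om)"
    using *(1) by (simp add: ev_left_def)
  show "\<lbrakk>\<eta> \<in> piece Om k; x \<in> carrier (tvec Om)\<rbrakk> \<Longrightarrow>
      ev_left Om \<alpha> (tvec Om) (ostens Om (forms Om k) (tvec Om) \<eta> x) = lact (tvec Om) (\<alpha> \<eta>) x"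
    using *(2) by (simp add: ev_left_def)
qed

section \<open>Generation of the bullet algebra\<close>

lemma generate_hom_subset:
  assumes "group G" "group H" "h \<in> hom G H" "X \<subseteq> carrier G" "subgroup K H" "h ` X \<subseteq> K" "x \<in> generate G X"
  shows "h x \<in> K"
proof -
  interpret group_hom G H h
    using assms by (intro group_hom.intro group_hom_axioms.intro)
  have "h x \<in> generate H (h ` X)" using generate_img[OF assms(4)] assms(7) by blast
  then show ?thesis
    using H.generate_subgroup_incl[OF assms(6,5)] by blast
qed

context geometry
begin

text \<open>
  Since $\square^{\langle n \rangle}$ preserves the degree, writing $u \otimes \underline x$ as
  $u \bullet \underline x - (\mathrm{ev} \otimes \mathrm{id})(u \otimes \square^{\langle n \rangle} \underline x)$ is a recursion on the degree.
\<close>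

definition fil :: "nat \<Rightarrow> 'w tvec set" where
  "fil n = generate (add_monoid (tvec Om)) {tw vs a | vs a. vs \<in> lists V \<and> length vs = n \<and> a \<in> piece Om 0}"

definition form_fil :: "nat \<Rightarrow> ('w \<times> 'w tvec) frag set set" where
  "form_fil n = generate (add_monoid F1)
    {ostens Om (forms Om 1) (tvec Om) \<eta> x | \<eta> x. \<eta> \<in> piece Om 1 \<and> x \<in> fil n}"

lemma fil_subgroup: "subgroup (fil n) (add_monoid (tvec Om))"
  unfolding fil_def by (rule group.generate_is_subgroup[OF tvec.a_group]) (use tword_closed in auto)

lemma fil_closed: "x \<in> fil n \<Longrightarrow> x \<in> carrier (tvec Om)"
  using subgroup.subset[OF fil_subgroup] by auto

lemma form_fil_subgroup: "subgroup (form_fil n) (add_monoid F1)"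
  unfolding form_fil_def
  by (rule group.generate_is_subgroup[OF ft.T.a_group]) (auto simp: ft.stens_closed fil_closed)

lemma tword_fil: "\<lbrakk>vs \<in> lists V; a \<in> piece Om 0\<rbrakk> \<Longrightarrow> tw vs a \<in> fil (length vs)"
  unfolding fil_def by (rule generate.incl) auto

lemma stens_form_fil: "\<lbrakk>\<eta> \<in> piece Om 1; x \<in> fil n\<rbrakk> \<Longrightarrow> ostens Om (forms Om 1) (tvec Om) \<eta> x \<in> form_fil n"
  unfolding form_fil_def by (rule generate.incl) auto

lemma fil_hom:
  assumes "abelian_group G" "h \<in> add_hom (tvec Om) G" "subgroup K (add_monoid G)" "x \<in> fil n"
    "\<And>vs a. \<lbrakk>vs \<in> lists V; length vs = n; a \<in> piece Om 0\<rbrakk> \<Longrightarrow> h (tw vs a) \<in> K"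
  shows "h x \<in> K"
  using assms(4,5) unfolding fil_def
  by (elim generate_hom_subset[OF tvec.a_group abelian_group.a_group[OF assms(1)]
        assms(2)[unfolded add_hom_def] _ assms(3), rotated -1])
    (use tword_closed in auto)

lemma form_fil_hom:
  assumes "abelian_group G" "h \<in> add_hom F1 G" "subgroup K (add_monoid G)" "x \<in> form_fil n"
    "\<And>\<eta> y. \<lbrakk>\<eta> \<in> piece Om 1; y \<in> fil n\<rbrakk> \<Longrightarrow> h (ostens Om (forms Om 1) (tvec Om) \<eta> y) \<in> K"
  shows "h x \<in> K"
  using assms(4,5) unfolding form_fil_def
  by (elim generate_hom_subset[OF ft.T.a_group abelian_group.a_group[OF assms(1)]
        assms(2)[unfolded add_hom_def] _ assms(3), rotated -1])
    (auto simp: ft.stens_closed fil_closed)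

lemma tcons_fil:
  assumes "u \<in> V" "x \<in> fil n"
  shows "tcons Om u x \<in> fil (Suc n)"
  by (rule fil_hom[OF tvec_group tcons_hom[OF assms(1)] fil_subgroup assms(2)])
    (use tword_fil[of "u # vs" a for vs a] assms in \<open>auto simp: tcons_tword\<close>)

lemma lact_fil:
  assumes "c \<in> piece Om 0" "x \<in> fil n"
  shows "lact (tvec Om) c x \<in> fil n"
proof (rule fil_hom[OF tvec_group lact_tvec_hom[OF assms(1)] fil_subgroup assms(2)])
  fix vs a assume "vs \<in> lists V" "length vs = n" "a \<in> piece Om 0"
  then show "lact (tvec Om) c (tw vs a) \<in> fil n"
    using assms(1) tword_fil[of "[]" "c \<otimes> a"] tword_fil[of "lact (vec Om) c (hd vs) # tl vs" a]
    by (cases vs) (auto simp: lact_tvec_Nil lact_tvec_Cons piece_mult vec.lact_closed)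
qed

text \<open>Both summands of \<open>bstep\<close> put exactly one letter in front of a tensor with
  the length of the tail.\<close>

lemma box_word_fil: "\<lbrakk>vs \<in> lists V; a \<in> piece Om 0\<rbrakk> \<Longrightarrow> box_word Om a vs \<in> form_fil (length vs)"
proof (induction vs)
  case Nil
  then show ?case
    using tword_fil[of "[]" \<one>] one_piece by (simp add: stens_form_fil piece_dif emb0_def)
next
  case (Cons v vs)
  then have v: "v \<in> V" "vs \<in> lists V" "a \<in> piece Om 0" and IH: "box_word Om a vs \<in> form_fil (length vs)"
    by simp_all
  have "bvec v (tw vs a) \<in> form_fil (Suc (length vs))"
    unfolding bvec_def form_cons_def using v tword_fil[OF v(2,3)]
    by (intro ft.T.finsum_in_subgroup[OF form_fil_subgroup])
      (simp_all add: stens_form_fil tcons_fil pbox_closed xi_closed ub_closed)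
  moreover have "qlift v (box_word Om a vs) \<in> form_fil (Suc (length vs))"
  proof (rule form_fil_hom[OF ft.T.abelian_group_axioms qlift_hom[OF v(1)] form_fil_subgroup IH])
    fix \<eta> y assume "\<eta> \<in> piece Om 1" "y \<in> fil (length vs)"
    then show "qlift v (ostens Om (forms Om 1) (tvec Om) \<eta> y) \<in> form_fil (Suc (length vs))"
      using v fil_closed unfolding form_cons_def
      by (simp add: qlift_stens qvec_def form_cons_def)
        (intro ft.T.finsum_in_subgroup[OF form_fil_subgroup],
          simp add: stens_form_fil tcons_fil qbox_closed xi_closed ub_closed)
  qed
  ultimately show ?case
    using subgroup.m_closed[OF form_fil_subgroup] v
    by (simp add: box_word_step bstep_def del: box_word.simps)
qed

lemma ev_left_fil:
  assumes "u \<in> V" "Y \<in> form_fil n"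
  shows "ev_left Om u (tvec Om) Y \<in> fil n"
proof -
  note u = assms(1)[unfolded vec_def]
  show ?thesis
    by (rule form_fil_hom[OF tvec_group ev_left_tvec_hom[OF u] fil_subgroup assms(2)])
      (use assms in \<open>simp add: ev_left_tvec_stens[OF u] fil_closed lact_fil vec_closed\<close>)
qed

end

section \<open>The bullet product\<close>

locale bullet_geometry = geometry Om for Om :: "('w, 'b) geometry_scheme" (structure) +
  fixes mul :: "'w tvec_op"
  assumes bullet: "bullet_product Om mul"
begin

abbreviation "T \<equiv> tvec_bullet Om mul"

lemma T_simps [simp]:
  "carrier T = carrier (tvec Om)" "add T = add (tvec Om)" "zero T = zero (tvec Om)"
  "mult T = mul" "lact T = lact (tvec Om)" "ract T x a = mul x (emb0 Om a)"
  "one T = one (tvec Om)"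
  by (simp_all add: tvec_bullet_def)

sublocale T: ring T
  using bullet by (simp add: bullet_product_def)

lemma one_T: "\<one>\<^bsub>tvec Om\<^esub> = emb0 Om \<one>"
  by (simp add: tvec_def words.one_talg emb0_def)

lemma mul_emb0: "\<lbrakk>a \<in> piece Om 0; x \<in> carrier (tvec Om)\<rbrakk> \<Longrightarrow> mul (emb0 Om a) x = lact (tvec Om) a x"
  using bullet by (simp add: bullet_product_def)

lemma mul_emb1: "\<lbrakk>u \<in> V; x \<in> carrier (tvec Om)\<rbrakk> \<Longrightarrow>
    mul (emb1 Om u) x = tcons Om u x \<oplus>\<^bsub>tvec Om\<^esub> ev_left Om u (tvec Om) (tbox Om x)"
  using bullet by (simp add: bullet_product_def)

lemma mul_closed: "\<lbrakk>x \<in> carrier (tvec Om); y \<in> carrier (tvec Om)\<rbrakk> \<Longrightarrow> mul x y \<in> carrier (tvec Om)"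
  using T.m_closed by simp

text \<open>The commutation rule of a vector field with a function. The derivative u(da) is what
  makes the right action by \<bullet> interact with \<open>vact\<close> in the balancing of
  \<open>lval\<close>.\<close>

lemma ev_left_emb0_dif:
  assumes "u \<in> V" "a \<in> piece Om 0"
  shows "mul (emb1 Om u) (emb0 Om a) = emb1 Om (ract (vec Om) u a) \<oplus>\<^bsub>tvec Om\<^esub> emb0 Om (u (dif Om a))"
  using assms ev_left_tvec_stens[OF assms(1)[unfolded vec_def]]
  by (simp add: mul_emb1 emb0_closed tbox_emb0 tcons_emb0 piece_dif one_piece lact_emb0 vec_closed pieces_closed)

text \<open>Serves as the induction principle of the bullet algebra, for properties that are
  accessible only for left factors in A and Vec A.\<close>

lemma bullet_subgroup:
  assumes H: "subgroup H (add_monoid (tvec Om))"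
    and emb0: "\<And>a. a \<in> piece Om 0 \<Longrightarrow> emb0 Om a \<in> H"
    and emb1: "\<And>u x. \<lbrakk>u \<in> V; x \<in> carrier (tvec Om); x \<in> H\<rbrakk> \<Longrightarrow> mul (emb1 Om u) x \<in> H"
    and x: "x \<in> carrier (tvec Om)"
  shows "x \<in> H"
proof -
  have id: "(\<lambda>x. x) \<in> add_hom (tvec Om) (tvec Om)" by (simp add: add_homI)
  have word: "tw vs a \<in> H" if "length vs = n" "vs \<in> lists V" "a \<in> piece Om 0" for n vs a
    using that
  proof (induction n arbitrary: vs a)
    case 0
    then show ?case using emb0 by (simp add: emb0_def)
  next
    case (Suc n)
    then obtain u ws where u: "vs = u # ws" "u \<in> V" "ws \<in> lists V" "length ws = n"
      by (cases vs) auto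
    \<comment> \<open>The correction term of u \<bullet> x is not a word, but a sum of words with
      the length of x. The induction hypothesis therefore has to be extended from words to all of
      \<open>fil n\<close>.\<close>
    have fil: "y \<in> H" if "y \<in> fil n" for y
      by (rule fil_hom[OF tvec_group id H that]) (rule Suc.IH)
    let ?y = "ev_left Om u (tvec Om) (box_word Om a ws)"
    have y: "?y \<in> fil n"
      using ev_left_fil[OF u(2) box_word_fil[OF u(3) Suc.prems(3)]] u(4) by simp
    have "mul (emb1 Om u) (tw ws a) = tw vs a \<oplus>\<^bsub>tvec Om\<^esub> ?y"
      using u Suc.prems by (simp add: mul_emb1 tword_closed tcons_tword tbox_tword)
    then have "tw vs a = mul (emb1 Om u) (tw ws a) \<ominus>\<^bsub>tvec Om\<^esub> ?y"
      using tword_closed[OF Suc.prems(2,3)] fil_closed[OF y]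
      by (simp add: a_minus_def tvec.a_assoc tvec.r_neg)
    moreover have "mul (emb1 Om u) (tw ws a) \<in> H"
      using u Suc.prems Suc.IH[of ws a] by (intro emb1) (simp_all add: tword_closed)
    moreover have "\<ominus>\<^bsub>tvec Om\<^esub> ?y \<in> H"
      using subgroup.m_inv_closed[OF H fil[OF y]] by (simp add: a_inv_def)
    ultimately show ?case
      using subgroup.m_closed[OF H] by (simp add: a_minus_def)
  qed
  show ?thesis
    using x
  proof (induction rule: tvec_induct)
    case (add X Y)
    then show ?case using subgroup.m_closed[OF H] by simp
  next
    case (minus X)
    then show ?case using subgroup.m_inv_closed[OF H] by (simp add: a_inv_def)
  qed (use word in simp)
qed

end

section \<open>Two-forms\<close>

lemma (in abelian_group) finsum_swap3:
  assumes "finite J" "finite K" "\<And>i j k. \<lbrakk>i \<in> I; j \<in> J; k \<in> K\<rbrakk> \<Longrightarrow> f i j k \<in> carrier G"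
  shows "(\<Oplus>i\<in>I. \<Oplus>j\<in>J. \<Oplus>k\<in>K. f i j k) = (\<Oplus>k\<in>K. \<Oplus>i\<in>I. \<Oplus>j\<in>J. f i j k)"
proof -
  have "(\<Oplus>i\<in>I. \<Oplus>j\<in>J. \<Oplus>k\<in>K. f i j k) = (\<Oplus>i\<in>I. \<Oplus>k\<in>K. \<Oplus>j\<in>J. f i j k)"
    using assms by (intro finsum_cong' finsum_swap) (auto intro!: finsum_closed)
  also have "\<dots> = (\<Oplus>k\<in>K. \<Oplus>i\<in>I. \<Oplus>j\<in>J. f i j k)"
    using assms by (intro finsum_swap) (auto intro!: finsum_closed)
  finally show ?thesis .
qed

context dga
begin

definition products2 :: "'w set" where
  "products2 = generate (add_monoid Om) {\<eta> \<otimes> \<zeta> | \<eta> \<zeta>. \<eta> \<in> piece Om 1 \<and> \<zeta> \<in> piece Om 1}"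

text \<open>A graded piece of the candidate subring in which only degree two has been cut down to
  the span of products. It still contains degrees 0 and 1, which generate, so the candidate is
  everything, and comparing degree two parts identifies \<Omega>^2.\<close>

definition deg_part :: "nat \<Rightarrow> 'w set" where
  "deg_part k = (if k = 2 then products2 else piece Om k)"

lemma products2_subgroup: "subgroup products2 (add_monoid Om)"
  unfolding products2_def by (rule group.generate_is_subgroup[OF a_group]) (auto simp: pieces_closed)

lemma products2_hom:
  assumes "h \<in> add_hom Om Om" "\<And>\<eta> \<zeta>. \<lbrakk>\<eta> \<in> piece Om 1; \<zeta> \<in> piece Om 1\<rbrakk> \<Longrightarrow> h (\<eta> \<otimes> \<zeta>) \<in> products2"
    "\<omega> \<in> products2"
  shows "h \<omega> \<in> products2"
  using assms(3) unfolding products2_def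
  by (elim generate_hom_subset[OF a_group a_group assms(1)[unfolded add_hom_def] _ products2_subgroup[unfolded products2_def], rotated -1])
    (use assms(2)[unfolded products2_def] in \<open>auto simp: pieces_closed\<close>)

lemma deg_part_subgroup: "subgroup (deg_part k) (add_monoid Om)"
  by (simp add: deg_part_def products2_subgroup piece_subgroup)

lemma deg_part_subset: "deg_part k \<subseteq> piece Om k"
proof -
  have "products2 \<subseteq> piece Om 2"
    unfolding products2_def
    by (rule group.generate_subgroup_incl[OF a_group _ piece_subgroup]) (auto simp: piece_mult)
  then show ?thesis by (simp add: deg_part_def)
qed

lemma mult_hom:
  assumes "x \<in> carrier Om"
  shows "(\<lambda>y. x \<otimes> y) \<in> add_hom Om Om" "(\<lambda>y. y \<otimes> x) \<in> add_hom Om Om"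
  using assms by (auto intro!: add_homI simp: l_distr r_distr)

text \<open>Only total degree two needs an argument. There either both factors are one-forms, or a
  scalar is absorbed by the one-form next to it.\<close>

lemma deg_part_mult:
  assumes "x \<in> deg_part k" "y \<in> deg_part l"
  shows "x \<otimes> y \<in> deg_part (k + l)"
proof (cases "k + l = 2")
  case False
  then show ?thesis
    using mult_piece[of x k y l] deg_part_subset assms by (auto simp: deg_part_def)
next
  case True
  have cl: "x \<in> carrier Om" "y \<in> carrier Om"
    using assms deg_part_subset piece_closed by blast+
  consider "k = 1" "l = 1" | "k = 0" "l = 2" | "k = 2" "l = 0" using True by linarith
  then show ?thesis
  proof cases
    case 1
    then show ?thesis
      using assms unfolding deg_part_def products2_def by (auto intro!: generate.incl)
  next
    case 2
    have "x \<otimes> (\<eta> \<otimes> \<zeta>) \<in> products2" if "\<eta> \<in> piece Om 1" "\<zeta> \<in> piece Om 1" for \<eta> \<zeta>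
      using that 2 assms piece_mult(1)[of x \<eta> 1] cl unfolding products2_def
      by (intro generate.incl CollectI exI[of _ "x \<otimes> \<eta>"] exI[of _ \<zeta>])
        (auto simp: m_assoc pieces_closed deg_part_def)
    then show ?thesis
      using 2 assms products2_hom[OF mult_hom(1)[OF cl(1)]] by (simp add: deg_part_def)
  next
    case 3
    have "\<eta> \<otimes> \<zeta> \<otimes> y \<in> products2" if "\<eta> \<in> piece Om 1" "\<zeta> \<in> piece Om 1" for \<eta> \<zeta>
      using that 3 assms piece_mult(2)[of \<zeta> 1 y] cl unfolding products2_def
      by (intro generate.incl CollectI exI[of _ \<eta>] exI[of _ "\<zeta> \<otimes> y"])
        (auto simp: m_assoc pieces_closed deg_part_def)
    then show ?thesis
      using 3 assms products2_hom[OF mult_hom(2)[OF cl(2)]] by (simp add: deg_part_def)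
  qed
qed

text \<open>The span is a subring, because its homogeneous parts multiply into each other, and it
  contains the generating degrees 0 and 1.\<close>

lemma deg_part_span: "generate (add_monoid Om) (\<Union>k. deg_part k) = carrier Om"
proof -
  let ?U = "generate (add_monoid Om) (\<Union>k. deg_part k)"
  have sub: "(\<Union>k. deg_part k) \<subseteq> carrier Om"
    using deg_part_subset piece_closed by blast
  have U: "subgroup ?U (add_monoid Om)"
    by (rule group.generate_is_subgroup[OF a_group]) (use sub in simp)
  have U_closed: "?U \<subseteq> carrier Om" using subgroup.subset[OF U] by simp
  have ext: "h x \<in> ?U" if "h \<in> add_hom Om Om" "\<And>k x. x \<in> deg_part k \<Longrightarrow> h x \<in> ?U" "x \<in> ?U" for h x
    by (rule generate_hom_subset[OF a_group a_group that(1)[unfolded add_hom_def] _ U _ that(3)])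
      (use that(2) sub in auto)
  \<comment> \<open>Products are extended one factor at a time: here the left factor is homogeneous
    and the right one arbitrary, in \<open>mult\<close> both are arbitrary.\<close>
  have step: "x \<otimes> y \<in> ?U" if "x \<in> deg_part k" "y \<in> ?U" for x y k
  proof (rule ext[OF mult_hom(1) _ that(2)])
    show "x \<in> carrier Om" using that(1) sub by blast
    show "x \<otimes> z \<in> ?U" if "z \<in> deg_part l" for l z
      using deg_part_mult[OF \<open>x \<in> deg_part k\<close> that] by (auto intro!: generate.incl)
  qed
  have mult: "x \<otimes> y \<in> ?U" if "x \<in> ?U" "y \<in> ?U" for x y
    by (rule ext[OF mult_hom(2) _ that(1)]) (use that U_closed step in auto)
  have gen: "piece Om 0 \<union> piece Om 1 \<subseteq> ?U"
    by (auto intro!: generate.incl simp: deg_part_def exI[of _ 0] exI[of _ 1])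
  have "subring ?U Om"
  proof (rule subringI[OF U_closed])
    show "\<one> \<in> ?U" using gen one_piece by blast
    show "\<ominus> x \<in> ?U" if "x \<in> ?U" for x
      using subgroup.m_inv_closed[OF U that] by (simp add: a_inv_def)
    show "x \<oplus> y \<in> ?U" if "x \<in> ?U" "y \<in> ?U" for x y
      using subgroup.m_closed[OF U that] by simp
  qed (rule mult)
  then have "carrier Om \<subseteq> ?U"
    using generate_ring_min_subring1[OF _ _ gen] generated gen U_closed by blast
  with U_closed show ?thesis by blast
qed

lemma finsum_extend:
  assumes "\<And>k. f k \<in> carrier Om" "\<And>k. k > N \<Longrightarrow> f k = \<zero>" "N \<le> (M::nat)"
  shows "(\<Oplus>k\<in>{..M}. f k) = (\<Oplus>k\<in>{..N}. f k)"
  by (rule add.finprod_mono_neutral_cong_left[symmetric]) (use assms in auto)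

text \<open>The components are given in all degrees and vanish above N, so that two decompositions
  can be added after passing to the larger of their bounds.\<close>

lemma deg_part_decomposition:
  assumes "x \<in> carrier Om"
  shows "\<exists>N f. (\<forall>k. f k \<in> deg_part k) \<and> (\<forall>k>N. f k = \<zero>) \<and> x = (\<Oplus>k\<in>{..N}. f k)"
proof -
  have zero: "\<zero> \<in> deg_part k" for k
    using subgroup.one_closed[OF deg_part_subgroup] by simp
  have cl: "y \<in> carrier Om" if "y \<in> deg_part k" for y k
    using that deg_part_subset piece_closed by blast
  have single: "\<exists>N f. (\<forall>k. f k \<in> deg_part k) \<and> (\<forall>k>N. f k = \<zero>) \<and> y = (\<Oplus>k\<in>{..N}. f k)"
    if "y \<in> deg_part l" for y l
    using that zero add.finprod_singleton[of l "{..l}" "\<lambda>_. y"] cl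
    by (intro exI[of _ l] exI[of _ "\<lambda>k. if l = k then y else \<zero>"]) auto
  have "x \<in> generate (add_monoid Om) (\<Union>k. deg_part k)"
    using assms deg_part_span by simp
  then show ?thesis
  proof (induction x rule: generate.induct)
    case one
    then show ?case using single[OF zero] by simp
  next
    case (incl h)
    then show ?case using single by blast
  next
    case (inv h)
    then obtain k where "h \<in> deg_part k" by blast
    from subgroup.m_inv_closed[OF deg_part_subgroup this] show ?case using single by blast
  next
    case (eng x y)
    then obtain N f M g where f: "\<forall>k. f k \<in> deg_part k" "\<forall>k>N. f k = \<zero>" "x = (\<Oplus>k\<in>{..N}. f k)"
      and g: "\<forall>k. g k \<in> deg_part k" "\<forall>k>M. g k = \<zero>" "y = (\<Oplus>k\<in>{..M}. g k)" by blast
    let ?N = "max N M"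
    have fg: "f k \<in> carrier Om" "g k \<in> carrier Om" for k
      using f(1) g(1) cl by blast+
    have "x = (\<Oplus>k\<in>{..?N}. f k)" "y = (\<Oplus>k\<in>{..?N}. g k)"
      using f g fg finsum_extend[of f N ?N] finsum_extend[of g M ?N] by simp_all
    then have "x \<oplus> y = (\<Oplus>k\<in>{..?N}. f k \<oplus> g k)"
      using fg by (simp add: finsum_addf)
    moreover have "f k \<oplus> g k \<in> deg_part k" for k
      using subgroup.m_closed[OF deg_part_subgroup, of "f k" k "g k"] f g by simp
    ultimately show ?case
      using f g by (intro exI[of _ ?N] exI[of _ "\<lambda>k. f k \<oplus> g k"]) auto
  qed
qed

text \<open>A two-form has a decomposition with components in \<open>deg_part\<close>, and also the
  one concentrated in degree two. Their difference decomposes zero, so independence of the pieces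
  equates the components of degree two.\<close>

lemma piece2_products: "piece Om 2 = products2"
proof
  show "piece Om 2 \<subseteq> products2"
  proof
    fix \<omega> assume \<omega>: "\<omega> \<in> piece Om 2"
    then obtain N f where f: "\<forall>k. f k \<in> deg_part k" "\<forall>k>N. f k = \<zero>" "\<omega> = (\<Oplus>k\<in>{..N}. f k)"
      using deg_part_decomposition[of \<omega>] pieces_closed by blast
    have fp: "f k \<in> piece Om k" for k using f(1) deg_part_subset by blast
    \<comment> \<open>The maximum ensures that degree two lies in the range of summation even if N
      is smaller.\<close>
    let ?M = "max N 2"
    let ?d = "\<lambda>k. if 2 = k then \<omega> else \<zero>"
    have d: "?d k \<in> piece Om k" for k using \<omega> piece_zero by auto
    have eq: "\<omega> = (\<Oplus>k\<in>{..?M}. f k)"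
      using f piece_closed[OF fp] finsum_extend[of f N ?M] by simp
    have "(\<Oplus>k\<in>{..?M}. f k \<ominus> ?d k) = (\<Oplus>k\<in>{..?M}. f k) \<ominus> (\<Oplus>k\<in>{..?M}. ?d k)"
      using fp d piece_closed by (intro finsum_minus) blast+
    also have "(\<Oplus>k\<in>{..?M}. ?d k) = \<omega>"
      using add.finprod_singleton[of 2 "{..?M}" "\<lambda>_. \<omega>"] \<omega> pieces_closed by simp
    finally have "(\<Oplus>k\<in>{..?M}. f k \<ominus> ?d k) = \<zero>"
      using eq \<omega> pieces_closed by (simp add: a_minus_def r_neg)
    moreover have "(\<lambda>k. f k \<ominus> ?d k) \<in> Pi {..?M} (piece Om)"
      using fp d piece_add piece_neg by (auto simp: a_minus_def)
    ultimately have "f 2 \<ominus> ?d 2 = \<zero>"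
      using piece_indep[of "\<lambda>k. f k \<ominus> ?d k" ?M 2] by simp
    then have "\<omega> = f 2"
      using fp[of 2] \<omega> pieces_closed by (simp add: minus_eq_zero_iff)
    then show "\<omega> \<in> products2" using f(1)[rule_format, of 2] by (simp add: deg_part_def)
  qed
  show "products2 \<subseteq> piece Om 2" using deg_part_subset[of 2] by (simp add: deg_part_def)
qed

lemma piece2_induct [consumes 1, case_names prod add minus]:
  assumes "\<omega> \<in> piece Om 2"
    and "\<And>\<eta> \<zeta>. \<lbrakk>\<eta> \<in> piece Om 1; \<zeta> \<in> piece Om 1\<rbrakk> \<Longrightarrow> P (\<eta> \<otimes> \<zeta>)"
    and add: "\<And>x y. \<lbrakk>x \<in> piece Om 2; y \<in> piece Om 2; P x; P y\<rbrakk> \<Longrightarrow> P (x \<oplus> y)"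
    and minus: "\<And>x. \<lbrakk>x \<in> piece Om 2; P x\<rbrakk> \<Longrightarrow> P (\<ominus> x)"
  shows "P \<omega>"
proof -
  \<comment> \<open>The zero form is covered by the product case, since 0 is also a
    one-form.\<close>
  have z: "P (\<zero> \<otimes> \<zero>)" by (rule assms(2)[OF piece_zero piece_zero])
  have "\<omega> \<in> generate (add_monoid Om) {\<eta> \<otimes> \<zeta> | \<eta> \<zeta>. \<eta> \<in> piece Om 1 \<and> \<zeta> \<in> piece Om 1}"
    using assms(1) by (simp add: piece2_products products2_def)
  then have "\<omega> \<in> piece Om 2 \<and> P \<omega>"
  proof (induction rule: generate.induct)
    case one
    then show ?case using z piece_zero by simp
  next
    case (incl h)
    then show ?case using assms(2) by (auto simp: piece_mult)
  next
    case (inv h)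
    then have "h \<in> piece Om 2" "P h" using assms(2) by (auto simp: piece_mult)
    then show ?case using minus[of h] piece_neg[of h 2] by (simp add: a_inv_def)
  next
    case (eng h1 h2)
    then show ?case using add by (simp add: piece_add)
  qed
  then show ?thesis by simp
qed

section \<open>Dual bases of finitely generated projective modules of forms\<close>

lemma abelian_group_free: "abelian_group (free_bimod (base Om) n)"
proof -
  let ?L = "free_bimod (base Om) n"
  have cl: "x i \<in> piece Om 0" "x i \<in> carrier Om" if "x \<in> carrier ?L" "i < n" for x i
    using PiE_mem[of x "{..<n}" "\<lambda>_. piece Om 0" i] that pieces_closed by (simp_all add: free_bimod_def)
  have ext: "x = y" if "x \<in> carrier ?L" "y \<in> carrier ?L" "\<And>i. i < n \<Longrightarrow> x i = y i" for x y
    using that PiE_ext[of x "{..<n}" "\<lambda>_. piece Om 0" y] by (simp add: free_bimod_def)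
  have mk: "(\<lambda>i\<in>{..<n}. f i) \<in> carrier ?L" if "\<And>i. i < n \<Longrightarrow> f i \<in> piece Om 0" for f
    using that by (simp add: free_bimod_def)
  have app: "(x \<oplus>\<^bsub>?L\<^esub> y) i = x i \<oplus> y i" "\<zero>\<^bsub>?L\<^esub> i = \<zero>" if "i < n" for x y i
    using that by (simp_all add: free_bimod_def)
  have add: "x \<oplus>\<^bsub>?L\<^esub> y \<in> carrier ?L" if "x \<in> carrier ?L" "y \<in> carrier ?L" for x y
    using mk[of "\<lambda>i. x i \<oplus> y i"] cl[OF that(1)] cl[OF that(2)] by (simp add: free_bimod_def piece_add)
  have zero: "\<zero>\<^bsub>?L\<^esub> \<in> carrier ?L"
    using mk[of "\<lambda>_. \<zero>"] piece_zero by (simp add: free_bimod_def)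
  show ?thesis
  proof (rule abelian_groupI)
    fix x assume x: "x \<in> carrier ?L"
    let ?y = "\<lambda>i\<in>{..<n}. \<ominus> x i"
    have y: "?y \<in> carrier ?L" by (rule mk) (simp add: cl[OF x] piece_neg)
    have "?y \<oplus>\<^bsub>?L\<^esub> x = \<zero>\<^bsub>?L\<^esub>"
      by (rule ext[OF add[OF y x] zero]) (simp add: app cl[OF x] l_neg)
    with y show "\<exists>y\<in>carrier ?L. y \<oplus>\<^bsub>?L\<^esub> x = \<zero>\<^bsub>?L\<^esub>" by blast
    show "\<zero>\<^bsub>?L\<^esub> \<oplus>\<^bsub>?L\<^esub> x = x"
      by (rule ext[OF add[OF zero x] x]) (simp add: app cl[OF x])
  next
    fix x y assume xy: "x \<in> carrier ?L" "y \<in> carrier ?L"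
    show "x \<oplus>\<^bsub>?L\<^esub> y = y \<oplus>\<^bsub>?L\<^esub> x"
      by (rule ext[OF add[OF xy] add[OF xy(2,1)]]) (simp add: app cl[OF xy(1)] cl[OF xy(2)] a_comm)
  next
    fix x y z assume xyz: "x \<in> carrier ?L" "y \<in> carrier ?L" "z \<in> carrier ?L"
    show "x \<oplus>\<^bsub>?L\<^esub> y \<oplus>\<^bsub>?L\<^esub> z = x \<oplus>\<^bsub>?L\<^esub> (y \<oplus>\<^bsub>?L\<^esub> z)"
      by (rule ext[OF add[OF add[OF xyz(1,2)] xyz(3)] add[OF xyz(1) add[OF xyz(2,3)]]])
        (simp add: app cl[OF xyz(1)] cl[OF xyz(2)] cl[OF xyz(3)] a_assoc)
  qed (auto intro: add zero)
qed

text \<open>For a retraction p of j on A^n, the dual basis consists of the images of the standard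
  vectors under p and the coordinates of j, the latter restricted to the carrier because elements of
  \<open>rhom\<close> are extensional.\<close>

lemma fgp_dual_basis:
  assumes "right_fgp (base Om) (forms Om k)"
  obtains n :: nat and e \<beta> where "\<And>m. m < n \<Longrightarrow> e m \<in> piece Om k"
    "\<And>m. m < n \<Longrightarrow> \<beta> m \<in> carrier (rhom (base Om) (forms Om k) (forms Om 0))"
    "\<And>\<omega>. \<omega> \<in> piece Om k \<Longrightarrow> \<omega> = (\<Oplus>m\<in>{..<n}. e m \<otimes> \<beta> m \<omega>)"
proof -
  obtain n j p where j: "j \<in> carrier (rhom (base Om) (forms Om k) (free_bimod (base Om) n))"
    and p: "p \<in> carrier (rhom (base Om) (free_bimod (base Om) n) (forms Om k))"
    and pj: "\<And>\<omega>. \<omega> \<in> piece Om k \<Longrightarrow> p (j \<omega>) = \<omega>"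
    using assms unfolding right_fgp_def by auto
  let ?L = "free_bimod (base Om) n"
  interpret L: abelian_group ?L by (rule abelian_group_free)
  interpret p: additive_map ?L "forms Om k" p
    by unfold_locales (rule rhom_carrierD(1)[OF p])
  define \<delta> where "\<delta> m = (\<lambda>i\<in>{..<n}. if i = m then \<one> else \<zero>)" for m
  have \<delta>: "\<delta> m \<in> carrier ?L" for m
    by (auto simp: \<delta>_def free_bimod_def one_piece piece_zero)
  have jcl: "j \<omega> \<in> carrier ?L" if "\<omega> \<in> piece Om k" for \<omega>
    using add_hom_closed[OF rhom_carrierD(1)[OF j]] that by simp
  have jm: "j \<omega> m \<in> piece Om 0" if "\<omega> \<in> piece Om k" "m < n" for \<omega> m
    using jcl[OF that(1)] that(2) by (auto simp: free_bimod_def)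
  let ?\<beta> = "\<lambda>m. restrict (\<lambda>\<omega>. j \<omega> m) (carrier (forms Om k))"
  have \<delta>r: "ract ?L (\<delta> m) a \<in> carrier ?L" if "a \<in> piece Om 0" for m a
  proof -
    have "(if i = m then \<one> else \<zero>) \<otimes> a \<in> piece Om 0" for i
      using that by (intro piece_mult) (auto simp: one_piece piece_zero)
    then show ?thesis by (simp add: free_bimod_def \<delta>_def)
  qed
  show thesis
  proof (rule that[of n "\<lambda>m. p (\<delta> m)" ?\<beta>])
    show "p (\<delta> m) \<in> piece Om k" if "m < n" for m using p.hom_closed[OF \<delta>] by simp
    show "?\<beta> m \<in> carrier (rhom (base Om) (forms Om k) (forms Om 0))" if "m < n" for m
    proof (rule rhomI[OF bimodule_forms])
      show "(\<lambda>\<omega>. j \<omega> m) \<in> add_hom (forms Om k) (forms Om 0)"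
        using that jm add_hom_add[OF rhom_carrierD(1)[OF j]]
        by (intro add_homI) (simp_all add: free_bimod_def)
      show "j (ract (forms Om k) \<omega> a) m = ract (forms Om 0) (j \<omega> m) a"
        if "a \<in> carrier (base Om)" "\<omega> \<in> carrier (forms Om k)" for a \<omega>
        using rhom_carrierD(3)[OF j that] \<open>m < n\<close> by (simp add: free_bimod_def)
    qed
    fix \<omega> assume \<omega>: "\<omega> \<in> piece Om k"
    have sum: "(\<Oplus>\<^bsub>?L\<^esub>m\<in>{..<n}. ract ?L (\<delta> m) (j \<omega> m)) \<in> carrier ?L"
      using \<delta>r jm[OF \<omega>] by (auto intro!: L.finsum_closed)
    have "j \<omega> = (\<Oplus>\<^bsub>?L\<^esub>m\<in>{..<n}. ract ?L (\<delta> m) (j \<omega> m))"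
    proof (rule PiE_ext)
      show "j \<omega> \<in> {..<n} \<rightarrow>\<^sub>E piece Om 0" using jcl[OF \<omega>] by (simp add: free_bimod_def)
      show "(\<Oplus>\<^bsub>?L\<^esub>m\<in>{..<n}. ract ?L (\<delta> m) (j \<omega> m)) \<in> {..<n} \<rightarrow>\<^sub>E piece Om 0"
        using sum by (simp add: free_bimod_def)
      fix i assume i: "i \<in> {..<n}"
      interpret q: additive_map ?L "forms Om 0" "\<lambda>x. x i"
        by unfold_locales (use i in \<open>auto intro!: add_homI simp: free_bimod_def\<close>)
      have "(\<Oplus>\<^bsub>?L\<^esub>m\<in>{..<n}. ract ?L (\<delta> m) (j \<omega> m)) i =
          (\<Oplus>\<^bsub>forms Om 0\<^esub>m\<in>{..<n}. if i = m then j \<omega> m else \<zero>)"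
        using i \<delta>r jm[OF \<omega>] pieces_closed
        by (intro q.map_finsum_eq) (auto simp: free_bimod_def \<delta>_def)
      also have "\<dots> = j \<omega> i"
        using forms.M.add.finprod_singleton[of i "{..<n}" "j \<omega>" 0, unfolded forms_simps] i jm[OF \<omega>] by auto
      finally show "j \<omega> i = (\<Oplus>\<^bsub>?L\<^esub>m\<in>{..<n}. ract ?L (\<delta> m) (j \<omega> m)) i" ..
    qed
    then have "\<omega> = p (\<Oplus>\<^bsub>?L\<^esub>m\<in>{..<n}. ract ?L (\<delta> m) (j \<omega> m))" using pj[OF \<omega>] by simp
    also have "\<dots> = (\<Oplus>\<^bsub>forms Om k\<^esub>m\<in>{..<n}. p (\<delta> m) \<otimes> ?\<beta> m \<omega>)"
      using \<delta>r jm[OF \<omega>] rhom_carrierD(3)[OF p _ \<delta>] \<omega> by (intro p.map_finsum_eq) simp_all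
    also have "\<dots> = (\<Oplus>m\<in>{..<n}. p (\<delta> m) \<otimes> ?\<beta> m \<omega>)"
      using p.hom_closed[OF \<delta>] jm[OF \<omega>] \<omega> by (intro finsum_forms) (simp add: piece_mult)
    finally show "\<omega> = (\<Oplus>m\<in>{..<n}. p (\<delta> m) \<otimes> ?\<beta> m \<omega>)" .
  qed
qed

end

section \<open>Flat bimodule connections\<close>

locale flat_connection = flat_bimod Om E
  for Om :: "('w, 'b) calculus_scheme" (structure) and E :: "('w, 'e, 'y) cbimod_scheme"
begin

lemmas E_lact = lact_closed[simplified] and E_ract = ract_closed[simplified]
  and E_lact_hom = lact_hom[simplified] and E_ract_hom = ract_hom[simplified]
  and E_lact_ract = lact_ract[simplified] and E_mult_lact = mult_lact[simplified]

lemma bimodule_E: "bimodule (base Om) E"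
  by (rule bimodule_axioms)

sublocale fe: tensor_pair "base Om" "forms Om k" E for k
  by (rule tensor_pair_bimodules[OF bimodule_forms bimodule_E])

sublocale ef: tensor_pair "base Om" E "forms Om k" for k
  by (rule tensor_pair_bimodules[OF bimodule_E bimodule_forms])

abbreviation "FE k \<equiv> otens Om (forms Om k) E"
abbreviation "EF k \<equiv> otens Om E (forms Om k)"

lemma FE_actions:
  assumes "a \<in> piece Om 0"
  shows lact_FE_hom: "lact (FE k) a \<in> add_hom (FE k) (FE k)"
    and lact_FE_stens: "\<lbrakk>\<eta> \<in> piece Om k; e \<in> carrier E\<rbrakk> \<Longrightarrow>
      lact (FE k) a (ostens Om (forms Om k) E \<eta> e) = ostens Om (forms Om k) E (a \<otimes> \<eta>) e"
    and ract_FE_hom: "(\<lambda>X. ract (FE k) X a) \<in> add_hom (FE k) (FE k)"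
    and ract_FE_stens: "\<lbrakk>\<eta> \<in> piece Om k; e \<in> carrier E\<rbrakk> \<Longrightarrow>
      ract (FE k) (ostens Om (forms Om k) E \<eta> e) a = ostens Om (forms Om k) E \<eta> (ract E e a)"
proof -
  have 1: "(\<lambda>m. lact (forms Om k) a m) \<in> add_hom (forms Om k) (forms Om k)"
    using forms.lact_hom[of a k] assms by simp
  have 2: "lact (forms Om k) a (ract (forms Om k) m b) = ract (forms Om k) (lact (forms Om k) a m) b"
    if "m \<in> carrier (forms Om k)" "b \<in> carrier (base Om)" for m b
    using that assms forms.lact_ract[of a b m k] by simp
  have 3: "(\<lambda>m. ract E m a) \<in> add_hom E E" using E_ract_hom[OF assms] .
  have 4: "ract E (lact E b m) a = lact E b (ract E m a)" if "m \<in> carrier E" "b \<in> carrier (base Om)" for m b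
    using that assms by (simp add: E_lact_ract)
  show "lact (FE k) a \<in> add_hom (FE k) (FE k)"
    by (rule fe.tens_lact_hom[OF 1 2])
  show "\<lbrakk>\<eta> \<in> piece Om k; e \<in> carrier E\<rbrakk> \<Longrightarrow>
      lact (FE k) a (ostens Om (forms Om k) E \<eta> e) = ostens Om (forms Om k) E (a \<otimes> \<eta>) e"
    using fe.tens_lact_stens[OF 1 2, where m = \<eta> and n = e] by simp
  show "(\<lambda>X. ract (FE k) X a) \<in> add_hom (FE k) (FE k)"
    by (rule fe.tens_ract_hom[OF 3 4])
  show "\<lbrakk>\<eta> \<in> piece Om k; e \<in> carrier E\<rbrakk> \<Longrightarrow>
      ract (FE k) (ostens Om (forms Om k) E \<eta> e) a = ostens Om (forms Om k) E \<eta> (ract E e a)"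
    using fe.tens_ract_stens[OF 3 4, where m = \<eta> and n = e] by simp
qed

lemma EF_actions:
  assumes "a \<in> piece Om 0"
  shows lact_EF_stens: "\<lbrakk>e \<in> carrier E; \<eta> \<in> piece Om k\<rbrakk> \<Longrightarrow>
      lact (EF k) a (ostens Om E (forms Om k) e \<eta>) = ostens Om E (forms Om k) (lact E a e) \<eta>"
    and ract_EF_stens: "\<lbrakk>e \<in> carrier E; \<eta> \<in> piece Om k\<rbrakk> \<Longrightarrow>
      ract (EF k) (ostens Om E (forms Om k) e \<eta>) a = ostens Om E (forms Om k) e (\<eta> \<otimes> a)"
proof -
  have 1: "(\<lambda>m. lact E a m) \<in> add_hom E E" using E_lact_hom[OF assms] .
  have 2: "lact E a (ract E m b) = ract E (lact E a m) b" if "m \<in> carrier E" "b \<in> carrier (base Om)" for m b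
    using that assms by (simp add: E_lact_ract)
  have 3: "(\<lambda>m. ract (forms Om k) m a) \<in> add_hom (forms Om k) (forms Om k)"
    using forms.ract_hom[of a k] assms by simp
  have 4: "ract (forms Om k) (lact (forms Om k) b m) a = lact (forms Om k) b (ract (forms Om k) m a)"
    if "m \<in> carrier (forms Om k)" "b \<in> carrier (base Om)" for m b
    using that assms forms.lact_ract[of b a m k] by simp
  show "\<lbrakk>e \<in> carrier E; \<eta> \<in> piece Om k\<rbrakk> \<Longrightarrow>
      lact (EF k) a (ostens Om E (forms Om k) e \<eta>) = ostens Om E (forms Om k) (lact E a e) \<eta>"
    using ef.tens_lact_stens[OF 1 2, where m = e and n = \<eta>] by simp
  show "\<lbrakk>e \<in> carrier E; \<eta> \<in> piece Om k\<rbrakk> \<Longrightarrow>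
      ract (EF k) (ostens Om E (forms Om k) e \<eta>) a = ostens Om E (forms Om k) e (\<eta> \<otimes> a)"
    using ef.tens_ract_stens[OF 3 4, where m = e and n = \<eta>] by simp
qed

section \<open>The braiding and the wedge product with values in E\<close>

definition sigt :: "'e \<Rightarrow> 'w \<Rightarrow> ('w \<times> 'e) frag set" where
  "sigt e \<eta> = sig E (ostens Om E (forms Om 1) e \<eta>)"

lemma sig_add_hom: "sig E \<in> add_hom (EF 1) (FE 1)"
  using sig_hom by (simp add: bimod_hom_def)

lemma sigt_hom1: "\<eta> \<in> piece Om 1 \<Longrightarrow> (\<lambda>e. sigt e \<eta>) \<in> add_hom E (FE 1)"
  unfolding sigt_def by (rule add_hom_compose[OF ef.stens_hom_left sig_add_hom]) simp

lemma sigt_hom2: "e \<in> carrier E \<Longrightarrow> sigt e \<in> add_hom (forms Om 1) (FE 1)"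
  unfolding sigt_def[abs_def] by (rule add_hom_compose[OF ef.stens_hom_right sig_add_hom])

lemma sigt_closed: "\<lbrakk>e \<in> carrier E; \<eta> \<in> piece Om 1\<rbrakk> \<Longrightarrow> sigt e \<eta> \<in> carrier (FE 1)"
  using add_hom_closed[OF sigt_hom1] .

lemma sigt_actions:
  assumes "e \<in> carrier E" "\<eta> \<in> piece Om 1" "a \<in> piece Om 0"
  shows sigt_lact: "sigt (lact E a e) \<eta> = lact (FE 1) a (sigt e \<eta>)"
    and sigt_ract: "sigt e (\<eta> \<otimes> a) = ract (FE 1) (sigt e \<eta>) a"
    and sigt_balanced: "sigt (ract E e a) \<eta> = sigt e (a \<otimes> \<eta>)"
  using assms sig_hom ef.stens_balanced[of e a \<eta> 1] ef.stens_closed[of e \<eta> 1]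
  by (simp_all add: sigt_def lact_EF_stens[symmetric] ract_EF_stens[symmetric] bimod_hom_def)

lemma nab_closed: "e \<in> carrier E \<Longrightarrow> nab E e \<in> carrier (FE 1)"
  by (rule add_hom_closed[OF nab_hom])

lemma nab_ract_sigt: "\<lbrakk>a \<in> piece Om 0; e \<in> carrier E\<rbrakk> \<Longrightarrow>
    nab E (ract E e a) = ract (FE 1) (nab E e) a \<oplus>\<^bsub>FE 1\<^esub> sigt e (dif Om a)"
  by (simp add: nab_ract sigt_def)

lemma wedge_left_props:
  assumes \<eta>: "\<eta> \<in> piece Om 1"
  shows wedge_left_hom: "wedge_left Om E \<eta> \<in> add_hom (FE 1) (FE 2)"
    and wedge_left_stens: "\<lbrakk>\<zeta> \<in> piece Om 1; e \<in> carrier E\<rbrakk> \<Longrightarrow>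
      wedge_left Om E \<eta> (ostens Om (forms Om 1) E \<zeta> e) = ostens Om (forms Om 2) E (\<eta> \<otimes> \<zeta>) e"
proof -
  have "balanced_map (base Om) (forms Om 1) E (FE 2) (\<lambda>\<zeta> e. ostens Om (forms Om 2) E (\<eta> \<otimes> \<zeta>) e)"
  proof (rule balanced_mapI)
    fix e assume e: "e \<in> carrier E"
    have "(\<lambda>\<zeta>. \<eta> \<otimes> \<zeta>) \<in> add_hom (forms Om 1) (forms Om 2)"
      using \<eta> by (intro add_homI) (simp_all add: piece_mult r_distr pieces_closed)
    from add_hom_compose[OF this fe.stens_hom_left[OF e]]
    show "(\<lambda>\<zeta>. ostens Om (forms Om 2) E (\<eta> \<otimes> \<zeta>) e) \<in> add_hom (forms Om 1) (FE 2)" .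
  next
    fix \<zeta> a e assume "\<zeta> \<in> carrier (forms Om 1)" "a \<in> carrier (base Om)" "e \<in> carrier E"
    then show "ostens Om (forms Om 2) E (\<eta> \<otimes> ract (forms Om 1) \<zeta> a) e =
        ostens Om (forms Om 2) E (\<eta> \<otimes> \<zeta>) (lact E a e)"
      using \<eta> fe.stens_balanced[of "\<eta> \<otimes> \<zeta>" 2 a e] by (simp add: m_assoc pieces_closed piece_mult)
  qed (use \<eta> in \<open>simp add: fe.stens_hom_right piece_mult\<close>)
  note * = fe.tlift_props[OF fe.T.abelian_group_axioms this]
  show "wedge_left Om E \<eta> \<in> add_hom (FE 1) (FE 2)"
    using *(1) by (simp add: wedge_left_def)
  show "\<lbrakk>\<zeta> \<in> piece Om 1; e \<in> carrier E\<rbrakk> \<Longrightarrow>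
      wedge_left Om E \<eta> (ostens Om (forms Om 1) E \<zeta> e) = ostens Om (forms Om 2) E (\<eta> \<otimes> \<zeta>) e"
    using *(2) by (simp add: wedge_left_def)
qed

lemma wedge_left_closed: "\<lbrakk>\<eta> \<in> piece Om 1; Y \<in> carrier (FE 1)\<rbrakk> \<Longrightarrow> wedge_left Om E \<eta> Y \<in> carrier (FE 2)"
  by (rule add_hom_closed[OF wedge_left_hom])

lemma wedge_left_add:
  assumes "\<eta> \<in> piece Om 1" "\<zeta> \<in> piece Om 1" "Y \<in> carrier (FE 1)"
  shows "wedge_left Om E (\<eta> \<oplus> \<zeta>) Y = wedge_left Om E \<eta> Y \<oplus>\<^bsub>FE 2\<^esub> wedge_left Om E \<zeta> Y"
proof (rule fe.tens_hom_eqI[OF assms(3) fe.T.abelian_group_axioms])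
  show "(\<lambda>Y. wedge_left Om E \<eta> Y \<oplus>\<^bsub>FE 2\<^esub> wedge_left Om E \<zeta> Y) \<in> add_hom (FE 1) (FE 2)"
    by (intro fe.T.add_hom_add_pointwise wedge_left_hom assms)
  fix \<chi> e assume "\<chi> \<in> carrier (forms Om 1)" "e \<in> carrier E"
  then show "wedge_left Om E (\<eta> \<oplus> \<zeta>) (ostens Om (forms Om 1) E \<chi> e) =
      wedge_left Om E \<eta> (ostens Om (forms Om 1) E \<chi> e) \<oplus>\<^bsub>FE 2\<^esub> wedge_left Om E \<zeta> (ostens Om (forms Om 1) E \<chi> e)"
    using assms fe.stens_add_left[of "\<eta> \<otimes> \<chi>" 2 "\<zeta> \<otimes> \<chi>" e]
    by (simp add: wedge_left_stens piece_add l_distr pieces_closed piece_mult)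
qed (simp add: wedge_left_hom piece_add assms)

lemma wedge_left_lact:
  assumes "\<eta> \<in> piece Om 1" "a \<in> piece Om 0" "Y \<in> carrier (FE 1)"
  shows "wedge_left Om E \<eta> (lact (FE 1) a Y) = wedge_left Om E (\<eta> \<otimes> a) Y"
proof (rule fe.tens_hom_eqI[OF assms(3) fe.T.abelian_group_axioms])
  show "(\<lambda>Y. wedge_left Om E \<eta> (lact (FE 1) a Y)) \<in> add_hom (FE 1) (FE 2)"
    by (rule add_hom_compose[OF lact_FE_hom[OF assms(2)] wedge_left_hom[OF assms(1)]])
qed (use assms in \<open>simp_all add: wedge_left_hom wedge_left_stens piece_mult lact_FE_stens m_assoc pieces_closed\<close>)

lemma wedge_left_ract:
  assumes "\<eta> \<in> piece Om 1" "a \<in> piece Om 0" "Y \<in> carrier (FE 1)"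
  shows "wedge_left Om E \<eta> (ract (FE 1) Y a) = ract (FE 2) (wedge_left Om E \<eta> Y) a"
proof (rule fe.tens_hom_eqI[OF assms(3) fe.T.abelian_group_axioms])
  show "(\<lambda>Y. wedge_left Om E \<eta> (ract (FE 1) Y a)) \<in> add_hom (FE 1) (FE 2)"
    by (rule add_hom_compose[OF ract_FE_hom[OF assms(2)] wedge_left_hom[OF assms(1)]])
  show "(\<lambda>Y. ract (FE 2) (wedge_left Om E \<eta> Y) a) \<in> add_hom (FE 1) (FE 2)"
    by (rule add_hom_compose[OF wedge_left_hom[OF assms(1)] ract_FE_hom[OF assms(2)]])
qed (use assms in \<open>simp add: wedge_left_stens piece_mult ract_FE_stens E_ract\<close>)

text \<open>$(\mathrm d \otimes \mathrm{id} - \mathrm{id} \wedge \nabla_E)$ and $Y \mapsto (\mathrm{id} \wedge \sigma_E)(Y \otimes \zeta)$ on $\Omega^1 \otimes_A E$.\<close>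

definition dnab :: "('w \<times> 'e) frag set \<Rightarrow> ('w \<times> 'e) frag set" where
  "dnab = tlift (FE 2) (\<lambda>(\<eta>, f). ostens Om (forms Om 2) E (dif Om \<eta>) f \<ominus>\<^bsub>FE 2\<^esub> wedge_left Om E \<eta> (nab E f))"

definition wsig :: "'w \<Rightarrow> ('w \<times> 'e) frag set \<Rightarrow> ('w \<times> 'e) frag set" where
  "wsig \<zeta> = tlift (FE 2) (\<lambda>(\<chi>, f). wedge_left Om E \<chi> (sigt f \<zeta>))"

lemma curvature_eq: "curvature Om E e = dnab (nab E e)"
  by (simp add: curvature_def dnab_def)

lemma stens2_closed: "\<lbrakk>\<omega> \<in> piece Om 2; f \<in> carrier E\<rbrakk> \<Longrightarrow> ostens Om (forms Om 2) E \<omega> f \<in> carrier (FE 2)"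
  by (rule fe.stens_closed) simp_all

lemma stens1_closed: "\<lbrakk>\<eta> \<in> piece Om 1; f \<in> carrier E\<rbrakk> \<Longrightarrow> ostens Om (forms Om 1) E \<eta> f \<in> carrier (FE 1)"
  by (rule fe.stens_closed) simp_all

lemma dif_forms12: "(\<lambda>\<eta>. dif Om \<eta>) \<in> add_hom (forms Om 1) (forms Om 2)"
  using dif_forms[of 1] by (simp add: numeral_2_eq_2 One_nat_def)

lemma wedge_left_hom_left: "Y \<in> carrier (FE 1) \<Longrightarrow> (\<lambda>\<eta>. wedge_left Om E \<eta> Y) \<in> add_hom (forms Om 1) (FE 2)"
  by (intro add_homI) (simp_all add: wedge_left_closed wedge_left_add)

text \<open>Neither summand is balanced alone. The term \<eta> \<and> da \<otimes> f from d(\<eta>a)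
  matches the one from \<nabla>_E(af), with the same sign in both expressions.\<close>

lemma dnab_props:
  shows dnab_hom: "dnab \<in> add_hom (FE 1) (FE 2)"
    and dnab_stens: "\<lbrakk>\<eta> \<in> piece Om 1; f \<in> carrier E\<rbrakk> \<Longrightarrow> dnab (ostens Om (forms Om 1) E \<eta> f) =
      ostens Om (forms Om 2) E (dif Om \<eta>) f \<ominus>\<^bsub>FE 2\<^esub> wedge_left Om E \<eta> (nab E f)"
proof -
  have "balanced_map (base Om) (forms Om 1) E (FE 2)
      (\<lambda>\<eta> f. ostens Om (forms Om 2) E (dif Om \<eta>) f \<ominus>\<^bsub>FE 2\<^esub> wedge_left Om E \<eta> (nab E f))"
  proof (rule balanced_mapI)
    fix f assume f: "f \<in> carrier E"
    show "(\<lambda>\<eta>. ostens Om (forms Om 2) E (dif Om \<eta>) f \<ominus>\<^bsub>FE 2\<^esub> wedge_left Om E \<eta> (nab E f)) \<in> add_hom (forms Om 1) (FE 2)"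
      by (rule fe.T.add_hom_diff[OF add_hom_compose[OF dif_forms12 fe.stens_hom_left[OF f]]
            wedge_left_hom_left[OF nab_closed[OF f]]])
  next
    fix \<eta> assume "\<eta> \<in> carrier (forms Om 1)"
    then have \<eta>: "\<eta> \<in> piece Om 1" by simp
    show "(\<lambda>f. ostens Om (forms Om 2) E (dif Om \<eta>) f \<ominus>\<^bsub>FE 2\<^esub> wedge_left Om E \<eta> (nab E f)) \<in> add_hom E (FE 2)"
      by (rule fe.T.add_hom_diff[OF fe.stens_hom_right add_hom_compose[OF nab_hom wedge_left_hom[OF \<eta>]]])
        (simp add: \<eta> piece_dif)
  next
    fix \<eta> a f assume "\<eta> \<in> carrier (forms Om 1)" "a \<in> carrier (base Om)" and f: "f \<in> carrier E"
    then have \<eta>: "\<eta> \<in> piece Om 1" and a: "a \<in> piece Om 0" by simp_all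
    have "ostens Om (forms Om 2) E (dif Om (\<eta> \<otimes> a)) f =
        ostens Om (forms Om 2) E (dif Om \<eta> \<otimes> a) f \<ominus>\<^bsub>FE 2\<^esub> ostens Om (forms Om 2) E (\<eta> \<otimes> dif Om a) f"
    proof -
      interpret h: additive_map "forms Om 2" "FE 2" "\<lambda>\<omega>. ostens Om (forms Om 2) E \<omega> f"
        by unfold_locales (rule fe.stens_hom_left[OF f])
      show ?thesis
        using h.map_minus[of "dif Om \<eta> \<otimes> a" "\<eta> \<otimes> dif Om a"] \<eta> a
        by (simp add: dif_mult1 pieces_closed piece_mult piece_dif a_minus_forms)
    qed
    moreover have "ostens Om (forms Om 2) E (dif Om \<eta> \<otimes> a) f = ostens Om (forms Om 2) E (dif Om \<eta>) (lact E a f)"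
      using fe.stens_balanced[of "dif Om \<eta>" 2 a f] \<eta> a f by (simp add: piece_dif)
    moreover have "wedge_left Om E \<eta> (nab E (lact E a f)) =
        ostens Om (forms Om 2) E (\<eta> \<otimes> dif Om a) f \<oplus>\<^bsub>FE 2\<^esub> wedge_left Om E (\<eta> \<otimes> a) (nab E f)"
      using \<eta> a f add_hom_add[OF wedge_left_hom[OF \<eta>]] add_hom_closed[OF lact_FE_hom[OF a]]
      by (simp add: nab_lact wedge_left_stens wedge_left_lact nab_closed stens1_closed piece_dif)
    ultimately show "ostens Om (forms Om 2) E (dif Om (ract (forms Om 1) \<eta> a)) f \<ominus>\<^bsub>FE 2\<^esub>
        wedge_left Om E (ract (forms Om 1) \<eta> a) (nab E f) =
        ostens Om (forms Om 2) E (dif Om \<eta>) (lact E a f) \<ominus>\<^bsub>FE 2\<^esub> wedge_left Om E \<eta> (nab E (lact E a f))"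
      using \<eta> a f
      by (simp add: a_minus_def fe.T.minus_add fe.T.a_assoc stens2_closed piece_mult piece_dif E_lact
          wedge_left_closed nab_closed)
  qed
  note * = fe.tlift_props[OF fe.T.abelian_group_axioms this]
  show "dnab \<in> add_hom (FE 1) (FE 2)"
    using *(1) by (simp add: dnab_def)
  show "\<lbrakk>\<eta> \<in> piece Om 1; f \<in> carrier E\<rbrakk> \<Longrightarrow> dnab (ostens Om (forms Om 1) E \<eta> f) =
      ostens Om (forms Om 2) E (dif Om \<eta>) f \<ominus>\<^bsub>FE 2\<^esub> wedge_left Om E \<eta> (nab E f)"
    using *(2) by (simp add: dnab_def)
qed

lemma wsig_props:
  assumes \<zeta>: "\<zeta> \<in> piece Om 1"
  shows wsig_hom: "wsig \<zeta> \<in> add_hom (FE 1) (FE 2)"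
    and wsig_stens: "\<lbrakk>\<chi> \<in> piece Om 1; f \<in> carrier E\<rbrakk> \<Longrightarrow>
      wsig \<zeta> (ostens Om (forms Om 1) E \<chi> f) = wedge_left Om E \<chi> (sigt f \<zeta>)"
proof -
  have "balanced_map (base Om) (forms Om 1) E (FE 2) (\<lambda>\<chi> f. wedge_left Om E \<chi> (sigt f \<zeta>))"
  proof (rule balanced_mapI)
    fix f assume f: "f \<in> carrier E"
    show "(\<lambda>\<chi>. wedge_left Om E \<chi> (sigt f \<zeta>)) \<in> add_hom (forms Om 1) (FE 2)"
      by (rule wedge_left_hom_left[OF sigt_closed[OF f \<zeta>]])
  next
    fix \<chi> assume "\<chi> \<in> carrier (forms Om 1)"
    then show "(\<lambda>f. wedge_left Om E \<chi> (sigt f \<zeta>)) \<in> add_hom E (FE 2)"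
      by (intro add_hom_compose[OF sigt_hom1[OF \<zeta>] wedge_left_hom]) simp
  qed (use \<zeta> in \<open>simp add: sigt_lact wedge_left_lact sigt_closed\<close>)
  note * = fe.tlift_props[OF fe.T.abelian_group_axioms this]
  show "wsig \<zeta> \<in> add_hom (FE 1) (FE 2)"
    using *(1) by (simp add: wsig_def)
  show "\<lbrakk>\<chi> \<in> piece Om 1; f \<in> carrier E\<rbrakk> \<Longrightarrow>
      wsig \<zeta> (ostens Om (forms Om 1) E \<chi> f) = wedge_left Om E \<chi> (sigt f \<zeta>)"
    using *(2) by (simp add: wsig_def)
qed

lemma dnab_closed: "Y \<in> carrier (FE 1) \<Longrightarrow> dnab Y \<in> carrier (FE 2)"
  by (rule add_hom_closed[OF dnab_hom])

lemma wsig_closed: "\<lbrakk>\<zeta> \<in> piece Om 1; Y \<in> carrier (FE 1)\<rbrakk> \<Longrightarrow> wsig \<zeta> Y \<in> carrier (FE 2)"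
  by (rule add_hom_closed[OF wsig_hom])

lemma ract_FE_closed: "\<lbrakk>a \<in> piece Om 0; Y \<in> carrier (FE k)\<rbrakk> \<Longrightarrow> ract (FE k) Y a \<in> carrier (FE k)"
  by (rule add_hom_closed[OF ract_FE_hom])

lemma wsig_add:
  assumes "\<eta> \<in> piece Om 1" "\<zeta> \<in> piece Om 1" "Y \<in> carrier (FE 1)"
  shows "wsig (\<eta> \<oplus> \<zeta>) Y = wsig \<eta> Y \<oplus>\<^bsub>FE 2\<^esub> wsig \<zeta> Y"
proof (rule fe.tens_hom_eqI[OF assms(3) fe.T.abelian_group_axioms])
  show "(\<lambda>Y. wsig \<eta> Y \<oplus>\<^bsub>FE 2\<^esub> wsig \<zeta> Y) \<in> add_hom (FE 1) (FE 2)"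
    by (intro fe.T.add_hom_add_pointwise wsig_hom assms)
  fix \<chi> e assume "\<chi> \<in> carrier (forms Om 1)" "e \<in> carrier E"
  then show "wsig (\<eta> \<oplus> \<zeta>) (ostens Om (forms Om 1) E \<chi> e) =
      wsig \<eta> (ostens Om (forms Om 1) E \<chi> e) \<oplus>\<^bsub>FE 2\<^esub> wsig \<zeta> (ostens Om (forms Om 1) E \<chi> e)"
    using assms add_hom_add[OF sigt_hom2[of e], of \<eta> \<zeta>] add_hom_add[OF wedge_left_hom[of \<chi>]]
    by (simp add: wsig_stens piece_add sigt_closed)
qed (simp add: wsig_hom piece_add assms)

lemma wsig_ract_form:
  assumes "\<zeta> \<in> piece Om 1" "a \<in> piece Om 0" "Y \<in> carrier (FE 1)"
  shows "wsig (\<zeta> \<otimes> a) Y = ract (FE 2) (wsig \<zeta> Y) a"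
proof (rule fe.tens_hom_eqI[OF assms(3) fe.T.abelian_group_axioms])
  show "(\<lambda>Y. ract (FE 2) (wsig \<zeta> Y) a) \<in> add_hom (FE 1) (FE 2)"
    by (rule add_hom_compose[OF wsig_hom[OF assms(1)] ract_FE_hom[OF assms(2)]])
qed (use assms in \<open>simp_all add: wsig_hom wsig_stens piece_mult sigt_ract wedge_left_ract sigt_closed\<close>)

lemma wsig_ract:
  assumes "\<zeta> \<in> piece Om 1" "a \<in> piece Om 0" "Y \<in> carrier (FE 1)"
  shows "wsig \<zeta> (ract (FE 1) Y a) = wsig (a \<otimes> \<zeta>) Y"
proof (rule fe.tens_hom_eqI[OF assms(3) fe.T.abelian_group_axioms])
  show "(\<lambda>Y. wsig \<zeta> (ract (FE 1) Y a)) \<in> add_hom (FE 1) (FE 2)"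
    by (rule add_hom_compose[OF ract_FE_hom[OF assms(2)] wsig_hom[OF assms(1)]])
qed (use assms in \<open>simp_all add: wsig_hom wsig_stens piece_mult ract_FE_stens E_ract sigt_balanced\<close>)

text \<open>The failure of right linearity comes from the braiding term of \<nabla>_E(ea) under id
  \<and> \<nabla>_E.\<close>

lemma dnab_ract:
  assumes "a \<in> piece Om 0" "Y \<in> carrier (FE 1)"
  shows "dnab (ract (FE 1) Y a) = ract (FE 2) (dnab Y) a \<ominus>\<^bsub>FE 2\<^esub> wsig (dif Om a) Y"
proof (rule fe.tens_hom_eqI[OF assms(2) fe.T.abelian_group_axioms])
  show "(\<lambda>Y. dnab (ract (FE 1) Y a)) \<in> add_hom (FE 1) (FE 2)"
    by (rule add_hom_compose[OF ract_FE_hom[OF assms(1)] dnab_hom])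
  show "(\<lambda>Y. ract (FE 2) (dnab Y) a \<ominus>\<^bsub>FE 2\<^esub> wsig (dif Om a) Y) \<in> add_hom (FE 1) (FE 2)"
    by (rule fe.T.add_hom_diff[OF add_hom_compose[OF dnab_hom ract_FE_hom[OF assms(1)]] wsig_hom])
      (simp add: assms piece_dif)
  fix \<zeta> g assume "\<zeta> \<in> carrier (forms Om 1)" and g: "g \<in> carrier E"
  then have \<zeta>: "\<zeta> \<in> piece Om 1" by simp
  interpret h: additive_map "FE 2" "FE 2" "\<lambda>Y. ract (FE 2) Y a"
    by unfold_locales (rule ract_FE_hom[OF assms(1)])
  show "dnab (ract (FE 1) (ostens Om (forms Om 1) E \<zeta> g) a) =
      ract (FE 2) (dnab (ostens Om (forms Om 1) E \<zeta> g)) a \<ominus>\<^bsub>FE 2\<^esub> wsig (dif Om a) (ostens Om (forms Om 1) E \<zeta> g)"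
    using \<zeta> g assms(1) add_hom_add[OF wedge_left_hom[OF \<zeta>]]
      h.map_minus[of "ostens Om (forms Om 2) E (dif Om \<zeta>) g" "wedge_left Om E \<zeta> (nab E g)"]
    by (simp add: ract_FE_stens dnab_stens E_ract nab_ract_sigt wsig_stens piece_dif wedge_left_ract
        nab_closed sigt_closed ract_FE_closed stens2_closed wedge_left_closed a_minus_def
        fe.T.minus_add fe.T.a_assoc)
qed

section \<open>The braiding on two-forms and its parallelism\<close>

definition sig2 :: "('e \<times> 'w) frag set \<Rightarrow> ('w \<times> 'e) frag set" where
  "sig2 = (SOME s. s \<in> add_hom (EF 2) (FE 2) \<and>
     (\<forall>e\<in>carrier E. \<forall>\<eta>\<in>piece Om 1. \<forall>\<zeta>\<in>piece Om 1.
        s (ostens Om E (forms Om 2) e (\<eta> \<otimes> \<zeta>)) = wsig \<zeta> (sigt e \<eta>)))"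

text \<open>A fixed choice of the map promised by \<open>extendable\<close>. Beyond additivity its
  values are prescribed on products of one-forms, and its linearity is derived from these.\<close>

lemma sig2_props:
  shows sig2_hom: "sig2 \<in> add_hom (EF 2) (FE 2)"
    and sig2_wedge: "\<lbrakk>e \<in> carrier E; \<eta> \<in> piece Om 1; \<zeta> \<in> piece Om 1\<rbrakk> \<Longrightarrow>
      sig2 (ostens Om E (forms Om 2) e (\<eta> \<otimes> \<zeta>)) = wsig \<zeta> (sigt e \<eta>)"
proof -
  have "\<exists>s. s \<in> add_hom (EF 2) (FE 2) \<and>
     (\<forall>e\<in>carrier E. \<forall>\<eta>\<in>piece Om 1. \<forall>\<zeta>\<in>piece Om 1.
        s (ostens Om E (forms Om 2) e (\<eta> \<otimes> \<zeta>)) = wsig \<zeta> (sigt e \<eta>))"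
    using extendable by (simp add: wsig_def sigt_def Bex_def)
  from someI_ex[OF this]
  show "sig2 \<in> add_hom (EF 2) (FE 2)"
    "\<lbrakk>e \<in> carrier E; \<eta> \<in> piece Om 1; \<zeta> \<in> piece Om 1\<rbrakk> \<Longrightarrow>
      sig2 (ostens Om E (forms Om 2) e (\<eta> \<otimes> \<zeta>)) = wsig \<zeta> (sigt e \<eta>)"
    by (simp_all add: sig2_def)
qed

definition sig2t :: "'e \<Rightarrow> 'w \<Rightarrow> ('w \<times> 'e) frag set" where
  "sig2t f \<omega> = sig2 (ostens Om E (forms Om 2) f \<omega>)"

lemma sig2t_hom: "f \<in> carrier E \<Longrightarrow> sig2t f \<in> add_hom (forms Om 2) (FE 2)"
  unfolding sig2t_def[abs_def] by (rule add_hom_compose[OF ef.stens_hom_right sig2_hom])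

lemma sig2t_closed: "\<lbrakk>f \<in> carrier E; \<omega> \<in> piece Om 2\<rbrakk> \<Longrightarrow> sig2t f \<omega> \<in> carrier (FE 2)"
  using add_hom_closed[OF sig2t_hom, of f \<omega>] by simp

lemma sig2t_wedge: "\<lbrakk>f \<in> carrier E; \<eta> \<in> piece Om 1; \<zeta> \<in> piece Om 1\<rbrakk> \<Longrightarrow>
    sig2t f (\<eta> \<otimes> \<zeta>) = wsig \<zeta> (sigt f \<eta>)"
  by (simp add: sig2t_def sig2_wedge)

text \<open>Two-forms are sums of products \<eta> \<and> \<zeta>. On these the value is \<sigma>_E
  applied twice, and a scalar can be attached to \<zeta>, where \<sigma>_E is right linear.\<close>

lemma sig2t_ract:
  assumes f: "f \<in> carrier E" and a: "a \<in> piece Om 0" and \<omega>: "\<omega> \<in> piece Om 2"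
  shows "sig2t f (\<omega> \<otimes> a) = ract (FE 2) (sig2t f \<omega>) a"
proof -
  interpret l: additive_map "forms Om 2" "FE 2" "\<lambda>\<omega>. sig2t f (\<omega> \<otimes> a)"
    using add_hom_compose[OF forms.ract_hom[of a 2] sig2t_hom[OF f]] a by unfold_locales simp
  interpret r: additive_map "forms Om 2" "FE 2" "\<lambda>\<omega>. ract (FE 2) (sig2t f \<omega>) a"
    by unfold_locales (rule add_hom_compose[OF sig2t_hom[OF f] ract_FE_hom[OF a]])
  show ?thesis
    using \<omega>
  proof (induction rule: piece2_induct)
    case (prod \<eta> \<zeta>)
    then show ?case
      using f a sig2t_wedge[of f \<eta> "\<zeta> \<otimes> a"]
      by (simp add: m_assoc pieces_closed piece_mult sig2t_wedge wsig_ract_form sigt_closed)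
  next
    case (add x y)
    then show ?case using l.hom_add[of x y] r.hom_add[of x y] by simp
  next
    case (minus x)
    then show ?case using l.hom_a_inv[of x] r.hom_a_inv[of x] by (simp add: a_inv_forms)
  qed
qed

text \<open>The defect of $\sigma_E$ from being parallel, which for flat extendable E is $\sigma_E(f \otimes \mathrm d\xi)$.\<close>

definition sigd :: "'e \<Rightarrow> 'w \<Rightarrow> ('w \<times> 'e) frag set" where
  "sigd f \<xi> = dnab (sigt f \<xi>) \<ominus>\<^bsub>FE 2\<^esub> wsig \<xi> (nab E f)"

lemma sigd_hom: "f \<in> carrier E \<Longrightarrow> sigd f \<in> add_hom (forms Om 1) (FE 2)"
  unfolding sigd_def[abs_def]
  by (intro fe.T.add_hom_diff add_hom_compose[OF sigt_hom2 dnab_hom] add_homI)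
    (simp_all add: wsig_closed wsig_add nab_closed)

text \<open>Flatness at f.b. By the right Leibniz rule \<nabla>_E(fb) is \<nabla>_E(f)b plus
  \<sigma>_E(f \<otimes> db); by flatness at f the first summand contributes to the curvature only
  the braiding term of \<open>dnab_ract\<close>, and the sum is the defect.\<close>

lemma sigd_dif:
  assumes f: "f \<in> carrier E" and b: "b \<in> piece Om 0"
  shows "sigd f (dif Om b) = \<zero>\<^bsub>FE 2\<^esub>"
proof -
  interpret h: additive_map "FE 2" "FE 2" "\<lambda>Y. ract (FE 2) Y b"
    by unfold_locales (rule ract_FE_hom[OF b])
  have "\<zero>\<^bsub>FE 2\<^esub> = dnab (nab E (ract E f b))"
    using flat[of "ract E f b"] f b by (simp add: curvature_eq E_ract)
  also have "\<dots> = dnab (ract (FE 1) (nab E f) b) \<oplus>\<^bsub>FE 2\<^esub> dnab (sigt f (dif Om b))"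
    using f b add_hom_add[OF dnab_hom] by (simp add: nab_ract_sigt ract_FE_closed nab_closed sigt_closed piece_dif)
  also have "dnab (ract (FE 1) (nab E f) b) = \<ominus>\<^bsub>FE 2\<^esub> wsig (dif Om b) (nab E f)"
    using f b flat[OF f]
    by (simp add: dnab_ract nab_closed curvature_eq a_minus_def wsig_closed piece_dif)
  finally show ?thesis
    using f b by (simp add: sigd_def a_minus_def fe.T.a_comm wsig_closed dnab_closed sigt_closed nab_closed piece_dif)
qed

text \<open>The term \<sigma>_E(f \<otimes> da) of \<nabla>_E(fa), braided once more with \<xi>, is
  the extended braiding on da \<and> \<xi>. The rule parallels d(a\<xi>) = da \<and> \<xi> + a
  d\<xi>.\<close>

lemma sigd_ract:
  assumes "f \<in> carrier E" "a \<in> piece Om 0" "\<xi> \<in> piece Om 1"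
  shows "sigd (ract E f a) \<xi> = sigd f (a \<otimes> \<xi>) \<ominus>\<^bsub>FE 2\<^esub> sig2t f (dif Om a \<otimes> \<xi>)"
  using assms add_hom_add[OF wsig_hom[of \<xi>]]
  by (simp add: sigd_def sigt_balanced nab_ract_sigt wsig_ract nab_closed ract_FE_closed sigt_closed piece_dif
      sig2t_wedge a_minus_def fe.T.minus_add fe.T.a_assoc wsig_closed dnab_closed piece_mult)

text \<open>Both sides are additive in \<xi>, and one-forms are sums of elements a.db, so these
  decide.\<close>

lemma sigd_eq:
  assumes f: "f \<in> carrier E" and \<xi>: "\<xi> \<in> piece Om 1"
  shows "sigd f \<xi> = sig2t f (dif Om \<xi>)"
proof -
  interpret l: additive_map "forms Om 1" "FE 2" "sigd f"
    by unfold_locales (rule sigd_hom[OF f])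
  interpret r: additive_map "forms Om 1" "FE 2" "\<lambda>\<xi>. sig2t f (dif Om \<xi>)"
    by unfold_locales (rule add_hom_compose[OF dif_forms12 sig2t_hom[OF f]])
  let ?P = "\<lambda>\<xi>. \<xi> \<in> piece Om 1 \<and> sigd f \<xi> = sig2t f (dif Om \<xi>)"
  \<comment> \<open>By \<open>sigd_dif\<close> the defect at f.a vanishes on db. Through
    \<open>sigd_ract\<close> this gives the defect at f on a.db, and d(a.db) = da \<and> db.\<close>
  have gen: "?P (a \<otimes> dif Om b)" if ab: "a \<in> piece Om 0" "b \<in> piece Om 0" for a b
  proof -
    let ?s = "sig2t f (dif Om a \<otimes> dif Om b)"
    have s: "?s \<in> carrier (FE 2)" "sigd f (a \<otimes> dif Om b) \<in> carrier (FE 2)"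
      using f ab add_hom_closed[OF sigd_hom[OF f]] by (auto intro!: sig2t_closed simp: piece_mult piece_dif)
    have "sigd f (a \<otimes> dif Om b) \<ominus>\<^bsub>FE 2\<^esub> ?s = \<zero>\<^bsub>FE 2\<^esub>"
      using sigd_ract[OF f ab(1), of "dif Om b"] sigd_dif[of "ract E f a" b] f ab by (simp add: piece_dif E_ract)
    then have "sigd f (a \<otimes> dif Om b) = ?s"
      using s by (simp add: fe.T.minus_eq_zero_iff)
    moreover have "dif Om (a \<otimes> dif Om b) = dif Om a \<otimes> dif Om b"
      using ab dif_mult0[of a "dif Om b"] dif_dif[of b] by (simp add: pieces_closed piece_dif)
    ultimately show ?thesis using ab by (simp add: piece_mult piece_dif)
  qed
  have "\<xi> \<in> generate (add_monoid Om) {a \<otimes> dif Om b | a b. a \<in> piece Om 0 \<and> b \<in> piece Om 0}"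
    using \<xi> piece_one by simp
  then have "?P \<xi>"
  proof (induction rule: generate.induct)
    case one
    then show ?case using l.hom_zero r.hom_zero piece_zero by simp
  next
    case (incl h)
    then show ?case using gen by blast
  next
    case (inv h)
    then have h: "?P h" using gen by blast
    then have "?P (\<ominus> h)"
      using l.hom_a_inv[of h] r.hom_a_inv[of h] by (simp add: a_inv_forms piece_neg)
    then show ?case by (simp add: a_inv_def)
  next
    case (eng x y)
    then show ?case using l.hom_add[of x y] r.hom_add[of x y] by (simp add: piece_add)
  qed
  then show ?thesis by simp
qed

end

section \<open>The crossing map\<close>

locale crossing = bullet_geometry Om mul + flat_connection Om E
  for Om :: "('w, 'b) geometry_scheme" (structure) and mul :: "'w tvec_op"
    and E :: "('w, 'e, 'y) cbimod_scheme"
begin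

abbreviation "dual2 \<equiv> carrier (rhom (base Om) (forms Om 2) (forms Om 0))"

lemma dual2_closed: "\<lbrakk>\<alpha> \<in> dual2; \<omega> \<in> piece Om 2\<rbrakk> \<Longrightarrow> \<alpha> \<omega> \<in> piece Om 0"
  using add_hom_closed[OF rhom_carrierD(1)] by fastforce

lemma ev1_props:
  assumes "u \<in> V"
  shows ev1_hom: "ev_left Om u E \<in> add_hom (FE 1) E"
    and ev1_stens: "\<lbrakk>\<eta> \<in> piece Om 1; e \<in> carrier E\<rbrakk> \<Longrightarrow>
      ev_left Om u E (ostens Om (forms Om 1) E \<eta> e) = lact E (u \<eta>) e"
    and ev1_closed: "Y \<in> carrier (FE 1) \<Longrightarrow> ev_left Om u E Y \<in> carrier E"
  using ev_left_props[OF bimodule_E assms[unfolded vec_def]] add_hom_closed by auto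

lemma ev2_props:
  assumes "\<alpha> \<in> dual2"
  shows ev2_hom: "ev_left Om \<alpha> E \<in> add_hom (FE 2) E"
    and ev2_stens: "\<lbrakk>\<omega> \<in> piece Om 2; e \<in> carrier E\<rbrakk> \<Longrightarrow>
      ev_left Om \<alpha> E (ostens Om (forms Om 2) E \<omega> e) = lact E (\<alpha> \<omega>) e"
  using ev_left_props[OF bimodule_E assms] by auto

lemma ev2_ract:
  assumes "\<alpha> \<in> dual2" "a \<in> piece Om 0" "Y \<in> carrier (FE 2)"
  shows "ev_left Om \<alpha> E (ract (FE 2) Y a) = ract E (ev_left Om \<alpha> E Y) a"
proof (rule fe.tens_hom_eqI[OF assms(3) M.abelian_group_axioms])
  show "(\<lambda>Y. ev_left Om \<alpha> E (ract (FE 2) Y a)) \<in> add_hom (FE 2) E"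
    by (rule add_hom_compose[OF ract_FE_hom[OF assms(2)] ev2_hom[OF assms(1)]])
  show "(\<lambda>Y. ract E (ev_left Om \<alpha> E Y) a) \<in> add_hom (FE 2) E"
    by (rule add_hom_compose[OF ev2_hom[OF assms(1)] E_ract_hom[OF assms(2)]])
qed (use assms in \<open>simp add: ract_FE_stens ev2_stens E_ract E_lact_ract dual2_closed\<close>)

lemma ev1_ract:
  assumes "u \<in> V" "a \<in> piece Om 0" "Y \<in> carrier (FE 1)"
  shows "ev_left Om u E (ract (FE 1) Y a) = ract E (ev_left Om u E Y) a"
proof (rule fe.tens_hom_eqI[OF assms(3) M.abelian_group_axioms])
  show "(\<lambda>Y. ev_left Om u E (ract (FE 1) Y a)) \<in> add_hom (FE 1) E"
    by (rule add_hom_compose[OF ract_FE_hom[OF assms(2)] ev1_hom[OF assms(1)]])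
  show "(\<lambda>Y. ract E (ev_left Om u E Y) a) \<in> add_hom (FE 1) E"
    by (rule add_hom_compose[OF ev1_hom[OF assms(1)] E_ract_hom[OF assms(2)]])
qed (use assms in \<open>simp add: ract_FE_stens ev1_stens E_ract E_lact_ract vec_closed\<close>)

lemma ev1_vec_lact:
  assumes "u \<in> V" "a \<in> piece Om 0" "Y \<in> carrier (FE 1)"
  shows "ev_left Om (lact (vec Om) a u) E Y = lact E a (ev_left Om u E Y)"
proof (rule fe.tens_hom_eqI[OF assms(3) M.abelian_group_axioms])
  have au: "lact (vec Om) a u \<in> V" using assms by (simp add: vec.lact_closed)
  show "ev_left Om (lact (vec Om) a u) E \<in> add_hom (FE 1) E" by (rule ev1_hom[OF au])
  show "(\<lambda>Y. lact E a (ev_left Om u E Y)) \<in> add_hom (FE 1) E"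
    by (rule add_hom_compose[OF ev1_hom[OF assms(1)] E_lact_hom[OF assms(2)]])
  show "ev_left Om (lact (vec Om) a u) E (ostens Om (forms Om 1) E \<eta> e) =
      lact E a (ev_left Om u E (ostens Om (forms Om 1) E \<eta> e))"
    if "\<eta> \<in> carrier (forms Om 1)" "e \<in> carrier E" for \<eta> e
    using that assms au by (simp add: ev1_stens vec_apply E_mult_lact vec_closed)
qed

section \<open>Components in the dual basis\<close>

definition component :: "('w \<times> 'e) frag set \<Rightarrow> nat \<Rightarrow> 'e" where
  "component Y i = ev_left Om (ub Om i) E Y"

lemma component_closed: "\<lbrakk>Y \<in> carrier (FE 1); i < rk Om\<rbrakk> \<Longrightarrow> component Y i \<in> carrier E"
  by (simp add: component_def ev1_closed ub_closed)

lemma FE1_expansion: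
  assumes Y: "Y \<in> carrier (FE 1)"
  shows "Y = (\<Oplus>\<^bsub>FE 1\<^esub>i\<in>I. ostens Om (forms Om 1) E (xi Om i) (component Y i))"
proof (rule fe.tens_hom_eqI[OF Y fe.T.abelian_group_axioms])
  show "(\<lambda>Y. Y) \<in> add_hom (FE 1) (FE 1)" by (auto intro!: add_homI)
  show "(\<lambda>Y. \<Oplus>\<^bsub>FE 1\<^esub>i\<in>I. ostens Om (forms Om 1) E (xi Om i) (component Y i)) \<in> add_hom (FE 1) (FE 1)"
  proof (rule fe.T.add_hom_finsum_pointwise)
    show "(\<lambda>Y. ostens Om (forms Om 1) E (xi Om i) (component Y i)) \<in> add_hom (FE 1) (FE 1)" if "i \<in> I" for i
      unfolding component_def using that
      by (intro add_hom_compose[OF ev1_hom fe.stens_hom_right]) (simp_all add: ub_closed xi_closed)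
  qed
  fix \<eta> e assume "\<eta> \<in> carrier (forms Om 1)" and e: "e \<in> carrier E"
  then have \<eta>: "\<eta> \<in> piece Om 1" by simp
  have t: "xi Om i \<otimes> ub Om i \<eta> \<in> piece Om 1" if "i \<in> I" for i
    using that \<eta> by (simp add: piece_mult(2) vec_closed xi_closed ub_closed)
  interpret h: additive_map "forms Om 1" "FE 1" "\<lambda>\<eta>. ostens Om (forms Om 1) E \<eta> e"
    by unfold_locales (rule fe.stens_hom_left[OF e])
  have "ostens Om (forms Om 1) E \<eta> e = ostens Om (forms Om 1) E (\<Oplus>\<^bsub>forms Om 1\<^esub>i\<in>I. xi Om i \<otimes> ub Om i \<eta>) e"
    using dual_basis[OF \<eta>] finsum_forms[of I, OF t] by simp
  also have "\<dots> = (\<Oplus>\<^bsub>FE 1\<^esub>i\<in>I. ostens Om (forms Om 1) E (xi Om i) (component (ostens Om (forms Om 1) E \<eta> e) i))"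
    using t \<eta> e fe.stens_balanced[of _ 1 _ e]
    by (intro h.map_finsum_eq) (simp_all add: component_def ev1_stens ub_closed xi_closed vec_closed)
  finally show "ostens Om (forms Om 1) E \<eta> e =
      (\<Oplus>\<^bsub>FE 1\<^esub>i\<in>I. ostens Om (forms Om 1) E (xi Om i) (component (ostens Om (forms Om 1) E \<eta> e) i))" .
qed

lemma FE1_map_expansion:
  assumes "abelian_group G" "h \<in> add_hom (FE 1) G" "Y \<in> carrier (FE 1)"
    and "\<And>i. i < rk Om \<Longrightarrow> h (ostens Om (forms Om 1) E (xi Om i) (component Y i)) = k i"
  shows "h Y = (\<Oplus>\<^bsub>G\<^esub>i\<in>I. k i)"
proof -
  interpret h: additive_map "FE 1" G h
    using assms(1,2) by (intro additive_map.intro additive_map_axioms.intro fe.T.abelian_group_axioms)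
  have "h Y = h (\<Oplus>\<^bsub>FE 1\<^esub>i\<in>I. ostens Om (forms Om 1) E (xi Om i) (component Y i))"
    using FE1_expansion[OF assms(3)] by simp
  also have "\<dots> = (\<Oplus>\<^bsub>G\<^esub>i\<in>I. k i)"
    using assms(3,4) by (intro h.map_finsum_eq) (simp_all add: stens1_closed xi_closed component_closed)
  finally show ?thesis .
qed

context
  fixes \<alpha> assumes \<alpha>: "\<alpha> \<in> dual2"
begin

text \<open>The coefficients of \<open>curv_hat Om mul \<alpha>\<close>, which is the sum of c1_i
  u_i minus the sum of c2_ij (u_j \<bullet> u_i). The same scalars express (\<alpha> \<otimes> id)
  of curvatures on E, which is how the two are compared.\<close>

definition c1 :: "nat \<Rightarrow> 'w" where "c1 i = \<alpha> (dif Om (xi Om i))"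
definition c2 :: "nat \<Rightarrow> nat \<Rightarrow> 'w" where "c2 i j = \<alpha> (xi Om i \<otimes> xi Om j)"

lemma c1_closed: "i < rk Om \<Longrightarrow> c1 i \<in> piece Om 0"
  by (simp add: c1_def dual2_closed[OF \<alpha>] piece_dif xi_closed)

lemma c2_closed: "\<lbrakk>i < rk Om; j < rk Om\<rbrakk> \<Longrightarrow> c2 i j \<in> piece Om 0"
  by (simp add: c2_def dual2_closed[OF \<alpha>] piece_mult xi_closed)

lemma ev2_wedge:
  assumes "Z \<in> carrier (FE 1)" "i < rk Om"
  shows "ev_left Om \<alpha> E (wedge_left Om E (xi Om i) Z) = (\<Oplus>\<^bsub>E\<^esub>j\<in>I. lact E (c2 i j) (component Z j))"
  by (rule FE1_map_expansion[OF M.abelian_group_axioms add_hom_compose[OF wedge_left_hom ev2_hom[OF \<alpha>]] assms(1)])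
    (use assms in \<open>simp_all add: xi_closed wedge_left_stens component_closed ev2_stens[OF \<alpha>] piece_mult c2_def\<close>)

lemma ev2_dnab:
  assumes "Y \<in> carrier (FE 1)"
  shows "ev_left Om \<alpha> E (dnab Y) = (\<Oplus>\<^bsub>E\<^esub>i\<in>I. lact E (c1 i) (component Y i)) \<ominus>\<^bsub>E\<^esub>
    (\<Oplus>\<^bsub>E\<^esub>i\<in>I. \<Oplus>\<^bsub>E\<^esub>j\<in>I. lact E (c2 i j) (component (nab E (component Y i)) j))"
proof -
  interpret ev: additive_map "FE 2" E "ev_left Om \<alpha> E"
    by unfold_locales (rule ev2_hom[OF \<alpha>])
  have "ev_left Om \<alpha> E (dnab Y) = (\<Oplus>\<^bsub>E\<^esub>i\<in>I. lact E (c1 i) (component Y i) \<ominus>\<^bsub>E\<^esub>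
      (\<Oplus>\<^bsub>E\<^esub>j\<in>I. lact E (c2 i j) (component (nab E (component Y i)) j)))"
    by (rule FE1_map_expansion[OF M.abelian_group_axioms add_hom_compose[OF dnab_hom ev2_hom[OF \<alpha>]] assms])
      (use assms in \<open>simp add: xi_closed dnab_stens component_closed ev.map_minus stens2_closed piece_dif
        wedge_left_closed nab_closed ev2_stens[OF \<alpha>] ev2_wedge c1_def\<close>)
  also have "\<dots> = (\<Oplus>\<^bsub>E\<^esub>i\<in>I. lact E (c1 i) (component Y i)) \<ominus>\<^bsub>E\<^esub>
    (\<Oplus>\<^bsub>E\<^esub>i\<in>I. \<Oplus>\<^bsub>E\<^esub>j\<in>I. lact E (c2 i j) (component (nab E (component Y i)) j))"
    using assms
    by (intro M.finsum_minus) (auto intro!: M.finsum_closed simp: E_lact c1_closed c2_closed component_closed nab_closed)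
  finally show ?thesis .
qed

lemma ev2_wsig:
  assumes "Y \<in> carrier (FE 1)" "\<zeta> \<in> piece Om 1"
  shows "ev_left Om \<alpha> E (wsig \<zeta> Y) = (\<Oplus>\<^bsub>E\<^esub>i\<in>I. \<Oplus>\<^bsub>E\<^esub>j\<in>I. lact E (c2 i j) (component (sigt (component Y i) \<zeta>) j))"
  by (rule FE1_map_expansion[OF M.abelian_group_axioms add_hom_compose[OF wsig_hom[OF assms(2)] ev2_hom[OF \<alpha>]] assms(1)])
    (use assms in \<open>simp add: xi_closed wsig_stens component_closed ev2_wedge sigt_closed\<close>)

text \<open>(\<alpha> \<otimes> id)\<sigma>_E(f \<otimes> \<omega>), to be used as a right module
  map in \<omega>.\<close>

definition hsig :: "'e \<Rightarrow> 'w \<Rightarrow> 'e" where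
  "hsig f \<omega> = ev_left Om \<alpha> E (sig2t f \<omega>)"

lemma hsig_hom: "f \<in> carrier E \<Longrightarrow> hsig f \<in> add_hom (forms Om 2) E"
  unfolding hsig_def[abs_def] by (rule add_hom_compose[OF sig2t_hom ev2_hom[OF \<alpha>]])

lemma hsig_closed: "\<lbrakk>f \<in> carrier E; \<omega> \<in> piece Om 2\<rbrakk> \<Longrightarrow> hsig f \<omega> \<in> carrier E"
  using add_hom_closed[OF hsig_hom, of f \<omega>] by simp

lemma hsig_ract: "\<lbrakk>f \<in> carrier E; \<omega> \<in> piece Om 2; a \<in> piece Om 0\<rbrakk> \<Longrightarrow> hsig f (\<omega> \<otimes> a) = ract E (hsig f \<omega>) a"
  by (simp add: hsig_def sig2t_ract ev2_ract[OF \<alpha>] sig2t_closed)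

text \<open>The vanishing curvature of E, contracted with \<alpha>. It will cancel the terms in
  which both derivatives fall on E.\<close>

lemma flat_components:
  assumes "f \<in> carrier E"
  shows "(\<Oplus>\<^bsub>E\<^esub>i\<in>I. lact E (c1 i) (component (nab E f) i)) =
    (\<Oplus>\<^bsub>E\<^esub>i\<in>I. \<Oplus>\<^bsub>E\<^esub>j\<in>I. lact E (c2 i j) (component (nab E (component (nab E f) i)) j))"
proof -
  interpret ev: additive_map "FE 2" E "ev_left Om \<alpha> E"
    by unfold_locales (rule ev2_hom[OF \<alpha>])
  have "ev_left Om \<alpha> E (dnab (nab E f)) = \<zero>\<^bsub>E\<^esub>"
    using flat[OF assms] by (simp add: curvature_eq)
  then show ?thesis
    using assms M.minus_eq_zero_iff
    by (simp add: ev2_dnab nab_closed component_closed M.finsum_closed Pi_def E_lact c1_closed c2_closed)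
qed

text \<open>\<open>sigd_eq\<close> contracted with \<alpha>. The first double sum comes from
  \<open>wsig\<close> of \<nabla>_E f, the second from the connection part of \<open>dnab\<close>;
  they are the terms with one derivative and one braiding, in the two orders.\<close>

lemma parallel_components:
  assumes "f \<in> carrier E" "\<xi> \<in> piece Om 1"
  shows "(\<Oplus>\<^bsub>E\<^esub>i\<in>I. lact E (c1 i) (component (sigt f \<xi>) i)) \<ominus>\<^bsub>E\<^esub>
    ((\<Oplus>\<^bsub>E\<^esub>i\<in>I. \<Oplus>\<^bsub>E\<^esub>j\<in>I. lact E (c2 i j) (component (sigt (component (nab E f) i) \<xi>) j)) \<oplus>\<^bsub>E\<^esub>
     (\<Oplus>\<^bsub>E\<^esub>i\<in>I. \<Oplus>\<^bsub>E\<^esub>j\<in>I. lact E (c2 i j) (component (nab E (component (sigt f \<xi>) i)) j))) = hsig f (dif Om \<xi>)"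
proof -
  interpret ev: additive_map "FE 2" E "ev_left Om \<alpha> E"
    by unfold_locales (rule ev2_hom[OF \<alpha>])
  have "hsig f (dif Om \<xi>) = ev_left Om \<alpha> E (dnab (sigt f \<xi>)) \<ominus>\<^bsub>E\<^esub> ev_left Om \<alpha> E (wsig \<xi> (nab E f))"
    using assms by (simp add: hsig_def sigd_eq[symmetric] sigd_def ev.map_minus dnab_closed wsig_closed sigt_closed nab_closed)
  then show ?thesis
    using assms
    by (simp add: ev2_dnab ev2_wsig nab_closed sigt_closed component_closed M.finsum_closed Pi_def E_lact c1_closed c2_closed
        a_minus_def M.minus_add M.a_ac)
qed

text \<open>Extendability contracted with \<alpha>: two braidings in succession are one braiding
  with a two-form.\<close>

lemma braid_components:
  assumes "f \<in> carrier E" "\<xi> \<in> piece Om 1" "\<zeta> \<in> piece Om 1"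
  shows "(\<Oplus>\<^bsub>E\<^esub>i\<in>I. \<Oplus>\<^bsub>E\<^esub>j\<in>I. lact E (c2 i j) (component (sigt (component (sigt f \<xi>) i) \<zeta>) j)) = hsig f (\<xi> \<otimes> \<zeta>)"
  using assms by (simp add: hsig_def sig2t_wedge ev2_wsig sigt_closed)

end

section \<open>Left multiplication by vector fields, seen on the target of the crossing map\<close>

abbreviation "ET \<equiv> otens Om E T"
abbreviation "et \<equiv> ostens Om E T"

sublocale et: tensor_pair "base Om" E T
  by unfold_locales (simp_all add: lact_tvec_closed E_ract)

sublocale te: tensor_pair "base Om" T E
  by unfold_locales (simp_all add: E_lact mul_closed emb0_closed)

sublocale ev: tensor_pair "base Om" E "vec Om"
  by (rule tensor_pair_bimodules[OF bimodule_E bimodule_vec])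

text \<open>As a right module map in \<eta> this represents \<sigma>_E^{-1}(u \<otimes> f), under
  the identification of E \<otimes> Vec A with Hom(\<Omega>^1, E).\<close>

definition vsigt :: "('w \<Rightarrow> 'w) \<Rightarrow> 'e \<Rightarrow> 'w \<Rightarrow> 'e" where
  "vsigt u f \<eta> = ev_left Om u E (sigt f \<eta>)"

lemma vsigt_closed: "\<lbrakk>u \<in> V; f \<in> carrier E; \<eta> \<in> piece Om 1\<rbrakk> \<Longrightarrow> vsigt u f \<eta> \<in> carrier E"
  by (simp add: vsigt_def ev1_closed sigt_closed)

lemma vsigt_hom1: "\<lbrakk>u \<in> V; \<eta> \<in> piece Om 1\<rbrakk> \<Longrightarrow> (\<lambda>f. vsigt u f \<eta>) \<in> add_hom E E"
  unfolding vsigt_def by (rule add_hom_compose[OF sigt_hom1 ev1_hom])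

lemma vsigt_right_map: "\<lbrakk>u \<in> V; f \<in> carrier E\<rbrakk> \<Longrightarrow> right_map E (vsigt u f)"
  unfolding right_map_def vsigt_def[abs_def]
  by (auto intro!: add_hom_compose[OF sigt_hom2 ev1_hom] simp: sigt_ract ev1_ract sigt_closed)

lemma vsigt_balanced: "\<lbrakk>u \<in> V; f \<in> carrier E; a \<in> piece Om 0; \<eta> \<in> piece Om 1\<rbrakk> \<Longrightarrow>
    vsigt u (ract E f a) \<eta> = vsigt u f (a \<otimes> \<eta>)"
  by (simp add: vsigt_def sigt_balanced)

lemma vact_closed: "\<lbrakk>u \<in> V; f \<in> carrier E\<rbrakk> \<Longrightarrow> vact Om E u f \<in> carrier E"
  by (simp add: vact_def ev1_closed nab_closed)

lemma vact_hom: "u \<in> V \<Longrightarrow> vact Om E u \<in> add_hom E E"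
  unfolding vact_def[abs_def] by (rule add_hom_compose[OF nab_hom ev1_hom])

lemma vact_ract: "\<lbrakk>u \<in> V; f \<in> carrier E; a \<in> piece Om 0\<rbrakk> \<Longrightarrow>
    vact Om E u (ract E f a) = ract E (vact Om E u f) a \<oplus>\<^bsub>E\<^esub> vsigt u f (dif Om a)"
  using add_hom_add[OF ev1_hom]
  by (simp add: vact_def vsigt_def nab_ract_sigt ract_FE_closed nab_closed sigt_closed piece_dif ev1_ract)

lemma esigi_eq:
  assumes "u \<in> V" "f \<in> carrier E"
  shows "esigi Om E u f = (\<Oplus>\<^bsub>otens Om E (vec Om)\<^esub>i\<in>I. ostens Om E (vec Om) (vsigt u f (xi Om i)) (ub Om i))"
  using the_vec_tensor[OF bimodule_E vsigt_right_map[OF assms]]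
  by (simp add: esigi_def vsigt_def sigt_def)

lemma mul_hom1: "y \<in> carrier (tvec Om) \<Longrightarrow> (\<lambda>x. mul x y) \<in> add_hom (tvec Om) (tvec Om)"
  using T.l_distr by (intro add_homI) (simp_all add: mul_closed)

lemma mul_hom2: "x \<in> carrier (tvec Om) \<Longrightarrow> (\<lambda>y. mul x y) \<in> add_hom (tvec Om) (tvec Om)"
  using T.r_distr by (intro add_homI) (simp_all add: mul_closed)

lemma mul_assoc: "\<lbrakk>x \<in> carrier (tvec Om); y \<in> carrier (tvec Om); z \<in> carrier (tvec Om)\<rbrakk> \<Longrightarrow>
    mul (mul x y) z = mul x (mul y z)"
  using T.m_assoc by simp

lemma lact_mul: "\<lbrakk>a \<in> piece Om 0; x \<in> carrier (tvec Om); y \<in> carrier (tvec Om)\<rbrakk> \<Longrightarrow>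
    mul (lact (tvec Om) a x) y = lact (tvec Om) a (mul x y)"
  using mul_assoc[of "emb0 Om a" x y] by (simp add: mul_emb0 emb0_closed mul_closed)

lemma mul_emb1_hom: "x \<in> carrier (tvec Om) \<Longrightarrow> (\<lambda>w. mul (emb1 Om w) x) \<in> add_hom (vec Om) (tvec Om)"
  by (rule add_hom_compose[OF emb1_hom mul_hom1])

lemma mul_emb1_lact: "\<lbrakk>a \<in> piece Om 0; w \<in> V; x \<in> carrier (tvec Om)\<rbrakk> \<Longrightarrow>
    mul (emb1 Om (lact (vec Om) a w)) x = lact (tvec Om) a (mul (emb1 Om w) x)"
  by (simp add: lact_emb1[symmetric] lact_mul emb1_closed)

lemma et_closed: "\<lbrakk>f \<in> carrier E; x \<in> carrier (tvec Om)\<rbrakk> \<Longrightarrow> et f x \<in> carrier ET"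
  using et.stens_closed by simp

lemma et_hom1: "x \<in> carrier (tvec Om) \<Longrightarrow> (\<lambda>f. et f x) \<in> add_hom E ET"
  using et.stens_hom_left by simp

lemma et_hom2: "f \<in> carrier E \<Longrightarrow> et f \<in> add_hom (tvec Om) ET"
  using et.stens_hom_right[of f] by (simp add: add_hom_def hom_def)

lemma et_vec_balanced: "x \<in> carrier (tvec Om) \<Longrightarrow>
    balanced_map (base Om) E (vec Om) ET (\<lambda>f w. et f (mul (emb1 Om w) x))"
  using et.stens_balanced
  by (intro balanced_mapI et_hom1 add_hom_compose[OF mul_emb1_hom et_hom2])
    (simp_all add: mul_closed emb1_closed mul_emb1_lact)

text \<open>What the recursion of \<open>crossing_map\<close> assigns to f \<otimes> x, with
  \<sigma>_E^{-1}(u \<otimes> f) expanded by \<open>esigi_eq\<close>.\<close>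

definition lval :: "('w \<Rightarrow> 'w) \<Rightarrow> 'e \<Rightarrow> 'w tvec \<Rightarrow> ('e \<times> 'w tvec) frag set" where
  "lval u f x = et (vact Om E u f) x \<oplus>\<^bsub>ET\<^esub>
     (\<Oplus>\<^bsub>ET\<^esub>k\<in>I. et (vsigt u f (xi Om k)) (mul (emb1 Om (ub Om k)) x))"

lemma tmap_esigi:
  assumes "u \<in> V" "f \<in> carrier E" "x \<in> carrier (tvec Om)"
  shows "tmap (base Om) E T id (\<lambda>w'. emb1 Om w' \<otimes>\<^bsub>T\<^esub> x) (esigi Om E u f) =
    (\<Oplus>\<^bsub>ET\<^esub>k\<in>I. et (vsigt u f (xi Om k)) (mul (emb1 Om (ub Om k)) x))"
proof -
  note b = et_vec_balanced[OF assms(3)]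
  interpret h: additive_map "otens Om E (vec Om)" ET "tlift ET (\<lambda>(f, w). et f (mul (emb1 Om w) x))"
    by unfold_locales (rule ev.tlift_hom[OF et.T.abelian_group_axioms b])
  have "tlift ET (\<lambda>(f, w). et f (mul (emb1 Om w) x)) (esigi Om E u f) =
      (\<Oplus>\<^bsub>ET\<^esub>k\<in>I. et (vsigt u f (xi Om k)) (mul (emb1 Om (ub Om k)) x))"
    unfolding esigi_eq[OF assms(1,2)]
    using assms
    by (intro h.map_finsum_eq)
      (simp_all add: ev.stens_closed ev.tlift_stens[OF et.T.abelian_group_axioms b] vsigt_closed xi_closed ub_closed)
  then show ?thesis by (simp add: tmap_def)
qed

lemma lval_term_closed: "\<lbrakk>u \<in> V; f \<in> carrier E; x \<in> carrier (tvec Om); k < rk Om\<rbrakk> \<Longrightarrow>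
    et (vsigt u f (xi Om k)) (mul (emb1 Om (ub Om k)) x) \<in> carrier ET"
  by (simp add: et_closed vsigt_closed xi_closed ub_closed mul_closed emb1_closed)

text \<open>Neither summand of \<open>lval\<close> is balanced: the terms in $\mathrm d a$ of the two cancel.\<close>

lemma lval_ract:
  assumes "u \<in> V" "f \<in> carrier E" "x \<in> carrier (tvec Om)" "a \<in> piece Om 0"
  shows "lval u (ract E f a) x = lval u f (lact (tvec Om) a x)"
proof -
  let ?S = "\<lambda>x. \<Oplus>\<^bsub>ET\<^esub>k\<in>I. et (vsigt u f (xi Om k)) (mul (emb1 Om (ub Om k)) x)"
  have ax: "lact (tvec Om) a x \<in> carrier (tvec Om)" using assms by (simp add: lact_tvec_closed)
  have S: "?S (lact (tvec Om) a x) \<in> carrier ET"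
    using assms ax by (auto intro!: et.T.finsum_closed lval_term_closed)
  have S': "(\<Oplus>\<^bsub>ET\<^esub>k\<in>I. et (vsigt u f (xi Om k)) (mul (emb1 Om (ract (vec Om) (ub Om k) a)) x)) \<in> carrier ET"
    using assms by (auto intro!: et.T.finsum_closed et_closed simp: vsigt_closed xi_closed ub_closed mul_closed emb1_closed vec.ract_closed)
  have et_balanced: "et (ract E g b) y = et g (lact (tvec Om) b y)"
    if "g \<in> carrier E" "b \<in> piece Om 0" "y \<in> carrier (tvec Om)" for g b y
    using et.stens_balanced[of g b y] that by simp
  \<comment> \<open>The derivatives of a that arise from moving it past the u_k resum, by the
    expansion of da, to the extra term that \<open>vact_ract\<close> produces on the other
    side.\<close>
  have d: "(\<Oplus>\<^bsub>ET\<^esub>k\<in>I. et (vsigt u f (xi Om k)) (lact (tvec Om) (ub Om k (dif Om a)) x)) = et (vsigt u f (dif Om a)) x"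
  proof -
    interpret h: additive_map E ET "\<lambda>f. et f x"
      by unfold_locales (rule et_hom1[OF assms(3)])
    have "et (vsigt u f (dif Om a)) x =
        et (\<Oplus>\<^bsub>E\<^esub>k\<in>I. ract E (vsigt u f (xi Om k)) (ub Om k (dif Om a))) x"
      using right_map_expansion[OF bimodule_E vsigt_right_map[OF assms(1,2)], of "dif Om a"] assms
      by (simp add: piece_dif)
    also have "\<dots> = (\<Oplus>\<^bsub>ET\<^esub>k\<in>I. et (vsigt u f (xi Om k)) (lact (tvec Om) (ub Om k (dif Om a)) x))"
      using assms
      by (intro h.map_finsum_eq) (simp_all add: E_ract vsigt_closed xi_closed ub_closed vec_closed piece_dif et_balanced)
    finally show ?thesis ..
  qed
  \<comment> \<open>The product u_k \<bullet> a, by associativity, creates both the right multiple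
    u_k.a and the derivative u_k(da).\<close>
  have split: "mul (emb1 Om (ub Om k)) (lact (tvec Om) a x) =
      mul (emb1 Om (ract (vec Om) (ub Om k) a)) x \<oplus>\<^bsub>tvec Om\<^esub> lact (tvec Om) (ub Om k (dif Om a)) x"
    if "k < rk Om" for k
  proof -
    have "mul (emb1 Om (ub Om k)) (lact (tvec Om) a x) = mul (mul (emb1 Om (ub Om k)) (emb0 Om a)) x"
      using assms that by (simp add: mul_assoc mul_emb0 emb0_closed emb1_closed ub_closed)
    also have "\<dots> = mul (emb1 Om (ract (vec Om) (ub Om k) a)) x \<oplus>\<^bsub>tvec Om\<^esub> lact (tvec Om) (ub Om k (dif Om a)) x"
      using assms that add_hom_add[OF mul_hom1[OF assms(3)]]
      by (simp add: ev_left_emb0_dif ub_closed emb0_closed emb1_closed vec.ract_closed mul_emb0 vec_closed piece_dif)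
    finally show ?thesis .
  qed
  have "?S (lact (tvec Om) a x) =
      (\<Oplus>\<^bsub>ET\<^esub>k\<in>I. et (vsigt u f (xi Om k)) (mul (emb1 Om (ract (vec Om) (ub Om k) a)) x) \<oplus>\<^bsub>ET\<^esub>
        et (vsigt u f (xi Om k)) (lact (tvec Om) (ub Om k (dif Om a)) x))"
    using assms add_hom_add[OF et_hom2]
    by (intro et.T.finsum_cong')
      (auto intro!: et.T.a_closed et_closed simp: split vsigt_closed xi_closed ub_closed mul_closed emb1_closed
        vec.ract_closed lact_tvec_closed vec_closed piece_dif)
  also have "\<dots> = (\<Oplus>\<^bsub>ET\<^esub>k\<in>I. et (vsigt u f (xi Om k)) (mul (emb1 Om (ract (vec Om) (ub Om k) a)) x)) \<oplus>\<^bsub>ET\<^esub>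
      et (vsigt u f (dif Om a)) x"
    unfolding d[symmetric] using assms
    by (intro et.T.finsum_addf)
      (auto intro!: et_closed simp: vsigt_closed xi_closed ub_closed mul_closed emb1_closed
        vec.ract_closed lact_tvec_closed vec_closed piece_dif)
  finally have Sa: "?S (lact (tvec Om) a x) =
      (\<Oplus>\<^bsub>ET\<^esub>k\<in>I. et (vsigt u f (xi Om k)) (mul (emb1 Om (ract (vec Om) (ub Om k) a)) x)) \<oplus>\<^bsub>ET\<^esub>
      et (vsigt u f (dif Om a)) x" .
  have "(\<Oplus>\<^bsub>ET\<^esub>k\<in>I. et (vsigt u (ract E f a) (xi Om k)) (mul (emb1 Om (ub Om k)) x)) =
      (\<Oplus>\<^bsub>ET\<^esub>k\<in>I. et (vsigt u f (a \<otimes> xi Om k)) (mul (emb1 Om (ub Om k)) x))"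
    using assms
    by (intro et.T.finsum_cong')
      (auto intro!: et_closed simp: vsigt_balanced vsigt_closed xi_closed ub_closed mul_closed emb1_closed piece_mult)
  \<comment> \<open>Passing a from \<xi>_k to u_k is again centrality of the dual basis
    element.\<close>
  also have "\<dots> = (\<Oplus>\<^bsub>ET\<^esub>k\<in>I. et (vsigt u f (xi Om k)) (mul (emb1 Om (ract (vec Om) (ub Om k) a)) x))"
    by (rule coev_central[OF bimodule_E et.T.abelian_group_axioms et_vec_balanced[OF assms(3)]
          vsigt_right_map[OF assms(1,2)] assms(4)])
  finally have "lval u (ract E f a) x = (et (vact Om E u f) (lact (tvec Om) a x) \<oplus>\<^bsub>ET\<^esub> et (vsigt u f (dif Om a)) x) \<oplus>\<^bsub>ET\<^esub>
      (\<Oplus>\<^bsub>ET\<^esub>k\<in>I. et (vsigt u f (xi Om k)) (mul (emb1 Om (ract (vec Om) (ub Om k) a)) x))"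
    using assms add_hom_add[OF et_hom1[OF assms(3)]]
    by (simp add: lval_def vact_ract E_ract vact_closed vsigt_closed piece_dif et_balanced)
  then show ?thesis
    using assms S' ax
    by (simp add: lval_def Sa et_closed vact_closed vsigt_closed piece_dif et.T.a_ac)
qed

lemma lval_balanced:
  assumes u: "u \<in> V"
  shows "balanced_map (base Om) E T ET (lval u)"
proof (rule balanced_mapI)
  fix x assume "x \<in> carrier T"
  then have x: "x \<in> carrier (tvec Om)" by simp
  show "(\<lambda>f. lval u f x) \<in> add_hom E ET"
    unfolding lval_def
  proof (intro et.T.add_hom_add_pointwise et.T.add_hom_finsum_pointwise)
    show "(\<lambda>f. et (vact Om E u f) x) \<in> add_hom E ET"
      by (rule add_hom_compose[OF vact_hom[OF u] et_hom1[OF x]])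
    show "(\<lambda>f. et (vsigt u f (xi Om k)) (mul (emb1 Om (ub Om k)) x)) \<in> add_hom E ET" if "k \<in> I" for k
      using that x u by (intro add_hom_compose[OF vsigt_hom1 et_hom1]) (simp_all add: xi_closed mul_closed emb1_closed ub_closed)
  qed
next
  fix f assume f: "f \<in> carrier E"
  have T: "add_hom T ET = add_hom (tvec Om) ET" by (simp add: add_hom_def hom_def)
  show "lval u f \<in> add_hom T ET"
    unfolding T lval_def[abs_def]
  proof (intro et.T.add_hom_add_pointwise et.T.add_hom_finsum_pointwise)
    show "(\<lambda>x. et (vact Om E u f) x) \<in> add_hom (tvec Om) ET"
      using et_hom2[OF vact_closed[OF u f]] .
    show "(\<lambda>x. et (vsigt u f (xi Om k)) (mul (emb1 Om (ub Om k)) x)) \<in> add_hom (tvec Om) ET" if "k \<in> I" for k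
      using that f u by (intro add_hom_compose[OF mul_hom2 et_hom2]) (simp_all add: xi_closed vsigt_closed emb1_closed ub_closed)
  qed
qed (use u in \<open>simp add: lval_ract\<close>)

definition lop :: "('w \<Rightarrow> 'w) \<Rightarrow> ('e \<times> 'w tvec) frag set \<Rightarrow> ('e \<times> 'w tvec) frag set" where
  "lop u = tlift ET (\<lambda>(f, x). lval u f x)"

lemma lop_props:
  assumes "u \<in> V"
  shows lop_hom: "lop u \<in> add_hom ET ET"
    and lop_stens: "\<lbrakk>f \<in> carrier E; x \<in> carrier (tvec Om)\<rbrakk> \<Longrightarrow> lop u (et f x) = lval u f x"
  using et.tlift_props[OF et.T.abelian_group_axioms lval_balanced[OF assms]]
  by (simp_all add: lop_def)

lemma lop_eq:
  assumes "u \<in> V" "X \<in> carrier ET"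
  shows "tlift ET (\<lambda>(f, x). et (vact Om E u f) x \<oplus>\<^bsub>ET\<^esub>
      tmap (base Om) E T id (\<lambda>w'. emb1 Om w' \<otimes>\<^bsub>T\<^esub> x) (esigi Om E u f)) X = lop u X"
  unfolding lop_def
  by (rule tlift_cong[OF et.tensor_pair_axioms et.T.abelian_group_axioms lval_balanced[OF assms(1)] _ assms(2)])
    (use assms(1) tmap_esigi in \<open>simp add: lval_def\<close>)

end

text \<open>Stated for a family of maps, since the ideal in \<open>theta_W\<close> is cut out by all
  right factors and all elements of E at once. A single map is the family over the one-element index
  set.\<close>

lemma preimage_subgroup:
  assumes "abelian_group M" "abelian_group N" "\<And>p. p \<in> P \<Longrightarrow> f p \<in> add_hom M N" "subgroup K (add_monoid N)"
  shows "subgroup {x \<in> carrier M. \<forall>p\<in>P. f p x \<in> K} (add_monoid M)"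
proof -
  interpret M: abelian_group M by (rule assms(1))
  interpret N: abelian_group N by (rule assms(2))
  have h: "additive_map M N (f p)" if "p \<in> P" for p
    using assms(3)[OF that] by unfold_locales
  show ?thesis
  proof (rule group.subgroupI[OF M.a_group])
    have "f p \<zero>\<^bsub>M\<^esub> \<in> K" if "p \<in> P" for p
    proof -
      interpret h: additive_map M N "f p" by (rule h[OF that])
      show ?thesis using subgroup.one_closed[OF assms(4)] by simp
    qed
    then show "{x \<in> carrier M. \<forall>p\<in>P. f p x \<in> K} \<noteq> {}" using M.zero_closed by blast
  next
    fix x assume x: "x \<in> {x \<in> carrier M. \<forall>p\<in>P. f p x \<in> K}"
    have "f p (\<ominus>\<^bsub>M\<^esub> x) \<in> K" if "p \<in> P" for p
    proof -
      interpret h: additive_map M N "f p" by (rule h[OF that])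
      show ?thesis using subgroup.m_inv_closed[OF assms(4), of "f p x"] x that by (simp add: a_inv_def[symmetric])
    qed
    then show "inv\<^bsub>add_monoid M\<^esub> x \<in> {x \<in> carrier M. \<forall>p\<in>P. f p x \<in> K}"
      using x by (simp add: a_inv_def[symmetric])
  next
    fix x y assume xy: "x \<in> {x \<in> carrier M. \<forall>p\<in>P. f p x \<in> K}" "y \<in> {x \<in> carrier M. \<forall>p\<in>P. f p x \<in> K}"
    have "f p (x \<oplus>\<^bsub>M\<^esub> y) \<in> K" if "p \<in> P" for p
      using xy that add_hom_add[OF assms(3)[OF that]] subgroup.m_closed[OF assms(4), of "f p x" "f p y"] by simp
    then show "x \<otimes>\<^bsub>add_monoid M\<^esub> y \<in> {x \<in> carrier M. \<forall>p\<in>P. f p x \<in> K}"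
      using xy by simp
  qed auto
qed

section \<open>The ideal and its image in the tensor product\<close>

context crossing
begin

abbreviation "W \<equiv> curv_ideal Om mul"
text \<open>Tensor products with the ideal are formed in their own right and reach those with T
  through \<open>tmap\<close> with identities; this map need not be injective, so membership is
  always stated for its image.\<close>

abbreviation "TW \<equiv> T\<lparr>carrier := W\<rparr>"

lemma curv_hat_eq:
  assumes \<alpha>: "\<alpha> \<in> dual2"
  shows "curv_hat Om mul \<alpha> = (\<Oplus>\<^bsub>tvec Om\<^esub>i\<in>I. lact (tvec Om) (c1 \<alpha> i) (emb1 Om (ub Om i))) \<ominus>\<^bsub>tvec Om\<^esub>
    (\<Oplus>\<^bsub>tvec Om\<^esub>i\<in>I. \<Oplus>\<^bsub>tvec Om\<^esub>j\<in>I. lact (tvec Om) (c2 \<alpha> i j) (mul (emb1 Om (ub Om j)) (emb1 Om (ub Om i))))"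
proof -
  interpret ev: additive_map "form_tvec Om 2" "tvec Om" "ev_left Om \<alpha> (tvec Om)"
    by unfold_locales (rule ev_left_tvec_hom[OF \<alpha>])
  let ?s = "ostens Om (forms Om 2) (tvec Om)"
  have s: "?s \<omega> x \<in> carrier (form_tvec Om 2)" if "\<omega> \<in> piece Om 2" "x \<in> carrier (tvec Om)" for \<omega> x
    using that by (simp add: ft.stens_closed)
  have "ev_left Om \<alpha> (tvec Om) (\<Oplus>\<^bsub>form_tvec Om 2\<^esub>i\<in>I. ?s (dif Om (xi Om i)) (emb1 Om (ub Om i))) =
      (\<Oplus>\<^bsub>tvec Om\<^esub>i\<in>I. lact (tvec Om) (c1 \<alpha> i) (emb1 Om (ub Om i)))"
    by (rule ev.map_finsum_eq)
      (simp_all add: s piece_dif xi_closed emb1_closed ub_closed ev_left_tvec_stens[OF \<alpha>] c1_def[OF \<alpha>])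
  moreover have "ev_left Om \<alpha> (tvec Om) (\<Oplus>\<^bsub>form_tvec Om 2\<^esub>i\<in>I. \<Oplus>\<^bsub>form_tvec Om 2\<^esub>j\<in>I.
        ?s (xi Om i \<otimes> xi Om j) (mul (emb1 Om (ub Om j)) (emb1 Om (ub Om i)))) =
      (\<Oplus>\<^bsub>tvec Om\<^esub>i\<in>I. \<Oplus>\<^bsub>tvec Om\<^esub>j\<in>I. lact (tvec Om) (c2 \<alpha> i j) (mul (emb1 Om (ub Om j)) (emb1 Om (ub Om i))))"
    by (intro ev.map_finsum_eq ft.T.finsum_closed)
      (auto intro!: s simp: piece_mult xi_closed emb1_closed ub_closed mul_closed ev_left_tvec_stens[OF \<alpha>] c2_def[OF \<alpha>])
  moreover have "(\<Oplus>\<^bsub>form_tvec Om 2\<^esub>i\<in>I. ?s (dif Om (xi Om i)) (emb1 Om (ub Om i))) \<in> carrier (form_tvec Om 2)"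
    by (auto intro!: ft.T.finsum_closed s simp: piece_dif xi_closed emb1_closed ub_closed)
  moreover have "(\<Oplus>\<^bsub>form_tvec Om 2\<^esub>i\<in>I. \<Oplus>\<^bsub>form_tvec Om 2\<^esub>j\<in>I.
        ?s (xi Om i \<otimes> xi Om j) (mul (emb1 Om (ub Om j)) (emb1 Om (ub Om i)))) \<in> carrier (form_tvec Om 2)"
    by (auto intro!: ft.T.finsum_closed s simp: piece_mult xi_closed emb1_closed ub_closed mul_closed)
  ultimately show ?thesis
    by (simp add: curv_hat_def curv_elem_def ev.map_minus)
qed

lemma curv_hat_closed: "\<alpha> \<in> dual2 \<Longrightarrow> curv_hat Om mul \<alpha> \<in> carrier (tvec Om)"
  unfolding curv_hat_eq
  by (intro tvec.minus_closed tvec.finsum_closed)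
    (auto simp: lact_tvec_closed emb1_closed ub_closed mul_closed c1_closed c2_closed intro!: tvec.finsum_closed)

lemma curv_hat_mul:
  assumes \<alpha>: "\<alpha> \<in> dual2" and x: "x \<in> carrier (tvec Om)"
  shows "mul (curv_hat Om mul \<alpha>) x = (\<Oplus>\<^bsub>tvec Om\<^esub>i\<in>I. lact (tvec Om) (c1 \<alpha> i) (mul (emb1 Om (ub Om i)) x)) \<ominus>\<^bsub>tvec Om\<^esub>
    (\<Oplus>\<^bsub>tvec Om\<^esub>i\<in>I. \<Oplus>\<^bsub>tvec Om\<^esub>j\<in>I. lact (tvec Om) (c2 \<alpha> i j) (mul (emb1 Om (ub Om j)) (mul (emb1 Om (ub Om i)) x)))"
proof -
  interpret m: additive_map "tvec Om" "tvec Om" "\<lambda>y. mul y x"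
    by unfold_locales (rule mul_hom1[OF x])
  have "mul (\<Oplus>\<^bsub>tvec Om\<^esub>i\<in>I. lact (tvec Om) (c1 \<alpha> i) (emb1 Om (ub Om i))) x =
      (\<Oplus>\<^bsub>tvec Om\<^esub>i\<in>I. lact (tvec Om) (c1 \<alpha> i) (mul (emb1 Om (ub Om i)) x))"
    using x by (intro m.map_finsum_eq)
      (simp_all add: lact_tvec_closed c1_closed[OF \<alpha>] emb1_closed ub_closed lact_mul)
  moreover have "mul (\<Oplus>\<^bsub>tvec Om\<^esub>i\<in>I. \<Oplus>\<^bsub>tvec Om\<^esub>j\<in>I. lact (tvec Om) (c2 \<alpha> i j) (mul (emb1 Om (ub Om j)) (emb1 Om (ub Om i)))) x =
    (\<Oplus>\<^bsub>tvec Om\<^esub>i\<in>I. \<Oplus>\<^bsub>tvec Om\<^esub>j\<in>I. lact (tvec Om) (c2 \<alpha> i j) (mul (emb1 Om (ub Om j)) (mul (emb1 Om (ub Om i)) x)))"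
    using x by (intro m.map_finsum_eq tvec.finsum_closed)
      (auto simp: lact_tvec_closed c2_closed[OF \<alpha>] emb1_closed ub_closed lact_mul mul_closed mul_assoc)
  moreover have "(\<Oplus>\<^bsub>tvec Om\<^esub>i\<in>I. lact (tvec Om) (c1 \<alpha> i) (emb1 Om (ub Om i))) \<in> carrier (tvec Om)"
    by (auto intro!: tvec.finsum_closed simp: lact_tvec_closed c1_closed[OF \<alpha>] emb1_closed ub_closed)
  moreover have "(\<Oplus>\<^bsub>tvec Om\<^esub>i\<in>I. \<Oplus>\<^bsub>tvec Om\<^esub>j\<in>I. lact (tvec Om) (c2 \<alpha> i j) (mul (emb1 Om (ub Om j)) (emb1 Om (ub Om i)))) \<in> carrier (tvec Om)"
    by (auto intro!: tvec.finsum_closed simp: lact_tvec_closed c2_closed[OF \<alpha>] emb1_closed ub_closed mul_closed)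
  ultimately show ?thesis
    unfolding curv_hat_eq[OF \<alpha>] by (simp add: m.map_minus)
qed

sublocale W: ideal W T
  unfolding curv_ideal_def by (rule T.genideal_ideal) (auto simp: curv_hat_closed)

lemma W_closed: "w \<in> W \<Longrightarrow> w \<in> carrier (tvec Om)"
  using W.a_Hcarr by simp

lemma W_mul: "\<lbrakk>x \<in> carrier (tvec Om); w \<in> W\<rbrakk> \<Longrightarrow> mul x w \<in> W" "\<lbrakk>w \<in> W; x \<in> carrier (tvec Om)\<rbrakk> \<Longrightarrow> mul w x \<in> W"
  using W.I_l_closed[of w x] W.I_r_closed[of w x] by simp_all

lemma W_lact: "\<lbrakk>a \<in> piece Om 0; w \<in> W\<rbrakk> \<Longrightarrow> lact (tvec Om) a w \<in> W"
  using W_mul(1)[of "emb0 Om a" w] by (simp add: mul_emb0 emb0_closed W_closed)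

lemma curv_hat_in_W: "\<alpha> \<in> dual2 \<Longrightarrow> curv_hat Om mul \<alpha> \<in> W"
  unfolding curv_ideal_def
  using T.genideal_self[of "curv_hat Om mul ` dual2"] curv_hat_closed by auto

lemma abelian_group_TW: "abelian_group TW"
proof (rule abelian_groupI)
  fix w assume w: "w \<in> carrier TW"
  then have "\<ominus>\<^bsub>tvec Om\<^esub> w \<in> W"
    using W.a_inv_closed[of w] by (simp add: a_inv_def m_inv_def)
  with w show "\<exists>y\<in>carrier TW. y \<oplus>\<^bsub>TW\<^esub> w = \<zero>\<^bsub>TW\<^esub>"
    by (intro bexI[of _ "\<ominus>\<^bsub>tvec Om\<^esub> w"]) (simp_all add: W_closed tvec.l_neg)
qed (use W.a_closed W.zero_closed in \<open>simp_all add: tvec.a_ac W_closed\<close>)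

sublocale wr: tensor_pair "base Om" E TW
  by (rule tensor_pair.intro[OF M.abelian_group_axioms abelian_group_TW]) (simp_all add: E_ract W_lact)

sublocale wl: tensor_pair "base Om" TW E
  by (rule tensor_pair.intro[OF abelian_group_TW M.abelian_group_axioms])
    (simp_all add: E_lact W_mul emb0_closed)

definition ImW :: "('e \<times> 'w tvec) frag set set" where
  "ImW = tmap (base Om) E T id id ` carrier (otens Om E TW)"

lemma incl_W: "(\<lambda>x. x) \<in> add_hom TW T"
  by (auto intro!: add_homI simp: W_closed)

lemma tmap_W_props:
  shows tmap_W_hom: "tmap (base Om) E T id id \<in> add_hom (otens Om E TW) ET"
    and tmap_W_stens: "\<lbrakk>f \<in> carrier E; w \<in> W\<rbrakk> \<Longrightarrow>
      tmap (base Om) E T id id (ostens Om E TW f w) = et f w"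
  using tmap_props[OF wr.tensor_pair_axioms et.tensor_pair_axioms, of id id] incl_W
  by (simp_all add: id_def add_homI)

lemma tmap_W_left_props:
  shows tmap_W_left_hom: "tmap (base Om) T E id id \<in> add_hom (otens Om TW E) (otens Om T E)"
    and tmap_W_left_stens: "\<lbrakk>w \<in> W; f \<in> carrier E\<rbrakk> \<Longrightarrow>
      tmap (base Om) T E id id (ostens Om TW E w f) = ostens Om T E w f"
  using tmap_props[OF wl.tensor_pair_axioms te.tensor_pair_axioms, of id id] incl_W
  by (simp_all add: id_def add_homI)

lemma ImW_subgroup: "subgroup ImW (add_monoid ET)"
proof -
  interpret h: additive_map "otens Om E TW" ET "tmap (base Om) E T id id"
    by unfold_locales (rule tmap_W_hom)
  show ?thesis
    using group_hom.img_is_subgroup[OF h.a_group_hom] by (simp add: ImW_def)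
qed

lemma et_ImW:
  assumes "f \<in> carrier E" "w \<in> W"
  shows "et f w \<in> ImW"
proof -
  have "ostens Om E TW f w \<in> carrier (otens Om E TW)"
    using assms by (intro wr.stens_closed) simp_all
  then show ?thesis
    using tmap_W_stens[OF assms] unfolding ImW_def by (metis imageI)
qed

lemma ImW_hom:
  assumes "abelian_group G" "h \<in> add_hom ET G" "subgroup K (add_monoid G)" "X \<in> ImW"
    "\<And>f w. \<lbrakk>f \<in> carrier E; w \<in> W\<rbrakk> \<Longrightarrow> h (et f w) \<in> K"
  shows "h X \<in> K"
proof -
  obtain Y where Y: "Y \<in> carrier (otens Om E TW)" "X = tmap (base Om) E T id id Y"
    using assms(4) by (auto simp: ImW_def)
  have "h (tmap (base Om) E T id id Y) \<in> K"
    by (rule wr.tens_hom_in_subgroup[OF Y(1) assms(1) add_hom_compose[OF tmap_W_hom assms(2)] assms(3)])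
      (simp add: tmap_W_stens assms(5))
  with Y(2) show ?thesis by simp
qed

text \<open>On f \<otimes> w the operator either acts on f alone or multiplies w from the left by
  some u_k, which stays in the ideal.\<close>

lemma ImW_lop:
  assumes "u \<in> V" "X \<in> ImW"
  shows "lop u X \<in> ImW"
proof (rule ImW_hom[OF et.T.abelian_group_axioms lop_hom[OF assms(1)] ImW_subgroup assms(2)])
  fix f w assume fw: "f \<in> carrier E" "w \<in> W"
  have "(\<Oplus>\<^bsub>ET\<^esub>k\<in>I. et (vsigt u f (xi Om k)) (mul (emb1 Om (ub Om k)) w)) \<in> ImW"
    using assms(1) fw
    by (intro et.T.finsum_in_subgroup[OF ImW_subgroup] et_ImW W_mul)
      (simp_all add: vsigt_closed xi_closed emb1_closed ub_closed)
  then show "lop u (et f w) \<in> ImW"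
    using subgroup.m_closed[OF ImW_subgroup et_ImW[OF vact_closed[OF assms(1) fw(1)] fw(2)]] assms(1) fw
    by (simp add: lop_stens W_closed lval_def)
qed

section \<open>Left linearity over A, and the curvature of the tensor product\<close>

lemma ET_lact:
  assumes "a \<in> piece Om 0"
  shows ET_lact_hom: "lact ET a \<in> add_hom ET ET"
    and ET_lact_stens: "\<lbrakk>f \<in> carrier E; x \<in> carrier (tvec Om)\<rbrakk> \<Longrightarrow> lact ET a (et f x) = et (lact E a f) x"
proof -
  have 2: "lact E a (ract E m b) = ract E (lact E a m) b" if "m \<in> carrier E" "b \<in> carrier (base Om)" for m b
    using that assms by (simp add: E_lact_ract)
  show "lact ET a \<in> add_hom ET ET"
    by (rule et.tens_lact_hom[OF E_lact_hom[OF assms] 2])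
  show "\<lbrakk>f \<in> carrier E; x \<in> carrier (tvec Om)\<rbrakk> \<Longrightarrow> lact ET a (et f x) = et (lact E a f) x"
    using et.tens_lact_stens[OF E_lact_hom[OF assms] 2, where m = f and n = x] by simp
qed

lemma ImW_lact:
  assumes "a \<in> piece Om 0" "X \<in> ImW"
  shows "lact ET a X \<in> ImW"
  by (rule ImW_hom[OF et.T.abelian_group_axioms ET_lact_hom[OF assms(1)] ImW_subgroup assms(2)])
    (simp add: ET_lact_stens[OF assms(1)] W_closed et_ImW E_lact assms(1))

lemma lval_lact:
  assumes "u \<in> V" "a \<in> piece Om 0" "f \<in> carrier E" "x \<in> carrier (tvec Om)"
  shows "lval (lact (vec Om) a u) f x = et (lact E a (vact Om E u f)) x \<oplus>\<^bsub>ET\<^esub>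
     (\<Oplus>\<^bsub>ET\<^esub>k\<in>I. et (lact E a (vsigt u f (xi Om k))) (mul (emb1 Om (ub Om k)) x))"
proof -
  have "(\<Oplus>\<^bsub>ET\<^esub>k\<in>I. et (vsigt (lact (vec Om) a u) f (xi Om k)) (mul (emb1 Om (ub Om k)) x)) =
      (\<Oplus>\<^bsub>ET\<^esub>k\<in>I. et (lact E a (vsigt u f (xi Om k))) (mul (emb1 Om (ub Om k)) x))"
    using assms
    by (intro et.T.finsum_cong')
      (auto intro!: et_closed simp: vsigt_def ev1_vec_lact sigt_closed xi_closed E_lact ev1_closed mul_closed emb1_closed ub_closed)
  then show ?thesis
    using assms by (simp add: lval_def vact_def ev1_vec_lact nab_closed)
qed

lemma lop_lact:
  assumes "u \<in> V" "a \<in> piece Om 0" "X \<in> carrier ET"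
  shows "lop (lact (vec Om) a u) X = lact ET a (lop u X)"
proof (rule et.tens_hom_eqI[OF assms(3) et.T.abelian_group_axioms])
  have au: "lact (vec Om) a u \<in> V" using assms by (simp add: vec.lact_closed)
  show "lop (lact (vec Om) a u) \<in> add_hom ET ET" by (rule lop_hom[OF au])
  show "(\<lambda>X. lact ET a (lop u X)) \<in> add_hom ET ET"
    by (rule add_hom_compose[OF lop_hom[OF assms(1)] ET_lact_hom[OF assms(2)]])
  fix f x assume f: "f \<in> carrier E" and "x \<in> carrier T"
  then have x: "x \<in> carrier (tvec Om)" by simp
  interpret h: additive_map ET ET "lact ET a"
    by unfold_locales (rule ET_lact_hom[OF assms(2)])
  have "lact ET a (\<Oplus>\<^bsub>ET\<^esub>k\<in>I. et (vsigt u f (xi Om k)) (mul (emb1 Om (ub Om k)) x)) =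
      (\<Oplus>\<^bsub>ET\<^esub>k\<in>I. et (lact E a (vsigt u f (xi Om k))) (mul (emb1 Om (ub Om k)) x))"
    using assms f x
    by (intro h.map_finsum_eq)
      (simp_all add: lval_term_closed ET_lact_stens vsigt_closed xi_closed mul_closed emb1_closed ub_closed)
  moreover have "(\<Oplus>\<^bsub>ET\<^esub>k\<in>I. et (vsigt u f (xi Om k)) (mul (emb1 Om (ub Om k)) x)) \<in> carrier ET"
    using assms f x by (auto intro!: et.T.finsum_closed lval_term_closed)
  ultimately show "lop (lact (vec Om) a u) (et f x) = lact ET a (lop u (et f x))"
    using assms f x au
    by (simp add: lop_stens lval_lact) (simp add: lval_def et_closed vact_closed ET_lact_stens)
qed

text \<open>Sorts a triple sum by the second tensor factor, which depends on k only, and gathers the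
  coefficients of each in E.\<close>

lemma ET_finsum_swap3:
  assumes "\<And>k. k < rk Om \<Longrightarrow> B k \<in> add_hom E ET" "\<And>i j k. \<lbrakk>i < rk Om; j < rk Om; k < rk Om\<rbrakk> \<Longrightarrow> m i j k \<in> carrier E"
  shows "(\<Oplus>\<^bsub>ET\<^esub>i\<in>I. \<Oplus>\<^bsub>ET\<^esub>j\<in>I. \<Oplus>\<^bsub>ET\<^esub>k\<in>I. B k (m i j k)) = (\<Oplus>\<^bsub>ET\<^esub>k\<in>I. B k (\<Oplus>\<^bsub>E\<^esub>i\<in>I. \<Oplus>\<^bsub>E\<^esub>j\<in>I. m i j k))"
proof -
  have "(\<Oplus>\<^bsub>ET\<^esub>i\<in>I. \<Oplus>\<^bsub>ET\<^esub>j\<in>I. \<Oplus>\<^bsub>ET\<^esub>k\<in>I. B k (m i j k)) = (\<Oplus>\<^bsub>ET\<^esub>k\<in>I. \<Oplus>\<^bsub>ET\<^esub>i\<in>I. \<Oplus>\<^bsub>ET\<^esub>j\<in>I. B k (m i j k))"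
    using add_hom_closed[OF assms(1)] assms(2) by (intro et.T.finsum_swap3) simp_all
  also have "\<dots> = (\<Oplus>\<^bsub>ET\<^esub>k\<in>I. B k (\<Oplus>\<^bsub>E\<^esub>i\<in>I. \<Oplus>\<^bsub>E\<^esub>j\<in>I. m i j k))"
  proof (rule et.T.finsum_cong')
    show "(\<lambda>k. B k (\<Oplus>\<^bsub>E\<^esub>i\<in>I. \<Oplus>\<^bsub>E\<^esub>j\<in>I. m i j k)) \<in> I \<rightarrow> carrier ET"
      using assms by (auto intro!: add_hom_closed[OF assms(1)] M.finsum_closed)
    fix k assume k: "k \<in> I"
    interpret B: additive_map E ET "B k"
      by unfold_locales (use assms(1) k in simp)
    show "(\<Oplus>\<^bsub>ET\<^esub>i\<in>I. \<Oplus>\<^bsub>ET\<^esub>j\<in>I. B k (m i j k)) = B k (\<Oplus>\<^bsub>E\<^esub>i\<in>I. \<Oplus>\<^bsub>E\<^esub>j\<in>I. m i j k)"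
      using assms(2) k
      by (intro B.map_finsum_eq[symmetric] B.map_finsum_eq M.finsum_closed) auto
  qed simp
  finally show ?thesis .
qed

text \<open>$(\alpha \otimes \mathrm{id})$ applied to the curvature $(\mathrm d \otimes \mathrm{id} - \mathrm{id} \wedge \nabla)\nabla t$ of
  $E \otimes_A \mathcal T\mathrm{Vec} A_\bullet$ with the connection $\nabla t = \sum_i \xi_i \otimes u_i t$.\<close>

definition kcurv :: "('w \<Rightarrow> 'w) \<Rightarrow> ('e \<times> 'w tvec) frag set \<Rightarrow> ('e \<times> 'w tvec) frag set" where
  "kcurv \<alpha> t = (\<Oplus>\<^bsub>ET\<^esub>i\<in>I. lop (lact (vec Om) (c1 \<alpha> i) (ub Om i)) t) \<ominus>\<^bsub>ET\<^esub>
     (\<Oplus>\<^bsub>ET\<^esub>i\<in>I. \<Oplus>\<^bsub>ET\<^esub>j\<in>I. lop (lact (vec Om) (c2 \<alpha> i j) (ub Om j)) (lop (ub Om i) t))"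

lemma kcurv_vec_closed:
  assumes "\<alpha> \<in> dual2"
  shows "i < rk Om \<Longrightarrow> lact (vec Om) (c1 \<alpha> i) (ub Om i) \<in> V"
    and "\<lbrakk>i < rk Om; j < rk Om\<rbrakk> \<Longrightarrow> lact (vec Om) (c2 \<alpha> i j) (ub Om j) \<in> V"
  using assms by (simp_all add: vec.lact_closed c1_closed c2_closed ub_closed)

lemma kcurv_hom:
  assumes "\<alpha> \<in> dual2"
  shows "kcurv \<alpha> \<in> add_hom ET ET"
  unfolding kcurv_def[abs_def]
proof (intro et.T.add_hom_diff et.T.add_hom_finsum_pointwise)
  show "lop (lact (vec Om) (c1 \<alpha> i) (ub Om i)) \<in> add_hom ET ET" if "i \<in> I" for i
    using that assms by (intro lop_hom kcurv_vec_closed) auto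
  show "(\<lambda>t. lop (lact (vec Om) (c2 \<alpha> i j) (ub Om j)) (lop (ub Om i) t)) \<in> add_hom ET ET"
    if "i \<in> I" "j \<in> I" for i j
    using that assms by (intro add_hom_compose[OF lop_hom lop_hom] kcurv_vec_closed) (auto simp: ub_closed)
qed

lemma component_nab: "component (nab E f) i = vact Om E (ub Om i) f"
  by (simp add: component_def vact_def)

lemma component_sigt: "component (sigt f \<xi>) i = vsigt (ub Om i) f \<xi>"
  by (simp add: component_def vsigt_def)

text \<open>The curvature of a tensor product: E contributes nothing since it is flat, and the mixed terms
  vanish up to $\sigma_E(f \otimes \mathrm d\xi_k)$ by \<open>parallel_components\<close>.\<close>

lemma kcurv_stens:
  assumes \<alpha>: "\<alpha> \<in> dual2" and f: "f \<in> carrier E" and x: "x \<in> carrier (tvec Om)"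
  shows "kcurv \<alpha> (et f x) =
    (\<Oplus>\<^bsub>ET\<^esub>k\<in>I. et (hsig \<alpha> f (dif Om (xi Om k))) (mul (emb1 Om (ub Om k)) x)) \<ominus>\<^bsub>ET\<^esub>
    (\<Oplus>\<^bsub>ET\<^esub>k\<in>I. \<Oplus>\<^bsub>ET\<^esub>l\<in>I. et (hsig \<alpha> f (xi Om k \<otimes> xi Om l)) (mul (emb1 Om (ub Om l)) (mul (emb1 Om (ub Om k)) x)))"
proof -
  let ?u = "ub Om" and ?\<xi> = "xi Om"
  define X where "X k = mul (emb1 Om (?u k)) x" for k
  define Y where "Y k l = mul (emb1 Om (?u l)) (X k)" for k l
  define D where "D i = vact Om E (?u i)" for i
  define s where "s i k g = vsigt (?u i) g (?\<xi> k)" for i k g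
  define a where "a i = lact E (c1 \<alpha> i)" for i
  define b where "b i j = lact E (c2 \<alpha> i j)" for i j
  note E_sums = M.finsum_closed
  have u: "?u i \<in> V" "?\<xi> i \<in> piece Om 1" if "i < rk Om" for i
    using that by (simp_all add: ub_closed xi_closed)
  have X: "X k \<in> carrier (tvec Om)" if "k < rk Om" for k
    using that x by (simp add: X_def mul_closed emb1_closed u)
  have Y: "Y k l \<in> carrier (tvec Om)" if "k < rk Om" "l < rk Om" for k l
    using that X by (simp add: Y_def mul_closed emb1_closed u)
  have D: "D i g \<in> carrier E" if "i < rk Om" "g \<in> carrier E" for i g
    using that by (simp add: D_def vact_closed u)
  have s: "s i k g \<in> carrier E" if "i < rk Om" "k < rk Om" "g \<in> carrier E" for i k g
    using that by (simp add: s_def vsigt_closed u)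
  have a: "a i g \<in> carrier E" if "i < rk Om" "g \<in> carrier E" for i g
    using that by (simp add: a_def E_lact c1_closed[OF \<alpha>])
  have b: "b i j g \<in> carrier E" if "i < rk Om" "j < rk Om" "g \<in> carrier E" for i j g
    using that by (simp add: b_def E_lact c2_closed[OF \<alpha>])
  have lop_a: "lop (lact (vec Om) (c1 \<alpha> i) (?u i)) (et g y) =
      et (a i (D i g)) y \<oplus>\<^bsub>ET\<^esub> (\<Oplus>\<^bsub>ET\<^esub>k\<in>I. et (a i (s i k g)) (mul (emb1 Om (?u k)) y))"
    if "i < rk Om" "g \<in> carrier E" "y \<in> carrier (tvec Om)" for i g y
    using that kcurv_vec_closed(1)[OF \<alpha>]
    by (simp add: lop_stens lval_lact u c1_closed[OF \<alpha>] a_def D_def s_def)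
  have lop_b: "lop (lact (vec Om) (c2 \<alpha> i j) (?u j)) (et g y) =
      et (b i j (D j g)) y \<oplus>\<^bsub>ET\<^esub> (\<Oplus>\<^bsub>ET\<^esub>k\<in>I. et (b i j (s j k g)) (mul (emb1 Om (?u k)) y))"
    if "i < rk Om" "j < rk Om" "g \<in> carrier E" "y \<in> carrier (tvec Om)" for i j g y
    using that kcurv_vec_closed(2)[OF \<alpha>]
    by (simp add: lop_stens lval_lact u c2_closed[OF \<alpha>] b_def D_def s_def)
  \<comment> \<open>The coefficients of the curvature, sorted by second tensor factor: Z1 and Z2
    belong to x, the sums P, Q and R to u_k \<bullet> x, and S to u_l \<bullet> (u_k \<bullet>
    x).\<close>
  define P where "P k = (\<Oplus>\<^bsub>E\<^esub>i\<in>I. a i (s i k f))" for k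
  define Q where "Q k = (\<Oplus>\<^bsub>E\<^esub>i\<in>I. \<Oplus>\<^bsub>E\<^esub>j\<in>I. b i j (s j k (D i f)))" for k
  define R where "R k = (\<Oplus>\<^bsub>E\<^esub>i\<in>I. \<Oplus>\<^bsub>E\<^esub>j\<in>I. b i j (D j (s i k f)))" for k
  define S where "S k l = (\<Oplus>\<^bsub>E\<^esub>i\<in>I. \<Oplus>\<^bsub>E\<^esub>j\<in>I. b i j (s j l (s i k f)))" for k l
  define Z1 where "Z1 = (\<Oplus>\<^bsub>E\<^esub>i\<in>I. a i (D i f))"
  define Z2 where "Z2 = (\<Oplus>\<^bsub>E\<^esub>i\<in>I. \<Oplus>\<^bsub>E\<^esub>j\<in>I. b i j (D j (D i f)))"
  have cl: "P k \<in> carrier E" "Q k \<in> carrier E" "R k \<in> carrier E" if "k < rk Om" for k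
    unfolding P_def Q_def R_def using that f by (auto intro!: E_sums simp: a b D s)
  have S: "S k l \<in> carrier E" if "k < rk Om" "l < rk Om" for k l
    unfolding S_def using that f by (auto intro!: E_sums simp: b s)
  have Z: "Z1 \<in> carrier E" "Z2 \<in> carrier E"
    unfolding Z1_def Z2_def using f by (auto intro!: E_sums simp: a b D)
  have Zeq: "Z1 = Z2"
    using flat_components[OF \<alpha> f] by (simp add: Z1_def Z2_def a_def b_def D_def component_nab)
  have PQR: "P k \<ominus>\<^bsub>E\<^esub> (Q k \<oplus>\<^bsub>E\<^esub> R k) = hsig \<alpha> f (dif Om (?\<xi> k))" if "k < rk Om" for k
    using parallel_components[OF \<alpha> f u(2)[OF that]]
    by (simp add: P_def Q_def R_def a_def b_def D_def s_def component_nab component_sigt)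
  have Seq: "S k l = hsig \<alpha> f (?\<xi> k \<otimes> ?\<xi> l)" if "k < rk Om" "l < rk Om" for k l
    using braid_components[OF \<alpha> f u(2)[OF that(1)] u(2)[OF that(2)]]
    by (simp add: S_def b_def s_def component_sigt)
  interpret hx: additive_map E ET "\<lambda>m. et m x"
    by unfold_locales (rule et_hom1[OF x])
  have hX: "additive_map E ET (\<lambda>m. et m (X k))" if "k < rk Om" for k
    by unfold_locales (rule et_hom1[OF X[OF that]])
  have A1: "(\<Oplus>\<^bsub>ET\<^esub>i\<in>I. lop (lact (vec Om) (c1 \<alpha> i) (?u i)) (et f x)) =
      et Z1 x \<oplus>\<^bsub>ET\<^esub> (\<Oplus>\<^bsub>ET\<^esub>k\<in>I. et (P k) (X k))"
  proof -
    have "(\<Oplus>\<^bsub>ET\<^esub>i\<in>I. lop (lact (vec Om) (c1 \<alpha> i) (?u i)) (et f x)) =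
        (\<Oplus>\<^bsub>ET\<^esub>i\<in>I. et (a i (D i f)) x \<oplus>\<^bsub>ET\<^esub> (\<Oplus>\<^bsub>ET\<^esub>k\<in>I. et (a i (s i k f)) (X k)))"
      using f x by (intro et.T.finsum_cong')
        (auto simp: lop_a X_def[symmetric] X a D s intro!: et.T.a_closed et.T.finsum_closed et_closed)
    also have "\<dots> = (\<Oplus>\<^bsub>ET\<^esub>i\<in>I. et (a i (D i f)) x) \<oplus>\<^bsub>ET\<^esub> (\<Oplus>\<^bsub>ET\<^esub>i\<in>I. \<Oplus>\<^bsub>ET\<^esub>k\<in>I. et (a i (s i k f)) (X k))"
      using f x by (intro et.T.finsum_addf) (auto simp: X a D s intro!: et.T.finsum_closed et_closed)
    also have "(\<Oplus>\<^bsub>ET\<^esub>i\<in>I. et (a i (D i f)) x) = et Z1 x"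
      unfolding Z1_def using f by (intro hx.map_finsum[symmetric]) (simp add: a D)
    also have "(\<Oplus>\<^bsub>ET\<^esub>i\<in>I. \<Oplus>\<^bsub>ET\<^esub>k\<in>I. et (a i (s i k f)) (X k)) = (\<Oplus>\<^bsub>ET\<^esub>k\<in>I. \<Oplus>\<^bsub>ET\<^esub>i\<in>I. et (a i (s i k f)) (X k))"
      using f by (intro et.T.finsum_swap) (auto simp: X a s intro!: et_closed)
    also have "\<dots> = (\<Oplus>\<^bsub>ET\<^esub>k\<in>I. et (P k) (X k))"
      using f cl X
      by (intro et.T.finsum_cong') (auto simp: P_def a s intro!: et_closed additive_map.map_finsum[OF hX, symmetric])
    finally show ?thesis .
  qed
  \<comment> \<open>Each application either differentiates the factor in E or braids with it and
    puts a u_k in front of x. Two applications give four kinds of terms: derivative twice,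
    derivative then braiding, braiding then derivative, braiding twice.\<close>
  have lop_lop: "lop (lact (vec Om) (c2 \<alpha> i j) (?u j)) (lop (?u i) (et f x)) =
      et (b i j (D j (D i f))) x \<oplus>\<^bsub>ET\<^esub> ((\<Oplus>\<^bsub>ET\<^esub>k\<in>I. et (b i j (s j k (D i f))) (X k)) \<oplus>\<^bsub>ET\<^esub>
      ((\<Oplus>\<^bsub>ET\<^esub>k\<in>I. et (b i j (D j (s i k f))) (X k)) \<oplus>\<^bsub>ET\<^esub>
       (\<Oplus>\<^bsub>ET\<^esub>k\<in>I. \<Oplus>\<^bsub>ET\<^esub>l\<in>I. et (b i j (s j l (s i k f))) (Y k l))))"
    if ij: "i < rk Om" "j < rk Om" for i j
  proof -
    interpret h: additive_map ET ET "lop (lact (vec Om) (c2 \<alpha> i j) (?u j))"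
      by unfold_locales (rule lop_hom[OF kcurv_vec_closed(2)[OF \<alpha> ij]])
    have "lop (?u i) (et f x) = et (D i f) x \<oplus>\<^bsub>ET\<^esub> (\<Oplus>\<^bsub>ET\<^esub>k\<in>I. et (s i k f) (X k))"
      using ij f x by (simp add: lop_stens u lval_def D_def s_def X_def)
    moreover have "lop (lact (vec Om) (c2 \<alpha> i j) (?u j)) (\<Oplus>\<^bsub>ET\<^esub>k\<in>I. et (s i k f) (X k)) =
        (\<Oplus>\<^bsub>ET\<^esub>k\<in>I. et (b i j (D j (s i k f))) (X k) \<oplus>\<^bsub>ET\<^esub> (\<Oplus>\<^bsub>ET\<^esub>l\<in>I. et (b i j (s j l (s i k f))) (Y k l)))"
      using ij f by (intro h.map_finsum_eq) (simp_all add: et_closed s X lop_b Y_def)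
    moreover have "\<dots> = (\<Oplus>\<^bsub>ET\<^esub>k\<in>I. et (b i j (D j (s i k f))) (X k)) \<oplus>\<^bsub>ET\<^esub>
       (\<Oplus>\<^bsub>ET\<^esub>k\<in>I. \<Oplus>\<^bsub>ET\<^esub>l\<in>I. et (b i j (s j l (s i k f))) (Y k l))"
      using ij f by (intro et.T.finsum_addf) (auto simp: X Y b D s intro!: et.T.finsum_closed et_closed)
    moreover have "(\<Oplus>\<^bsub>ET\<^esub>k\<in>I. et (s i k f) (X k)) \<in> carrier ET"
      "(\<Oplus>\<^bsub>ET\<^esub>k\<in>I. et (b i j (s j k (D i f))) (X k)) \<in> carrier ET"
      "(\<Oplus>\<^bsub>ET\<^esub>k\<in>I. et (b i j (D j (s i k f))) (X k)) \<in> carrier ET"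
      "(\<Oplus>\<^bsub>ET\<^esub>k\<in>I. \<Oplus>\<^bsub>ET\<^esub>l\<in>I. et (b i j (s j l (s i k f))) (Y k l)) \<in> carrier ET"
      using ij f by (auto simp: X Y b D s intro!: et.T.finsum_closed et_closed)
    ultimately show ?thesis
      using ij f x by (simp add: et_closed D lop_b X_def[symmetric] b et.T.a_assoc)
  qed
  have A2: "(\<Oplus>\<^bsub>ET\<^esub>i\<in>I. \<Oplus>\<^bsub>ET\<^esub>j\<in>I. lop (lact (vec Om) (c2 \<alpha> i j) (?u j)) (lop (?u i) (et f x))) =
      et Z2 x \<oplus>\<^bsub>ET\<^esub> ((\<Oplus>\<^bsub>ET\<^esub>k\<in>I. et (Q k) (X k)) \<oplus>\<^bsub>ET\<^esub> ((\<Oplus>\<^bsub>ET\<^esub>k\<in>I. et (R k) (X k)) \<oplus>\<^bsub>ET\<^esub>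
        (\<Oplus>\<^bsub>ET\<^esub>k\<in>I. \<Oplus>\<^bsub>ET\<^esub>l\<in>I. et (S k l) (Y k l))))"
  proof -
    have split2: "(\<Oplus>\<^bsub>ET\<^esub>i\<in>I. \<Oplus>\<^bsub>ET\<^esub>j\<in>I. p i j \<oplus>\<^bsub>ET\<^esub> q i j) =
        (\<Oplus>\<^bsub>ET\<^esub>i\<in>I. \<Oplus>\<^bsub>ET\<^esub>j\<in>I. p i j) \<oplus>\<^bsub>ET\<^esub> (\<Oplus>\<^bsub>ET\<^esub>i\<in>I. \<Oplus>\<^bsub>ET\<^esub>j\<in>I. q i j)"
      if "\<And>i j. \<lbrakk>i < rk Om; j < rk Om\<rbrakk> \<Longrightarrow> p i j \<in> carrier ET" "\<And>i j. \<lbrakk>i < rk Om; j < rk Om\<rbrakk> \<Longrightarrow> q i j \<in> carrier ET" for p q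
    proof -
      have "(\<Oplus>\<^bsub>ET\<^esub>i\<in>I. \<Oplus>\<^bsub>ET\<^esub>j\<in>I. p i j \<oplus>\<^bsub>ET\<^esub> q i j) = (\<Oplus>\<^bsub>ET\<^esub>i\<in>I. (\<Oplus>\<^bsub>ET\<^esub>j\<in>I. p i j) \<oplus>\<^bsub>ET\<^esub> (\<Oplus>\<^bsub>ET\<^esub>j\<in>I. q i j))"
        using that by (intro et.T.finsum_cong' et.T.finsum_addf) (auto intro!: et.T.a_closed et.T.finsum_closed)
      also have "\<dots> = (\<Oplus>\<^bsub>ET\<^esub>i\<in>I. \<Oplus>\<^bsub>ET\<^esub>j\<in>I. p i j) \<oplus>\<^bsub>ET\<^esub> (\<Oplus>\<^bsub>ET\<^esub>i\<in>I. \<Oplus>\<^bsub>ET\<^esub>j\<in>I. q i j)"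
        using that by (intro et.T.finsum_addf) (auto intro!: et.T.finsum_closed)
      finally show ?thesis .
    qed
    define p1 where "p1 i j = et (b i j (D j (D i f))) x" for i j
    define p2 where "p2 i j = (\<Oplus>\<^bsub>ET\<^esub>k\<in>I. et (b i j (s j k (D i f))) (X k))" for i j
    define p3 where "p3 i j = (\<Oplus>\<^bsub>ET\<^esub>k\<in>I. et (b i j (D j (s i k f))) (X k))" for i j
    define p4 where "p4 i j = (\<Oplus>\<^bsub>ET\<^esub>k\<in>I. \<Oplus>\<^bsub>ET\<^esub>l\<in>I. et (b i j (s j l (s i k f))) (Y k l))" for i j
    have p: "p1 i j \<in> carrier ET" "p2 i j \<in> carrier ET" "p3 i j \<in> carrier ET" "p4 i j \<in> carrier ET"
      if "i < rk Om" "j < rk Om" for i j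
      using that f x by (auto simp: p1_def p2_def p3_def p4_def X Y b D s intro!: et.T.finsum_closed et_closed)
    have "(\<Oplus>\<^bsub>ET\<^esub>i\<in>I. \<Oplus>\<^bsub>ET\<^esub>j\<in>I. lop (lact (vec Om) (c2 \<alpha> i j) (?u j)) (lop (?u i) (et f x))) =
        (\<Oplus>\<^bsub>ET\<^esub>i\<in>I. \<Oplus>\<^bsub>ET\<^esub>j\<in>I. p1 i j \<oplus>\<^bsub>ET\<^esub> (p2 i j \<oplus>\<^bsub>ET\<^esub> (p3 i j \<oplus>\<^bsub>ET\<^esub> p4 i j)))"
      using p by (intro et.T.finsum_cong')
        (auto simp: lop_lop p1_def[symmetric] p2_def[symmetric] p3_def[symmetric] p4_def[symmetric]
          intro!: et.T.finsum_closed)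
    also have "\<dots> = (\<Oplus>\<^bsub>ET\<^esub>i\<in>I. \<Oplus>\<^bsub>ET\<^esub>j\<in>I. p1 i j) \<oplus>\<^bsub>ET\<^esub> ((\<Oplus>\<^bsub>ET\<^esub>i\<in>I. \<Oplus>\<^bsub>ET\<^esub>j\<in>I. p2 i j) \<oplus>\<^bsub>ET\<^esub>
        ((\<Oplus>\<^bsub>ET\<^esub>i\<in>I. \<Oplus>\<^bsub>ET\<^esub>j\<in>I. p3 i j) \<oplus>\<^bsub>ET\<^esub> (\<Oplus>\<^bsub>ET\<^esub>i\<in>I. \<Oplus>\<^bsub>ET\<^esub>j\<in>I. p4 i j)))"
      using p by (simp add: split2)
    also have "(\<Oplus>\<^bsub>ET\<^esub>i\<in>I. \<Oplus>\<^bsub>ET\<^esub>j\<in>I. p1 i j) = et Z2 x"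
      unfolding Z2_def p1_def using f
      by (intro hx.map_finsum_eq[symmetric] hx.map_finsum_eq M.finsum_closed) (auto simp: b D)
    also have "(\<Oplus>\<^bsub>ET\<^esub>i\<in>I. \<Oplus>\<^bsub>ET\<^esub>j\<in>I. p2 i j) = (\<Oplus>\<^bsub>ET\<^esub>k\<in>I. et (Q k) (X k))"
      unfolding p2_def Q_def using f by (intro ET_finsum_swap3 et_hom1) (simp_all add: X b D s)
    also have "(\<Oplus>\<^bsub>ET\<^esub>i\<in>I. \<Oplus>\<^bsub>ET\<^esub>j\<in>I. p3 i j) = (\<Oplus>\<^bsub>ET\<^esub>k\<in>I. et (R k) (X k))"
      unfolding p3_def R_def using f by (intro ET_finsum_swap3 et_hom1) (simp_all add: X b D s)
    also have "(\<Oplus>\<^bsub>ET\<^esub>i\<in>I. \<Oplus>\<^bsub>ET\<^esub>j\<in>I. p4 i j) =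
        (\<Oplus>\<^bsub>ET\<^esub>k\<in>I. \<Oplus>\<^bsub>ET\<^esub>i\<in>I. \<Oplus>\<^bsub>ET\<^esub>j\<in>I. \<Oplus>\<^bsub>ET\<^esub>l\<in>I. et (b i j (s j l (s i k f))) (Y k l))"
      unfolding p4_def using f
      by (intro et.T.finsum_swap3) (auto simp: Y b s intro!: et.T.finsum_closed et_closed)
    also have "\<dots> = (\<Oplus>\<^bsub>ET\<^esub>k\<in>I. \<Oplus>\<^bsub>ET\<^esub>l\<in>I. et (S k l) (Y k l))"
    proof (rule et.T.finsum_cong')
      show "(\<lambda>k. \<Oplus>\<^bsub>ET\<^esub>l\<in>I. et (S k l) (Y k l)) \<in> I \<rightarrow> carrier ET"
        by (auto intro!: et.T.finsum_closed et_closed simp: S Y)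
      fix k assume "k \<in> I"
      then show "(\<Oplus>\<^bsub>ET\<^esub>i\<in>I. \<Oplus>\<^bsub>ET\<^esub>j\<in>I. \<Oplus>\<^bsub>ET\<^esub>l\<in>I. et (b i j (s j l (s i k f))) (Y k l)) =
          (\<Oplus>\<^bsub>ET\<^esub>l\<in>I. et (S k l) (Y k l))"
        unfolding S_def using f by (intro ET_finsum_swap3 et_hom1) (simp_all add: Y b s)
    qed simp
    finally show ?thesis .
  qed
  define SP where "SP = (\<Oplus>\<^bsub>ET\<^esub>k\<in>I. et (P k) (X k))"
  define SQ where "SQ = (\<Oplus>\<^bsub>ET\<^esub>k\<in>I. et (Q k) (X k))"
  define SR where "SR = (\<Oplus>\<^bsub>ET\<^esub>k\<in>I. et (R k) (X k))"
  define SS where "SS = (\<Oplus>\<^bsub>ET\<^esub>k\<in>I. \<Oplus>\<^bsub>ET\<^esub>l\<in>I. et (S k l) (Y k l))"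
  have sums: "SP \<in> carrier ET" "SQ \<in> carrier ET" "SR \<in> carrier ET" "SS \<in> carrier ET" "et Z2 x \<in> carrier ET"
    unfolding SP_def SQ_def SR_def SS_def
    using cl S Z X Y x by (auto intro!: et.T.finsum_closed et_closed)
  have "(\<Oplus>\<^bsub>ET\<^esub>k\<in>I. et (hsig \<alpha> f (dif Om (?\<xi> k))) (X k)) = (\<Oplus>\<^bsub>ET\<^esub>k\<in>I. et (P k) (X k) \<ominus>\<^bsub>ET\<^esub> (et (Q k) (X k) \<oplus>\<^bsub>ET\<^esub> et (R k) (X k)))"
  proof (rule et.T.finsum_cong')
    fix k assume "k \<in> I"
    then have k: "k < rk Om" by simp
    interpret h: additive_map E ET "\<lambda>m. et m (X k)" by (rule hX[OF k])
    show "et (hsig \<alpha> f (dif Om (?\<xi> k))) (X k) = et (P k) (X k) \<ominus>\<^bsub>ET\<^esub> (et (Q k) (X k) \<oplus>\<^bsub>ET\<^esub> et (R k) (X k))"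
      using cl[OF k] h.map_minus[of "P k" "Q k \<oplus>\<^bsub>E\<^esub> R k"] h.hom_add[of "Q k" "R k"] by (simp add: PQR[OF k, symmetric])
  qed (use cl X in \<open>auto intro!: et.T.minus_closed et.T.a_closed et_closed\<close>)
  also have "\<dots> = SP \<ominus>\<^bsub>ET\<^esub> (\<Oplus>\<^bsub>ET\<^esub>k\<in>I. et (Q k) (X k) \<oplus>\<^bsub>ET\<^esub> et (R k) (X k))"
    unfolding SP_def using cl X by (intro et.T.finsum_minus) (auto intro!: et.T.a_closed et_closed)
  also have "(\<Oplus>\<^bsub>ET\<^esub>k\<in>I. et (Q k) (X k) \<oplus>\<^bsub>ET\<^esub> et (R k) (X k)) = SQ \<oplus>\<^bsub>ET\<^esub> SR"
    unfolding SQ_def SR_def using cl X by (intro et.T.finsum_addf) (auto intro!: et_closed)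
  finally have main: "(\<Oplus>\<^bsub>ET\<^esub>k\<in>I. et (hsig \<alpha> f (dif Om (?\<xi> k))) (X k)) = SP \<ominus>\<^bsub>ET\<^esub> (SQ \<oplus>\<^bsub>ET\<^esub> SR)" .
  have SSeq: "(\<Oplus>\<^bsub>ET\<^esub>k\<in>I. \<Oplus>\<^bsub>ET\<^esub>l\<in>I. et (hsig \<alpha> f (?\<xi> k \<otimes> ?\<xi> l)) (Y k l)) = SS"
    unfolding SS_def using S Y
    by (intro et.T.finsum_cong') (auto simp: Seq[symmetric] intro!: et.T.finsum_closed et_closed)
  \<comment> \<open>Flatness has entered through \<open>Zeq\<close>, so the terms with second factor
    x cancel. The coefficients of u_k \<bullet> x combine to P - (Q + R), which \<open>PQR\<close>
    identifies, and the double braiding remains with a minus sign.\<close>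
  have "kcurv \<alpha> (et f x) = (et Z2 x \<oplus>\<^bsub>ET\<^esub> SP) \<ominus>\<^bsub>ET\<^esub> (et Z2 x \<oplus>\<^bsub>ET\<^esub> (SQ \<oplus>\<^bsub>ET\<^esub> (SR \<oplus>\<^bsub>ET\<^esub> SS)))"
    unfolding kcurv_def A1 A2 Zeq SP_def SQ_def SR_def SS_def ..
  also have "\<dots> = (SP \<ominus>\<^bsub>ET\<^esub> (SQ \<oplus>\<^bsub>ET\<^esub> SR)) \<ominus>\<^bsub>ET\<^esub> SS"
    using sums et.T.add_diff_add_cancel[of SP "et Z2 x" "SQ \<oplus>\<^bsub>ET\<^esub> (SR \<oplus>\<^bsub>ET\<^esub> SS)"]
    by (simp add: et.T.a_comm[of "et Z2 x"]) (simp add: a_minus_def et.T.minus_add et.T.a_assoc)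
  finally show ?thesis
    using main SSeq by (simp add: X_def Y_def)
qed

text \<open>The map (\<alpha> \<otimes> id)\<sigma>_E(f \<otimes> -) takes values in E rather than
  in A, so it is not itself an argument of \<open>curv_hat\<close>. Finite projectivity of
  \<Omega>^2 splits it into finitely many functionals \<beta>_m with coefficients h_m in E.\<close>

lemma kcurv_ImW:
  assumes fgp: "right_fgp (base Om) (forms Om 2)" and \<alpha>: "\<alpha> \<in> dual2" and t: "t \<in> carrier ET"
  shows "kcurv \<alpha> t \<in> ImW"
proof (rule et.tens_hom_in_subgroup[OF t et.T.abelian_group_axioms kcurv_hom[OF \<alpha>] ImW_subgroup])
  fix f x assume f: "f \<in> carrier E" and "x \<in> carrier T"
  then have x: "x \<in> carrier (tvec Om)" by simp
  obtain n :: nat and e \<beta> where e: "\<And>m. m < n \<Longrightarrow> e m \<in> piece Om 2"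
    and \<beta>: "\<And>m. m < n \<Longrightarrow> \<beta> m \<in> dual2"
    and dual: "\<And>\<omega>. \<omega> \<in> piece Om 2 \<Longrightarrow> \<omega> = (\<Oplus>m\<in>{..<n}. e m \<otimes> \<beta> m \<omega>)"
    by (rule fgp_dual_basis[OF fgp]) (rule that)
  define X where "X k = mul (emb1 Om (ub Om k)) x" for k
  define Y where "Y k l = mul (emb1 Om (ub Om l)) (X k)" for k l
  define h where "h m = hsig \<alpha> f (e m)" for m
  have X: "X k \<in> carrier (tvec Om)" if "k < rk Om" for k
    using that x by (simp add: X_def mul_closed emb1_closed ub_closed)
  have Y: "Y k l \<in> carrier (tvec Om)" if "k < rk Om" "l < rk Om" for k l
    using that X by (simp add: Y_def mul_closed emb1_closed ub_closed)
  have h: "h m \<in> carrier E" if "m < n" for m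
    using that f e by (simp add: h_def hsig_closed[OF \<alpha>])
  have \<beta>cl: "\<beta> m \<omega> \<in> piece Om 0" if "m < n" "\<omega> \<in> piece Om 2" for m \<omega>
    using dual2_closed[OF \<beta>[OF that(1)] that(2)] .
  \<comment> \<open>By right linearity \<omega> contributes only through the scalars
    \<beta>_m(\<omega>), and these pass across the tensor product to act on y.\<close>
  have ex: "et (hsig \<alpha> f \<omega>) y = (\<Oplus>\<^bsub>ET\<^esub>m\<in>{..<n}. et (h m) (lact (tvec Om) (\<beta> m \<omega>) y))"
    if \<omega>: "\<omega> \<in> piece Om 2" and y: "y \<in> carrier (tvec Om)" for \<omega> y
  proof -
    interpret g: additive_map "forms Om 2" E "hsig \<alpha> f"
      by unfold_locales (rule hsig_hom[OF \<alpha> f])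
    interpret ey: additive_map E ET "\<lambda>m. et m y"
      by unfold_locales (rule et_hom1[OF y])
    have tm: "e m \<otimes> \<beta> m \<omega> \<in> piece Om 2" if "m < n" for m
      using that e \<beta>cl \<omega> by (simp add: piece_mult(2))
    have "\<omega> = (\<Oplus>\<^bsub>forms Om 2\<^esub>m\<in>{..<n}. e m \<otimes> \<beta> m \<omega>)"
      using dual[OF \<omega>] finsum_forms[of "{..<n}" "\<lambda>m. e m \<otimes> \<beta> m \<omega>" 2] tm by simp
    moreover have "hsig \<alpha> f (\<Oplus>\<^bsub>forms Om 2\<^esub>m\<in>{..<n}. e m \<otimes> \<beta> m \<omega>) = (\<Oplus>\<^bsub>E\<^esub>m\<in>{..<n}. ract E (h m) (\<beta> m \<omega>))"
      using tm f e \<omega> \<beta>cl by (intro g.map_finsum_eq) (simp_all add: hsig_ract[OF \<alpha>] h_def)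
    ultimately have "et (hsig \<alpha> f \<omega>) y = et (\<Oplus>\<^bsub>E\<^esub>m\<in>{..<n}. ract E (h m) (\<beta> m \<omega>)) y" by simp
    also have "\<dots> = (\<Oplus>\<^bsub>ET\<^esub>m\<in>{..<n}. et (h m) (lact (tvec Om) (\<beta> m \<omega>) y))"
      using h \<beta>cl[OF _ \<omega>] y et.stens_balanced
      by (intro ey.map_finsum_eq) (simp_all add: E_ract)
    finally show ?thesis .
  qed
  define p where "p m = (\<Oplus>\<^bsub>tvec Om\<^esub>k\<in>I. lact (tvec Om) (c1 (\<beta> m) k) (X k))" for m
  define q where "q m = (\<Oplus>\<^bsub>tvec Om\<^esub>k\<in>I. \<Oplus>\<^bsub>tvec Om\<^esub>l\<in>I. lact (tvec Om) (c2 (\<beta> m) k l) (Y k l))" for m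
  have pq: "p m \<in> carrier (tvec Om)" "q m \<in> carrier (tvec Om)" if "m < n" for m
    unfolding p_def q_def using that X Y c1_closed[OF \<beta>] c2_closed[OF \<beta>]
    by (auto intro!: tvec.finsum_closed simp: lact_tvec_closed)
  have hm: "additive_map (tvec Om) ET (et (h m))" if "m < n" for m
    by unfold_locales (rule et_hom2[OF h[OF that]])
  have ex1: "et (hsig \<alpha> f (dif Om (xi Om k))) (X k) =
      (\<Oplus>\<^bsub>ET\<^esub>m\<in>{..<n}. et (h m) (lact (tvec Om) (c1 (\<beta> m) k) (X k)))" if "k < rk Om" for k
    by (rule trans[OF ex et.T.finsum_cong'])
      (use that X h in \<open>auto simp: piece_dif xi_closed c1_def[OF \<beta>] \<beta>cl lact_tvec_closed intro!: et_closed\<close>)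
  have ex2: "et (hsig \<alpha> f (xi Om k \<otimes> xi Om l)) (Y k l) =
      (\<Oplus>\<^bsub>ET\<^esub>m\<in>{..<n}. et (h m) (lact (tvec Om) (c2 (\<beta> m) k l) (Y k l)))" if "k < rk Om" "l < rk Om" for k l
    by (rule trans[OF ex et.T.finsum_cong'])
      (use that Y h in \<open>auto simp: piece_mult xi_closed c2_def[OF \<beta>] \<beta>cl lact_tvec_closed intro!: et_closed\<close>)
  have "(\<Oplus>\<^bsub>ET\<^esub>k\<in>I. et (hsig \<alpha> f (dif Om (xi Om k))) (X k)) =
      (\<Oplus>\<^bsub>ET\<^esub>k\<in>I. \<Oplus>\<^bsub>ET\<^esub>m\<in>{..<n}. et (h m) (lact (tvec Om) (c1 (\<beta> m) k) (X k)))"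
    using X h \<beta> by (intro et.T.finsum_cong')
      (auto simp: ex1 c1_closed lact_tvec_closed intro!: et.T.finsum_closed et_closed)
  also have "\<dots> = (\<Oplus>\<^bsub>ET\<^esub>m\<in>{..<n}. \<Oplus>\<^bsub>ET\<^esub>k\<in>I. et (h m) (lact (tvec Om) (c1 (\<beta> m) k) (X k)))"
    using X h \<beta> by (intro et.T.finsum_swap) (auto simp: lact_tvec_closed c1_closed intro!: et_closed)
  also have "\<dots> = (\<Oplus>\<^bsub>ET\<^esub>m\<in>{..<n}. et (h m) (p m))"
    using X h \<beta> pq unfolding p_def
    by (intro et.T.finsum_cong')
      (auto simp: lact_tvec_closed c1_closed intro!: et_closed additive_map.map_finsum[OF hm, symmetric])
  finally have s1: "(\<Oplus>\<^bsub>ET\<^esub>k\<in>I. et (hsig \<alpha> f (dif Om (xi Om k))) (X k)) = (\<Oplus>\<^bsub>ET\<^esub>m\<in>{..<n}. et (h m) (p m))" .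
  have "(\<Oplus>\<^bsub>ET\<^esub>k\<in>I. \<Oplus>\<^bsub>ET\<^esub>l\<in>I. et (hsig \<alpha> f (xi Om k \<otimes> xi Om l)) (Y k l)) =
      (\<Oplus>\<^bsub>ET\<^esub>k\<in>I. \<Oplus>\<^bsub>ET\<^esub>l\<in>I. \<Oplus>\<^bsub>ET\<^esub>m\<in>{..<n}. et (h m) (lact (tvec Om) (c2 (\<beta> m) k l) (Y k l)))"
    using Y h \<beta> by (intro et.T.finsum_cong')
      (auto simp: ex2 c2_closed lact_tvec_closed intro!: et.T.finsum_closed et_closed)
  also have "\<dots> = (\<Oplus>\<^bsub>ET\<^esub>m\<in>{..<n}. \<Oplus>\<^bsub>ET\<^esub>k\<in>I. \<Oplus>\<^bsub>ET\<^esub>l\<in>I. et (h m) (lact (tvec Om) (c2 (\<beta> m) k l) (Y k l)))"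
    using Y h \<beta> by (intro et.T.finsum_swap3) (auto simp: lact_tvec_closed c2_closed intro!: et_closed)
  also have "\<dots> = (\<Oplus>\<^bsub>ET\<^esub>m\<in>{..<n}. et (h m) (q m))"
  proof (rule et.T.finsum_cong')
    fix m assume "m \<in> {..<n}"
    then have m: "m < n" by simp
    interpret hm: additive_map "tvec Om" ET "et (h m)" by (rule hm[OF m])
    show "(\<Oplus>\<^bsub>ET\<^esub>k\<in>I. \<Oplus>\<^bsub>ET\<^esub>l\<in>I. et (h m) (lact (tvec Om) (c2 (\<beta> m) k l) (Y k l))) = et (h m) (q m)"
      unfolding q_def using Y c2_closed[OF \<beta>[OF m]]
      by (intro hm.map_finsum_eq[symmetric] hm.map_finsum_eq tvec.finsum_closed) (auto simp: lact_tvec_closed)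
  qed (use pq h in \<open>auto intro!: et_closed\<close>)
  finally have s2: "(\<Oplus>\<^bsub>ET\<^esub>k\<in>I. \<Oplus>\<^bsub>ET\<^esub>l\<in>I. et (hsig \<alpha> f (xi Om k \<otimes> xi Om l)) (Y k l)) =
      (\<Oplus>\<^bsub>ET\<^esub>m\<in>{..<n}. et (h m) (q m))" .
  have "kcurv \<alpha> (et f x) = (\<Oplus>\<^bsub>ET\<^esub>m\<in>{..<n}. et (h m) (p m)) \<ominus>\<^bsub>ET\<^esub> (\<Oplus>\<^bsub>ET\<^esub>m\<in>{..<n}. et (h m) (q m))"
    using kcurv_stens[OF \<alpha> f x] s1 s2 by (simp add: X_def Y_def)
  also have "\<dots> = (\<Oplus>\<^bsub>ET\<^esub>m\<in>{..<n}. et (h m) (p m) \<ominus>\<^bsub>ET\<^esub> et (h m) (q m))"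
    using pq h by (intro et.T.finsum_minus[symmetric]) (auto intro!: et_closed)
  also have "\<dots> \<in> ImW"
  proof (rule et.T.finsum_in_subgroup[OF ImW_subgroup])
    fix m assume "m \<in> {..<n}"
    then have m: "m < n" by simp
    \<comment> \<open>For fixed m, the scalars c1 and c2 of \<beta>_m applied to the products with x
      are the expansion of \<open>curv_hat\<close> at \<beta>_m, multiplied by x on the
      right.\<close>
    have "et (h m) (p m) \<ominus>\<^bsub>ET\<^esub> et (h m) (q m) = et (h m) (mul (curv_hat Om mul (\<beta> m)) x)"
      using additive_map.map_minus[OF hm[OF m] pq[OF m]] curv_hat_mul[OF \<beta>[OF m] x]
      by (simp add: p_def q_def X_def Y_def)
    also have "\<dots> \<in> ImW"
      using m x by (intro et_ImW h W_mul curv_hat_in_W \<beta>)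
    finally show "et (h m) (p m) \<ominus>\<^bsub>ET\<^esub> et (h m) (q m) \<in> ImW" .
  qed
  finally show "kcurv \<alpha> (et f x) \<in> ImW" .
qed

section \<open>The quotient algebra and its tensor products with E\<close>

lemma ring_dalg_hom: "ring_hom_ring T (T Quot W) (dproj Om mul)"
  using W.rcos_ring_hom_ring by (simp add: dproj_def[abs_def])

abbreviation "D \<equiv> dalg Om mul"
abbreviation "\<pi> \<equiv> dproj Om mul"

lemma dalg_fields:
  "carrier D = carrier (T Quot W)" "add D = add (T Quot W)" "zero D = zero (T Quot W)"
  "lact D a X = \<pi> (emb0 Om a) \<otimes>\<^bsub>T Quot W\<^esub> X" "ract D X a = X \<otimes>\<^bsub>T Quot W\<^esub> \<pi> (emb0 Om a)"
  by (simp_all add: dalg_def Let_def ring.defs bimod.defs)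

sublocale Q: ring "T Quot W"
  by (rule W.quotient_is_ring)

lemma dproj_carrier: "carrier D = \<pi> ` carrier (tvec Om)"
  by (auto simp: dalg_fields FactRing_def A_RCOSETS_def RCOSETS_def dproj_def a_r_coset_def)

lemma dproj_props:
  assumes "x \<in> carrier (tvec Om)"
  shows dproj_closed: "\<pi> x \<in> carrier D"
    and dproj_add: "y \<in> carrier (tvec Om) \<Longrightarrow> \<pi> (x \<oplus>\<^bsub>tvec Om\<^esub> y) = \<pi> x \<oplus>\<^bsub>D\<^esub> \<pi> y"
    and dproj_mul: "y \<in> carrier (tvec Om) \<Longrightarrow> \<pi> (mul x y) = \<pi> x \<otimes>\<^bsub>T Quot W\<^esub> \<pi> y"
    and dproj_lact: "a \<in> piece Om 0 \<Longrightarrow> \<pi> (lact (tvec Om) a x) = lact D a (\<pi> x)"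
    and dproj_ract: "a \<in> piece Om 0 \<Longrightarrow> \<pi> (mul x (emb0 Om a)) = ract D (\<pi> x) a"
proof -
  interpret h: ring_hom_ring T "T Quot W" \<pi> by (rule ring_dalg_hom)
  show "\<pi> x \<in> carrier D" using assms by (simp add: dproj_carrier)
  show "y \<in> carrier (tvec Om) \<Longrightarrow> \<pi> (x \<oplus>\<^bsub>tvec Om\<^esub> y) = \<pi> x \<oplus>\<^bsub>D\<^esub> \<pi> y"
    using h.hom_add[of x y] assms by (simp add: dalg_fields)
  show m: "y \<in> carrier (tvec Om) \<Longrightarrow> \<pi> (mul x y) = \<pi> x \<otimes>\<^bsub>T Quot W\<^esub> \<pi> y" for y
    using h.hom_mult[of x y] assms by simp
  show "a \<in> piece Om 0 \<Longrightarrow> \<pi> (lact (tvec Om) a x) = lact D a (\<pi> x)"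
    using h.hom_mult[of "emb0 Om a" x] assms by (simp add: mul_emb0 emb0_closed dalg_fields)
  show "a \<in> piece Om 0 \<Longrightarrow> \<pi> (mul x (emb0 Om a)) = ract D (\<pi> x) a"
    using m[of "emb0 Om a"] by (simp add: emb0_closed dalg_fields)
qed

lemma dproj_hom: "\<pi> \<in> add_hom T D"
  by (rule add_homI) (simp_all add: dproj_closed dproj_add)

lemma dproj_zero: "w \<in> W \<Longrightarrow> \<pi> w = \<zero>\<^bsub>D\<^esub>"
  using W.a_rcos_const[of w] by (simp add: dproj_def dalg_fields FactRing_def)

lemma dproj_eqD:
  assumes "x \<in> carrier (tvec Om)" "y \<in> carrier (tvec Om)" "\<pi> x = \<pi> y"
  shows "x \<ominus>\<^bsub>tvec Om\<^esub> y \<in> W"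
proof -
  have "x \<ominus>\<^bsub>T\<^esub> y \<in> W"
    using T.quotient_eq_iff_same_a_r_cos[OF W.ideal_axioms, of x y] assms by (simp add: dproj_def)
  then show ?thesis by (simp add: a_minus_def a_inv_def m_inv_def)
qed

lemma abelian_group_dalg: "abelian_group D"
  using abelian_groupE[OF Q.abelian_group_axioms] by (intro abelian_groupI) (auto simp: dalg_fields)

lemma dalg_actions_closed:
  "\<lbrakk>a \<in> piece Om 0; X \<in> carrier D\<rbrakk> \<Longrightarrow> lact D a X \<in> carrier D"
  "\<lbrakk>a \<in> piece Om 0; X \<in> carrier D\<rbrakk> \<Longrightarrow> ract D X a \<in> carrier D"
  using Q.m_closed dproj_closed[OF emb0_closed] by (simp_all add: dalg_fields)

sublocale ed: tensor_pair "base Om" E D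
  by (rule tensor_pair.intro[OF M.abelian_group_axioms abelian_group_dalg])
    (simp_all add: E_ract dalg_actions_closed)

sublocale de: tensor_pair "base Om" D E
  by (rule tensor_pair.intro[OF abelian_group_dalg M.abelian_group_axioms])
    (simp_all add: E_lact dalg_actions_closed)

lemma id_hom: "id \<in> add_hom E E" by (simp add: add_homI)

lemma proj_ET_props:
  shows proj_ET_hom: "tmap (base Om) E D id \<pi> \<in> add_hom ET (otens Om E D)"
    and proj_ET_stens: "\<lbrakk>f \<in> carrier E; x \<in> carrier (tvec Om)\<rbrakk> \<Longrightarrow>
      tmap (base Om) E D id \<pi> (et f x) = ostens Om E D f (\<pi> x)"
  using tmap_props[OF et.tensor_pair_axioms ed.tensor_pair_axioms id_hom dproj_hom]
  by (simp_all add: dproj_lact)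

lemma proj_TE_props:
  shows proj_TE_hom: "tmap (base Om) D E \<pi> id \<in> add_hom (otens Om T E) (otens Om D E)"
    and proj_TE_stens: "\<lbrakk>x \<in> carrier (tvec Om); f \<in> carrier E\<rbrakk> \<Longrightarrow>
      tmap (base Om) D E \<pi> id (ostens Om T E x f) = ostens Om D E (\<pi> x) f"
  using tmap_props[OF te.tensor_pair_axioms de.tensor_pair_axioms dproj_hom id_hom]
  by (simp_all add: dproj_ract)

text \<open>The projection kills the ideal in the second factor. The claim is an instance of
  \<open>ImW_hom\<close> with the trivial subgroup as target.\<close>

lemma proj_ImW:
  assumes "X \<in> ImW"
  shows "tmap (base Om) E D id \<pi> X = \<zero>\<^bsub>otens Om E D\<^esub>"
proof -
  have "tmap (base Om) E D id \<pi> X \<in> {\<zero>\<^bsub>otens Om E D\<^esub>}"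
  proof (rule ImW_hom[OF ed.T.abelian_group_axioms proj_ET_hom _ assms])
    show "subgroup {\<zero>\<^bsub>otens Om E D\<^esub>} (add_monoid (otens Om E D))"
      using group.triv_subgroup[OF ed.T.a_group] by simp
    fix f w assume fw: "f \<in> carrier E" "w \<in> W"
    interpret h: additive_map D "otens Om E D" "ostens Om E D f"
      by unfold_locales (rule ed.stens_hom_right[OF fw(1)])
    show "tmap (base Om) E D id \<pi> (et f w) \<in> {\<zero>\<^bsub>otens Om E D\<^esub>}"
      using fw h.hom_zero by (simp add: proj_ET_stens W_closed dproj_zero)
  qed
  then show ?thesis by simp
qed

section \<open>The crossing map on the ideal and on the quotient\<close>

context
  fixes \<theta> :: "('w tvec \<times> 'e) frag set \<Rightarrow> ('e \<times> 'w tvec) frag set"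
  assumes theta: "crossing_map Om mul E \<theta>"
    and fgp2: "right_fgp (base Om) (forms Om 2)"
begin

abbreviation "te \<equiv> ostens Om T E"

lemma theta_hom: "\<theta> \<in> add_hom (otens Om T E) ET"
  using theta by (simp add: crossing_map_def Let_def)

lemma te_closed: "\<lbrakk>x \<in> carrier (tvec Om); e \<in> carrier E\<rbrakk> \<Longrightarrow> te x e \<in> carrier (otens Om T E)"
  using te.stens_closed by simp

lemma te_hom: "e \<in> carrier E \<Longrightarrow> (\<lambda>x. te x e) \<in> add_hom (tvec Om) (otens Om T E)"
  using te.stens_hom_left[of e] by (simp add: add_hom_def hom_def)

lemma theta_te_hom: "e \<in> carrier E \<Longrightarrow> (\<lambda>x. \<theta> (te x e)) \<in> add_hom (tvec Om) ET"
  by (rule add_hom_compose[OF te_hom theta_hom])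

lemma theta_closed: "\<lbrakk>x \<in> carrier (tvec Om); e \<in> carrier E\<rbrakk> \<Longrightarrow> \<theta> (te x e) \<in> carrier ET"
  by (rule add_hom_closed[OF theta_te_hom])

lemma theta_emb0: "\<lbrakk>a \<in> piece Om 0; e \<in> carrier E\<rbrakk> \<Longrightarrow> \<theta> (te (emb0 Om a) e) = et (lact E a e) (emb0 Om \<one>)"
  using theta by (simp add: crossing_map_def Let_def one_T)

lemma theta_emb1:
  assumes "u \<in> V" "x \<in> carrier (tvec Om)" "e \<in> carrier E"
  shows "\<theta> (te (mul (emb1 Om u) x) e) = lop u (\<theta> (te x e))"
proof -
  have "\<theta> (te (emb1 Om u \<otimes>\<^bsub>T\<^esub> x) e) = tlift ET (\<lambda>(f, x). et (vact Om E u f) x \<oplus>\<^bsub>ET\<^esub>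
      tmap (base Om) E T id (\<lambda>w'. emb1 Om w' \<otimes>\<^bsub>T\<^esub> x) (esigi Om E u f)) (\<theta> (te x e))"
    using theta assms unfolding crossing_map_def Let_def by simp
  then show ?thesis
    using lop_eq[OF assms(1) theta_closed[OF assms(2,3)]] by simp
qed

text \<open>\<open>crossing_map\<close> asks only for additivity and the recursion. Left linearity
  over A follows by the induction principle of the bullet algebra: a(u \<bullet> y) is (a.u)
  \<bullet> y, and \<open>lop\<close> is left linear in the vector field.\<close>

lemma theta_lact:
  assumes a: "a \<in> piece Om 0" and x: "x \<in> carrier (tvec Om)" and e: "e \<in> carrier E"
  shows "\<theta> (te (lact (tvec Om) a x) e) = lact ET a (\<theta> (te x e))"
proof -
  let ?d = "\<lambda>x. \<theta> (te (lact (tvec Om) a x) e) \<ominus>\<^bsub>ET\<^esub> lact ET a (\<theta> (te x e))"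
  \<comment> \<open>The index set with one element gives the shape required by
    \<open>preimage_subgroup\<close>; the equality is put as membership of the difference in the
    trivial subgroup.\<close>
  let ?H = "{x \<in> carrier (tvec Om). \<forall>p\<in>{()}. ?d x \<in> {\<zero>\<^bsub>ET\<^esub>}}"
  have cl: "\<theta> (te (lact (tvec Om) a y) e) \<in> carrier ET" "lact ET a (\<theta> (te y e)) \<in> carrier ET"
    if "y \<in> carrier (tvec Om)" for y
    using that a e by (auto intro!: theta_closed lact_tvec_closed add_hom_closed[OF ET_lact_hom])
  have mem: "y \<in> ?H" if "y \<in> carrier (tvec Om)" "\<theta> (te (lact (tvec Om) a y) e) = lact ET a (\<theta> (te y e))" for y
    using that cl[OF that(1)] by (simp add: et.T.minus_eq_zero_iff)
  have "x \<in> ?H"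
  proof (rule bullet_subgroup[OF _ _ _ x])
    show "subgroup ?H (add_monoid (tvec Om))"
    proof (rule preimage_subgroup[OF tvec_group et.T.abelian_group_axioms])
      show "?d \<in> add_hom (tvec Om) ET"
        by (intro et.T.add_hom_diff add_hom_compose[OF lact_tvec_hom[OF a] theta_te_hom[OF e]]
            add_hom_compose[OF theta_te_hom[OF e] ET_lact_hom[OF a]])
      show "subgroup {\<zero>\<^bsub>ET\<^esub>} (add_monoid ET)"
        using group.triv_subgroup[OF et.T.a_group] by simp
    qed
    show "emb0 Om b \<in> ?H" if "b \<in> piece Om 0" for b
      using that a e by (intro mem) (simp_all add: emb0_closed lact_emb0 theta_emb0 piece_mult ET_lact_stens E_lact one_piece E_mult_lact)
    show "mul (emb1 Om u) y \<in> ?H" if "u \<in> V" "y \<in> carrier (tvec Om)" for u y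
    proof (rule mem)
      have "\<theta> (te (lact (tvec Om) a (mul (emb1 Om u) y)) e) = \<theta> (te (mul (emb1 Om (lact (vec Om) a u)) y) e)"
        using that a by (simp add: mul_emb1_lact)
      also have "\<dots> = lact ET a (\<theta> (te (mul (emb1 Om u) y) e))"
        using that a e by (simp add: theta_emb1 vec.lact_closed lop_lact theta_closed)
      finally show "\<theta> (te (lact (tvec Om) a (mul (emb1 Om u) y)) e) = lact ET a (\<theta> (te (mul (emb1 Om u) y) e))" .
    qed (use that in \<open>simp add: mul_closed emb1_closed\<close>)
  qed
  then have "?d x = \<zero>\<^bsub>ET\<^esub>" by simp
  then show ?thesis using cl[OF x] by (simp add: et.T.minus_eq_zero_iff)
qed

text \<open>Each term of \<open>curv_hat_mul\<close> is a product with vector fields on the left, in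
  the order in which \<open>theta_emb1\<close> turns them into operators, and the coefficients are
  absorbed into the vector fields.\<close>

lemma theta_curv:
  assumes \<alpha>: "\<alpha> \<in> dual2" and y: "y \<in> carrier (tvec Om)" and e: "e \<in> carrier E"
  shows "\<theta> (te (mul (curv_hat Om mul \<alpha>) y) e) = kcurv \<alpha> (\<theta> (te y e))"
proof -
  interpret h: additive_map "tvec Om" ET "\<lambda>x. \<theta> (te x e)"
    by unfold_locales (rule theta_te_hom[OF e])
  have u: "ub Om i \<in> V" if "i < rk Om" for i using that by (rule ub_closed)
  have c: "mul (emb1 Om (ub Om i)) z \<in> carrier (tvec Om)" if "i < rk Om" "z \<in> carrier (tvec Om)" for i z
    using that by (simp add: mul_closed emb1_closed u)
  have "\<theta> (te (\<Oplus>\<^bsub>tvec Om\<^esub>i\<in>I. lact (tvec Om) (c1 \<alpha> i) (mul (emb1 Om (ub Om i)) y)) e) =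
      (\<Oplus>\<^bsub>ET\<^esub>i\<in>I. lop (lact (vec Om) (c1 \<alpha> i) (ub Om i)) (\<theta> (te y e)))"
    using y e
    by (intro h.map_finsum_eq)
      (simp_all add: lact_tvec_closed c1_closed[OF \<alpha>] c u mul_emb1_lact[symmetric] theta_emb1 vec.lact_closed mul_closed emb1_closed)
  moreover have "\<theta> (te (\<Oplus>\<^bsub>tvec Om\<^esub>i\<in>I. \<Oplus>\<^bsub>tvec Om\<^esub>j\<in>I. lact (tvec Om) (c2 \<alpha> i j)
        (mul (emb1 Om (ub Om j)) (mul (emb1 Om (ub Om i)) y))) e) =
      (\<Oplus>\<^bsub>ET\<^esub>i\<in>I. \<Oplus>\<^bsub>ET\<^esub>j\<in>I. lop (lact (vec Om) (c2 \<alpha> i j) (ub Om j)) (lop (ub Om i) (\<theta> (te y e))))"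
    using y e
    by (intro h.map_finsum_eq tvec.finsum_closed)
      (auto simp: lact_tvec_closed c2_closed[OF \<alpha>] c u mul_emb1_lact[symmetric] theta_emb1 vec.lact_closed mul_closed emb1_closed)
  moreover have "(\<Oplus>\<^bsub>tvec Om\<^esub>i\<in>I. lact (tvec Om) (c1 \<alpha> i) (mul (emb1 Om (ub Om i)) y)) \<in> carrier (tvec Om)"
    "(\<Oplus>\<^bsub>tvec Om\<^esub>i\<in>I. \<Oplus>\<^bsub>tvec Om\<^esub>j\<in>I. lact (tvec Om) (c2 \<alpha> i j)
        (mul (emb1 Om (ub Om j)) (mul (emb1 Om (ub Om i)) y))) \<in> carrier (tvec Om)"
    using y by (auto intro!: tvec.finsum_closed simp: lact_tvec_closed c1_closed[OF \<alpha>] c2_closed[OF \<alpha>] c)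
  ultimately show ?thesis
    by (simp add: curv_hat_mul[OF \<alpha> y] kcurv_def h.map_minus)
qed

text \<open>For x in A this is \<open>theta_lact\<close>, for x in Vec A the stability
  \<open>ImW_lop\<close>; the induction principle does the rest.\<close>

lemma theta_left_ideal:
  assumes x: "x \<in> carrier (tvec Om)" and y: "y \<in> carrier (tvec Om)" and e: "e \<in> carrier E"
    and mem: "\<theta> (te y e) \<in> ImW"
  shows "\<theta> (te (mul x y) e) \<in> ImW"
proof -
  let ?H = "{x \<in> carrier (tvec Om). \<forall>p\<in>{()}. \<theta> (te (mul x y) e) \<in> ImW}"
  have "x \<in> ?H"
  proof (rule bullet_subgroup[OF _ _ _ x])
    show "subgroup ?H (add_monoid (tvec Om))"
      by (rule preimage_subgroup[OF tvec_group et.T.abelian_group_axioms _ ImW_subgroup])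
        (rule add_hom_compose[OF mul_hom1[OF y] theta_te_hom[OF e]])
    show "emb0 Om b \<in> ?H" if "b \<in> piece Om 0" for b
      using that y e mem by (simp add: emb0_closed mul_emb0 theta_lact ImW_lact)
    show "mul (emb1 Om u) z \<in> ?H" if "u \<in> V" "z \<in> carrier (tvec Om)" "z \<in> ?H" for u z
      using that y e by (simp add: mul_closed emb1_closed mul_assoc theta_emb1 ImW_lop)
  qed
  then show ?thesis by simp
qed

text \<open>The set J allows an arbitrary right factor y. By associativity it is then closed under
  right multiplication, and \<open>theta_left_ideal\<close> closes it under left multiplication. It
  contains the generators because \<open>kcurv_ImW\<close> holds for every element of the target, in
  particular for \<theta>(y \<otimes> e).\<close>

lemma theta_W:
  assumes w: "w \<in> W" and e: "e \<in> carrier E"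
  shows "\<theta> (te w e) \<in> ImW"
proof -
  let ?J = "{x \<in> carrier (tvec Om). \<forall>(y, e)\<in>carrier (tvec Om) \<times> carrier E. \<theta> (te (mul x y) e) \<in> ImW}"
  have sub: "subgroup {x \<in> carrier (tvec Om). \<forall>p\<in>carrier (tvec Om) \<times> carrier E.
      (case p of (y, e) \<Rightarrow> \<lambda>x. \<theta> (te (mul x y) e)) x \<in> ImW} (add_monoid (tvec Om))"
    by (rule preimage_subgroup[OF tvec_group et.T.abelian_group_axioms _ ImW_subgroup])
      (auto intro: add_hom_compose[OF mul_hom1 theta_te_hom])
  have "ideal ?J T"
  proof (rule idealI[OF T.ring_axioms])
    show "subgroup ?J (add_monoid T)"
      using sub subgroup.subset[OF sub] unfolding subgroup_def by (simp add: m_inv_def case_prod_beta)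
    show "x \<otimes>\<^bsub>T\<^esub> a \<in> ?J" if "a \<in> ?J" "x \<in> carrier T" for a x
      using that theta_left_ideal[of x "mul a y" e for y e] by (auto simp: mul_closed mul_assoc)
    show "a \<otimes>\<^bsub>T\<^esub> x \<in> ?J" if "a \<in> ?J" "x \<in> carrier T" for a x
      using that by (auto simp: mul_closed mul_assoc)
  qed
  moreover have "curv_hat Om mul ` dual2 \<subseteq> ?J"
    by (auto simp: curv_hat_closed theta_curv intro!: kcurv_ImW[OF fgp2] theta_closed)
  ultimately have "W \<subseteq> ?J"
    unfolding curv_ideal_def by (rule T.genideal_minimal)
  \<comment> \<open>Membership in J is specialised to the right factor 1.\<close>
  then have "\<theta> (te (mul w (emb0 Om \<one>)) e) \<in> ImW"
    using w e emb0_closed[OF one_piece] by blast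
  moreover have "mul w (emb0 Om \<one>) = w"
    using T.r_one[of w] W_closed[OF w] by (simp add: one_T)
  ultimately show ?thesis by simp
qed

lemma theta_image: "\<theta> ` tmap (base Om) T E id id ` carrier (otens Om TW E) \<subseteq> ImW"
proof clarify
  fix X assume X: "X \<in> carrier (otens Om TW E)"
  show "\<theta> (tmap (base Om) T E id id X) \<in> ImW"
    by (rule wl.tens_hom_in_subgroup[OF X et.T.abelian_group_axioms
          add_hom_compose[OF tmap_W_left_hom theta_hom] ImW_subgroup])
      (simp add: tmap_W_left_stens theta_W)
qed

text \<open>Uses a chosen representative of the coset. Two representatives differ by an element of
  the ideal, whose image under \<theta> dies in the tensor product with the quotient, so the choice
  does not matter.\<close>

definition dtheta :: "'w tvec set \<Rightarrow> 'e \<Rightarrow> ('e \<times> 'w tvec set) frag set" where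
  "dtheta X e = tmap (base Om) E D id \<pi> (\<theta> (te (SOME x. x \<in> carrier (tvec Om) \<and> \<pi> x = X) e))"

lemma dtheta_eq:
  assumes x: "x \<in> carrier (tvec Om)" and e: "e \<in> carrier E"
  shows "dtheta (\<pi> x) e = tmap (base Om) E D id \<pi> (\<theta> (te x e))"
proof -
  let ?y = "SOME y. y \<in> carrier (tvec Om) \<and> \<pi> y = \<pi> x"
  have y: "?y \<in> carrier (tvec Om)" "\<pi> ?y = \<pi> x"
    using someI[of "\<lambda>y. y \<in> carrier (tvec Om) \<and> \<pi> y = \<pi> x" x] x by auto
  interpret h: additive_map "tvec Om" "otens Om E D" "\<lambda>x. tmap (base Om) E D id \<pi> (\<theta> (te x e))"
    by unfold_locales (rule add_hom_compose[OF theta_te_hom[OF e] proj_ET_hom])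
  have "tmap (base Om) E D id \<pi> (\<theta> (te ?y e)) \<ominus>\<^bsub>otens Om E D\<^esub> tmap (base Om) E D id \<pi> (\<theta> (te x e)) = \<zero>\<^bsub>otens Om E D\<^esub>"
    using h.map_minus[OF y(1) x] proj_ImW[OF theta_W[OF dproj_eqD[OF y(1) x y(2)] e]] by simp
  then show ?thesis
    using h.hom_closed[OF y(1)] h.hom_closed[OF x] by (simp add: dtheta_def ed.T.minus_eq_zero_iff)
qed

lemma dtheta_balanced: "balanced_map (base Om) D E (otens Om E D) dtheta"
proof (rule balanced_mapI)
  fix e assume e: "e \<in> carrier E"
  have h: "(\<lambda>x. tmap (base Om) E D id \<pi> (\<theta> (te x e))) \<in> add_hom (tvec Om) (otens Om E D)"
    by (rule add_hom_compose[OF theta_te_hom[OF e] proj_ET_hom])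
  show "(\<lambda>X. dtheta X e) \<in> add_hom D (otens Om E D)"
  proof (rule add_homI)
    fix X assume "X \<in> carrier D"
    then show "dtheta X e \<in> carrier (otens Om E D)"
      using add_hom_closed[OF h] e by (auto simp: dproj_carrier dtheta_eq)
  next
    fix X Y assume "X \<in> carrier D" "Y \<in> carrier D"
    then obtain x y where "x \<in> carrier (tvec Om)" "y \<in> carrier (tvec Om)" "X = \<pi> x" "Y = \<pi> y"
      by (auto simp: dproj_carrier)
    then show "dtheta (X \<oplus>\<^bsub>D\<^esub> Y) e = dtheta X e \<oplus>\<^bsub>otens Om E D\<^esub> dtheta Y e"
      using add_hom_add[OF h] e by (simp add: dtheta_eq dproj_add[symmetric])
  qed
next
  fix X assume "X \<in> carrier D"
  then obtain x where x: "x \<in> carrier (tvec Om)" "X = \<pi> x" by (auto simp: dproj_carrier)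
  have h: "(\<lambda>e. tmap (base Om) E D id \<pi> (\<theta> (te x e))) \<in> add_hom E (otens Om E D)"
    using x by (intro add_hom_compose[OF add_hom_compose[OF te.stens_hom_right theta_hom] proj_ET_hom]) simp
  show "(\<lambda>e. dtheta X e) \<in> add_hom E (otens Om E D)"
    by (rule add_hom_cong[OF h]) (simp_all add: x dtheta_eq M.abelian_monoid_axioms)
next
  fix X a e assume "X \<in> carrier D" "a \<in> carrier (base Om)" and e: "e \<in> carrier E"
  then obtain x where x: "x \<in> carrier (tvec Om)" "X = \<pi> x" and a: "a \<in> piece Om 0"
    by (auto simp: dproj_carrier)
  \<comment> \<open>The right action on the quotient is induced by \<bullet>, as is the one on T, so
    the balancing of the source tensor product carries over.\<close>
  show "dtheta (ract D X a) e = dtheta X (lact E a e)"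
    using x a e te.stens_balanced[of x a e]
    by (simp add: dproj_ract[symmetric] dtheta_eq mul_closed emb0_closed E_lact)
qed

text \<open>Existence is the lift of \<open>dtheta\<close>, cut down to its carrier. Extensionality
  is what makes the induced map unique as a function and not only on the tensor product.\<close>

lemma quotient_theta:
  "\<exists>!\<theta>'. \<theta>' \<in> add_hom (otens Om D E) (otens Om E D) \<and> \<theta>' \<in> extensional (carrier (otens Om D E)) \<and>
     (\<forall>X\<in>carrier (otens Om T E). \<theta>' (tmap (base Om) D E \<pi> id X) = tmap (base Om) E D id \<pi> (\<theta> X))"
proof (rule ex_ex1I)
  let ?t = "tlift (otens Om E D) (\<lambda>(X, e). dtheta X e)"
  note t = de.tlift_hom[OF ed.T.abelian_group_axioms dtheta_balanced]
    de.tlift_stens[OF ed.T.abelian_group_axioms dtheta_balanced]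
  have "restrict ?t (carrier (otens Om D E)) (tmap (base Om) D E \<pi> id X) = tmap (base Om) E D id \<pi> (\<theta> X)"
    if X: "X \<in> carrier (otens Om T E)" for X
  proof -
    have "?t (tmap (base Om) D E \<pi> id X) = tmap (base Om) E D id \<pi> (\<theta> X)"
      by (rule te.tens_hom_eqI[OF X ed.T.abelian_group_axioms add_hom_compose[OF proj_TE_hom t(1)]
            add_hom_compose[OF theta_hom proj_ET_hom]])
        (simp add: proj_TE_stens t(2) dproj_closed dtheta_eq)
    then show ?thesis using add_hom_closed[OF proj_TE_hom X] by simp
  qed
  moreover have "restrict ?t (carrier (otens Om D E)) \<in> add_hom (otens Om D E) (otens Om E D)"
    by (rule add_hom_cong[OF t(1)]) (simp_all add: de.T.abelian_monoid_axioms)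
  ultimately show "\<exists>\<theta>'. \<theta>' \<in> add_hom (otens Om D E) (otens Om E D) \<and> \<theta>' \<in> extensional (carrier (otens Om D E)) \<and>
     (\<forall>X\<in>carrier (otens Om T E). \<theta>' (tmap (base Om) D E \<pi> id X) = tmap (base Om) E D id \<pi> (\<theta> X))"
    by blast
next
  fix \<theta>1 \<theta>2
  assume 1: "\<theta>1 \<in> add_hom (otens Om D E) (otens Om E D) \<and> \<theta>1 \<in> extensional (carrier (otens Om D E)) \<and>
     (\<forall>X\<in>carrier (otens Om T E). \<theta>1 (tmap (base Om) D E \<pi> id X) = tmap (base Om) E D id \<pi> (\<theta> X))"
    and 2: "\<theta>2 \<in> add_hom (otens Om D E) (otens Om E D) \<and> \<theta>2 \<in> extensional (carrier (otens Om D E)) \<and>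
     (\<forall>X\<in>carrier (otens Om T E). \<theta>2 (tmap (base Om) D E \<pi> id X) = tmap (base Om) E D id \<pi> (\<theta> X))"
  \<comment> \<open>The projection to the quotient is onto, so every simple tensor comes from one
    over T, where the values of both maps are prescribed.\<close>
  have gen: "\<theta>1 (ostens Om D E X e) = \<theta>2 (ostens Om D E X e)" if "X \<in> carrier D" "e \<in> carrier E" for X e
  proof -
    obtain x where x: "x \<in> carrier (tvec Om)" "X = \<pi> x" using \<open>X \<in> carrier D\<close> by (auto simp: dproj_carrier)
    then have "ostens Om D E X e = tmap (base Om) D E \<pi> id (te x e)"
      using that by (simp add: proj_TE_stens)
    then show ?thesis using 1 2 te_closed[OF x(1) that(2)] by simp
  qed
  show "\<theta>1 = \<theta>2"
  proof (rule extensionalityI)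
    show "\<theta>1 Z = \<theta>2 Z" if "Z \<in> carrier (otens Om D E)" for Z
      by (rule de.tens_hom_eqI[where h = \<theta>1 and k = \<theta>2, OF that ed.T.abelian_group_axioms])
        (use 1 2 gen in simp_all)
  qed (use 1 2 in simp_all)
qed

end

end

theorem corollary7p3:
  fixes Om :: "'w geometry"
    and mul :: "'w tvec_op"
    and E :: "('w, 'e) cbimod"
    and \<theta> :: "('w tvec \<times> 'e) frag set \<Rightarrow>
              ('e \<times> 'w tvec) frag set"
  assumes "geometry Om"
    and "bullet_product Om mul"
    and "flat_bimod Om E"
    and "right_fgp (base Om) (forms Om 2)"
    and "crossing_map Om mul E \<theta>"
  shows "\<theta> ` tmap (base Om) (tvec_bullet Om mul) E id id `
             carrier (tens (base Om) ((tvec_bullet Om mul)\<lparr>carrier := curv_ideal Om mul\<rparr>) E)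
         \<subseteq> tmap (base Om) E (tvec_bullet Om mul) id id `
             carrier (tens (base Om) E ((tvec_bullet Om mul)\<lparr>carrier := curv_ideal Om mul\<rparr>))
         \<and> (\<exists>!\<theta>'. \<theta>' \<in> add_hom (tens (base Om) (dalg Om mul) E) (tens (base Om) E (dalg Om mul)) \<and>
               \<theta>' \<in> extensional (carrier (tens (base Om) (dalg Om mul) E)) \<and>
               (\<forall>X\<in>carrier (tens (base Om) (tvec_bullet Om mul) E).
                  \<theta>' (tmap (base Om) (dalg Om mul) E (dproj Om mul) id X) =
                  tmap (base Om) E (dalg Om mul) id (dproj Om mul) (\<theta> X)))"
proof -
  interpret crossing Om mul E
    using assms(1-3)
    by (intro crossing.intro bullet_geometry.intro bullet_geometry_axioms.intro flat_connection.intro)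
  show ?thesis
    using theta_image[OF assms(5,4)] quotient_theta[OF assms(5,4)] by (simp add: ImW_def)
qed

end
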